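(* Let $\mathcal{A}=\mathrm{Rep}_kQ$ and fix an isomorphism $\iota:\overline{\mathbb{Q}}_l\to\mathbb{C}$ (used to identify scalars). There is an isomorphism of algebras $$\Phi:\mathcal{CF}^{F,tw}(Q)\to\mathcal{H}^{tw}(\mathcal{A}),\qquad 1_{\mathcal{O}^F_M}\mapsto[M],$$ satisfying $\delta^t\circ\Phi=(\Phi\otimes\Phi)\circ\delta^t$ and $\sigma^t\circ\Phi=\Phi\circ\sigma^t$.
   Context: $k=\mathbb{F}_q$ is a finite field of characteristic $p$, $\mathbb{K}=\overline{\mathbb{F}}_q$, $l\ne p$ a prime, $v_q=\sqrt q$ a fixed square root of $q$ in $\overline{\mathbb{Q}}_l$, corresponding under $\iota$ to the square root used in $\mathbb{C}$. $Q=(Q_0,Q_1,s,t)$ is a finite quiver, $\mathcal{A}=\mathrm{Rep}_kQ$ its finite-dimensional $k$-representations (also called $kQ$-modules). $\langle\alpha,\beta\rangle=\sum_i\alpha_i\beta_i-\sum_h\alpha_{s(h)}\beta_{t(h)}$; for modules, $\langle\underline{\dim}M,\underline{\dim}N\rangle=\dim\mathrm{Hom}(M,N)-\dim\mathrm{Ext}^1(M,N)$. Ringel-Hall side. $\mathcal{H}^{tw}(\mathcal{A})$ has $\mathbb{C}$-basis the isomorphism classes $[M]$. $F^L_{MN}$ is the number of submodules $X\subset L$ with $X\cong N$, $L/X\cong M$; $h_L^{MN}=|\mathrm{Ext}^1_{\mathcal{A}}(M,N)_L|/|\mathrm{Hom}_{\mathcal{A}}(M,N)|$ with $\mathrm{Ext}^1(M,N)_L$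 the extension classes with middle term isomorphic to $L$. Product $[M]\cdot[N]=v_q^{\langle\underline{\dim}M,\underline{\dim}N\rangle}\sum_{[L]}F^L_{MN}[L]$; comultiplication $\delta^t([L])=\sum_{[M],[N]}v_q^{\langle\underline{\dim}M,\underline{\dim}N\rangle}h_L^{MN}[M]\otimes[N]$. For $r\ge1$, $F^N_{M_1\cdots M_r}$ is the number of filtrations $0=X_0\subseteq\cdots\subseteq X_r=N$ with $X_{i+1}/X_i\cong M_{r-i}$, and $h_M^{M_1\cdots M_r}$ is the coefficient of $[M_1]\otimes\cdots\otimes[M_r]$ in the iterated untwisted comultiplication of $[M]$ (untwisted: $\delta([L])=\sum h_L^{MN}[M]\otimes[N]$). The antipode is $$\sigma^t([M])=\delta_{M,0}[0]+\sum_{r\ge1}(-1)^r\sum_{[N],[M_1],\dots,[M_r]\ne0}v_q^{2\sum_{i<j}\langle\underline{\dim}M_i,\underline{\dim}M_j\rangle}h_M^{M_1\cdots M_r}F^N_{M_1\cdots M_r}[N].$$ Function side. $\mathbb{E}_\alpha=\bigoplus_h\mathrm{Hom}_{\mathbb{K}}(\mathbb{K}^{\alpha_{s(h)}},\mathbb{K}^{\alpha_{t(h)}})$, $G_\alpha=\prod_iGL(\alpha_i,\mathbb{K})$ acting by $(g\cdot x)_h=g_{t(h)}x_hg_{s(h)}^{-1}$; superscript $F$ denotes $\mathbb{F}_q$-points. $\mathcal{CF}^F_\alpha$ is the space of $G^F_\alpha$-invariant functions $\mathbb{E}^F_\alpha\to\overline{\mathbb{Q}}_l$; $1_{\mathcal{O}^F_M}$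 is the characteristic function of the set of points of $\mathbb{E}_\alpha^F$ whose $kQ$-module is isomorphic to $M$. For maps of finite sets $\phi_!(f)(y)=\sum_{\phi(x)=y}f(x)$, $\phi^*g=g\circ\phi$. $\underline m_{\alpha,\beta}=|G^F_\alpha\times G^F_\beta|^{-1}(p_3)_!(p_2)_!p_1^*$ on $F$-fixed points of $\mathbb{E}_\alpha\times\mathbb{E}_\beta\xleftarrow{p_1}\mathbb{E}'\xrightarrow{p_2}\mathbb{E}''\xrightarrow{p_3}\mathbb{E}_{\alpha+\beta}$, where $\mathbb{E}''=\{(x,W)\}$ with $W$ an $x$-stable graded subspace of dimension vector $\beta$, $\mathbb{E}'=\{(x,W,\rho_1,\rho_2)\}$ with $\rho_1:\mathbb{K}^{\alpha+\beta}/W\cong\mathbb{K}^\alpha$, $\rho_2:W\cong\mathbb{K}^\beta$, $p_1$ transports the induced representations via $\rho_1,\rho_2$, and $p_2,p_3$ are projections. $\delta_{\alpha,\beta}=q^{-\sum_i\alpha_i\beta_i}\kappa_!i^*$, where, for $W=\mathbb{K}^\beta\subset\mathbb{K}^\alpha\oplus\mathbb{K}^\beta$, $F_{\alpha,\beta}\subset\mathbb{E}_{\alpha+\beta}$ is the set of $x$ stabilizing $W$, $i$ its inclusion, $\kappa(x)=$ (representation on quotient, representation on $W$). Set $\underline m^t_{\alpha,\beta}=v_q^{\langle\alpha,\beta\rangle}\underline m_{\alpha,\beta}$, $\delta^t_{\alpha,\beta}=v_q^{\langle\alpha,\beta\rangle}\delta_{\alpha,\beta}$, $\delta^t=\sum_{\alpha+\beta=\gamma}\delta^t_{\alpha,\beta}$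 on $\mathcal{CF}^F_\gamma$. $\mathcal{CF}^{F,tw}(Q)=\bigoplus_\alpha\mathcal{CF}^F_\alpha$ with product $\underline m^t$ and comultiplication $\delta^t$. With $\underline m^{t,r}_{\alpha_1,\dots,\alpha_r}$, $\delta^{t,r}_{\alpha_1,\dots,\alpha_r}$ the iterated $r$-factor versions (identity for $r=1$), $\sigma^t$ is the linear map with $\sigma^t(1_0)=1_0$ ($1_0$ the constant function $1$ on $\mathbb{E}_0$) and $\sigma^t(f)=\sum_{r\ge1}(-1)^r\sum_{\alpha_1,\dots,\alpha_r\ne0,\ \alpha_1+\cdots+\alpha_r=\alpha}\underline m^{t,r}_{\alpha_1,\dots,\alpha_r}\delta^{t,r}_{\alpha_1,\dots,\alpha_r}(f)$ for $f\in\mathcal{CF}^F_\alpha$, $\alpha\neq0$. *)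

theory Defs
  imports
    Complex_Main
    "HOL-Library.Function_Algebras"
    "HOL-Library.Groups_Big_Fun"
    "HOL-Library.FuncSet"
    "HOL-Library.Cardinality"
    "HOL-Algebra.QuotRing"
    "HOL-Algebra.Algebraic_Closure_Type"
    "Jordan_Normal_Form.VS_Connect"
    "Graph_Theory.Digraph"
begin

section \<open>The coefficient field\<close>

definition padic_abs :: "nat \<Rightarrow> rat \<Rightarrow> real" where
  "padic_abs l r = (if r = 0 then 0 else
     (case quotient_of r of (a, b) \<Rightarrow>
        real l powi (int (multiplicity (int l) b) - int (multiplicity (int l) a))))"

text \<open>\<open>S\<close> with the absolute value \<open>N\<close> is a completion of the rationals with respect to the
  \<open>l\<close>-adic absolute value, i.e. a copy of the field of \<open>l\<close>-adic numbers.\<close>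

definition is_Ql :: "nat \<Rightarrow> 'e::field_char_0 set \<Rightarrow> ('e \<Rightarrow> real) \<Rightarrow> bool" where
  "is_Ql l S N \<longleftrightarrow>
     1 \<in> S \<and> (\<forall>x\<in>S. \<forall>y\<in>S. x - y \<in> S \<and> x * y \<in> S) \<and> (\<forall>x\<in>S. inverse x \<in> S) \<and>
     (\<forall>x\<in>S. N x \<ge> 0 \<and> (N x = 0 \<longleftrightarrow> x = 0)) \<and>
     (\<forall>x\<in>S. \<forall>y\<in>S. N (x * y) = N x * N y \<and> N (x + y) \<le> N x + N y) \<and>
     (\<forall>r. N (of_rat r) = padic_abs l r) \<and>
     (\<forall>x\<in>S. \<forall>\<epsilon>>0. \<exists>r. N (x - of_rat r) < \<epsilon>) \<and>
     (\<forall>s. (\<forall>n::nat. s n \<in> S) \<and> (\<forall>\<epsilon>>0. \<exists>k. \<forall>m\<ge>k. \<forall>n\<ge>k. N (s m - s n) < \<epsilon>) \<longrightarrow>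
          (\<exists>x\<in>S. \<forall>\<epsilon>>0. \<exists>k. \<forall>n\<ge>k. N (s n - x) < \<epsilon>))"

definition is_Ql_closure :: "nat \<Rightarrow> 'e::{alg_closed_field,field_char_0} itself \<Rightarrow> bool" where
  "is_Ql_closure l _ \<longleftrightarrow> (\<exists>(S :: 'e set) N. is_Ql l S N \<and>
     (\<forall>z. \<exists>p. p \<noteq> 0 \<and> (\<forall>n. Polynomial.coeff p n \<in> S) \<and> Polynomial.poly p z = 0))"

definition field_iso :: "('a::field \<Rightarrow> 'b::field) \<Rightarrow> bool" where
  "field_iso \<iota> \<longleftrightarrow> bij \<iota> \<and> \<iota> 1 = 1 \<and>
     (\<forall>x y. \<iota> (x + y) = \<iota> x + \<iota> y) \<and> (\<forall>x y. \<iota> (x * y) = \<iota> x * \<iota> y)"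


section \<open>Quiver representations\<close>

text \<open>A quiver is a \<open>fin_digraph\<close>; \<open>tail\<close> and \<open>head\<close> are the maps \<open>s\<close> and \<open>t\<close>. Dimension vectors
  vanish outside the vertex set.\<close>

definition dimvecs :: "('i, 'h) pre_digraph \<Rightarrow> ('i \<Rightarrow> nat) set" where
  "dimvecs Q = {\<alpha>. \<forall>i. i \<notin> verts Q \<longrightarrow> \<alpha> i = 0}"

definition euler_form :: "('i, 'h) pre_digraph \<Rightarrow> ('i \<Rightarrow> nat) \<Rightarrow> ('i \<Rightarrow> nat) \<Rightarrow> int" where
  "euler_form Q \<alpha> \<beta> =
     (\<Sum>i\<in>verts Q. int (\<alpha> i) * int (\<beta> i)) -
     (\<Sum>h\<in>arcs Q. int (\<alpha> (tail Q h)) * int (\<beta> (head Q h)))"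

text \<open>The type \<open>'v\<close> of vectors is left open, so that quotients by subrepresentations (whose vectors
  are cosets) are representations in the same sense.\<close>

record ('i, 'h, 'a, 'v) quiver_rep =
  vsp :: "'i \<Rightarrow> ('a, 'v) module"
  vmap :: "'h \<Rightarrow> 'v \<Rightarrow> 'v"

definition is_rep :: "('i, 'h) pre_digraph \<Rightarrow> ('i, 'h, 'a::field, 'v) quiver_rep \<Rightarrow> bool" where
  "is_rep Q M \<longleftrightarrow>
     (\<forall>i\<in>verts Q. vectorspace class_ring (vsp M i) \<and> vectorspace.fin_dim class_ring (vsp M i)) \<and>
     (\<forall>h\<in>arcs Q. linear_map class_ring (vsp M (tail Q h)) (vsp M (head Q h)) (vmap M h))"

definition dimv :: "('i, 'h) pre_digraph \<Rightarrow> ('i, 'h, 'a::field, 'v) quiver_rep \<Rightarrow> 'i \<Rightarrow> nat" where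
  "dimv Q M = (\<lambda>i. if i \<in> verts Q then vectorspace.dim class_ring (vsp M i) else 0)"

text \<open>Morphisms are taken extensional, so that each is counted once.\<close>

definition lin_maps :: "('a::field, 'v) module \<Rightarrow> ('a, 'w) module \<Rightarrow> ('v \<Rightarrow> 'w) set" where
  "lin_maps V W = (carrier V \<rightarrow>\<^sub>E carrier W) \<inter> module_hom class_ring V W"

definition lin_isos :: "('a::field, 'v) module \<Rightarrow> ('a, 'w) module \<Rightarrow> ('v \<Rightarrow> 'w) set" where
  "lin_isos V W = {f \<in> lin_maps V W. bij_betw f (carrier V) (carrier W)}"

definition rep_hom :: "('i, 'h) pre_digraph \<Rightarrow> ('i, 'h, 'a::field, 'v) quiver_rep \<Rightarrow>
    ('i, 'h, 'a, 'w) quiver_rep \<Rightarrow> ('i \<Rightarrow> 'v \<Rightarrow> 'w) set" where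
  "rep_hom Q M N = {f \<in> (\<Pi>\<^sub>E i\<in>verts Q. lin_maps (vsp M i) (vsp N i)).
     \<forall>h\<in>arcs Q. \<forall>v\<in>carrier (vsp M (tail Q h)).
       f (head Q h) (vmap M h v) = vmap N h (f (tail Q h) v)}"

definition rep_iso :: "('i, 'h) pre_digraph \<Rightarrow> ('i, 'h, 'a::field, 'v) quiver_rep \<Rightarrow>
    ('i, 'h, 'a, 'w) quiver_rep \<Rightarrow> bool" where
  "rep_iso Q M N \<longleftrightarrow> (\<exists>f \<in> rep_hom Q M N. \<forall>i\<in>verts Q. f i \<in> lin_isos (vsp M i) (vsp N i))"

definition subreps :: "('i, 'h) pre_digraph \<Rightarrow> ('i, 'h, 'a::field, 'v) quiver_rep \<Rightarrow>
    ('i \<Rightarrow> 'v set) set" where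
  "subreps Q M = {W \<in> (\<Pi>\<^sub>E i\<in>verts Q. {U. VectorSpace.subspace class_ring U (vsp M i)}).
     \<forall>h\<in>arcs Q. vmap M h ` W (tail Q h) \<subseteq> W (head Q h)}"

definition sub_rep :: "('i, 'h, 'a, 'v) quiver_rep \<Rightarrow> ('i \<Rightarrow> 'v set) \<Rightarrow>
    ('i, 'h, 'a, 'v) quiver_rep" where
  "sub_rep M W = \<lparr>vsp = (\<lambda>i. (vsp M i)\<lparr>carrier := W i\<rparr>), vmap = vmap M\<rparr>"

text \<open>The ring multiplication and unit that the record type carries along are irrelevant.\<close>

definition quot_module :: "('a::field, 'v) module \<Rightarrow> 'v set \<Rightarrow> ('a, 'v set) module" where
  "quot_module V W =
     \<lparr>carrier = a_rcosets\<^bsub>V\<^esub> W, monoid.mult = (\<lambda>_ _. W), one = W, zero = W, add = set_add V,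
      module.smult = (\<lambda>a c. \<Union>v\<in>c. W +>\<^bsub>V\<^esub> (a \<odot>\<^bsub>V\<^esub> v))\<rparr>"

definition quot_rep :: "('i, 'h) pre_digraph \<Rightarrow> ('i, 'h, 'a::field, 'v) quiver_rep \<Rightarrow>
    ('i \<Rightarrow> 'v set) \<Rightarrow> ('i, 'h, 'a, 'v set) quiver_rep" where
  "quot_rep Q M W =
     \<lparr>vsp = (\<lambda>i. quot_module (vsp M i) (W i)),
      vmap = (\<lambda>h c. \<Union>v\<in>c. W (head Q h) +>\<^bsub>vsp M (head Q h)\<^esub> vmap M h v)\<rparr>"

definition point_rep :: "('i \<Rightarrow> nat) \<Rightarrow> ('h \<Rightarrow> 'a::field mat) \<Rightarrow> ('i, 'h, 'a, 'a vec) quiver_rep" where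
  "point_rep \<alpha> x = \<lparr>vsp = (\<lambda>i. module_vec TYPE('a) (\<alpha> i)), vmap = (\<lambda>h v. x h *\<^sub>v v)\<rparr>"


section \<open>Isomorphism classes, Hall numbers and extensions\<close>

text \<open>The objects of \<open>Rep\<^sub>k Q\<close> are the finite-dimensional representations whose vector spaces live on
  subsets of \<open>'k vec\<close>. As this type contains all \<open>k\<^sup>n\<close>, every finite-dimensional representation
  is isomorphic to one of these.\<close>

type_synonym ('i, 'h, 'k) kQ_module = "('i, 'h, 'k, 'k vec) quiver_rep"

definition isoclass :: "('i, 'h) pre_digraph \<Rightarrow> ('i, 'h, 'k::field) kQ_module \<Rightarrow>
    ('i, 'h, 'k) kQ_module set" where
  "isoclass Q M = {N. is_rep Q N \<and> rep_iso Q M N}"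

definition isoclasses :: "('i, 'h) pre_digraph \<Rightarrow> ('i, 'h, 'k::field) kQ_module set set" where
  "isoclasses Q = isoclass Q ` {M. is_rep Q M}"

definition zero_rep :: "('i, 'h, 'k::field) kQ_module" where
  "zero_rep = \<lparr>vsp = (\<lambda>_. module_vec TYPE('k) 0), vmap = (\<lambda>_ v. v)\<rparr>"

definition hall_number :: "('i, 'h) pre_digraph \<Rightarrow> ('i, 'h, 'k::field) kQ_module \<Rightarrow>
    ('i, 'h, 'k) kQ_module \<Rightarrow> ('i, 'h, 'k) kQ_module \<Rightarrow> nat" where
  "hall_number Q L M N =
     card {U \<in> subreps Q L. rep_iso Q (sub_rep L U) N \<and> rep_iso Q (quot_rep Q L U) M}"

text \<open>Filtrations \<open>0 = X\<^sub>0 \<subseteq> \<dots> \<subseteq> X\<^sub>r = N\<close> with \<open>X\<^sub>i\<^sub>+\<^sub>1 / X\<^sub>i \<cong> M\<^sub>r\<^sub>-\<^sub>i\<close>; the list \<open>Ms\<close> is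
  indexed from 0, so that \<open>M\<^sub>r\<^sub>-\<^sub>i\<close> is \<open>Ms ! (r - i - 1)\<close>.\<close>

definition filtrations :: "('i, 'h) pre_digraph \<Rightarrow> ('i, 'h, 'k::field) kQ_module \<Rightarrow>
    ('i, 'h, 'k) kQ_module list \<Rightarrow> ('i \<Rightarrow> 'k vec set) list set" where
  "filtrations Q N Ms = {Xs. length Xs = Suc (length Ms) \<and> set Xs \<subseteq> subreps Q N \<and>
     (\<forall>j\<in>verts Q. (Xs ! 0) j = {\<zero>\<^bsub>vsp N j\<^esub>} \<and> (Xs ! length Ms) j = carrier (vsp N j)) \<and>
     (\<forall>i<length Ms. (\<forall>j\<in>verts Q. (Xs ! i) j \<subseteq> (Xs ! Suc i) j) \<and>
        rep_iso Q (quot_rep Q (sub_rep N (Xs ! Suc i)) (Xs ! i)) (Ms ! (length Ms - i - 1)))}"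

text \<open>Yoneda extensions \<open>0 \<longrightarrow> N \<longrightarrow> E \<longrightarrow> M \<longrightarrow> 0\<close>, given as triples \<open>(E, f, g)\<close>, and the
  set \<open>Ext\<^sup>1(M, N)\<close> of their equivalence classes.\<close>

definition extensions :: "('i, 'h) pre_digraph \<Rightarrow> ('i, 'h, 'k::field) kQ_module \<Rightarrow>
    ('i, 'h, 'k) kQ_module \<Rightarrow> (('i, 'h, 'k) kQ_module \<times> ('i \<Rightarrow> 'k vec \<Rightarrow> 'k vec) \<times>
    ('i \<Rightarrow> 'k vec \<Rightarrow> 'k vec)) set" where
  "extensions Q M N = {(E, f, g). is_rep Q E \<and> f \<in> rep_hom Q N E \<and> g \<in> rep_hom Q E M \<and>
     (\<forall>i\<in>verts Q. inj_on (f i) (carrier (vsp N i)) \<and>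
        f i ` carrier (vsp N i) = {e \<in> carrier (vsp E i). g i e = \<zero>\<^bsub>vsp M i\<^esub>} \<and>
        g i ` carrier (vsp E i) = carrier (vsp M i))}"

definition ext_equiv where
  "ext_equiv Q M N = {((E, f, g), (E', f', g')).
     (E, f, g) \<in> extensions Q M N \<and> (E', f', g') \<in> extensions Q M N \<and>
     (\<exists>\<phi> \<in> rep_hom Q E E'. \<forall>i\<in>verts Q. \<phi> i \<in> lin_isos (vsp E i) (vsp E' i) \<and>
        (\<forall>n\<in>carrier (vsp N i). \<phi> i (f i n) = f' i n) \<and>
        (\<forall>e\<in>carrier (vsp E i). g' i (\<phi> i e) = g i e))}"

definition Ext1 where
  "Ext1 Q M N = extensions Q M N // ext_equiv Q M N"

definition Ext1_middle where
  "Ext1_middle Q M N L = {\<xi> \<in> Ext1 Q M N. \<exists>(E, f, g) \<in> \<xi>. rep_iso Q E L}"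

definition h_number :: "('i, 'h) pre_digraph \<Rightarrow> ('i, 'h, 'k::field) kQ_module \<Rightarrow>
    ('i, 'h, 'k) kQ_module \<Rightarrow> ('i, 'h, 'k) kQ_module \<Rightarrow> complex" where
  "h_number Q L M N = of_nat (card (Ext1_middle Q M N L)) / of_nat (card (rep_hom Q M N))"


section \<open>Function spaces and their tensor squares\<close>

text \<open>Both algebras are realised as spaces \<open>V\<close> of functions \<open>'x \<Rightarrow> 'c\<close>; then \<open>V \<otimes> V\<close> is the space of
  functions on pairs spanned by the products \<open>f(x) g(y)\<close>.\<close>

definition pure_tensor :: "('x \<Rightarrow> 'c::field) \<Rightarrow> ('x \<Rightarrow> 'c) \<Rightarrow> 'x \<times> 'x \<Rightarrow> 'c" where
  "pure_tensor f g = (\<lambda>(x, y). f x * g y)"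

definition tensor_square :: "('x \<Rightarrow> 'c::field) set \<Rightarrow> ('x \<times> 'x \<Rightarrow> 'c) set" where
  "tensor_square V = {(\<Sum>j<n. pure_tensor (f j) (g j)) | (n::nat) f g.
     \<forall>j<n. f j \<in> V \<and> g j \<in> V}"

definition scale :: "'c::field \<Rightarrow> ('x \<Rightarrow> 'c) \<Rightarrow> 'x \<Rightarrow> 'c" where
  "scale c f = (\<lambda>x. c * f x)"

text \<open>\<open>T\<close> is \<open>\<Phi> \<otimes> \<Phi>\<close> on \<open>V \<otimes> V\<close>. Scalars are identified along \<open>\<iota>\<close>, so linear means \<open>\<iota>\<close>-semilinear.
  These conditions determine \<open>T\<close> uniquely on \<open>V \<otimes> V\<close>.\<close>

definition is_tensor_square_map :: "('c::field \<Rightarrow> 'd::field) \<Rightarrow> ('x \<Rightarrow> 'c) set \<Rightarrow>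
    (('x \<Rightarrow> 'c) \<Rightarrow> ('y \<Rightarrow> 'd)) \<Rightarrow> (('x \<times> 'x \<Rightarrow> 'c) \<Rightarrow> ('y \<times> 'y \<Rightarrow> 'd)) \<Rightarrow> bool" where
  "is_tensor_square_map \<iota> V \<Phi> T \<longleftrightarrow>
     (\<forall>u\<in>tensor_square V. \<forall>w\<in>tensor_square V. T (u + w) = T u + T w) \<and>
     (\<forall>c. \<forall>u\<in>tensor_square V. T (scale c u) = scale (\<iota> c) (T u)) \<and>
     (\<forall>f\<in>V. \<forall>g\<in>V. T (pure_tensor f g) = pure_tensor (\<Phi> f) (\<Phi> g))"


section \<open>The twisted Ringel--Hall algebra\<close>

text \<open>Elements are the finitely supported functions on isomorphism classes, \<open>[M]\<close> being the indicator
  function of the class of \<open>M\<close>. The parameter \<open>v\<close> is the chosen complex square root of \<open>q\<close>.\<close>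

definition hall_space :: "('i, 'h) pre_digraph \<Rightarrow> (('i, 'h, 'k::field) kQ_module set \<Rightarrow> complex) set"
  where "hall_space Q = {f. finite {c. f c \<noteq> 0} \<and> {c. f c \<noteq> 0} \<subseteq> isoclasses Q}"

definition class_basis :: "'c \<Rightarrow> 'c \<Rightarrow> complex" where
  "class_basis c = (\<lambda>d. if d = c then 1 else 0)"

definition representative :: "'m set \<Rightarrow> 'm" where
  "representative c = (SOME M. M \<in> c)"

definition class_euler :: "('i, 'h) pre_digraph \<Rightarrow> ('i, 'h, 'k::field) kQ_module set \<Rightarrow>
    ('i, 'h, 'k) kQ_module set \<Rightarrow> int" where
  "class_euler Q a b = euler_form Q (dimv Q (representative a)) (dimv Q (representative b))"

definition hall_mult :: "complex \<Rightarrow> ('i, 'h) pre_digraph \<Rightarrow>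
    (('i, 'h, 'k::field) kQ_module set \<Rightarrow> complex) \<Rightarrow> (('i, 'h, 'k) kQ_module set \<Rightarrow> complex) \<Rightarrow>
    ('i, 'h, 'k) kQ_module set \<Rightarrow> complex" where
  "hall_mult v Q f g = (\<lambda>c. if c \<in> isoclasses Q then
     (\<Sum>a | f a \<noteq> 0. \<Sum>b | g b \<noteq> 0. f a * g b * v powi class_euler Q a b *
        of_nat (hall_number Q (representative c) (representative a) (representative b)))
     else 0)"

definition hall_algebra :: "complex \<Rightarrow> ('i, 'h) pre_digraph \<Rightarrow>
    (('i, 'h, 'k::field) kQ_module set \<Rightarrow> complex) ring" where
  "hall_algebra v Q = \<lparr>carrier = hall_space Q, monoid.mult = hall_mult v Q,
     one = class_basis (isoclass Q zero_rep), zero = (\<lambda>_. 0), add = (+)\<rparr>"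

definition hall_comult_untwisted :: "('i, 'h) pre_digraph \<Rightarrow>
    (('i, 'h, 'k::field) kQ_module set \<Rightarrow> complex) \<Rightarrow>
    ('i, 'h, 'k) kQ_module set \<times> ('i, 'h, 'k) kQ_module set \<Rightarrow> complex" where
  "hall_comult_untwisted Q f = (\<lambda>(a, b). if a \<in> isoclasses Q \<and> b \<in> isoclasses Q then
     (\<Sum>c | f c \<noteq> 0. f c * h_number Q (representative c) (representative a) (representative b))
     else 0)"

definition hall_comult :: "complex \<Rightarrow> ('i, 'h) pre_digraph \<Rightarrow>
    (('i, 'h, 'k::field) kQ_module set \<Rightarrow> complex) \<Rightarrow>
    ('i, 'h, 'k) kQ_module set \<times> ('i, 'h, 'k) kQ_module set \<Rightarrow> complex" where
  "hall_comult v Q f = (\<lambda>(a, b). v powi class_euler Q a b * hall_comult_untwisted Q f (a, b))"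

text \<open>The iterated untwisted comultiplication, obtained by applying the comultiplication repeatedly to
  the last tensor factor. The argument lists are the indices \<open>[M\<^sub>1] \<otimes> \<dots> \<otimes> [M\<^sub>r]\<close>, so the value
  at such a list is the coefficient there.\<close>

fun hall_comult_iter :: "('i, 'h) pre_digraph \<Rightarrow> (('i, 'h, 'k::field) kQ_module set \<Rightarrow> complex) \<Rightarrow>
    ('i, 'h, 'k) kQ_module set list \<Rightarrow> complex" where
  "hall_comult_iter Q f [] = 0"
| "hall_comult_iter Q f [a] = f a"
| "hall_comult_iter Q f (a # b # cs) =
     hall_comult_iter Q (\<lambda>d. hall_comult_untwisted Q f (a, d)) (b # cs)"

text \<open>The value at the class \<open>n\<close> of the antipode of \<open>[M]\<close>, for \<open>m\<close> the class of \<open>M\<close>. The sums over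
  \<open>r\<close> and over \<open>[M\<^sub>1], \<dots>, [M\<^sub>r]\<close> are merged into one sum over lists; it has only finitely many
  nonzero terms.\<close>

definition hall_antipode_coeff :: "complex \<Rightarrow> ('i, 'h) pre_digraph \<Rightarrow>
    ('i, 'h, 'k::field) kQ_module set \<Rightarrow> ('i, 'h, 'k) kQ_module set \<Rightarrow> complex" where
  "hall_antipode_coeff v Q m n =
     (if m = isoclass Q zero_rep \<and> n = isoclass Q zero_rep then 1 else 0) +
     Sum_any (\<lambda>as. if as \<noteq> [] \<and> set as \<subseteq> isoclasses Q - {isoclass Q zero_rep} then
        (-1) ^ length as *
        v powi (2 * (\<Sum>j<length as. \<Sum>i<j. class_euler Q (as ! i) (as ! j))) *
        hall_comult_iter Q (class_basis m) as *
        of_nat (card (filtrations Q (representative n) (map representative as)))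
      else 0)"

definition hall_antipode :: "complex \<Rightarrow> ('i, 'h) pre_digraph \<Rightarrow>
    (('i, 'h, 'k::field) kQ_module set \<Rightarrow> complex) \<Rightarrow> ('i, 'h, 'k) kQ_module set \<Rightarrow> complex" where
  "hall_antipode v Q f = (\<lambda>n. if n \<in> isoclasses Q then
     (\<Sum>m | f m \<noteq> 0. f m * hall_antipode_coeff v Q m n) else 0)"


section \<open>Representation spaces over the algebraic closure and Frobenius\<close>

type_synonym ('h, 'k) point = "'h \<Rightarrow> 'k alg_closure mat"

definition rep_space :: "('i, 'h) pre_digraph \<Rightarrow> ('i \<Rightarrow> nat) \<Rightarrow> ('h, 'k::field) point set" where
  "rep_space Q \<alpha> = (\<Pi>\<^sub>E h\<in>arcs Q. carrier_mat (\<alpha> (head Q h)) (\<alpha> (tail Q h)))"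

definition GL_group :: "('i, 'h) pre_digraph \<Rightarrow> ('i \<Rightarrow> nat) \<Rightarrow> ('i \<Rightarrow> 'k::field alg_closure mat) set"
  where "GL_group Q \<alpha> = (\<Pi>\<^sub>E i\<in>verts Q. Units (ring_mat TYPE('k alg_closure) (\<alpha> i) ()))"

definition GL_act :: "('i, 'h) pre_digraph \<Rightarrow> ('i \<Rightarrow> nat) \<Rightarrow> ('i \<Rightarrow> 'k::field alg_closure mat) \<Rightarrow>
    ('h, 'k) point \<Rightarrow> ('h, 'k) point" where
  "GL_act Q \<alpha> g x = (\<lambda>h\<in>arcs Q. g (head Q h) * x h *
     m_inv (ring_mat TYPE('k alg_closure) (\<alpha> (tail Q h)) ()) (g (tail Q h)))"

definition frob :: "'k::{field,finite} alg_closure \<Rightarrow> 'k alg_closure" where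
  "frob z = z ^ CARD('k)"

definition rep_space_F :: "('i, 'h) pre_digraph \<Rightarrow> ('i \<Rightarrow> nat) \<Rightarrow>
    ('h, 'k::{field,finite}) point set" where
  "rep_space_F Q \<alpha> = {x \<in> rep_space Q \<alpha>. \<forall>h\<in>arcs Q. map_mat frob (x h) = x h}"

definition GL_group_F :: "('i, 'h) pre_digraph \<Rightarrow> ('i \<Rightarrow> nat) \<Rightarrow>
    ('i \<Rightarrow> 'k::{field,finite} alg_closure mat) set" where
  "GL_group_F Q \<alpha> = {g \<in> GL_group Q \<alpha>. \<forall>i\<in>verts Q. map_mat frob (g i) = g i}"

text \<open>The \<open>kQ\<close>-module of an \<open>\<bbbF>\<^sub>q\<close>-point: its matrices have entries in the image of \<open>k\<close> in the
  algebraic closure, and \<open>of_ac\<close> inverts the inclusion of \<open>k\<close>.\<close>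

definition module_of_point :: "('i \<Rightarrow> nat) \<Rightarrow> ('h, 'k::{field,finite}) point \<Rightarrow>
    ('i, 'h, 'k) kQ_module" where
  "module_of_point \<alpha> x = point_rep \<alpha> (\<lambda>h. map_mat of_ac (x h))"

type_synonym ('i, 'k) flag = "'i \<Rightarrow> 'k alg_closure vec set"

definition E_two :: "('i, 'h) pre_digraph \<Rightarrow> ('i \<Rightarrow> nat) \<Rightarrow> ('i \<Rightarrow> nat) \<Rightarrow>
    (('h, 'k::field) point \<times> ('i, 'k) flag) set" where
  "E_two Q \<alpha> \<beta> = {(x, W). x \<in> rep_space Q (\<alpha> + \<beta>) \<and> W \<in> subreps Q (point_rep (\<alpha> + \<beta>) x) \<and>
     (\<forall>i\<in>verts Q. dimv Q (sub_rep (point_rep (\<alpha> + \<beta>) x) W) i = \<beta> i)}"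

type_synonym ('i, 'h, 'k) framed = "('h, 'k) point \<times> ('i, 'k) flag \<times>
    ('i \<Rightarrow> 'k alg_closure vec set \<Rightarrow> 'k alg_closure vec) \<times>
    ('i \<Rightarrow> 'k alg_closure vec \<Rightarrow> 'k alg_closure vec)"

definition E_one :: "('i, 'h) pre_digraph \<Rightarrow> ('i \<Rightarrow> nat) \<Rightarrow> ('i \<Rightarrow> nat) \<Rightarrow>
    ('i, 'h, 'k::field) framed set" where
  "E_one Q \<alpha> \<beta> = {(x, W, \<rho>1, \<rho>2). (x, W) \<in> E_two Q \<alpha> \<beta> \<and>
     \<rho>1 \<in> (\<Pi>\<^sub>E i\<in>verts Q. lin_isos (vsp (quot_rep Q (point_rep (\<alpha> + \<beta>) x) W) i)
                                   (module_vec TYPE('k alg_closure) (\<alpha> i))) \<and>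
     \<rho>2 \<in> (\<Pi>\<^sub>E i\<in>verts Q. lin_isos (vsp (sub_rep (point_rep (\<alpha> + \<beta>) x) W) i)
                                   (module_vec TYPE('k alg_closure) (\<beta> i)))}"

text \<open>Frobenius acts on subspaces and cosets by taking images, and on a linear map \<open>\<rho>\<close> by
  \<open>F \<circ> \<rho> \<circ> F\<^sup>-\<^sup>1\<close>; hence \<open>\<rho>\<close> is fixed iff it commutes with \<open>F\<close>.\<close>

definition E_two_F :: "('i, 'h) pre_digraph \<Rightarrow> ('i \<Rightarrow> nat) \<Rightarrow> ('i \<Rightarrow> nat) \<Rightarrow>
    (('h, 'k::{field,finite}) point \<times> ('i, 'k) flag) set" where
  "E_two_F Q \<alpha> \<beta> = {(x, W) \<in> E_two Q \<alpha> \<beta>. x \<in> rep_space_F Q (\<alpha> + \<beta>) \<and>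
     (\<forall>i\<in>verts Q. map_vec frob ` W i = W i)}"

definition E_one_F :: "('i, 'h) pre_digraph \<Rightarrow> ('i \<Rightarrow> nat) \<Rightarrow> ('i \<Rightarrow> nat) \<Rightarrow>
    ('i, 'h, 'k::{field,finite}) framed set" where
  "E_one_F Q \<alpha> \<beta> = {(x, W, \<rho>1, \<rho>2) \<in> E_one Q \<alpha> \<beta>. (x, W) \<in> E_two_F Q \<alpha> \<beta> \<and>
     (\<forall>i\<in>verts Q.
        (\<forall>c \<in> carrier (vsp (quot_rep Q (point_rep (\<alpha> + \<beta>) x) W) i).
           \<rho>1 i (map_vec frob ` c) = map_vec frob (\<rho>1 i c)) \<and>
        (\<forall>w \<in> W i. \<rho>2 i (map_vec frob w) = map_vec frob (\<rho>2 i w)))}"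

text \<open>The transported representation is the unique one making \<open>\<rho>1\<close> (resp. \<open>\<rho>2\<close>) a morphism from the
  induced representation.\<close>

definition proj1 :: "('i, 'h) pre_digraph \<Rightarrow> ('i \<Rightarrow> nat) \<Rightarrow> ('i \<Rightarrow> nat) \<Rightarrow>
    ('i, 'h, 'k::field) framed \<Rightarrow> ('h, 'k) point \<times> ('h, 'k) point" where
  "proj1 Q \<alpha> \<beta> = (\<lambda>(x, W, \<rho>1, \<rho>2).
     (THE y. y \<in> rep_space Q \<alpha> \<and>
        \<rho>1 \<in> rep_hom Q (quot_rep Q (point_rep (\<alpha> + \<beta>) x) W) (point_rep \<alpha> y),
      THE z. z \<in> rep_space Q \<beta> \<and>
        \<rho>2 \<in> rep_hom Q (sub_rep (point_rep (\<alpha> + \<beta>) x) W) (point_rep \<beta> z)))"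

definition proj2 :: "('i, 'h, 'k) framed \<Rightarrow> ('h, 'k) point \<times> ('i, 'k) flag" where
  "proj2 = (\<lambda>(x, W, \<rho>1, \<rho>2). (x, W))"

definition proj3 :: "('h, 'k) point \<times> ('i, 'k) flag \<Rightarrow> ('h, 'k) point" where
  "proj3 = (\<lambda>(x, W). x)"

definition std_flag :: "('i, 'h) pre_digraph \<Rightarrow> ('i \<Rightarrow> nat) \<Rightarrow> ('i \<Rightarrow> nat) \<Rightarrow> ('i, 'k::field) flag" where
  "std_flag Q \<alpha> \<beta> = (\<lambda>i\<in>verts Q. {v \<in> carrier_vec (\<alpha> i + \<beta> i). \<forall>j<\<alpha> i. v $ j = 0})"

definition stab_space_F :: "('i, 'h) pre_digraph \<Rightarrow> ('i \<Rightarrow> nat) \<Rightarrow> ('i \<Rightarrow> nat) \<Rightarrow>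
    ('h, 'k::{field,finite}) point set" where
  "stab_space_F Q \<alpha> \<beta> =
     {x \<in> rep_space_F Q (\<alpha> + \<beta>). std_flag Q \<alpha> \<beta> \<in> subreps Q (point_rep (\<alpha> + \<beta>) x)}"

text \<open>The matrices stabilising \<open>std_flag\<close> are block lower triangular; in the standard bases the
  upper left block is the map induced on the quotient and the lower right block the one on the
  subspace.\<close>

definition kappa :: "('i, 'h) pre_digraph \<Rightarrow> ('i \<Rightarrow> nat) \<Rightarrow> ('i \<Rightarrow> nat) \<Rightarrow>
    ('h, 'k::field) point \<Rightarrow> ('h, 'k) point \<times> ('h, 'k) point" where
  "kappa Q \<alpha> \<beta> x =
     ((\<lambda>h\<in>arcs Q. mat (\<alpha> (head Q h)) (\<alpha> (tail Q h)) (\<lambda>(r, c). x h $$ (r, c))),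
      (\<lambda>h\<in>arcs Q. mat (\<beta> (head Q h)) (\<beta> (tail Q h))
         (\<lambda>(r, c). x h $$ (\<alpha> (head Q h) + r, \<alpha> (tail Q h) + c))))"


section \<open>The algebra of invariant functions\<close>

text \<open>Functions on a set are extended by zero, and \<open>CF\<close> is a space of functions on the disjoint union
  of the \<open>rep_space_F Q \<alpha>\<close>, whose points are pairs \<open>(\<alpha>, x)\<close>. The parameter \<open>v\<close> is the square root
  of \<open>q\<close> in the coefficient field.\<close>

type_synonym ('i, 'h, 'k, 'e) cf = "('i \<Rightarrow> nat) \<times> ('h, 'k) point \<Rightarrow> 'e"

definition push :: "'a set \<Rightarrow> ('a \<Rightarrow> 'b) \<Rightarrow> ('a \<Rightarrow> 'e::field) \<Rightarrow> 'b \<Rightarrow> 'e" where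
  "push A \<phi> f = (\<lambda>y. \<Sum>x | x \<in> A \<and> \<phi> x = y. f x)"

definition CF_comp :: "('i, 'h) pre_digraph \<Rightarrow> ('i \<Rightarrow> nat) \<Rightarrow>
    (('h, 'k::{field,finite}) point \<Rightarrow> 'e::field) set" where
  "CF_comp Q \<alpha> = {f. (\<forall>x. x \<notin> rep_space_F Q \<alpha> \<longrightarrow> f x = 0) \<and>
     (\<forall>g\<in>GL_group_F Q \<alpha>. \<forall>x\<in>rep_space_F Q \<alpha>. f (GL_act Q \<alpha> g x) = f x)}"

definition CF :: "('i, 'h) pre_digraph \<Rightarrow>
    (('i \<Rightarrow> nat) \<times> ('h, 'k::{field,finite}) point \<Rightarrow> 'e::field) set" where
  "CF Q = {f. (\<forall>\<alpha>\<in>dimvecs Q. (\<lambda>x. f (\<alpha>, x)) \<in> CF_comp Q \<alpha>) \<and>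
     (\<forall>\<alpha> x. \<alpha> \<notin> dimvecs Q \<longrightarrow> f (\<alpha>, x) = 0) \<and> finite {\<alpha>. \<exists>x. f (\<alpha>, x) \<noteq> 0}}"

definition orbit_fun :: "('i, 'h) pre_digraph \<Rightarrow> ('i, 'h, 'k::{field,finite}) kQ_module \<Rightarrow>
    ('i \<Rightarrow> nat) \<times> ('h, 'k) point \<Rightarrow> 'e::field" where
  "orbit_fun Q M = (\<lambda>(\<alpha>, x). if \<alpha> \<in> dimvecs Q \<and> x \<in> rep_space_F Q \<alpha> \<and>
     rep_iso Q (module_of_point \<alpha> x) M then 1 else 0)"

definition m_twisted :: "'e::field \<Rightarrow> ('i, 'h) pre_digraph \<Rightarrow> ('i \<Rightarrow> nat) \<Rightarrow> ('i \<Rightarrow> nat) \<Rightarrow>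
    (('h, 'k::{field,finite}) point \<times> ('h, 'k) point \<Rightarrow> 'e) \<Rightarrow> ('h, 'k) point \<Rightarrow> 'e" where
  "m_twisted v Q \<alpha> \<beta> f = scale (v powi euler_form Q \<alpha> \<beta> *
       inverse (of_nat (card ((GL_group_F Q \<alpha> \<times> GL_group_F Q \<beta>)
         :: (('i \<Rightarrow> 'k alg_closure mat) \<times> ('i \<Rightarrow> 'k alg_closure mat)) set))))
     (push (E_two_F Q \<alpha> \<beta>) proj3 (push (E_one_F Q \<alpha> \<beta>) proj2 (f \<circ> proj1 Q \<alpha> \<beta>)))"

definition delta_twisted :: "'e::field \<Rightarrow> ('i, 'h) pre_digraph \<Rightarrow> ('i \<Rightarrow> nat) \<Rightarrow> ('i \<Rightarrow> nat) \<Rightarrow>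
    (('h, 'k::{field,finite}) point \<Rightarrow> 'e) \<Rightarrow> ('h, 'k) point \<times> ('h, 'k) point \<Rightarrow> 'e" where
  "delta_twisted v Q \<alpha> \<beta> f = scale (v powi euler_form Q \<alpha> \<beta> *
       of_nat CARD('k) powi (- (\<Sum>i\<in>verts Q. int (\<alpha> i) * int (\<beta> i))))
     (push (stab_space_F Q \<alpha> \<beta>) (kappa Q \<alpha> \<beta>) f)"

text \<open>The iterated operations; functions on \<open>\<bbbE>\<^sub>1 \<times> \<dots> \<times> \<bbbE>\<^sub>r\<close> are functions of lists of length \<open>r\<close>.
  The comultiplication is iterated in the last tensor factor, the product is bracketed to the
  right.\<close>

fun m_iter :: "'e::field \<Rightarrow> ('i, 'h) pre_digraph \<Rightarrow> ('i \<Rightarrow> nat) list \<Rightarrow>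
    (('h, 'k::{field,finite}) point list \<Rightarrow> 'e) \<Rightarrow> ('h, 'k) point \<Rightarrow> 'e" where
  "m_iter v Q [] f = (\<lambda>_. 0)"
| "m_iter v Q [\<alpha>] f = (\<lambda>x. f [x])"
| "m_iter v Q (\<alpha> # \<beta> # \<gamma>s) f =
     m_twisted v Q \<alpha> (sum_list (\<beta> # \<gamma>s)) (\<lambda>(x, y). m_iter v Q (\<beta> # \<gamma>s) (\<lambda>ys. f (x # ys)) y)"

fun delta_iter :: "'e::field \<Rightarrow> ('i, 'h) pre_digraph \<Rightarrow> ('i \<Rightarrow> nat) list \<Rightarrow>
    (('h, 'k::{field,finite}) point \<Rightarrow> 'e) \<Rightarrow> ('h, 'k) point list \<Rightarrow> 'e" where
  "delta_iter v Q [\<alpha>] f [x] = f x"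
| "delta_iter v Q (\<alpha> # \<beta> # \<gamma>s) f (x # ys) =
     delta_iter v Q (\<beta> # \<gamma>s) (\<lambda>y. delta_twisted v Q \<alpha> (sum_list (\<beta> # \<gamma>s)) f (x, y)) ys"
| "delta_iter v Q _ f _ = 0"

definition CF_mult :: "'e::field \<Rightarrow> ('i, 'h) pre_digraph \<Rightarrow>
    (('i \<Rightarrow> nat) \<times> ('h, 'k::{field,finite}) point \<Rightarrow> 'e) \<Rightarrow>
    (('i \<Rightarrow> nat) \<times> ('h, 'k) point \<Rightarrow> 'e) \<Rightarrow> ('i \<Rightarrow> nat) \<times> ('h, 'k) point \<Rightarrow> 'e" where
  "CF_mult v Q f g = (\<lambda>(\<gamma>, z).
     \<Sum>(\<alpha>, \<beta>) \<in> {(\<alpha>, \<beta>). \<alpha> \<in> dimvecs Q \<and> \<beta> \<in> dimvecs Q \<and> \<alpha> + \<beta> = \<gamma>}.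
       m_twisted v Q \<alpha> \<beta> (\<lambda>(x, y). f (\<alpha>, x) * g (\<beta>, y)) z)"

definition CF_comult :: "'e::field \<Rightarrow> ('i, 'h) pre_digraph \<Rightarrow>
    (('i \<Rightarrow> nat) \<times> ('h, 'k::{field,finite}) point \<Rightarrow> 'e) \<Rightarrow>
    (('i \<Rightarrow> nat) \<times> ('h, 'k) point) \<times> (('i \<Rightarrow> nat) \<times> ('h, 'k) point) \<Rightarrow> 'e" where
  "CF_comult v Q f = (\<lambda>((\<alpha>, x), (\<beta>, y)). if \<alpha> \<in> dimvecs Q \<and> \<beta> \<in> dimvecs Q
     then delta_twisted v Q \<alpha> \<beta> (\<lambda>z. f (\<alpha> + \<beta>, z)) (x, y) else 0)"

text \<open>On the component of dimension vector 0, which is spanned by \<open>1\<^sub>0\<close>, the antipode is the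
  identity.\<close>

definition CF_antipode :: "'e::field \<Rightarrow> ('i, 'h) pre_digraph \<Rightarrow>
    (('i \<Rightarrow> nat) \<times> ('h, 'k::{field,finite}) point \<Rightarrow> 'e) \<Rightarrow>
    ('i \<Rightarrow> nat) \<times> ('h, 'k) point \<Rightarrow> 'e" where
  "CF_antipode v Q f = (\<lambda>(\<gamma>, z). if \<gamma> = 0 then f (\<gamma>, z) else
     (\<Sum>\<alpha>s | \<alpha>s \<noteq> [] \<and> set \<alpha>s \<subseteq> dimvecs Q - {0} \<and> sum_list \<alpha>s = \<gamma>.
        (-1) ^ length \<alpha>s * m_iter v Q \<alpha>s (delta_iter v Q \<alpha>s (\<lambda>x. f (\<gamma>, x))) z))"

definition CF_algebra :: "'e::field \<Rightarrow> ('i, 'h) pre_digraph \<Rightarrow>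
    (('i \<Rightarrow> nat) \<times> ('h, 'k::{field,finite}) point \<Rightarrow> 'e) ring" where
  "CF_algebra v Q = \<lparr>carrier = CF Q, monoid.mult = CF_mult v Q,
     one = (\<lambda>(\<alpha>, x). if \<alpha> = 0 \<and> x \<in> rep_space_F Q 0 then 1 else 0),
     zero = (\<lambda>_. 0), add = (+)\<rparr>"

end

theory Submission
  imports Defs
begin

text \<open>Both sides are governed by the same counts over \<open>k\<close>.

  \<^bold>\<open>Spaces.\<close> The points of the representation space fixed by Frobenius are the representations of
  \<open>Q\<close> on coordinate spaces over \<open>k\<close>, and two of them lie in one orbit iff their modules are
  isomorphic (\<open>GL_act_rep_iso\<close>, \<open>rep_iso_GL_act\<close>). Hence the invariant functions are the pullbacks
  of the finitely supported functions on isomorphism classes (\<open>pullback_class_value\<close>); \<open>\<Phi>\<close> inverts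
  the pullback, and it remains to compare the operations at each point.

  \<^bold>\<open>Product.\<close> Let \<open>L\<close> be the module of a point. By Galois descent, the flags of the induction diagram
  over this point are the subrepresentations \<open>U\<close> of \<open>L\<close> (\<open>bij_betw_fixed_flag\<close>). The pairs
  \<open>(\<rho>\<^sub>1, \<rho>\<^sub>2)\<close> over a flag form a torsor under the group \<open>G\<^sub>\<alpha> \<times> G\<^sub>\<beta>\<close> of fixed points
  (\<open>bij_betw_equiv_coords\<close>), which cancels the normalising factor. So the product at the point is a
  sum over \<open>U\<close> of values at \<open>(L / U, U)\<close> (\<open>m_twisted_sum\<close>), and the number of \<open>U\<close> with given classes
  is a Hall number.

  \<^bold>\<open>Coproduct.\<close> The fibre of \<open>\<kappa>\<close> over a pair of points with modules \<open>M\<close> and \<open>N\<close> consists of all lower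
  left blocks. Each of them defines an extension of \<open>M\<close> by \<open>N\<close>, and every extension arises
  (\<open>ext_of_surj\<close>). Two blocks are equivalent iff they differ by the additive action of
  \<open>\<Prod>\<^sub>i Hom(k\<^sup>\<alpha>\<^sup>i, k\<^sup>\<beta>\<^sup>i)\<close>, whose stabilisers have the size of \<open>Hom(M, N)\<close> (\<open>card_ext_class_fibre\<close>).
  Dividing by the order of the acting group turns the number of blocks with middle term \<open>L\<close> into
  \<open>|Ext(M, N)\<^sub>L| / |Hom(M, N)|\<close>.

  \<^bold>\<open>Antipode.\<close> Iterating, the product counts filtrations (\<open>m_iter_classes\<close>) and the coproduct gives the
  coefficients of the iterated comultiplication (\<open>delta_iter_classes\<close>). Each contributes the exponent
  \<open>\<Sum>\<^sub>i\<^sub><\<^sub>j \<langle>\<alpha>\<^sub>i, \<alpha>\<^sub>j\<rangle>\<close>, whence the factor 2 in the exponent on the Hall side.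

  All operations are built from field operations, \<open>v\<close> and integers, so they commute with \<open>\<iota>\<close>, and the
  comparison can be made over the complex numbers.\<close>

unbundle no fps_syntax

section \<open>Linear maps and coordinates\<close>

abbreviation is_vs :: "('a::field, 'v) module \<Rightarrow> bool" where
  "is_vs V \<equiv> vectorspace class_ring V"

abbreviation fin_dim :: "('a::field, 'v) module \<Rightarrow> bool" where
  "fin_dim V \<equiv> vectorspace.fin_dim class_ring V"

abbreviation ldim :: "('a::field, 'v) module \<Rightarrow> nat" where
  "ldim V \<equiv> vectorspace.dim class_ring V"

abbreviation lhom :: "('a::field, 'v) module \<Rightarrow> ('a, 'w) module \<Rightarrow> ('v \<Rightarrow> 'w) set" where
  "lhom V W \<equiv> module_hom class_ring V W"

lemma lhom_iff:
  "f \<in> lhom V W \<longleftrightarrow> f \<in> carrier V \<rightarrow> carrier W \<and>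
     (\<forall>x\<in>carrier V. \<forall>y\<in>carrier V. f (x \<oplus>\<^bsub>V\<^esub> y) = f x \<oplus>\<^bsub>W\<^esub> f y) \<and>
     (\<forall>r. \<forall>x\<in>carrier V. f (r \<odot>\<^bsub>V\<^esub> x) = r \<odot>\<^bsub>W\<^esub> f x)"
  by (auto simp: module_hom_def class_ring_simps)

lemma lhomI:
  assumes "\<And>x. x \<in> carrier V \<Longrightarrow> f x \<in> carrier W"
    and "\<And>x y. x \<in> carrier V \<Longrightarrow> y \<in> carrier V \<Longrightarrow> f (x \<oplus>\<^bsub>V\<^esub> y) = f x \<oplus>\<^bsub>W\<^esub> f y"
    and "\<And>r x. x \<in> carrier V \<Longrightarrow> f (r \<odot>\<^bsub>V\<^esub> x) = r \<odot>\<^bsub>W\<^esub> f x"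
  shows "f \<in> lhom V W"
  using assms by (auto simp: lhom_iff)

lemma lhom_closed: "f \<in> lhom V W \<Longrightarrow> x \<in> carrier V \<Longrightarrow> f x \<in> carrier W"
  and lhom_add: "f \<in> lhom V W \<Longrightarrow> x \<in> carrier V \<Longrightarrow> y \<in> carrier V \<Longrightarrow>
    f (x \<oplus>\<^bsub>V\<^esub> y) = f x \<oplus>\<^bsub>W\<^esub> f y"
  and lhom_smult: "f \<in> lhom V W \<Longrightarrow> x \<in> carrier V \<Longrightarrow> f (r \<odot>\<^bsub>V\<^esub> x) = r \<odot>\<^bsub>W\<^esub> f x"
  by (auto simp: lhom_iff)

lemma lhom_cong:
  assumes V: "is_vs V" and eq: "\<And>x. x \<in> carrier V \<Longrightarrow> f x = g x" and f: "f \<in> lhom V W"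
  shows "g \<in> lhom V W"
proof (rule lhomI)
  interpret vectorspace class_ring V by fact
  fix x assume x: "x \<in> carrier V"
  show "g x \<in> carrier W" using eq[OF x] lhom_closed[OF f x] by simp
  show "g (r \<odot>\<^bsub>V\<^esub> x) = r \<odot>\<^bsub>W\<^esub> g x" for r
    using eq[OF x] eq[of "r \<odot>\<^bsub>V\<^esub> x"] f x by (auto simp: lhom_iff class_ring_simps)
  fix y assume y: "y \<in> carrier V"
  show "g (x \<oplus>\<^bsub>V\<^esub> y) = g x \<oplus>\<^bsub>W\<^esub> g y"
    using eq[OF x] eq[OF y] eq[of "x \<oplus>\<^bsub>V\<^esub> y"] f x y by (auto simp: lhom_iff)
qed

lemma lhom_comp: "f \<in> lhom U V \<Longrightarrow> g \<in> lhom V W \<Longrightarrow> (\<lambda>x. g (f x)) \<in> lhom U W"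
  by (rule lhomI) (simp_all add: lhom_closed lhom_add lhom_smult)

lemma linear_map_iff: "linear_map class_ring V W f \<longleftrightarrow> is_vs V \<and> is_vs W \<and> f \<in> lhom V W"
  by (auto simp: linear_map_def mod_hom_def mod_hom_axioms_def vectorspace_def)

lemma lhom_zero:
  assumes "is_vs V" "is_vs W" "f \<in> lhom V W"
  shows "f \<zero>\<^bsub>V\<^esub> = \<zero>\<^bsub>W\<^esub>"
proof -
  interpret linear_map class_ring V W f using assms by (simp add: linear_map_iff)
  show ?thesis by simp
qed

lemma vs_zero_closed: "is_vs V \<Longrightarrow> \<zero>\<^bsub>V\<^esub> \<in> carrier V"
  and vs_add_closed: "is_vs V \<Longrightarrow> x \<in> carrier V \<Longrightarrow> y \<in> carrier V \<Longrightarrow> x \<oplus>\<^bsub>V\<^esub> y \<in> carrier V"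
  and vs_minus_closed: "is_vs V \<Longrightarrow> x \<in> carrier V \<Longrightarrow> y \<in> carrier V \<Longrightarrow> x \<ominus>\<^bsub>V\<^esub> y \<in> carrier V"
  and vs_smult_closed: "is_vs V \<Longrightarrow> x \<in> carrier V \<Longrightarrow> r \<odot>\<^bsub>V\<^esub> x \<in> carrier V"
proof -
  assume "is_vs V"
  then interpret vectorspace class_ring V .
  show "\<zero>\<^bsub>V\<^esub> \<in> carrier V" by simp
  show "x \<in> carrier V \<Longrightarrow> y \<in> carrier V \<Longrightarrow> x \<oplus>\<^bsub>V\<^esub> y \<in> carrier V" by simp
  show "x \<in> carrier V \<Longrightarrow> y \<in> carrier V \<Longrightarrow> x \<ominus>\<^bsub>V\<^esub> y \<in> carrier V" by simp
  show "x \<in> carrier V \<Longrightarrow> r \<odot>\<^bsub>V\<^esub> x \<in> carrier V" by (simp add: class_ring_simps)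
qed

lemma lin_mapsD: "f \<in> lin_maps V W \<Longrightarrow> f \<in> lhom V W" "f \<in> lin_maps V W \<Longrightarrow> f \<in> extensional (carrier V)"
  by (auto simp: lin_maps_def PiE_def)

lemma lin_isosD: "f \<in> lin_isos V W \<Longrightarrow> f \<in> lhom V W" "f \<in> lin_isos V W \<Longrightarrow> f \<in> extensional (carrier V)"
  "f \<in> lin_isos V W \<Longrightarrow> bij_betw f (carrier V) (carrier W)" "f \<in> lin_isos V W \<Longrightarrow> f \<in> lin_maps V W"
  by (auto simp: lin_isos_def lin_maps_def PiE_def)

lemma lin_mapsI: "f \<in> lhom V W \<Longrightarrow> f \<in> extensional (carrier V) \<Longrightarrow> f \<in> lin_maps V W"
  by (auto simp: lin_maps_def lhom_closed PiE_def)

lemma restrict_lin_maps: "is_vs V \<Longrightarrow> f \<in> lhom V W \<Longrightarrow> restrict f (carrier V) \<in> lin_maps V W"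
  by (rule lin_mapsI, rule lhom_cong[where f = f]) auto

lemma restrict_lin_isos:
  "is_vs V \<Longrightarrow> f \<in> lhom V W \<Longrightarrow> bij_betw f (carrier V) (carrier W) \<Longrightarrow>
    restrict f (carrier V) \<in> lin_isos V W"
  by (auto simp: lin_isos_def restrict_lin_maps)

lemma lhom_inv_into:
  assumes V: "is_vs V" and f: "f \<in> lhom V W" and bij: "bij_betw f (carrier V) (carrier W)"
  shows "inv_into (carrier V) f \<in> lhom W V"
proof (rule lhomI)
  let ?g = "inv_into (carrier V) f"
  have inj: "inj_on f (carrier V)" and im: "f ` carrier V = carrier W"
    using bij by (auto simp: bij_betw_def)
  fix y assume "y \<in> carrier W"
  then show gy: "?g y \<in> carrier V" by (metis im inv_into_into)
  have fy: "f (?g y) = y" using \<open>y \<in> carrier W\<close> by (simp add: f_inv_into_f im)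
  show "?g (r \<odot>\<^bsub>W\<^esub> y) = r \<odot>\<^bsub>V\<^esub> ?g y" for r
    using inv_into_f_f[OF inj vs_smult_closed[OF V gy]] lhom_smult[OF f gy] fy by simp
  fix z assume "z \<in> carrier W"
  have gz: "?g z \<in> carrier V" using \<open>z \<in> carrier W\<close> by (metis im inv_into_into)
  have fz: "f (?g z) = z" using \<open>z \<in> carrier W\<close> by (simp add: f_inv_into_f im)
  show "?g (y \<oplus>\<^bsub>W\<^esub> z) = ?g y \<oplus>\<^bsub>V\<^esub> ?g z"
    using inv_into_f_f[OF inj vs_add_closed[OF V gy gz]] lhom_add[OF f gy gz] fy fz by simp
qed

definition lin_inv :: "('a::field, 'v) module \<Rightarrow> ('a, 'w) module \<Rightarrow> ('v \<Rightarrow> 'w) \<Rightarrow> 'w \<Rightarrow> 'v" where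
  "lin_inv V W f = restrict (inv_into (carrier V) f) (carrier W)"

lemma lin_inv_isos:
  assumes "is_vs V" "is_vs W" "f \<in> lin_isos V W"
  shows "lin_inv V W f \<in> lin_isos W V"
  unfolding lin_inv_def using assms
  by (auto intro!: restrict_lin_isos lhom_inv_into bij_betw_inv_into dest: lin_isosD)

lemma lin_inv_left: "f \<in> lin_isos V W \<Longrightarrow> x \<in> carrier V \<Longrightarrow> lin_inv V W f (f x) = x"
  using lin_isosD(3)[of f V W] by (auto simp: lin_inv_def bij_betw_def)

lemma lin_inv_right: "f \<in> lin_isos V W \<Longrightarrow> y \<in> carrier W \<Longrightarrow> f (lin_inv V W f y) = y"
  using lin_isosD(3)[of f V W] by (auto simp: lin_inv_def bij_betw_def f_inv_into_f)

lemma is_vs_module_vec [simp]: "is_vs (module_vec TYPE('a::field) n)"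
  by (rule vec_vs)

lemma fin_dim_module_vec [simp]: "fin_dim (module_vec TYPE('a::field) n)"
  using vec_space.fin_dim by auto

lemma ldim_module_vec [simp]: "ldim (module_vec TYPE('a::field) n) = n"
  using vec_space.dim_is_n by auto

text \<open>A set that receives a map from a vector space onto it which respects the operations inherits
  all the axioms.\<close>

lemma is_vs_image:
  assumes V: "is_vs V" and f: "f \<in> lhom V W" and im: "f ` carrier V = carrier W"
    and zero: "f \<zero>\<^bsub>V\<^esub> = \<zero>\<^bsub>W\<^esub>"
  shows "is_vs W"
proof -
  interpret V: vectorspace class_ring V by fact
  note [simp] = lhom_add[OF f, symmetric] lhom_smult[OF f, symmetric] zero[symmetric]
  have ex: "\<exists>x\<in>carrier V. w = f x" if "w \<in> carrier W" for w using that im by auto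
  have cl: "f x \<in> carrier W" if "x \<in> carrier V" for x using that im by auto
  show ?thesis
  proof (rule vs_criteria)
    show "Ring.field (class_ring :: 'a ring)" by (rule class_field)
    show "\<zero>\<^bsub>W\<^esub> \<in> carrier W" by (simp add: cl)
    show "\<forall>v w. v \<in> carrier W \<and> w \<in> carrier W \<longrightarrow> v \<oplus>\<^bsub>W\<^esub> w \<in> carrier W"
      by (auto dest!: ex intro!: cl)
    show "\<forall>v\<in>carrier W. \<exists>u\<in>carrier W. v \<oplus>\<^bsub>W\<^esub> u = \<zero>\<^bsub>W\<^esub>"
    proof
      fix v assume "v \<in> carrier W"
      then obtain x where x: "x \<in> carrier V" "v = f x" using ex by blast
      show "\<exists>u\<in>carrier W. v \<oplus>\<^bsub>W\<^esub> u = \<zero>\<^bsub>W\<^esub>"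
        by (rule bexI[of _ "f (\<ominus>\<^bsub>V\<^esub> x)"]) (use x in \<open>auto simp: V.r_neg intro: cl\<close>)
    qed
    show "\<forall>c v. c \<in> carrier class_ring \<and> v \<in> carrier W \<longrightarrow> c \<odot>\<^bsub>W\<^esub> v \<in> carrier W"
      by (auto dest!: ex intro!: cl vs_smult_closed[OF V])
    show "\<forall>v w. v \<in> carrier W \<and> w \<in> carrier W \<longrightarrow> v \<oplus>\<^bsub>W\<^esub> w = w \<oplus>\<^bsub>W\<^esub> v"
      by (auto dest!: ex simp: V.a_comm)
    show "\<forall>v w x. v \<in> carrier W \<and> w \<in> carrier W \<and> x \<in> carrier W \<longrightarrow>
        v \<oplus>\<^bsub>W\<^esub> w \<oplus>\<^bsub>W\<^esub> x = v \<oplus>\<^bsub>W\<^esub> (w \<oplus>\<^bsub>W\<^esub> x)"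
      by (auto dest!: ex simp: V.a_assoc)
    show "\<forall>v\<in>carrier W. v \<oplus>\<^bsub>W\<^esub> \<zero>\<^bsub>W\<^esub> = v"
      by (auto dest!: ex)
    show "\<forall>a b v. a \<in> carrier class_ring \<and> b \<in> carrier class_ring \<and> v \<in> carrier W \<longrightarrow>
        a \<otimes>\<^bsub>class_ring\<^esub> b \<odot>\<^bsub>W\<^esub> v = a \<odot>\<^bsub>W\<^esub> (b \<odot>\<^bsub>W\<^esub> v)"
      by (auto dest!: ex simp: vs_smult_closed[OF V] V.smult_assoc1[simplified class_ring_simps, simplified])
    show "\<forall>v\<in>carrier W. \<one>\<^bsub>class_ring\<^esub> \<odot>\<^bsub>W\<^esub> v = v"
      by (auto dest!: ex simp: V.smult_one[simplified class_ring_simps, simplified])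
    show "\<forall>a b v. a \<in> carrier class_ring \<and> b \<in> carrier class_ring \<and> v \<in> carrier W \<longrightarrow>
        (a \<oplus>\<^bsub>class_ring\<^esub> b) \<odot>\<^bsub>W\<^esub> v = a \<odot>\<^bsub>W\<^esub> v \<oplus>\<^bsub>W\<^esub> b \<odot>\<^bsub>W\<^esub> v"
      by (auto dest!: ex simp: vs_smult_closed[OF V] V.smult_l_distr[simplified class_ring_simps, simplified])
    show "\<forall>a v w. a \<in> carrier class_ring \<and> v \<in> carrier W \<and> w \<in> carrier W \<longrightarrow>
        a \<odot>\<^bsub>W\<^esub> (v \<oplus>\<^bsub>W\<^esub> w) = a \<odot>\<^bsub>W\<^esub> v \<oplus>\<^bsub>W\<^esub> a \<odot>\<^bsub>W\<^esub> w"
      by (auto dest!: ex simp: vs_smult_closed[OF V] V.smult_r_distr[simplified class_ring_simps, simplified])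
  qed
qed

lemma fin_dim_image:
  assumes "is_vs V" "fin_dim V" "is_vs W" "f \<in> lhom V W" "f ` carrier V = carrier W"
  shows "fin_dim W"
proof -
  interpret linear_map class_ring V W f using assms by (simp add: linear_map_iff)
  show ?thesis using surj_fin_dim assms by blast
qed

lemma ldim_iso:
  assumes "is_vs V" "fin_dim V" "is_vs W" "f \<in> lhom V W" "bij_betw f (carrier V) (carrier W)"
  shows "ldim W = ldim V"
proof -
  interpret linear_map class_ring V W f using assms by (simp add: linear_map_iff)
  show ?thesis using dim_eq[OF assms(2)] assms(5) by (simp add: bij_betw_def)
qed

definition lcomb :: "('a::field, 'v) module \<Rightarrow> nat \<Rightarrow> (nat \<Rightarrow> 'v) \<Rightarrow> 'a vec \<Rightarrow> 'v" where
  "lcomb V n t v = finsum V (\<lambda>j. v $ j \<odot>\<^bsub>V\<^esub> t j) {..<n}"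

lemma lcomb_lhom:
  assumes V: "is_vs V" and t: "\<And>j. j < n \<Longrightarrow> t j \<in> carrier V"
  shows "lcomb V n t \<in> lhom (module_vec TYPE('a::field) n) (V :: ('a, 'v) module)"
proof -
  interpret V: vectorspace class_ring V by fact
  have cl: "(\<lambda>j. c j \<odot>\<^bsub>V\<^esub> t j) \<in> {..<n} \<rightarrow> carrier V" for c
    using t by (auto intro: vs_smult_closed[OF V])
  show ?thesis
  proof (rule lhomI)
    fix x y :: "'a vec" and r :: 'a
    assume x: "x \<in> carrier (module_vec TYPE('a) n)"
    then have xd: "dim_vec x = n" by (simp add: module_vec_simps)
    show "lcomb V n t x \<in> carrier V"
      unfolding lcomb_def by (rule V.finsum_closed[OF cl])
    show "lcomb V n t (r \<odot>\<^bsub>module_vec TYPE('a) n\<^esub> x) = r \<odot>\<^bsub>V\<^esub> lcomb V n t x"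
      unfolding lcomb_def using cl t xd
      by (subst V.finsum_smult)
        (auto intro!: V.finsum_cong' simp: module_vec_simps class_ring_simps V.smult_assoc1[simplified class_ring_simps, simplified] vs_smult_closed[OF V])
    assume y: "y \<in> carrier (module_vec TYPE('a) n)"
    then have yd: "dim_vec y = n" by (simp add: module_vec_simps)
    show "lcomb V n t (x \<oplus>\<^bsub>module_vec TYPE('a) n\<^esub> y) = lcomb V n t x \<oplus>\<^bsub>V\<^esub> lcomb V n t y"
      unfolding lcomb_def using cl t xd yd
      by (subst V.finsum_addf[symmetric])
        (auto simp del: V.finsum_addf intro!: V.finsum_cong' simp: module_vec_simps class_ring_simps V.smult_l_distr[simplified class_ring_simps, simplified] vs_smult_closed[OF V] vs_add_closed[OF V])
  qed
qed

lemma lcomb_unit_vec: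
  assumes V: "is_vs V" and t: "\<And>j. j < n \<Longrightarrow> t j \<in> carrier V" and i: "i < n"
  shows "lcomb V n t (unit_vec n i) = t i"
proof -
  interpret V: vectorspace class_ring V by fact
  have "lcomb V n t (unit_vec n i) = finsum V (\<lambda>j. if i = j then t j else \<zero>\<^bsub>V\<^esub>) {..<n}"
    unfolding lcomb_def using t i V.smult_one[simplified class_ring_simps] V.lmult_0
    by (intro V.finsum_cong') (auto simp: unit_vec_def)
  also have "\<dots> = t i"
    using t i by (subst V.finsum_singleton) auto
  finally show ?thesis .
qed

lemma vec_eq_lcomb:
  assumes v: "v \<in> carrier_vec n"
  shows "lcomb (module_vec TYPE('a::field) n) n (unit_vec n) v = v"
proof -
  let ?V = "module_vec TYPE('a) n"
  interpret V: vectorspace class_ring ?V by simp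
  have part: "finsum ?V (\<lambda>j. v $ j \<odot>\<^bsub>?V\<^esub> unit_vec n j) {..<m} =
      vec n (\<lambda>i. if i < m then v $ i else 0)" if "m \<le> n" for m
    using that
  proof (induction m)
    case 0
    then show ?case by (auto simp: module_vec_simps zero_vec_def)
  next
    case (Suc m)
    have "(\<lambda>j. v $ j \<odot>\<^bsub>?V\<^esub> unit_vec n j) \<in> {..<m} \<rightarrow> carrier ?V"
      by (auto simp: module_vec_simps)
    moreover have "v $ m \<odot>\<^bsub>?V\<^esub> unit_vec n m \<in> carrier ?V"
      by (auto simp: module_vec_simps)
    ultimately show ?case using Suc v unfolding lessThan_Suc
      by (subst V.finsum_insert) (auto simp: module_vec_simps less_Suc_eq intro!: eq_vecI)
  qed
  show ?thesis
    unfolding lcomb_def part[OF le_refl] using v by (intro eq_vecI) auto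
qed

lemma lhom_injI:
  assumes V: "is_vs V" and W: "is_vs W" and f: "f \<in> lhom V W"
    and ker: "\<And>x. x \<in> carrier V \<Longrightarrow> f x = \<zero>\<^bsub>W\<^esub> \<Longrightarrow> x = \<zero>\<^bsub>V\<^esub>"
  shows "inj_on f (carrier V)"
proof -
  interpret linear_map class_ring V W f using assms by (simp add: linear_map_iff)
  have "{v \<in> carrier V. f v = \<zero>\<^bsub>W\<^esub>} = {\<zero>\<^bsub>V\<^esub>}" using ker by auto
  then show ?thesis using Ke0_imp_inj by (simp add: ker_def)
qed

lemma lhom_finsum:
  assumes V: "is_vs V" and W: "is_vs W" and f: "f \<in> lhom V W" and g: "g \<in> A \<rightarrow> carrier V"
    and "finite A"
  shows "f (finsum V g A) = finsum W (\<lambda>x. f (g x)) A"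
proof -
  interpret V: vectorspace class_ring V by fact
  interpret W: vectorspace class_ring W by fact
  show ?thesis
    using \<open>finite A\<close> g
  proof (induction A rule: finite_induct)
    case (insert a A)
    then have g: "g \<in> A \<rightarrow> carrier V" "g a \<in> carrier V" by auto
    then have "(\<lambda>x. f (g x)) \<in> A \<rightarrow> carrier W" "f (g a) \<in> carrier W"
      using lhom_closed[OF f] by auto
    then show ?case using insert g
      by (simp add: V.finsum_insert W.finsum_insert lhom_add[OF f] V.finsum_closed)
  qed (simp add: lhom_zero[OF V W f])
qed

lemma lhom_vec_eq_lcomb:
  assumes V: "is_vs V" and f: "f \<in> lhom (module_vec TYPE('a::field) n) V" and v: "v \<in> carrier_vec n"
  shows "f v = lcomb V n (\<lambda>j. f (unit_vec n j)) v"
proof -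
  let ?K = "module_vec TYPE('a) n"
  interpret V: vectorspace class_ring V by fact
  have "f v = f (lcomb ?K n (unit_vec n) v)" by (simp add: vec_eq_lcomb v)
  also have "\<dots> = finsum V (\<lambda>j. f (v $ j \<odot>\<^bsub>?K\<^esub> unit_vec n j)) {..<n}"
    unfolding lcomb_def by (subst lhom_finsum[OF _ V f]) (auto simp: module_vec_simps)
  also have "\<dots> = lcomb V n (\<lambda>j. f (unit_vec n j)) v"
    unfolding lcomb_def
    by (rule V.finsum_cong')
      (auto simp: lhom_smult[OF f, simplified module_vec_simps] module_vec_simps intro!: vs_smult_closed[OF V] lhom_closed[OF f])
  finally show ?thesis .
qed

lemma lhom_vec_eqI:
  assumes "is_vs V" "f \<in> lhom (module_vec TYPE('a::field) n) V" "g \<in> lhom (module_vec TYPE('a) n) V"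
    and "\<And>j. j < n \<Longrightarrow> f (unit_vec n j) = g (unit_vec n j)" and v: "v \<in> carrier_vec n"
  shows "f v = g v"
proof -
  interpret V: vectorspace class_ring V by fact
  have "lcomb V n (\<lambda>j. f (unit_vec n j)) v = lcomb V n (\<lambda>j. g (unit_vec n j)) v"
    unfolding lcomb_def
  proof (rule V.finsum_cong')
    show "(\<lambda>j. v $ j \<odot>\<^bsub>V\<^esub> g (unit_vec n j)) \<in> {..<n} \<rightarrow> carrier V"
      by (auto intro!: vs_smult_closed[OF assms(1)] lhom_closed[OF assms(3)] simp: module_vec_simps)
  qed (simp_all add: assms(4))
  then show ?thesis
    using lhom_vec_eq_lcomb[OF assms(1) assms(2) v] lhom_vec_eq_lcomb[OF assms(1) assms(3) v] by simp
qed

lemma mult_mat_vec_lhom: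
  "A \<in> carrier_mat m n \<Longrightarrow> (\<lambda>v. A *\<^sub>v v) \<in> lhom (module_vec TYPE('a::field) n) (module_vec TYPE('a) m)"
  by (rule lhomI) (auto simp: module_vec_simps mult_add_distrib_mat_vec mult_mat_vec)

definition mat_of_lhom :: "nat \<Rightarrow> nat \<Rightarrow> ('a::field vec \<Rightarrow> 'a vec) \<Rightarrow> 'a mat" where
  "mat_of_lhom m n f = mat m n (\<lambda>(i, j). f (unit_vec n j) $ i)"

lemma mat_of_lhom_carrier [simp]: "mat_of_lhom m n f \<in> carrier_mat m n"
  by (simp add: mat_of_lhom_def)

lemma mat_unit_vec:
  assumes "A \<in> carrier_mat m n" "j < n" shows "(A :: 'a::field mat) *\<^sub>v unit_vec n j = col A j"
  using assms by (intro eq_vecI) auto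

lemma mat_of_lhom:
  assumes f: "f \<in> lhom (module_vec TYPE('a::field) n) (module_vec TYPE('a) m)" and v: "v \<in> carrier_vec n"
  shows "mat_of_lhom m n f *\<^sub>v v = f v"
proof (rule lhom_vec_eqI[OF _ mult_mat_vec_lhom f _ v])
  fix j assume j: "j < n"
  have "f (unit_vec n j) \<in> carrier_vec m"
    using lhom_closed[OF f, of "unit_vec n j"] by (simp add: module_vec_simps)
  then show "mat_of_lhom m n f *\<^sub>v unit_vec n j = f (unit_vec n j)"
    by (subst mat_unit_vec[where m = m]) (auto simp: mat_of_lhom_def j col_def intro!: eq_vecI)
qed auto

lemma mat_eq_by_vec:
  assumes "A \<in> carrier_mat m n" "B \<in> carrier_mat m n"
    and "\<And>v. v \<in> carrier_vec n \<Longrightarrow> A *\<^sub>v v = B *\<^sub>v v"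
  shows "A = (B :: 'a::field mat)"
proof (rule eq_matI)
  fix i j assume "i < dim_row B" "j < dim_col B"
  then have ij: "i < m" "j < n" using assms by auto
  have "col A j = col B j"
    using assms(3)[of "unit_vec n j"] assms(1,2) ij by (simp add: mat_unit_vec)
  then show "A $$ (i, j) = B $$ (i, j)"
    using assms(1,2) ij by (metis carrier_matD index_col)
qed (use assms in auto)

lemma coordinates_exist:
  assumes V: "is_vs (V :: ('a::field, 'v) module)" and fd: "fin_dim V"
  shows "\<exists>\<phi>. \<phi> \<in> lin_isos (module_vec TYPE('a) (ldim V)) V"
proof -
  interpret V: vectorspace class_ring V by fact
  obtain \<beta> where fin: "finite \<beta>" and bas: "V.basis \<beta>" using V.finite_basis_exists[OF fd] by blast
  define n where "n = card \<beta>"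
  obtain t where t: "bij_betw t {..<n} \<beta>"
    using bij_betw_from_nat_into_finite[OF fin] n_def by blast
  have \<beta>: "\<beta> \<subseteq> carrier V" "V.gen_set \<beta>" "V.lin_indpt \<beta>" using bas by (auto simp: V.basis_def)
  have tc: "t j \<in> carrier V" if "j < n" for j using t that \<beta> by (auto simp: bij_betw_def)
  let ?K = "module_vec TYPE('a) n"
  let ?f = "lcomb V n t"
  have lin: "?f \<in> lhom ?K V" by (rule lcomb_lhom[OF V tc])
  have sums: "?f v = V.lincomb (\<lambda>w. v $ inv_into {..<n} t w) \<beta>" for v
  proof -
    have "\<beta> = t ` {..<n}" and inj: "inj_on t {..<n}" using t by (auto simp: bij_betw_def)
    then show ?thesis unfolding V.lincomb_def lcomb_def
      by simp (subst V.finsum_reindex, auto intro!: V.finsum_cong' vs_smult_closed[OF V] tc)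
  qed
  have "inj_on ?f (carrier ?K)"
  proof -
    have "v = 0\<^sub>v n" if v: "v \<in> carrier_vec n" and 0: "?f v = \<zero>\<^bsub>V\<^esub>" for v
    proof (rule eq_vecI)
      fix j assume "j < dim_vec (0\<^sub>v n :: 'a vec)"
      then have j: "j < n" by simp
      show "v $ j = 0\<^sub>v n $ j"
      proof (rule ccontr)
        assume "v $ j \<noteq> 0\<^sub>v n $ j"
        then have "v $ inv_into {..<n} t (t j) \<noteq> 0" using t j by (simp add: bij_betw_def)
        moreover have "t j \<in> \<beta>" using t j by (auto simp: bij_betw_def)
        ultimately have "V.lin_dep \<beta>"
          using V.lin_dep_crit[of \<beta> \<beta> "\<lambda>w. v $ inv_into {..<n} t w" "t j"] fin 0 sums
          by (auto simp: class_ring_simps)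
        then show False using \<beta> by simp
      qed
    qed (use v in auto)
    then show ?thesis by (intro lhom_injI[OF _ V lin]) (auto simp: module_vec_simps)
  qed
  moreover have "?f ` carrier ?K = carrier V"
  proof
    show "?f ` carrier ?K \<subseteq> carrier V" using lin by (auto simp: lhom_iff)
    show "carrier V \<subseteq> ?f ` carrier ?K"
    proof
      fix w assume "w \<in> carrier V"
      then obtain a where a: "V.lincomb a \<beta> = w" 
        using V.finite_in_span[OF fin \<beta>(1)] \<beta>(2) by blast
      have "?f (vec n (\<lambda>j. a (t j))) = V.lincomb a \<beta>"
        unfolding sums V.lincomb_def using t \<beta>(1)
        by (intro V.finsum_cong') 
          (auto simp: bij_betw_def f_inv_into_f inv_into_into intro!: vs_smult_closed[OF V])
      then show "w \<in> ?f ` carrier ?K" using a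
        by (intro image_eqI[of _ _ "vec n (\<lambda>j. a (t j))"]) (auto simp: module_vec_simps)
    qed
  qed
  ultimately have bij: "bij_betw ?f (carrier ?K) (carrier V)" by (simp add: bij_betw_def)
  have "ldim V = n" using ldim_iso[OF _ _ V lin bij] by simp
  then show ?thesis using restrict_lin_isos[OF _ lin bij] by auto
qed

section \<open>Subspaces and quotients\<close>

abbreviation lsubspace :: "'v set \<Rightarrow> ('a::field, 'v) module \<Rightarrow> bool" where
  "lsubspace U V \<equiv> VectorSpace.subspace class_ring U V"

abbreviation coset :: "('a::field, 'v) module \<Rightarrow> 'v set \<Rightarrow> 'v \<Rightarrow> 'v set" where
  "coset V U v \<equiv> U +>\<^bsub>V\<^esub> v"

lemma lsubspace_iff:
  "lsubspace U V \<longleftrightarrow> is_vs V \<and> U \<subseteq> carrier V \<and> \<zero>\<^bsub>V\<^esub> \<in> U \<and>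
     (\<forall>x\<in>U. \<forall>y\<in>U. x \<oplus>\<^bsub>V\<^esub> y \<in> U) \<and> (\<forall>r. \<forall>x\<in>U. r \<odot>\<^bsub>V\<^esub> x \<in> U)"
  by (auto simp: subspace_def submodule_def vectorspace_def class_ring_simps)

lemma lsubspace_is_vs: "lsubspace U V \<Longrightarrow> is_vs (V\<lparr>carrier := U\<rparr>)"
  using vectorspace.subspace_is_vs by (auto simp: subspace_def)

lemma lsubspace_minus:
  assumes "lsubspace U V" "x \<in> U" "y \<in> U"
  shows "x \<ominus>\<^bsub>V\<^esub> y \<in> U"
proof -
  interpret V: vectorspace class_ring V using assms by (simp add: lsubspace_iff)
  have "y \<in> carrier V" "x \<in> carrier V" using assms by (auto simp: lsubspace_iff)
  then have "x \<ominus>\<^bsub>V\<^esub> y = x \<oplus>\<^bsub>V\<^esub> (- 1) \<odot>\<^bsub>V\<^esub> y"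
    using V.smult_minus_1[of y] by (simp add: a_minus_def class_ring_simps)
  then show ?thesis using assms by (auto simp: lsubspace_iff)
qed

lemma lsubspace_abelian_subgroup:
  assumes U: "lsubspace U V"
  shows "abelian_subgroup U V"
proof -
  interpret V: vectorspace class_ring V using U by (simp add: lsubspace_iff)
  have sub: "U \<subseteq> carrier V" using U by (simp add: lsubspace_iff)
  have inv: "\<ominus>\<^bsub>V\<^esub> x \<in> U" if "x \<in> U" for x
    using lsubspace_minus[OF U _ that, of "\<zero>\<^bsub>V\<^esub>"] U that sub by (auto simp: lsubspace_iff a_minus_def)
  show ?thesis
  proof (rule abelian_subgroupI3)
    show "additive_subgroup U V"
      using U sub inv
      by (intro additive_subgroupI V.add.subgroupI) (auto simp: lsubspace_iff a_inv_def)
  qed unfold_locales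
qed

lemma vs_minus_add:
  assumes V: "is_vs V" and x: "x \<in> carrier V" and y: "y \<in> carrier V"
  shows "x \<ominus>\<^bsub>V\<^esub> y \<oplus>\<^bsub>V\<^esub> y = x" "x \<oplus>\<^bsub>V\<^esub> y \<ominus>\<^bsub>V\<^esub> y = x"
proof -
  interpret V: vectorspace class_ring V by fact
  show "x \<ominus>\<^bsub>V\<^esub> y \<oplus>\<^bsub>V\<^esub> y = x" "x \<oplus>\<^bsub>V\<^esub> y \<ominus>\<^bsub>V\<^esub> y = x"
    using x y by (simp_all add: a_minus_def V.a_assoc V.r_neg V.l_neg)
qed

lemma vs_minus_self:
  assumes V: "is_vs V" and x: "x \<in> carrier V"
  shows "x \<ominus>\<^bsub>V\<^esub> x = \<zero>\<^bsub>V\<^esub>"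
proof -
  interpret V: vectorspace class_ring V by fact
  show ?thesis using x by (simp add: a_minus_def V.r_neg)
qed

lemma vs_zero_add:
  assumes V: "is_vs V" and x: "x \<in> carrier V"
  shows "\<zero>\<^bsub>V\<^esub> \<oplus>\<^bsub>V\<^esub> x = x" "x \<oplus>\<^bsub>V\<^esub> \<zero>\<^bsub>V\<^esub> = x"
proof -
  interpret V: vectorspace class_ring V by fact
  show "\<zero>\<^bsub>V\<^esub> \<oplus>\<^bsub>V\<^esub> x = x" "x \<oplus>\<^bsub>V\<^esub> \<zero>\<^bsub>V\<^esub> = x" using x by simp_all
qed

lemma vs_minus_zero: "is_vs V \<Longrightarrow> x \<in> carrier V \<Longrightarrow> x \<ominus>\<^bsub>V\<^esub> \<zero>\<^bsub>V\<^esub> = x"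
  using vs_minus_add(1)[of V x "\<zero>\<^bsub>V\<^esub>"] by (simp add: vs_zero_add vs_zero_closed vs_minus_closed)

lemma vs_minus_eq_zero:
  "is_vs V \<Longrightarrow> x \<in> carrier V \<Longrightarrow> y \<in> carrier V \<Longrightarrow> x \<ominus>\<^bsub>V\<^esub> y = \<zero>\<^bsub>V\<^esub> \<longleftrightarrow> x = y"
  using vs_minus_add(1)[of V x y] by (auto simp: vs_zero_add vs_minus_self)

lemma lhom_minus:
  assumes "is_vs V" "is_vs W" "f \<in> lhom V W" "x \<in> carrier V" "y \<in> carrier V"
  shows "f (x \<ominus>\<^bsub>V\<^esub> y) = f x \<ominus>\<^bsub>W\<^esub> f y"
proof -
  interpret linear_map class_ring V W f using assms by (simp add: linear_map_iff)
  show ?thesis using assms by simp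
qed

lemma mem_coset_iff:
  assumes U: "lsubspace U V" and x: "x \<in> carrier V" and y: "y \<in> carrier V"
  shows "x \<in> coset V U y \<longleftrightarrow> x \<ominus>\<^bsub>V\<^esub> y \<in> U"
proof -
  interpret V: vectorspace class_ring V using U by (simp add: lsubspace_iff)
  have sub: "U \<subseteq> carrier V" using U by (simp add: lsubspace_iff)
  have "x = u \<oplus>\<^bsub>V\<^esub> y \<longleftrightarrow> x \<ominus>\<^bsub>V\<^esub> y = u" if "u \<in> U" for u
    using vs_minus_add[OF V.vectorspace_axioms _ y] x sub that by auto
  then show ?thesis by (auto simp: a_r_coset_def')
qed

lemma coset_eq_iff:
  assumes U: "lsubspace U V" and x: "x \<in> carrier V" and y: "y \<in> carrier V"
  shows "coset V U x = coset V U y \<longleftrightarrow> x \<ominus>\<^bsub>V\<^esub> y \<in> U"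
proof -
  interpret abelian_subgroup U V by (rule lsubspace_abelian_subgroup[OF U])
  show ?thesis unfolding mem_coset_iff[OF assms, symmetric]
    using a_repr_independence[OF _ y, of x U] a_rcos_self[OF x] a_subgroup by blast
qed

lemma coset_self: "lsubspace U V \<Longrightarrow> x \<in> carrier V \<Longrightarrow> x \<in> coset V U x"
  by (rule abelian_subgroup.a_rcos_self[OF lsubspace_abelian_subgroup])

lemma coset_subset: "lsubspace U V \<Longrightarrow> x \<in> carrier V \<Longrightarrow> coset V U x \<subseteq> carrier V"
  by (auto simp: a_r_coset_def' lsubspace_iff intro!: vs_add_closed)

lemma quot_module_sel [simp]:
  "zero (quot_module V U) = U" "add (quot_module V U) = set_add V"
  "carrier (quot_module V U) = coset V U ` carrier V"
  by (auto simp: quot_module_def A_RCOSETS_def' )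

text \<open>The unions over a coset in the quotient operations take the same value at each element.\<close>

lemma UN_coset:
  assumes U: "lsubspace U V" and x: "x \<in> carrier V"
    and const: "\<And>v. v \<in> carrier V \<Longrightarrow> v \<ominus>\<^bsub>V\<^esub> x \<in> U \<Longrightarrow> F v = F x"
  shows "(\<Union>v\<in>coset V U x. F v) = F x"
  using coset_self[OF U x] const mem_coset_iff[OF U _ x] coset_subset[OF U x] by blast

lemma quot_smult:
  assumes U: "lsubspace U V" and x: "x \<in> carrier V"
  shows "r \<odot>\<^bsub>quot_module V U\<^esub> coset V U x = coset V U (r \<odot>\<^bsub>V\<^esub> x)"
proof -
  interpret V: vectorspace class_ring V using U by (simp add: lsubspace_iff)
  have vs: "is_vs V" by (rule V.vectorspace_axioms)
  have "(\<Union>v\<in>coset V U x. coset V U (r \<odot>\<^bsub>V\<^esub> v)) = coset V U (r \<odot>\<^bsub>V\<^esub> x)"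
  proof (rule UN_coset[OF U x])
    fix v assume v: "v \<in> carrier V" "v \<ominus>\<^bsub>V\<^esub> x \<in> U"
    have "r \<odot>\<^bsub>V\<^esub> v \<ominus>\<^bsub>V\<^esub> r \<odot>\<^bsub>V\<^esub> x = r \<odot>\<^bsub>V\<^esub> (v \<ominus>\<^bsub>V\<^esub> x)"
      using v x V.smult_r_distr[of r v "\<ominus>\<^bsub>V\<^esub> x"] V.smult_r_minus[of r x]
      by (simp add: a_minus_def class_ring_simps)
    then show "coset V U (r \<odot>\<^bsub>V\<^esub> v) = coset V U (r \<odot>\<^bsub>V\<^esub> x)"
      using U v x by (subst coset_eq_iff[OF U]) (auto simp: lsubspace_iff vs_smult_closed[OF vs])
  qed
  then show ?thesis by (simp add: quot_module_def)
qed

lemma coset_lhom: "lsubspace U V \<Longrightarrow> coset V U \<in> lhom V (quot_module V U)"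
  by (rule lhomI)
    (auto simp: quot_smult abelian_subgroup.a_rcos_sum[OF lsubspace_abelian_subgroup])

lemma coset_zero:
  assumes "lsubspace U V"
  shows "coset V U \<zero>\<^bsub>V\<^esub> = U"
proof -
  interpret abelian_subgroup U V by (rule lsubspace_abelian_subgroup[OF assms])
  show ?thesis using a_subset by simp
qed

lemma is_vs_quot: "lsubspace U V \<Longrightarrow> is_vs (quot_module V U)"
  by (rule is_vs_image[OF _ coset_lhom]) (auto simp: lsubspace_iff coset_zero)

lemma fin_dim_quot: "lsubspace U V \<Longrightarrow> fin_dim V \<Longrightarrow> fin_dim (quot_module V U)"
  by (rule fin_dim_image[OF _ _ is_vs_quot coset_lhom]) (auto simp: lsubspace_iff)

lemma coset_eq_zero_iff: "lsubspace U V \<Longrightarrow> x \<in> carrier V \<Longrightarrow> coset V U x = U \<longleftrightarrow> x \<in> U"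
proof -
  assume U: "lsubspace U V" and x: "x \<in> carrier V"
  interpret V: vectorspace class_ring V using U by (simp add: lsubspace_iff)
  show ?thesis
    using coset_eq_iff[OF U x, of "\<zero>\<^bsub>V\<^esub>"] x by (simp add: coset_zero[OF U] vs_minus_zero V.vectorspace_axioms)
qed

lemma ldim_sub_quot:
  assumes U: "lsubspace U V" and fd: "fin_dim V"
  shows "ldim V = ldim (V\<lparr>carrier := U\<rparr>) + ldim (quot_module V U)"
proof -
  have V: "is_vs V" and sub: "U \<subseteq> carrier V" using U by (auto simp: lsubspace_iff)
  interpret linear_map class_ring V "quot_module V U" "coset V U"
    using V is_vs_quot[OF U] coset_lhom[OF U] by (simp add: linear_map_iff)
  have "ker = U" using sub coset_eq_zero_iff[OF U] by (auto simp: ker_def)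
  moreover have "im = carrier (quot_module V U)" by (simp add: im_def)
  moreover have "(quot_module V U)\<lparr>carrier := carrier (quot_module V U)\<rparr> = quot_module V U"
    by (rule module.equality) (simp_all)
  ultimately show ?thesis using rank_nullity[OF fd] by (simp only: add.commute)
qed

lemma quot_induced:
  assumes U: "lsubspace U V" and Y: "is_vs Y" and f: "f \<in> lhom V Y"
    and ker: "\<And>v. v \<in> carrier V \<Longrightarrow> f v = \<zero>\<^bsub>Y\<^esub> \<longleftrightarrow> v \<in> U" and surj: "f ` carrier V = carrier Y"
  shows "\<exists>g. g \<in> lhom (quot_module V U) Y \<and> bij_betw g (carrier (quot_module V U)) (carrier Y) \<and>
     (\<forall>v\<in>carrier V. g (coset V U v) = f v)"
proof -
  interpret V: vectorspace class_ring V using U by (simp add: lsubspace_iff)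
  interpret linear_map class_ring V Y f using Y f V.vectorspace_axioms by (simp add: linear_map_iff)
  define g where "g c = f (SOME v. v \<in> c)" for c
  have eq: "f x = f y \<longleftrightarrow> x \<ominus>\<^bsub>V\<^esub> y \<in> U" if "x \<in> carrier V" "y \<in> carrier V" for x y
    using that ker[of "x \<ominus>\<^bsub>V\<^esub> y"] by (simp add: vs_minus_eq_zero[OF Y])
  have g: "g (coset V U v) = f v" if v: "v \<in> carrier V" for v
  proof -
    have "(SOME w. w \<in> coset V U v) \<in> coset V U v" using coset_self[OF U v] by (rule someI)
    then show ?thesis
      unfolding g_def using mem_coset_iff[OF U _ v] coset_subset[OF U v] eq[OF _ v] by blast
  qed
  have "g \<in> lhom (quot_module V U) Y"
  proof (rule lhomI)
    fix c assume "c \<in> carrier (quot_module V U)"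
    then obtain v where v: "v \<in> carrier V" "c = coset V U v" by auto
    show "g c \<in> carrier Y" using v by (simp add: g lhom_closed[OF f])
    show "g (r \<odot>\<^bsub>quot_module V U\<^esub> c) = r \<odot>\<^bsub>Y\<^esub> g c" for r
      using v by (simp add: quot_smult[OF U] g lhom_smult[OF f] vs_smult_closed[OF V.vectorspace_axioms])
    fix d assume "d \<in> carrier (quot_module V U)"
    then obtain w where w: "w \<in> carrier V" "d = coset V U w" by auto
    show "g (c \<oplus>\<^bsub>quot_module V U\<^esub> d) = g c \<oplus>\<^bsub>Y\<^esub> g d"
      using v w
      by (simp add: abelian_subgroup.a_rcos_sum[OF lsubspace_abelian_subgroup[OF U]] g lhom_add[OF f])
  qed
  moreover have "bij_betw g (carrier (quot_module V U)) (carrier Y)"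
    unfolding bij_betw_def inj_on_def using surj
    by (auto simp: g eq coset_eq_iff[OF U] image_image)
  ultimately show ?thesis using g by blast
qed

lemma lsubspace_image:
  assumes U: "lsubspace U V" and W: "is_vs W" and f: "f \<in> lhom V W"
  shows "lsubspace (f ` U) W"
proof -
  have V: "is_vs V" and sub: "U \<subseteq> carrier V" using U by (auto simp: lsubspace_iff)
  show ?thesis
    unfolding lsubspace_iff
  proof (intro conjI ballI allI)
    show "\<zero>\<^bsub>W\<^esub> \<in> f ` U" using lhom_zero[OF V W f] U by (force simp: lsubspace_iff)
    show "f ` U \<subseteq> carrier W" using sub lhom_closed[OF f] by auto
    fix x assume "x \<in> f ` U"
    then obtain a where a: "a \<in> U" "x = f a" by auto
    show "r \<odot>\<^bsub>W\<^esub> x \<in> f ` U" for r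
      using a sub U lhom_smult[OF f, of a r] by (auto simp: lsubspace_iff intro!: image_eqI[of _ _ "r \<odot>\<^bsub>V\<^esub> a"])
    fix y assume "y \<in> f ` U"
    then obtain b where b: "b \<in> U" "y = f b" by auto
    show "x \<oplus>\<^bsub>W\<^esub> y \<in> f ` U"
      using a b sub U lhom_add[OF f, of a b] by (intro image_eqI[of _ _ "a \<oplus>\<^bsub>V\<^esub> b"]) (auto simp: lsubspace_iff subset_iff)
  qed (rule W)
qed

lemma card_carrier_vec: "card (carrier_vec n :: 'a::{field,finite} vec set) = CARD('a) ^ n"
  and finite_carrier_vec [simp]: "finite (carrier_vec n :: 'a::{field,finite} vec set)"
proof -
  have "bij_betw (\<lambda>v. \<lambda>i\<in>{..<n}. v $ i) (carrier_vec n :: 'a vec set) ({..<n} \<rightarrow>\<^sub>E UNIV)"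
    by (rule bij_betw_byWitness[where f' = "\<lambda>g. vec n g"])
      (auto simp: fun_eq_iff PiE_def extensional_def)
  then show "card (carrier_vec n :: 'a::{field,finite} vec set) = CARD('a) ^ n"
    "finite (carrier_vec n :: 'a::{field,finite} vec set)"
    by (auto dest: bij_betw_same_card bij_betw_finite simp: card_PiE finite_PiE)
qed

lemma finite_carrier:
  assumes "is_vs (V :: ('a::{field,finite}, 'v) module)" "fin_dim V"
  shows "finite (carrier V)"
proof -
  obtain \<phi> where "\<phi> \<in> lin_isos (module_vec TYPE('a) (ldim V)) V" using coordinates_exist[OF assms] by blast
  then show ?thesis using bij_betw_finite[OF lin_isosD(3)] by (fastforce simp: module_vec_simps)
qed

lemma fin_dim_if_finite:
  assumes "is_vs V" "finite (carrier V)"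
  shows "fin_dim V"
proof -
  interpret vectorspace class_ring V by fact
  have "span (carrier V) = carrier V"
    using in_own_span[of "carrier V"] span_is_subset2[of "carrier V"] by auto
  then show ?thesis unfolding fin_dim_def using assms(2) by blast
qed

section \<open>Representations and their isomorphisms\<close>

locale quiver = fin_digraph Q for Q :: "('i, 'h) pre_digraph"
begin

lemma is_repD:
  assumes "is_rep Q M"
  shows "i \<in> verts Q \<Longrightarrow> is_vs (vsp M i)" "i \<in> verts Q \<Longrightarrow> fin_dim (vsp M i)"
    "h \<in> arcs Q \<Longrightarrow> vmap M h \<in> lhom (vsp M (tail Q h)) (vsp M (head Q h))"
  using assms by (auto simp: is_rep_def linear_map_iff)

lemma is_repI:
  assumes "\<And>i. i \<in> verts Q \<Longrightarrow> is_vs (vsp M i)" "\<And>i. i \<in> verts Q \<Longrightarrow> fin_dim (vsp M i)"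
    "\<And>h. h \<in> arcs Q \<Longrightarrow> vmap M h \<in> lhom (vsp M (tail Q h)) (vsp M (head Q h))"
  shows "is_rep Q M"
  using assms by (auto simp: is_rep_def linear_map_iff)

lemma vmap_closed:
  "is_rep Q M \<Longrightarrow> h \<in> arcs Q \<Longrightarrow> v \<in> carrier (vsp M (tail Q h)) \<Longrightarrow> vmap M h v \<in> carrier (vsp M (head Q h))"
  by (blast dest: is_repD(3) lhom_closed)

definition is_iso :: "('i, 'h, 'a::field, 'v) quiver_rep \<Rightarrow> ('i, 'h, 'a, 'w) quiver_rep \<Rightarrow>
    ('i \<Rightarrow> 'v \<Rightarrow> 'w) \<Rightarrow> bool" where
  "is_iso M N f \<longleftrightarrow> (\<forall>i\<in>verts Q. f i \<in> lin_isos (vsp M i) (vsp N i)) \<and>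
     (\<forall>h\<in>arcs Q. \<forall>v\<in>carrier (vsp M (tail Q h)). f (head Q h) (vmap M h v) = vmap N h (f (tail Q h) v))"

lemma is_isoD:
  assumes "is_iso M N f"
  shows "i \<in> verts Q \<Longrightarrow> f i \<in> lin_isos (vsp M i) (vsp N i)"
    "i \<in> verts Q \<Longrightarrow> f i \<in> lhom (vsp M i) (vsp N i)"
    "i \<in> verts Q \<Longrightarrow> bij_betw (f i) (carrier (vsp M i)) (carrier (vsp N i))"
    "i \<in> verts Q \<Longrightarrow> v \<in> carrier (vsp M i) \<Longrightarrow> f i v \<in> carrier (vsp N i)"
    "h \<in> arcs Q \<Longrightarrow> v \<in> carrier (vsp M (tail Q h)) \<Longrightarrow>
      f (head Q h) (vmap M h v) = vmap N h (f (tail Q h) v)"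
  using assms by (auto simp: is_iso_def dest: lin_isosD intro: lhom_closed)

lemma rep_iso_iff: "rep_iso Q M N \<longleftrightarrow> (\<exists>f. is_iso M N f)"
proof
  assume "\<exists>f. is_iso M N f"
  then obtain f where f: "is_iso M N f" by blast
  have "restrict f (verts Q) \<in> rep_hom Q M N"
    using f by (auto simp: rep_hom_def is_iso_def dest: lin_isosD)
  then show "rep_iso Q M N"
    unfolding rep_iso_def using f by (intro bexI[of _ "restrict f (verts Q)"]) (auto simp: is_iso_def)
qed (auto simp: rep_iso_def rep_hom_def is_iso_def)

lemma rep_isoI:
  assumes M: "is_rep Q M" and lin: "\<And>i. i \<in> verts Q \<Longrightarrow> f i \<in> lhom (vsp M i) (vsp N i)"
    and bij: "\<And>i. i \<in> verts Q \<Longrightarrow> bij_betw (f i) (carrier (vsp M i)) (carrier (vsp N i))"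
    and comm: "\<And>h v. h \<in> arcs Q \<Longrightarrow> v \<in> carrier (vsp M (tail Q h)) \<Longrightarrow>
      f (head Q h) (vmap M h v) = vmap N h (f (tail Q h) v)"
  shows "rep_iso Q M N"
proof -
  have "is_iso M N (\<lambda>i. restrict (f i) (carrier (vsp M i)))"
    unfolding is_iso_def
    using M lin bij comm by (auto intro!: restrict_lin_isos simp: is_repD(1) vmap_closed)
  then show ?thesis unfolding rep_iso_iff by blast
qed

lemma rep_iso_refl: "is_rep Q M \<Longrightarrow> rep_iso Q M M"
  by (rule rep_isoI[where f = "\<lambda>i v. v"]) (auto intro: lhomI simp: bij_betw_def)

lemma is_iso_inv:
  assumes M: "is_rep Q M" and N: "is_rep Q N" and f: "is_iso M N f"
  shows "is_iso N M (\<lambda>i. lin_inv (vsp M i) (vsp N i) (f i))"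
  unfolding is_iso_def
proof (intro conjI ballI)
  show "lin_inv (vsp M i) (vsp N i) (f i) \<in> lin_isos (vsp N i) (vsp M i)" if "i \<in> verts Q" for i
    using that M N f by (intro lin_inv_isos) (auto simp: is_repD is_isoD)
  fix h v assume h: "h \<in> arcs Q" and v: "v \<in> carrier (vsp N (tail Q h))"
  let ?t = "tail Q h" and ?h = "head Q h"
  let ?gt = "lin_inv (vsp M ?t) (vsp N ?t) (f ?t)" and ?gh = "lin_inv (vsp M ?h) (vsp N ?h) (f ?h)"
  have ft: "f ?t \<in> lin_isos (vsp M ?t) (vsp N ?t)" and fh: "f ?h \<in> lin_isos (vsp M ?h) (vsp N ?h)"
    using f h by (auto intro!: is_isoD(1))
  have gv: "?gt v \<in> carrier (vsp M ?t)"
    using lin_inv_isos[OF is_repD(1)[OF M] is_repD(1)[OF N] ft] h v by (auto dest!: lin_isosD(1) lhom_closed)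
  have "?gh (vmap N h v) = ?gh (f ?h (vmap M h (?gt v)))"
    using is_isoD(5)[OF f h gv] lin_inv_right[OF ft v] by simp
  also have "\<dots> = vmap M h (?gt v)"
    by (rule lin_inv_left[OF fh vmap_closed[OF M h gv]])
  finally show "?gh (vmap N h v) = vmap M h (?gt v)" .
qed

lemma rep_iso_sym: "is_rep Q M \<Longrightarrow> is_rep Q N \<Longrightarrow> rep_iso Q M N \<Longrightarrow> rep_iso Q N M"
  using is_iso_inv unfolding rep_iso_iff by blast

lemma rep_iso_trans:
  assumes "is_rep Q M" "rep_iso Q M N" "rep_iso Q N L"
  shows "rep_iso Q M L"
proof -
  obtain f g where f: "is_iso M N f" and g: "is_iso N L g" using assms(2,3) by (auto simp: rep_iso_iff)
  show ?thesis
  proof (rule rep_isoI[OF assms(1), where f = "\<lambda>i v. g i (f i v)"])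
    fix i assume i: "i \<in> verts Q"
    show "(\<lambda>v. g i (f i v)) \<in> lhom (vsp M i) (vsp L i)"
      by (rule lhom_comp[OF is_isoD(2)[OF f i] is_isoD(2)[OF g i]])
    show "bij_betw (\<lambda>v. g i (f i v)) (carrier (vsp M i)) (carrier (vsp L i))"
      using bij_betw_trans[OF is_isoD(3)[OF f i] is_isoD(3)[OF g i]] by (simp add: o_def)
  qed (auto simp: is_isoD[OF f] is_isoD[OF g])
qed

lemma dimv_iso:
  assumes "is_rep Q M" "is_rep Q N" "rep_iso Q M N"
  shows "dimv Q M = dimv Q N"
proof -
  obtain f where f: "is_iso M N f" using assms(3) by (auto simp: rep_iso_iff)
  show ?thesis
    unfolding dimv_def using f assms
    by (intro ext) (simp add: ldim_iso[OF is_repD(1)[OF assms(1)] is_repD(2)[OF assms(1)]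
        is_repD(1)[OF assms(2)] is_isoD(2)[OF f] is_isoD(3)[OF f]])
qed

lemma dimv_dimvecs: "dimv Q M \<in> dimvecs Q"
  by (auto simp: dimv_def dimvecs_def)


section \<open>Points of representation spaces over a field\<close>

definition reps_over :: "'a::field itself \<Rightarrow> ('i \<Rightarrow> nat) \<Rightarrow> ('h \<Rightarrow> 'a mat) set" where
  "reps_over _ \<alpha> = {x. \<forall>h\<in>arcs Q. x h \<in> carrier_mat (\<alpha> (head Q h)) (\<alpha> (tail Q h))}"

lemma point_rep_sel [simp]:
  "vsp (point_rep \<alpha> (x :: 'h \<Rightarrow> 'a::field mat)) i = module_vec TYPE('a) (\<alpha> i)"
  "vmap (point_rep \<alpha> x) h v = x h *\<^sub>v v"
  by (simp_all add: point_rep_def)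

lemma is_rep_point_rep: "x \<in> reps_over TYPE('a::field) \<alpha> \<Longrightarrow> is_rep Q (point_rep \<alpha> x)"
  by (rule is_repI)
    (auto simp: reps_over_def point_rep_def intro!: mult_mat_vec_lhom)

lemma dimv_point_rep: "\<alpha> \<in> dimvecs Q \<Longrightarrow> dimv Q (point_rep \<alpha> (x :: 'h \<Rightarrow> 'a::field mat)) = \<alpha>"
  by (auto simp: dimv_def dimvecs_def)

text \<open>Coordinates on the spaces of \<open>M\<close> turn its structure maps into matrices.\<close>

lemma rep_has_coordinates:
  assumes M: "is_rep Q (M :: ('i, 'h, 'a::field, 'v) quiver_rep)"
  shows "\<exists>x\<in>reps_over TYPE('a) (dimv Q M). rep_iso Q (point_rep (dimv Q M) x) M"
proof -
  let ?K = "\<lambda>i. module_vec TYPE('a) (dimv Q M i)"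
  have "\<exists>\<theta>. \<theta> \<in> lin_isos (?K i) (vsp M i)" if "i \<in> verts Q" for i
    using coordinates_exist[OF is_repD(1)[OF M that] is_repD(2)[OF M that]] that by (simp add: dimv_def)
  then obtain \<theta> where \<theta>: "\<And>i. i \<in> verts Q \<Longrightarrow> \<theta> i \<in> lin_isos (?K i) (vsp M i)" by metis
  define \<eta> where "\<eta> i = lin_inv (?K i) (vsp M i) (\<theta> i)" for i
  have \<eta>: "\<eta> i \<in> lin_isos (vsp M i) (?K i)" if "i \<in> verts Q" for i
    unfolding \<eta>_def using that by (intro lin_inv_isos \<theta>) (auto simp: is_repD[OF M])
  define x where "x h = mat_of_lhom (dimv Q M (head Q h)) (dimv Q M (tail Q h))
     (\<lambda>v. \<eta> (head Q h) (vmap M h (\<theta> (tail Q h) v)))" for h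
  have xv: "x h *\<^sub>v v = \<eta> (head Q h) (vmap M h (\<theta> (tail Q h) v))"
    if h: "h \<in> arcs Q" and v: "v \<in> carrier (?K (tail Q h))" for h v
    unfolding x_def
  proof (rule mat_of_lhom)
    show "(\<lambda>v. \<eta> (head Q h) (vmap M h (\<theta> (tail Q h) v))) \<in> lhom (?K (tail Q h)) (?K (head Q h))"
      by (rule lhom_comp[OF lhom_comp[OF lin_isosD(1)[OF \<theta>] is_repD(3)[OF M h]] lin_isosD(1)[OF \<eta>]])
        (use h in auto)
  qed (use v in \<open>simp add: module_vec_simps\<close>)
  have x: "x \<in> reps_over TYPE('a) (dimv Q M)" by (simp add: reps_over_def x_def)
  have "is_iso (point_rep (dimv Q M) x) M \<theta>"
    unfolding is_iso_def
  proof (intro conjI ballI)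
    fix h v assume h: "h \<in> arcs Q" and "v \<in> carrier (vsp (point_rep (dimv Q M) x) (tail Q h))"
    then have v: "v \<in> carrier (?K (tail Q h))" by simp
    have "vmap M h (\<theta> (tail Q h) v) \<in> carrier (vsp M (head Q h))"
      using h by (intro vmap_closed[OF M h] lhom_closed[OF lin_isosD(1)[OF \<theta>] v]) auto
    then show "\<theta> (head Q h) (vmap (point_rep (dimv Q M) x) h v) = vmap M h (\<theta> (tail Q h) v)"
      using h by (simp add: xv[OF h v] \<eta>_def lin_inv_right[OF \<theta>])
  qed (simp add: \<theta>)
  then show ?thesis using x unfolding rep_iso_iff by blast
qed


section \<open>Subrepresentations and quotients\<close>

lemma subrepsD:
  assumes "U \<in> subreps Q M"
  shows "i \<in> verts Q \<Longrightarrow> lsubspace (U i) (vsp M i)" "i \<in> verts Q \<Longrightarrow> U i \<subseteq> carrier (vsp M i)"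
    "h \<in> arcs Q \<Longrightarrow> v \<in> U (tail Q h) \<Longrightarrow> vmap M h v \<in> U (head Q h)" "U \<in> extensional (verts Q)"
  using assms by (auto simp: subreps_def lsubspace_iff PiE_def Pi_def image_subset_iff)

lemma subrepsI:
  assumes "\<And>i. i \<in> verts Q \<Longrightarrow> lsubspace (U i) (vsp M i)" "U \<in> extensional (verts Q)"
    "\<And>h v. h \<in> arcs Q \<Longrightarrow> v \<in> U (tail Q h) \<Longrightarrow> vmap M h v \<in> U (head Q h)"
  shows "U \<in> subreps Q M"
  using assms by (auto simp: subreps_def PiE_def)

lemma sub_rep_sel [simp]:
  "vsp (sub_rep M U) i = (vsp M i)\<lparr>carrier := U i\<rparr>" "vmap (sub_rep M U) = vmap M"
  by (simp_all add: sub_rep_def)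

lemma vsp_quot_rep [simp]: "vsp (quot_rep Q M U) i = quot_module (vsp M i) (U i)"
  by (simp add: quot_rep_def)

lemma sub_rep_sub_rep [simp]: "sub_rep (sub_rep M U) W = sub_rep M W"
  by (simp add: sub_rep_def)

lemma vmap_quot_rep:
  assumes M: "is_rep Q M" and U: "U \<in> subreps Q M" and h: "h \<in> arcs Q"
    and v: "v \<in> carrier (vsp M (tail Q h))"
  shows "vmap (quot_rep Q M U) h (coset (vsp M (tail Q h)) (U (tail Q h)) v) =
    coset (vsp M (head Q h)) (U (head Q h)) (vmap M h v)"
proof -
  have t: "tail Q h \<in> verts Q" and hd: "head Q h \<in> verts Q" using h by auto
  note lin = is_repD(3)[OF M h]
  show ?thesis unfolding quot_rep_def quiver_rep.simps
  proof (rule UN_coset[OF subrepsD(1)[OF U t] v])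
    fix w assume w: "w \<in> carrier (vsp M (tail Q h))" "w \<ominus>\<^bsub>vsp M (tail Q h)\<^esub> v \<in> U (tail Q h)"
    then show "coset (vsp M (head Q h)) (U (head Q h)) (vmap M h w) =
        coset (vsp M (head Q h)) (U (head Q h)) (vmap M h v)"
      using lhom_minus[OF is_repD(1)[OF M t] is_repD(1)[OF M hd] lin w(1) v] subrepsD(3)[OF U h w(2)]
      by (subst coset_eq_iff[OF subrepsD(1)[OF U hd]]) (auto simp: lhom_closed[OF lin] v)
  qed
qed

lemma is_rep_quot_rep:
  assumes M: "is_rep Q M" and U: "U \<in> subreps Q M"
  shows "is_rep Q (quot_rep Q M U)"
proof (rule is_repI)
  fix i assume i: "i \<in> verts Q"
  show "is_vs (vsp (quot_rep Q M U) i)" "fin_dim (vsp (quot_rep Q M U) i)"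
    using is_vs_quot[OF subrepsD(1)[OF U i]] fin_dim_quot[OF subrepsD(1)[OF U i] is_repD(2)[OF M i]]
    by simp_all
next
  fix h assume h: "h \<in> arcs Q"
  then have t: "tail Q h \<in> verts Q" and hd: "head Q h \<in> verts Q" by auto
  let ?ct = "coset (vsp M (tail Q h)) (U (tail Q h))"
  let ?ch = "coset (vsp M (head Q h)) (U (head Q h))"
  note lin = is_repD(3)[OF M h] and vm = vmap_quot_rep[OF M U h]
  note Ut = subrepsD(1)[OF U t] and Uh = subrepsD(1)[OF U hd]
  show "vmap (quot_rep Q M U) h \<in> lhom (vsp (quot_rep Q M U) (tail Q h)) (vsp (quot_rep Q M U) (head Q h))"
  proof (rule lhomI)
    fix c assume "c \<in> carrier (vsp (quot_rep Q M U) (tail Q h))"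
    then obtain v where v: "v \<in> carrier (vsp M (tail Q h))" "c = ?ct v" by auto
    show "vmap (quot_rep Q M U) h c \<in> carrier (vsp (quot_rep Q M U) (head Q h))"
      using v by (auto simp: vm lhom_closed[OF lin])
    show "vmap (quot_rep Q M U) h (r \<odot>\<^bsub>vsp (quot_rep Q M U) (tail Q h)\<^esub> c) =
        r \<odot>\<^bsub>vsp (quot_rep Q M U) (head Q h)\<^esub> vmap (quot_rep Q M U) h c" for r
      using v by (simp add: vm quot_smult[OF Ut] quot_smult[OF Uh] lhom_closed[OF lin] lhom_smult[OF lin]
          vs_smult_closed[OF is_repD(1)[OF M t]])
    fix d assume "d \<in> carrier (vsp (quot_rep Q M U) (tail Q h))"
    then obtain w where w: "w \<in> carrier (vsp M (tail Q h))" "d = ?ct w" by auto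
    show "vmap (quot_rep Q M U) h (c \<oplus>\<^bsub>vsp (quot_rep Q M U) (tail Q h)\<^esub> d) =
        vmap (quot_rep Q M U) h c \<oplus>\<^bsub>vsp (quot_rep Q M U) (head Q h)\<^esub> vmap (quot_rep Q M U) h d"
      unfolding vsp_quot_rep v(2) w(2) vm[OF v(1)] vm[OF w(1)]
        lhom_add[OF coset_lhom[OF Ut] v(1) w(1), symmetric]
        lhom_add[OF coset_lhom[OF Uh] lhom_closed[OF lin v(1)] lhom_closed[OF lin w(1)], symmetric]
      using v w by (simp add: vm lhom_add[OF lin] vs_add_closed[OF is_repD(1)[OF M t]])
  qed
qed

lemma is_rep_sub_rep:
  assumes M: "is_rep Q (M :: ('i, 'h, 'a::{field,finite}, 'v) quiver_rep)" and U: "U \<in> subreps Q M"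
  shows "is_rep Q (sub_rep M U)"
proof (rule is_repI)
  fix i assume i: "i \<in> verts Q"
  show "is_vs (vsp (sub_rep M U) i)" using lsubspace_is_vs[OF subrepsD(1)[OF U i]] by simp
  then show "fin_dim (vsp (sub_rep M U) i)"
    using finite_carrier[OF is_repD(1)[OF M i] is_repD(2)[OF M i]] subrepsD(2)[OF U i]
    by (intro fin_dim_if_finite) (auto intro: finite_subset)
next
  fix h assume h: "h \<in> arcs Q"
  then have t: "tail Q h \<in> verts Q" by auto
  show "vmap (sub_rep M U) h \<in> lhom (vsp (sub_rep M U) (tail Q h)) (vsp (sub_rep M U) (head Q h))"
    using subrepsD(2)[OF U t] subrepsD(3)[OF U h] lhom_add[OF is_repD(3)[OF M h]] lhom_smult[OF is_repD(3)[OF M h]]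
    by (intro lhomI) (simp_all add: subset_iff)
qed

lemma dimv_sub_quot:
  assumes M: "is_rep Q M" and U: "U \<in> subreps Q M"
  shows "dimv Q M = dimv Q (quot_rep Q M U) + dimv Q (sub_rep M U)"
  using ldim_sub_quot[OF subrepsD(1)[OF U] is_repD(2)[OF M]]
  by (auto simp: dimv_def fun_eq_iff)

lemma rep_iso_quotI:
  assumes M: "is_rep Q M" and N: "is_rep Q N" and U: "U \<in> subreps Q M"
    and lin: "\<And>i. i \<in> verts Q \<Longrightarrow> f i \<in> lhom (vsp M i) (vsp N i)"
    and ker: "\<And>i v. i \<in> verts Q \<Longrightarrow> v \<in> carrier (vsp M i) \<Longrightarrow> f i v = \<zero>\<^bsub>vsp N i\<^esub> \<longleftrightarrow> v \<in> U i"
    and surj: "\<And>i. i \<in> verts Q \<Longrightarrow> f i ` carrier (vsp M i) = carrier (vsp N i)"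
    and comm: "\<And>h v. h \<in> arcs Q \<Longrightarrow> v \<in> carrier (vsp M (tail Q h)) \<Longrightarrow>
      f (head Q h) (vmap M h v) = vmap N h (f (tail Q h) v)"
  shows "rep_iso Q (quot_rep Q M U) N"
proof -
  have "\<exists>g. g \<in> lhom (quot_module (vsp M i) (U i)) (vsp N i) \<and>
      bij_betw g (carrier (quot_module (vsp M i) (U i))) (carrier (vsp N i)) \<and>
      (\<forall>v\<in>carrier (vsp M i). g (coset (vsp M i) (U i) v) = f i v)" if i: "i \<in> verts Q" for i
    by (rule quot_induced[OF subrepsD(1)[OF U i] is_repD(1)[OF N i] lin[OF i] ker[OF i] surj[OF i]])
  then obtain g where g: "\<And>i. i \<in> verts Q \<Longrightarrow> g i \<in> lhom (quot_module (vsp M i) (U i)) (vsp N i) \<and>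
      bij_betw (g i) (carrier (quot_module (vsp M i) (U i))) (carrier (vsp N i)) \<and>
      (\<forall>v\<in>carrier (vsp M i). g i (coset (vsp M i) (U i) v) = f i v)" by metis
  show ?thesis
  proof (rule rep_isoI[OF is_rep_quot_rep[OF M U], where f = g])
    fix h c assume h: "h \<in> arcs Q" and "c \<in> carrier (vsp (quot_rep Q M U) (tail Q h))"
    then obtain v where v: "v \<in> carrier (vsp M (tail Q h))" "c = coset (vsp M (tail Q h)) (U (tail Q h)) v"
      by auto
    show "g (head Q h) (vmap (quot_rep Q M U) h c) = vmap N h (g (tail Q h) c)"
      using g h v vmap_closed[OF M h v(1)] by (simp add: vmap_quot_rep[OF M U h v(1)] comm)
  qed (use g in auto)
qed

lemma rep_iso_subI:
  assumes N: "is_rep Q N" and M: "is_rep Q M" and U: "U \<in> subreps Q M"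
    and lin: "\<And>i. i \<in> verts Q \<Longrightarrow> f i \<in> lhom (vsp N i) (vsp M i)"
    and bij: "\<And>i. i \<in> verts Q \<Longrightarrow> bij_betw (f i) (carrier (vsp N i)) (U i)"
    and comm: "\<And>h v. h \<in> arcs Q \<Longrightarrow> v \<in> carrier (vsp N (tail Q h)) \<Longrightarrow>
      f (head Q h) (vmap N h v) = vmap M h (f (tail Q h) v)"
  shows "rep_iso Q N (sub_rep M U)"
proof (rule rep_isoI[OF N, where f = f])
  fix i assume i: "i \<in> verts Q"
  have "f i v \<in> U i" if "v \<in> carrier (vsp N i)" for v using bij[OF i] that by (auto simp: bij_betw_def)
  then show "f i \<in> lhom (vsp N i) (vsp (sub_rep M U) i)"
    using lhom_add[OF lin[OF i]] lhom_smult[OF lin[OF i]] by (intro lhomI) auto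
qed (use bij comm in auto)

definition image_subrep :: "('i \<Rightarrow> 'v \<Rightarrow> 'w) \<Rightarrow> ('i \<Rightarrow> 'v set) \<Rightarrow> 'i \<Rightarrow> 'w set" where
  "image_subrep f U = (\<lambda>i\<in>verts Q. f i ` U i)"

lemma image_subrep_subreps:
  assumes M: "is_rep Q M" and N: "is_rep Q N" and f: "is_iso M N f" and U: "U \<in> subreps Q M"
  shows "image_subrep f U \<in> subreps Q N"
proof (rule subrepsI)
  fix i assume i: "i \<in> verts Q"
  show "lsubspace (image_subrep f U i) (vsp N i)"
    using lsubspace_image[OF subrepsD(1)[OF U i] is_repD(1)[OF N i] is_isoD(2)[OF f i]] i
    by (simp add: image_subrep_def)
next
  fix h v assume h: "h \<in> arcs Q" and v: "v \<in> image_subrep f U (tail Q h)"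
  then obtain u where u: "u \<in> U (tail Q h)" "v = f (tail Q h) u" by (auto simp: image_subrep_def)
  then have "vmap N h v = f (head Q h) (vmap M h u)"
    using subrepsD(2)[OF U, of "tail Q h"] h by (subst is_isoD(5)[OF f h]) auto
  then show "vmap N h v \<in> image_subrep f U (head Q h)"
    using h subrepsD(3)[OF U h u(1)] by (auto simp: image_subrep_def)
qed (simp add: image_subrep_def)

lemma bij_betw_image_subrep:
  assumes M: "is_rep Q M" and N: "is_rep Q N" and f: "is_iso M N f"
  shows "bij_betw (image_subrep f) (subreps Q M) (subreps Q N)"
proof -
  let ?g = "\<lambda>i. lin_inv (vsp M i) (vsp N i) (f i)"
  have g: "is_iso N M ?g" by (rule is_iso_inv[OF M N f])
  show ?thesis
  proof (rule bij_betw_byWitness[where f' = "image_subrep ?g"])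
    show "\<forall>U\<in>subreps Q M. image_subrep ?g (image_subrep f U) = U"
    proof (intro ballI extensionalityI[of _ "verts Q"])
      fix U i assume U: "U \<in> subreps Q M" and i: "i \<in> verts Q"
      have "?g i (f i u) = u" if "u \<in> U i" for u
        by (rule lin_inv_left[OF is_isoD(1)[OF f i]]) (use subrepsD(2)[OF U i] that in auto)
      then show "image_subrep ?g (image_subrep f U) i = U i"
        using i by (simp add: image_subrep_def image_image)
    qed (auto simp: image_subrep_def subrepsD(4))
    show "\<forall>U\<in>subreps Q N. image_subrep f (image_subrep ?g U) = U"
    proof (intro ballI extensionalityI[of _ "verts Q"])
      fix U i assume U: "U \<in> subreps Q N" and i: "i \<in> verts Q"
      have "f i (?g i u) = u" if "u \<in> U i" for u
        by (rule lin_inv_right[OF is_isoD(1)[OF f i]]) (use subrepsD(2)[OF U i] that in auto)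
      then show "image_subrep f (image_subrep ?g U) i = U i"
        using i by (simp add: image_subrep_def image_image)
    qed (auto simp: image_subrep_def subrepsD(4))
  qed (use image_subrep_subreps[OF M N f] image_subrep_subreps[OF N M g] in auto)
qed

lemma sub_rep_image_subrep:
  assumes M: "is_rep Q (M :: ('i, 'h, 'a::{field,finite}, 'v) quiver_rep)" and N: "is_rep Q N"
    and f: "is_iso M N f" and U: "U \<in> subreps Q M"
  shows "rep_iso Q (sub_rep M U) (sub_rep N (image_subrep f U))"
proof (rule rep_iso_subI[OF is_rep_sub_rep[OF M U] N image_subrep_subreps[OF M N f U], where f = f])
  fix i assume i: "i \<in> verts Q"
  note sub = subrepsD(2)[OF U i]
  show "f i \<in> lhom (vsp (sub_rep M U) i) (vsp N i)"
    using sub lhom_add[OF is_isoD(2)[OF f i]] lhom_smult[OF is_isoD(2)[OF f i]]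
      lhom_closed[OF is_isoD(2)[OF f i]] by (intro lhomI) (simp_all add: subset_iff)
  show "bij_betw (f i) (carrier (vsp (sub_rep M U) i)) (image_subrep f U i)"
    using sub is_isoD(3)[OF f i] i by (auto simp: bij_betw_def image_subrep_def inj_on_subset)
next
  fix h v assume h: "h \<in> arcs Q" and "v \<in> carrier (vsp (sub_rep M U) (tail Q h))"
  then show "f (head Q h) (vmap (sub_rep M U) h v) = vmap N h (f (tail Q h) v)"
    using subrepsD(2)[OF U, of "tail Q h"] by (auto intro!: is_isoD(5)[OF f h])
qed

lemma quot_rep_image_subrep:
  assumes M: "is_rep Q M" and N: "is_rep Q N"
    and f: "is_iso M N f" and U: "U \<in> subreps Q M"
  shows "rep_iso Q (quot_rep Q M U) (quot_rep Q N (image_subrep f U))"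
proof -
  let ?U = "image_subrep f U"
  have V: "?U \<in> subreps Q N" by (rule image_subrep_subreps[OF M N f U])
  show ?thesis
  proof (rule rep_iso_quotI[OF M is_rep_quot_rep[OF N V] U,
        where f = "\<lambda>i v. coset (vsp N i) (?U i) (f i v)"])
    fix i assume i: "i \<in> verts Q"
    show "(\<lambda>v. coset (vsp N i) (?U i) (f i v)) \<in> lhom (vsp M i) (vsp (quot_rep Q N ?U) i)"
      using lhom_comp[OF is_isoD(2)[OF f i] coset_lhom[OF subrepsD(1)[OF V i]]] by simp
    have im: "f i ` carrier (vsp M i) = carrier (vsp N i)" and inj: "inj_on (f i) (carrier (vsp M i))"
      using is_isoD(3)[OF f i] by (auto simp: bij_betw_def)
    show "(\<lambda>v. coset (vsp N i) (?U i) (f i v)) ` carrier (vsp M i) = carrier (vsp (quot_rep Q N ?U) i)"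
      unfolding vsp_quot_rep quot_module_sel(3) im[symmetric] by (simp only: image_image)
    fix v assume v: "v \<in> carrier (vsp M i)"
    then show "coset (vsp N i) (?U i) (f i v) = \<zero>\<^bsub>vsp (quot_rep Q N ?U) i\<^esub> \<longleftrightarrow> v \<in> U i"
      using coset_eq_zero_iff[OF subrepsD(1)[OF V i] is_isoD(4)[OF f i v]] i inj_on_image_mem_iff[OF inj v subrepsD(2)[OF U i]]
      by (simp add: image_subrep_def)
  next
    fix h v assume h: "h \<in> arcs Q" and v: "v \<in> carrier (vsp M (tail Q h))"
    then have "f (tail Q h) v \<in> carrier (vsp N (tail Q h))" by (intro is_isoD(4)[OF f]) auto
    then show "coset (vsp N (head Q h)) (?U (head Q h)) (f (head Q h) (vmap M h v)) =
        vmap (quot_rep Q N ?U) h (coset (vsp N (tail Q h)) (?U (tail Q h)) (f (tail Q h) v))"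
      by (simp add: vmap_quot_rep[OF N V h] is_isoD(5)[OF f h v])
  qed
qed

lemma finite_subreps:
  assumes M: "is_rep Q (M :: ('i, 'h, 'a::{field,finite}, 'v) quiver_rep)"
  shows "finite (subreps Q M)"
proof (rule finite_subset)
  show "subreps Q M \<subseteq> (\<Pi>\<^sub>E i\<in>verts Q. Pow (carrier (vsp M i)))"
    using subrepsD(2)[of _ M] subrepsD(4)[of _ M] by (auto simp: PiE_def)
  show "finite (\<Pi>\<^sub>E i\<in>verts Q. Pow (carrier (vsp M i)))"
    using finite_carrier is_repD[OF M] by (intro finite_PiE) auto
qed

end

section \<open>The Frobenius map of the algebraic closure of a finite field\<close>

text \<open>Multiplication by \<open>a\<close> permutes the nonzero elements, whose product can be cancelled.\<close>

lemma finite_field_power_card: "(a :: 'k::{field,finite}) ^ CARD('k) = a"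
proof (cases "a = 0")
  case False
  let ?S = "UNIV - {0 :: 'k}"
  have "bij_betw ((*) a) ?S ?S"
    by (rule bij_betw_byWitness[where f' = "\<lambda>x. x / a"]) (use False in auto)
  then have "(\<Prod>x\<in>?S. a * x) = (\<Prod>x\<in>?S. x)"
    by (rule prod.reindex_bij_betw)
  then have "a ^ card ?S * \<Prod>?S = \<Prod>?S" by (simp add: prod.distrib)
  moreover have "\<Prod>?S \<noteq> (0 :: 'k)" by simp
  ultimately have "a ^ card ?S = 1" by simp
  moreover have "CARD('k) = Suc (card ?S)"
    by (rule card.remove) auto
  ultimately show ?thesis by (simp only: power_Suc mult_1_right)
next
  case True
  then show ?thesis using finite_UNIV_card_ge_0[where 'a = 'k] by (simp add: power_0_left)
qed

context
  fixes ty :: "'k::{field,finite} itself"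
begin

lemma frob_to_ac [simp]: "frob (to_ac (a :: 'k)) = to_ac a"
  unfolding frob_def by (simp flip: to_ac_power add: finite_field_power_card)

lemma card_range_to_ac: "card (range (to_ac :: 'k \<Rightarrow> 'k alg_closure)) = CARD('k)"
  by (rule card_image[OF inj_to_ac])

lemma CARD_gt_1: "CARD('k) > 1"
proof -
  have "card {0, 1 :: 'k} \<le> CARD('k)" by (rule card_mono) auto
  then show ?thesis by simp
qed

text \<open>The polynomial \<open>(x + 1)\<^sup>q - x\<^sup>q - 1\<close> has degree less than \<open>q\<close> and the \<open>q\<close> elements of \<open>k\<close> as
  roots, hence it vanishes.\<close>

lemma frob_add: "frob (x + y) = frob x + frob (y :: 'k alg_closure)"
proof (cases "y = 0")
  case False
  define q where "q = CARD('k)"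
  have q: "q > 1" using CARD_gt_1 by (simp add: q_def)
  define P :: "'k alg_closure poly" where "P = [:1, 1:] ^ q - monom 1 q - 1"
  have deg: "degree ([:1, 1:] ^ q :: 'k alg_closure poly) = q" by (simp add: degree_power_eq)
  have "degree P \<le> q"
    unfolding P_def by (intro degree_diff_le) (auto simp: deg degree_monom_eq)
  moreover have "coeff P q = 0"
  proof -
    have "lead_coeff ([:1, 1:] ^ q :: 'k alg_closure poly) = lead_coeff [:1, 1:] ^ q"
      by (rule lead_coeff_power)
    then have "coeff ([:1, 1:] ^ q :: 'k alg_closure poly) q = 1" unfolding deg by simp
    then show ?thesis using q unfolding P_def coeff_diff by simp
  qed
  ultimately have "P = 0 \<or> degree P < q" by (rule eq_zero_or_degree_less)
  moreover have "q \<le> degree P" if nz: "P \<noteq> 0"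
  proof -
    have "poly P (to_ac a) = 0" for a :: 'k
    proof -
      have "poly P (to_ac a) = (1 + to_ac a) ^ q - to_ac a ^ q - 1"
        by (simp add: P_def poly_monom poly_power)
      also have "\<dots> = to_ac ((1 + a) ^ q - a ^ q - 1)" by simp
      also have "\<dots> = 0" unfolding q_def finite_field_power_card by simp
      finally show ?thesis .
    qed
    then have "range (to_ac :: 'k \<Rightarrow> _) \<subseteq> {x. poly P x = 0}" by auto
    then have "card (range (to_ac :: 'k \<Rightarrow> _)) \<le> card {x. poly P x = 0}"
      by (rule card_mono[OF poly_roots_finite[OF nz]])
    then show ?thesis
      unfolding card_range_to_ac q_def[symmetric] using card_poly_roots_bound[OF nz] by simp
  qed
  ultimately have "P = 0" by linarith
  then have "poly P (x / y) = 0" by simp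
  moreover have "poly P (x / y) = (1 + x / y) ^ q - (x / y) ^ q - 1"
    by (simp add: P_def poly_monom poly_power)
  ultimately have "(1 + x / y) ^ q = (x / y) ^ q + 1" by (simp only: algebra_simps) simp
  then have "y ^ q * (1 + x / y) ^ q = (y * (x / y)) ^ q + y ^ q"
    by (simp only: distrib_left power_mult_distrib mult_1_right)
  also have "y * (x / y) = x" using False by simp
  finally have "y ^ q * (1 + x / y) ^ q = x ^ q + y ^ q" .
  moreover have "y * (1 + x / y) = x + y" using False by (simp add: field_simps)
  ultimately show ?thesis by (simp add: frob_def q_def flip: power_mult_distrib)
qed (simp add: frob_def)

lemma frob_mult: "frob (x * y) = frob x * frob (y :: 'k alg_closure)"
  by (simp add: frob_def power_mult_distrib)

lemma frob_0 [simp]: "frob (0 :: 'k alg_closure) = 0"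
  and frob_1 [simp]: "frob (1 :: 'k alg_closure) = 1"
  by (auto simp: frob_def)

lemma frob_minus: "frob (x - y) = frob x - frob (y :: 'k alg_closure)"
  using frob_add[of "x - y" y] by simp

lemma frob_fixed_iff: "frob (z :: 'k alg_closure) = z \<longleftrightarrow> z \<in> range to_ac"
proof -
  define P :: "'k alg_closure poly" where "P = monom 1 CARD('k) - [:0, 1:]"
  have "coeff P CARD('k) = 1" using CARD_gt_1 by (auto simp: P_def coeff_pCons split: nat.splits)
  then have nz: "P \<noteq> 0" by auto
  have "degree P \<le> CARD('k)"
    unfolding P_def using CARD_gt_1 by (intro degree_diff_le) (auto simp: degree_monom_eq)
  have roots: "poly P z = 0 \<longleftrightarrow> frob z = z" for z by (simp add: P_def poly_monom frob_def)
  have "range to_ac = {z. poly P z = 0}"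
    by (rule card_seteq[OF poly_roots_finite[OF nz]])
      (use card_poly_roots_bound[OF nz] \<open>degree P \<le> CARD('k)\<close> card_range_to_ac in \<open>auto simp: roots\<close>)
  then show ?thesis using roots by blast
qed

lemma artin_schreier: "\<exists>d. frob d - d = (c :: 'k alg_closure)"
proof -
  define P :: "'k alg_closure poly" where "P = monom 1 CARD('k) - [:c, 1:]"
  have "coeff P CARD('k) = 1" using CARD_gt_1 by (auto simp: P_def coeff_pCons split: nat.splits)
  then have "degree P \<ge> CARD('k)" by (intro le_degree) auto
  then have "degree P > 0" using CARD_gt_1 by simp
  then obtain d where "poly P d = 0" using alg_closed_imp_poly_has_root by blast
  then show ?thesis by (intro exI[of _ d]) (simp add: P_def poly_monom frob_def)
qed

lemma frob_surj: "\<exists>d. frob d = (c :: 'k alg_closure)"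
proof -
  define P :: "'k alg_closure poly" where "P = monom 1 CARD('k) - [:c:]"
  have "coeff P CARD('k) = 1" using CARD_gt_1 by (auto simp: P_def coeff_pCons split: nat.splits)
  then have "degree P \<ge> CARD('k)" by (intro le_degree) auto
  then have "degree P > 0" using CARD_gt_1 by simp
  then obtain d where "poly P d = 0" using alg_closed_imp_poly_has_root by blast
  then show ?thesis by (intro exI[of _ d]) (simp add: P_def poly_monom frob_def)
qed

end

interpretation frob_hom: comm_ring_hom "frob :: 'k::{field,finite} alg_closure \<Rightarrow> 'k alg_closure"
  by unfold_locales (simp_all add: frob_add frob_mult)

interpretation to_ac_hom: comm_ring_hom "to_ac :: 'k::field \<Rightarrow> 'k alg_closure"
  by unfold_locales simp_all

abbreviation F_vec :: "'k::{field,finite} alg_closure vec \<Rightarrow> 'k alg_closure vec" where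
  "F_vec \<equiv> map_vec frob"

abbreviation F_mat :: "'k::{field,finite} alg_closure mat \<Rightarrow> 'k alg_closure mat" where
  "F_mat \<equiv> map_mat frob"

abbreviation ac_vec :: "'k::field vec \<Rightarrow> 'k alg_closure vec" where
  "ac_vec \<equiv> map_vec to_ac"

abbreviation ac_mat :: "'k::field mat \<Rightarrow> 'k alg_closure mat" where
  "ac_mat \<equiv> map_mat to_ac"

lemma F_vec_ac_vec [simp]: "F_vec (ac_vec v) = ac_vec v"
  by (intro eq_vecI) auto

lemma F_mat_ac_mat [simp]: "F_mat (ac_mat A) = ac_mat A"
  by (intro eq_matI) auto

lemma of_ac_ac_vec [simp]: "map_vec of_ac (ac_vec v) = v"
  by (intro eq_vecI) auto

lemma of_ac_ac_mat [simp]: "map_mat of_ac (ac_mat A) = A"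
  by (intro eq_matI) auto

lemma ac_vec_of_ac:
  assumes "F_vec v = v" shows "ac_vec (map_vec of_ac v) = v"
proof (rule eq_vecI)
  fix i assume i: "i < dim_vec v"
  then have "frob (v $ i) = v $ i" using assms by (metis index_map_vec(1))
  then show "ac_vec (map_vec of_ac v) $ i = v $ i" using i by (auto simp: frob_fixed_iff)
qed simp

lemma ac_mat_of_ac:
  assumes "F_mat A = A" shows "ac_mat (map_mat of_ac A) = A"
proof (rule eq_matI)
  fix i j assume ij: "i < dim_row A" "j < dim_col A"
  then have "frob (A $$ (i, j)) = A $$ (i, j)" using assms by (metis index_map_mat(1))
  then show "ac_mat (map_mat of_ac A) $$ (i, j) = A $$ (i, j)" using ij by (auto simp: frob_fixed_iff)
qed simp_all

lemma ac_vec_inj: "ac_vec v = ac_vec w \<longleftrightarrow> v = w"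
  by (metis of_ac_ac_vec)

lemma ac_mat_inj: "ac_mat A = ac_mat B \<longleftrightarrow> A = B"
  by (metis of_ac_ac_mat)

lemma F_vec_add: "v \<in> carrier_vec n \<Longrightarrow> w \<in> carrier_vec n \<Longrightarrow> F_vec (v + w) = F_vec v + F_vec w"
  and F_vec_minus: "v \<in> carrier_vec n \<Longrightarrow> w \<in> carrier_vec n \<Longrightarrow> F_vec (v - w) = F_vec v - F_vec w"
  and F_vec_smult: "F_vec (c \<cdot>\<^sub>v v) = frob c \<cdot>\<^sub>v F_vec v"
  by (auto intro!: eq_vecI simp: frob_add frob_minus frob_mult)

lemma ac_vec_add: "v \<in> carrier_vec n \<Longrightarrow> w \<in> carrier_vec n \<Longrightarrow> ac_vec (v + w) = ac_vec v + ac_vec w"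
  and ac_vec_smult: "ac_vec (c \<cdot>\<^sub>v v) = to_ac c \<cdot>\<^sub>v ac_vec v"
  by (auto intro!: eq_vecI)

lemma F_vec_surj:
  assumes "w \<in> carrier_vec n"
  shows "\<exists>v\<in>carrier_vec n. F_vec v = w"
proof -
  obtain d where d: "\<And>c. frob (d c) = (c :: 'a alg_closure)" using frob_surj by metis
  show ?thesis by (rule bexI[of _ "map_vec d w"]) (use assms d in \<open>auto intro!: eq_vecI\<close>)
qed

lemma lcomb_in_subspace:
  assumes W: "lsubspace W V" and t: "\<And>j. j < n \<Longrightarrow> t j \<in> W"
  shows "lcomb V n t v \<in> W"
proof -
  interpret V: vectorspace class_ring V using W by (simp add: lsubspace_iff)
  have sub: "W \<subseteq> carrier V" using W by (simp add: lsubspace_iff)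
  have "finsum V (\<lambda>j. v $ j \<odot>\<^bsub>V\<^esub> t j) A \<in> W" if "finite A" "A \<subseteq> {..<n}" for A
    using that
  proof (induction A rule: finite_induct)
    case (insert a A)
    then have "(\<lambda>j. v $ j \<odot>\<^bsub>V\<^esub> t j) \<in> A \<rightarrow> carrier V" "v $ a \<odot>\<^bsub>V\<^esub> t a \<in> W"
      using t W sub by (auto simp: lsubspace_iff subset_iff Pi_iff)
    then show ?case using insert W sub by (subst V.finsum_insert) (auto simp: lsubspace_iff)
  qed (use W in \<open>auto simp: lsubspace_iff\<close>)
  then show ?thesis by (simp add: lcomb_def)
qed

lemma mult_mat_vec_in_subspace:
  assumes W: "lsubspace W (module_vec TYPE('a::field) n)" and B: "B \<in> carrier_mat n b"
    and cols: "\<And>j. j < b \<Longrightarrow> col B j \<in> W" and d: "d \<in> carrier_vec b"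
  shows "B *\<^sub>v d \<in> W"
  using lhom_vec_eq_lcomb[OF is_vs_module_vec mult_mat_vec_lhom[OF B] d]
    lcomb_in_subspace[OF W, of b "\<lambda>j. B *\<^sub>v unit_vec b j"] cols B
  by (simp add: mat_unit_vec)

section \<open>Descent of Frobenius-stable subspaces\<close>

definition fixed_vecs :: "nat \<Rightarrow> 'k::field alg_closure vec set \<Rightarrow> 'k vec set" where
  "fixed_vecs n W = {u \<in> carrier_vec n. ac_vec u \<in> W}"

text \<open>Galois descent. For \<open>w \<in> W\<close> with an entry 1, the vector \<open>F w - w\<close> lies in \<open>W\<close> and has
  smaller support, so by induction it is a combination of fixed vectors of \<open>W\<close>; solving an
  Artin--Schreier equation for each coefficient shows that \<open>w\<close> itself is such a combination up to
  a fixed vector.\<close>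

lemma descent:
  fixes W :: "'k::{field,finite} alg_closure vec set" and B :: "'k mat"
  assumes W: "lsubspace W (module_vec TYPE('k alg_closure) n)"
    and stable: "\<And>w. w \<in> W \<Longrightarrow> F_vec w \<in> W"
    and B: "B \<in> carrier_mat n b" and im: "(\<lambda>d. B *\<^sub>v d) ` carrier_vec b = fixed_vecs n W"
  shows "W = (\<lambda>d. ac_mat B *\<^sub>v d) ` carrier_vec b"
proof
  let ?B = "ac_mat B"
  have B': "?B \<in> carrier_mat n b" using B by simp
  have sub: "W \<subseteq> carrier_vec n" and W_add: "\<And>x y. x \<in> W \<Longrightarrow> y \<in> W \<Longrightarrow> x + y \<in> W"
    and W_smult: "\<And>r x. x \<in> W \<Longrightarrow> r \<cdot>\<^sub>v x \<in> W"
    using W by (auto simp: lsubspace_iff module_vec_simps)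
  have W_minus: "x - y \<in> W" if "x \<in> W" "y \<in> W" for x y
  proof -
    have "x - y = x + (- 1) \<cdot>\<^sub>v y" using that sub by (intro eq_vecI) auto
    then show ?thesis using that W_add W_smult by metis
  qed
  have cols: "col ?B j \<in> W" if j: "j < b" for j
  proof -
    have "B *\<^sub>v unit_vec b j \<in> fixed_vecs n W" using im by auto
    then have "ac_vec (col B j) \<in> W" unfolding mat_unit_vec[OF B j] by (simp add: fixed_vecs_def)
    also have "ac_vec (col B j) = col ?B j"
      by (rule eq_vecI) (use B j in \<open>simp_all add: col_def\<close>)
    finally show ?thesis .
  qed
  show sup: "(\<lambda>d. ?B *\<^sub>v d) ` carrier_vec b \<subseteq> W"
    using mult_mat_vec_in_subspace[OF W B' cols] by blast
  show "W \<subseteq> (\<lambda>d. ?B *\<^sub>v d) ` carrier_vec b"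
  proof
    fix w assume "w \<in> W"
    then show "w \<in> (\<lambda>d. ?B *\<^sub>v d) ` carrier_vec b"
    proof (induction "card {i. i < n \<and> w $ i \<noteq> 0}" arbitrary: w rule: less_induct)
      case less
      have w: "w \<in> carrier_vec n" using sub less.prems by auto
      show ?case
      proof (cases "w = 0\<^sub>v n")
        case True
        have "?B *\<^sub>v 0\<^sub>v b = 0\<^sub>v n"
          by (rule eq_vecI) (use B in simp_all)
        then show ?thesis using True by (intro image_eqI[of w _ "0\<^sub>v b"]) simp_all
      next
        case False
        then obtain j where j: "j < n" "w $ j \<noteq> 0"
          using w eq_vecI[of w "0\<^sub>v n"] by auto
        define w' where "w' = inverse (w $ j) \<cdot>\<^sub>v w"
        have w'W: "w' \<in> W" unfolding w'_def by (rule W_smult[OF less.prems])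
        have w': "w' \<in> carrier_vec n" using w'W sub by auto
        define u where "u = F_vec w' - w'"
        have uW: "u \<in> W" unfolding u_def by (rule W_minus[OF stable[OF w'W] w'W])
        have "{i. i < n \<and> u $ i \<noteq> 0} \<subset> {i. i < n \<and> w $ i \<noteq> 0}"
        proof (rule psubsetI)
          have ui: "u $ i = frob (inverse (w $ j) * w $ i) - inverse (w $ j) * w $ i" if "i < n" for i
            using that w by (simp add: u_def w'_def)
          show "{i. i < n \<and> u $ i \<noteq> 0} \<subseteq> {i. i < n \<and> w $ i \<noteq> 0}" using ui by fastforce
          have "u $ j = 0" using ui[OF j(1)] j by simp
          then show "{i. i < n \<and> u $ i \<noteq> 0} \<noteq> {i. i < n \<and> w $ i \<noteq> 0}" using j by blast
        qed
        then have "card {i. i < n \<and> u $ i \<noteq> 0} < card {i. i < n \<and> w $ i \<noteq> 0}"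
          by (intro psubset_card_mono) auto
        then obtain e where e: "e \<in> carrier_vec b" "u = ?B *\<^sub>v e" using less.hyps uW by blast
        obtain as where as: "\<And>c. frob (as c) - as c = (c :: 'k alg_closure)" using artin_schreier by metis
        define d where "d = map_vec as e"
        have d: "d \<in> carrier_vec b" using e by (simp add: d_def)
        have "as c + c = frob (as c)" for c using as[of c] by (simp add: algebra_simps)
        then have Fd: "F_vec d = d + e" using e by (intro eq_vecI) (auto simp: d_def)
        define z where "z = w' - ?B *\<^sub>v d"
        have Bd: "?B *\<^sub>v d \<in> W" using sup d by blast
        have Bdc: "?B *\<^sub>v d \<in> carrier_vec n" using Bd sub by blast
        have z_plus: "w' = ?B *\<^sub>v d + z"
          unfolding z_def by (rule eq_vecI) (use w' Bdc B in simp_all)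
        have zW: "z \<in> W" unfolding z_def by (rule W_minus[OF w'W Bd])
        have "F_vec z = F_vec w' - F_vec (?B *\<^sub>v d)"
          unfolding z_def by (rule F_vec_minus[OF w' Bdc])
        also have "F_vec (?B *\<^sub>v d) = ?B *\<^sub>v (d + e)"
          using frob_hom.mult_mat_vec_hom[OF B' d] by (simp add: Fd)
        also have "\<dots> = ?B *\<^sub>v d + u" using B' d e by (simp add: mult_add_distrib_mat_vec)
        also have "F_vec w' - (?B *\<^sub>v d + u) = z"
          unfolding z_def u_def by (rule eq_vecI) (use w' Bdc B in simp_all)
        finally have Fz: "F_vec z = z" .
        have "map_vec of_ac z \<in> fixed_vecs n W"
          using zW subsetD[OF sub zW] ac_vec_of_ac[OF Fz] by (simp add: fixed_vecs_def)
        then obtain f where f: "f \<in> carrier_vec b" "map_vec of_ac z = B *\<^sub>v f" unfolding im[symmetric] by blast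
        have "z = ?B *\<^sub>v ac_vec f"
          using to_ac_hom.mult_mat_vec_hom[OF B f(1)] ac_vec_of_ac[OF Fz] f(2) by simp
        then have "w' = ?B *\<^sub>v d + ?B *\<^sub>v ac_vec f"
          using w' Bdc z_plus by simp
        then have "w' = ?B *\<^sub>v (d + ac_vec f)" using B' d f by (simp add: mult_add_distrib_mat_vec)
        then have "w $ j \<cdot>\<^sub>v w' = ?B *\<^sub>v (w $ j \<cdot>\<^sub>v (d + ac_vec f))"
          using mult_mat_vec[OF B', of "d + ac_vec f" "w $ j"] d f by simp
        moreover have "w = w $ j \<cdot>\<^sub>v w'"
          by (rule eq_vecI) (use j w in \<open>simp_all add: w'_def\<close>)
        ultimately have "w = ?B *\<^sub>v (w $ j \<cdot>\<^sub>v (d + ac_vec f))" by simp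
        then show ?thesis using d f by (intro image_eqI[of w _ "w $ j \<cdot>\<^sub>v (d + ac_vec f)"]) auto
      qed
    qed
  qed
qed

section \<open>Frobenius-equivariant coordinates\<close>

lemma Units_ring_mat_iff:
  "g \<in> Units (ring_mat TYPE('a::field) n ()) \<longleftrightarrow>
     g \<in> carrier_mat n n \<and> bij_betw (\<lambda>v. g *\<^sub>v v) (carrier_vec n) (carrier_vec n)"
proof
  assume "g \<in> Units (ring_mat TYPE('a) n ())"
  then obtain g' where g: "g \<in> carrier_mat n n" and g': "g' \<in> carrier_mat n n"
    and inv: "g' * g = 1\<^sub>m n" "g * g' = 1\<^sub>m n"
    by (auto simp: Units_def ring_mat_simps)
  have "bij_betw (\<lambda>v. g *\<^sub>v v) (carrier_vec n) (carrier_vec n)"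
  proof (rule bij_betw_byWitness[where f' = "\<lambda>v. g' *\<^sub>v v"])
    show "\<forall>v\<in>carrier_vec n. g' *\<^sub>v (g *\<^sub>v v) = v"
      using assoc_mult_mat_vec[OF g' g] inv(1) by simp
    show "\<forall>v\<in>carrier_vec n. g *\<^sub>v (g' *\<^sub>v v) = v"
      using assoc_mult_mat_vec[OF g g'] inv(2) by simp
  qed (use g g' in auto)
  then show "g \<in> carrier_mat n n \<and> bij_betw (\<lambda>v. g *\<^sub>v v) (carrier_vec n) (carrier_vec n)"
    using g by blast
next
  let ?K = "module_vec TYPE('a) n"
  assume *: "g \<in> carrier_mat n n \<and> bij_betw (\<lambda>v. g *\<^sub>v v) (carrier_vec n) (carrier_vec n)"
  then have g: "g \<in> carrier_mat n n"
    and bij: "bij_betw (\<lambda>v. g *\<^sub>v v) (carrier ?K) (carrier ?K)" by (simp_all add: module_vec_simps)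
  let ?f = "inv_into (carrier ?K) (\<lambda>v. g *\<^sub>v v)"
  have f: "?f \<in> lhom ?K ?K" by (rule lhom_inv_into[OF _ mult_mat_vec_lhom[OF g] bij]) simp
  define g' where "g' = mat_of_lhom n n ?f"
  have g': "g' \<in> carrier_mat n n" by (simp add: g'_def)
  have fv: "g' *\<^sub>v v = ?f v" if "v \<in> carrier_vec n" for v unfolding g'_def by (rule mat_of_lhom[OF f that])
  have fc: "?f v \<in> carrier_vec n" if "v \<in> carrier_vec n" for v
    using lhom_closed[OF f] that by (simp add: module_vec_simps)
  have "g * g' = 1\<^sub>m n"
  proof (rule mat_eq_by_vec)
    fix v :: "'a vec" assume v: "v \<in> carrier_vec n"
    have "g *\<^sub>v ?f v = v"
      using bij_betw_inv_into_right[OF bij] v by (simp add: module_vec_simps)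
    then show "g * g' *\<^sub>v v = 1\<^sub>m n *\<^sub>v v"
      using assoc_mult_mat_vec[OF g g' v] fv[OF v] v by simp
  qed (use g g' in auto)
  moreover have "g' * g = 1\<^sub>m n"
  proof (rule mat_eq_by_vec)
    fix v :: "'a vec" assume v: "v \<in> carrier_vec n"
    then have gv: "g *\<^sub>v v \<in> carrier_vec n" using g by simp
    have "?f (g *\<^sub>v v) = v"
      using bij_betw_inv_into_left[OF bij] v by (simp add: module_vec_simps)
    then show "g' * g *\<^sub>v v = 1\<^sub>m n *\<^sub>v v"
      using assoc_mult_mat_vec[OF g' g v] fv[OF gv] v by simp
  qed (use g g' in auto)
  ultimately show "g \<in> Units (ring_mat TYPE('a) n ())"
    using g g' by (auto simp: Units_def ring_mat_simps)
qed

definition GL_F :: "'k::{field,finite} itself \<Rightarrow> nat \<Rightarrow> 'k alg_closure mat set" where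
  "GL_F _ n = {h \<in> Units (ring_mat TYPE('k alg_closure) n ()). F_mat h = h}"

definition equiv_coords :: "('k::{field,finite} alg_closure, 'v) module \<Rightarrow> ('v \<Rightarrow> 'v) \<Rightarrow> nat \<Rightarrow>
    ('v \<Rightarrow> 'k alg_closure vec) set" where
  "equiv_coords V \<Phi> n = {\<rho> \<in> lin_isos V (module_vec TYPE('k alg_closure) n).
     \<forall>v\<in>carrier V. \<rho> (\<Phi> v) = F_vec (\<rho> v)}"

text \<open>The equivariant coordinate systems of a space with a Frobenius map form a torsor under the
  group of fixed points of the general linear group.\<close>

lemma bij_betw_equiv_coords:
  fixes V :: "('k::{field,finite} alg_closure, 'v) module"
  assumes V: "is_vs V" and \<Phi>: "\<And>v. v \<in> carrier V \<Longrightarrow> \<Phi> v \<in> carrier V"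
    and \<rho>0: "\<rho>0 \<in> equiv_coords V \<Phi> n"
  shows "bij_betw (\<lambda>h. \<lambda>v\<in>carrier V. h *\<^sub>v \<rho>0 v) (GL_F TYPE('k) n) (equiv_coords V \<Phi> n)"
proof -
  let ?K = "module_vec TYPE('k alg_closure) n"
  have iso0: "\<rho>0 \<in> lin_isos V ?K" and eq0: "\<And>v. v \<in> carrier V \<Longrightarrow> \<rho>0 (\<Phi> v) = F_vec (\<rho>0 v)"
    using \<rho>0 by (auto simp: equiv_coords_def)
  have c0: "\<rho>0 v \<in> carrier_vec n" if "v \<in> carrier V" for v
    using lhom_closed[OF lin_isosD(1)[OF iso0] that] by (simp add: module_vec_simps)
  define \<sigma> where "\<sigma> = lin_inv V ?K \<rho>0"
  have \<sigma>: "\<sigma> \<in> lin_isos ?K V" unfolding \<sigma>_def by (rule lin_inv_isos[OF V is_vs_module_vec iso0])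
  have \<sigma>c: "\<sigma> d \<in> carrier V" if "d \<in> carrier_vec n" for d
    using lhom_closed[OF lin_isosD(1)[OF \<sigma>]] that by (simp add: module_vec_simps)
  have \<rho>\<sigma>: "\<rho>0 (\<sigma> d) = d" if "d \<in> carrier_vec n" for d
    using lin_inv_right[OF iso0] that by (simp add: \<sigma>_def module_vec_simps)
  have hD: "h \<in> carrier_mat n n" "bij_betw (\<lambda>v. h *\<^sub>v v) (carrier_vec n) (carrier_vec n)" "F_mat h = h"
    if "h \<in> GL_F TYPE('k) n" for h
    using that by (auto simp: GL_F_def Units_ring_mat_iff)
  show ?thesis
    unfolding bij_betw_def
  proof
    show "inj_on (\<lambda>h. \<lambda>v\<in>carrier V. h *\<^sub>v \<rho>0 v) (GL_F TYPE('k) n)"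
    proof (rule inj_onI)
      fix h h' assume h: "h \<in> GL_F TYPE('k) n" and h': "h' \<in> GL_F TYPE('k) n"
        and eq: "(\<lambda>v\<in>carrier V. h *\<^sub>v \<rho>0 v) = (\<lambda>v\<in>carrier V. h' *\<^sub>v \<rho>0 v)"
      show "h = h'"
      proof (rule mat_eq_by_vec[OF hD(1)[OF h] hD(1)[OF h']])
        fix d :: "'k alg_closure vec" assume d: "d \<in> carrier_vec n"
        show "h *\<^sub>v d = h' *\<^sub>v d"
          using fun_cong[OF eq, of "\<sigma> d"] \<sigma>c[OF d] \<rho>\<sigma>[OF d] by simp
      qed
    qed
    show "(\<lambda>h. \<lambda>v\<in>carrier V. h *\<^sub>v \<rho>0 v) ` GL_F TYPE('k) n = equiv_coords V \<Phi> n"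
    proof (intro equalityI subsetI)
      fix \<rho> assume "\<rho> \<in> (\<lambda>h. \<lambda>v\<in>carrier V. h *\<^sub>v \<rho>0 v) ` GL_F TYPE('k) n"
      then obtain h where h: "h \<in> GL_F TYPE('k) n" and \<rho>: "\<rho> = (\<lambda>v\<in>carrier V. h *\<^sub>v \<rho>0 v)" by blast
      have "\<rho> \<in> lin_isos V ?K"
        unfolding \<rho>
      proof (rule restrict_lin_isos[OF V])
        show "(\<lambda>v. h *\<^sub>v \<rho>0 v) \<in> lhom V ?K"
          by (rule lhom_comp[OF lin_isosD(1)[OF iso0] mult_mat_vec_lhom[OF hD(1)[OF h]]])
        show "bij_betw (\<lambda>v. h *\<^sub>v \<rho>0 v) (carrier V) (carrier ?K)"
          using bij_betw_trans[OF lin_isosD(3)[OF iso0], of "\<lambda>v. h *\<^sub>v v"] hD(2)[OF h]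
          by (simp add: o_def module_vec_simps)
      qed
      moreover have "\<rho> (\<Phi> v) = F_vec (\<rho> v)" if v: "v \<in> carrier V" for v
        using frob_hom.mult_mat_vec_hom[OF hD(1)[OF h] c0[OF v]] hD(3)[OF h] v
        by (simp add: \<rho> \<Phi> eq0)
      ultimately show "\<rho> \<in> equiv_coords V \<Phi> n" by (simp add: equiv_coords_def)
    next
      fix \<rho> assume \<rho>: "\<rho> \<in> equiv_coords V \<Phi> n"
      then have iso: "\<rho> \<in> lin_isos V ?K" and eq: "\<And>v. v \<in> carrier V \<Longrightarrow> \<rho> (\<Phi> v) = F_vec (\<rho> v)"
        by (auto simp: equiv_coords_def)
      define h where "h = mat_of_lhom n n (\<lambda>d. \<rho> (\<sigma> d))"
      have hc: "h \<in> carrier_mat n n" by (simp add: h_def)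
      have hd: "h *\<^sub>v d = \<rho> (\<sigma> d)" if "d \<in> carrier_vec n" for d
        unfolding h_def by (rule mat_of_lhom[OF lhom_comp[OF lin_isosD(1)[OF \<sigma>] lin_isosD(1)[OF iso]] that])
      have \<sigma>\<rho>: "\<sigma> (\<rho>0 v) = v" if "v \<in> carrier V" for v
        using lin_inv_left[OF iso0 that] by (simp add: \<sigma>_def)
      have "bij_betw (\<lambda>d. \<rho> (\<sigma> d)) (carrier_vec n) (carrier_vec n)"
        using bij_betw_trans[OF lin_isosD(3)[OF \<sigma>] lin_isosD(3)[OF iso]]
        by (simp add: o_def module_vec_simps)
      then have "bij_betw (\<lambda>d. h *\<^sub>v d) (carrier_vec n) (carrier_vec n)"
        by (subst bij_betw_cong[where g = "\<lambda>d. \<rho> (\<sigma> d)"]) (simp_all add: hd)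
      moreover have "F_mat h = h"
      proof (rule mat_eq_by_vec[OF _ hc])
        fix d :: "'k alg_closure vec" assume "d \<in> carrier_vec n"
        then obtain e where e: "e \<in> carrier_vec n" "F_vec e = d" using F_vec_surj by blast
        have "\<Phi> (\<sigma> e) = \<sigma> d"
          using eq0[OF \<sigma>c[OF e(1)]] \<rho>\<sigma>[OF e(1)] e(2) \<sigma>\<rho>[OF \<Phi>[OF \<sigma>c[OF e(1)]]] by simp
        then have "h *\<^sub>v d = F_vec (\<rho> (\<sigma> e))"
          using eq[OF \<sigma>c[OF e(1)]] hd \<open>d \<in> carrier_vec n\<close> by simp
        also have "\<dots> = F_mat h *\<^sub>v d"
          using frob_hom.mult_mat_vec_hom[OF hc e(1)] hd[OF e(1)] e(2) by simp
        finally show "F_mat h *\<^sub>v d = h *\<^sub>v d" by simp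
      qed (use hc in simp)
      ultimately have "h \<in> GL_F TYPE('k) n" using hc by (simp add: GL_F_def Units_ring_mat_iff)
      moreover have "\<rho> = (\<lambda>v\<in>carrier V. h *\<^sub>v \<rho>0 v)"
        using lin_isosD(2)[OF iso]
        by (intro extensionalityI[of _ "carrier V"]) (simp_all add: hd c0 \<sigma>\<rho>)
      ultimately show "\<rho> \<in> (\<lambda>h. \<lambda>v\<in>carrier V. h *\<^sub>v \<rho>0 v) ` GL_F TYPE('k) n" by blast
    qed
  qed
qed

lemma finite_carrier_mat [simp]: "finite (carrier_mat m n :: 'a::{field,finite} mat set)"
proof -
  have "inj_on (\<lambda>A. \<lambda>ij\<in>{..<m} \<times> {..<n}. A $$ ij) (carrier_mat m n :: 'a mat set)"
  proof (rule inj_onI)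
    fix A B :: "'a mat" assume AB: "A \<in> carrier_mat m n" "B \<in> carrier_mat m n"
      and eq: "(\<lambda>ij\<in>{..<m} \<times> {..<n}. A $$ ij) = (\<lambda>ij\<in>{..<m} \<times> {..<n}. B $$ ij)"
    show "A = B"
    proof (rule eq_matI)
      fix i j assume "i < dim_row B" "j < dim_col B"
      then show "A $$ (i, j) = B $$ (i, j)" using fun_cong[OF eq, of "(i, j)"] AB by simp
    qed (use AB in auto)
  qed
  moreover have "finite ((\<lambda>A. \<lambda>ij\<in>{..<m} \<times> {..<n}. A $$ ij) ` (carrier_mat m n :: 'a mat set))"
  proof (rule finite_subset)
    show "(\<lambda>A. \<lambda>ij\<in>{..<m} \<times> {..<n}. A $$ ij) ` (carrier_mat m n :: 'a mat set) \<subseteq>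
        ({..<m} \<times> {..<n}) \<rightarrow>\<^sub>E UNIV" by (intro image_subsetI) simp
    show "finite (({..<m} \<times> {..<n}) \<rightarrow>\<^sub>E (UNIV :: 'a set))" by (simp add: finite_PiE)
  qed
  ultimately show ?thesis by (rule finite_imageD[rotated])
qed

lemma finite_GL_F: "finite (GL_F TYPE('k::{field,finite}) n)"
proof (rule finite_subset)
  show "GL_F TYPE('k) n \<subseteq> ac_mat ` (carrier_mat n n :: 'k mat set)"
  proof
    fix h assume "h \<in> GL_F TYPE('k) n"
    then have "h \<in> carrier_mat n n" "ac_mat (map_mat of_ac h) = h"
      by (auto simp: GL_F_def Units_ring_mat_iff ac_mat_of_ac)
    then show "h \<in> ac_mat ` carrier_mat n n" by (intro image_eqI[of _ _ "map_mat of_ac h"]) auto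
  qed
qed simp

lemma one_GL_F: "1\<^sub>m n \<in> GL_F TYPE('k::{field,finite}) n"
  by (auto simp: GL_F_def Units_def ring_mat_simps frob_hom.mat_hom_one intro!: bexI[of _ "1\<^sub>m n"])

definition subspace_matrices :: "nat \<Rightarrow> 'k::field vec set \<Rightarrow> nat \<Rightarrow> 'k mat \<Rightarrow> nat \<Rightarrow> 'k mat \<Rightarrow> 'k mat \<Rightarrow> bool" where
  "subspace_matrices n U b B a P R \<longleftrightarrow>
     B \<in> carrier_mat n b \<and> inj_on (\<lambda>d. B *\<^sub>v d) (carrier_vec b) \<and> (\<lambda>d. B *\<^sub>v d) ` carrier_vec b = U \<and>
     P \<in> carrier_mat a n \<and> R \<in> carrier_mat n a \<and> P * R = 1\<^sub>m a \<and>
     (\<forall>v\<in>carrier_vec n. P *\<^sub>v v = 0\<^sub>v a \<longleftrightarrow> v \<in> U) \<and> n = a + b \<and>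
     b = ldim ((module_vec TYPE('k) n)\<lparr>carrier := U\<rparr>)"

lemma subspace_matricesD:
  assumes "subspace_matrices n U b B a P R"
  shows "B \<in> carrier_mat n b" "inj_on (\<lambda>d. B *\<^sub>v d) (carrier_vec b)"
    "(\<lambda>d. B *\<^sub>v d) ` carrier_vec b = U" "P \<in> carrier_mat a n" "R \<in> carrier_mat n a" "P * R = 1\<^sub>m a"
    "\<And>v. v \<in> carrier_vec n \<Longrightarrow> P *\<^sub>v v = 0\<^sub>v a \<longleftrightarrow> v \<in> U" "n = a + b"
    "b = ldim ((module_vec TYPE('k) n)\<lparr>carrier := (U :: 'k::field vec set)\<rparr>)"
  using assms unfolding subspace_matrices_def by blast+

text \<open>A subspace of \<open>k\<^sup>n\<close> is both the image of an injective matrix and the kernel of a matrix with a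
  right inverse; these two matrices keep their meaning over the closure.\<close>

lemma ex_subspace_matrices:
  fixes U :: "'k::{field,finite} vec set"
  assumes U: "lsubspace U (module_vec TYPE('k) n)"
  shows "\<exists>b B a P R. subspace_matrices n U b B a P R"
proof -
  let ?V = "module_vec TYPE('k) n"
  let ?S = "?V\<lparr>carrier := U\<rparr>" and ?T = "quot_module ?V U"
  define b where "b = ldim ?S"
  define a where "a = ldim ?T"
  have sub: "U \<subseteq> carrier_vec n" using U by (simp add: lsubspace_iff module_vec_simps)
  have S: "is_vs ?S" by (rule lsubspace_is_vs[OF U])
  have T: "is_vs ?T" by (rule is_vs_quot[OF U])
  have "finite (carrier ?S)" using sub by (auto intro: finite_subset)
  then obtain \<phi> where \<phi>: "\<phi> \<in> lin_isos (module_vec TYPE('k) b) ?S"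
    using coordinates_exist[OF S] fin_dim_if_finite[OF S] by (auto simp: b_def)
  obtain \<psi> where \<psi>: "\<psi> \<in> lin_isos (module_vec TYPE('k) a) ?T"
    using coordinates_exist[OF T] fin_dim_quot[OF U] by (auto simp: a_def)
  have "\<phi> \<in> lhom (module_vec TYPE('k) b) ?V"
    using lin_isosD(1)[OF \<phi>] sub by (auto simp: lhom_iff module_vec_simps)
  note \<phi>l = this
  define B where "B = mat_of_lhom n b \<phi>"
  have Bd: "B *\<^sub>v d = \<phi> d" if "d \<in> carrier_vec b" for d
    unfolding B_def by (rule mat_of_lhom[OF \<phi>l that])
  have bij: "bij_betw (\<lambda>d. B *\<^sub>v d) (carrier_vec b) U"
    using lin_isosD(3)[OF \<phi>]
    by (subst bij_betw_cong[where g = \<phi>]) (simp_all add: Bd module_vec_simps)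
  define \<tau> where "\<tau> = lin_inv (module_vec TYPE('k) a) ?T \<psi>"
  have \<tau>: "\<tau> \<in> lin_isos ?T (module_vec TYPE('k) a)"
    unfolding \<tau>_def by (rule lin_inv_isos[OF is_vs_module_vec T \<psi>])
  define p where "p v = \<tau> (coset ?V U v)" for v
  have p: "p \<in> lhom ?V (module_vec TYPE('k) a)"
    using lhom_comp[OF coset_lhom[OF U] lin_isosD(1)[OF \<tau>]] by (simp add: p_def[abs_def])
  define P where "P = mat_of_lhom a n p"
  have Pv: "P *\<^sub>v v = p v" if "v \<in> carrier_vec n" for v
    unfolding P_def by (rule mat_of_lhom[OF p that])
  have ker: "P *\<^sub>v v = 0\<^sub>v a \<longleftrightarrow> v \<in> U" if v: "v \<in> carrier_vec n" for v
  proof -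
    have vV: "v \<in> carrier ?V" using v by (simp add: module_vec_simps)
    have "\<tau> U = 0\<^sub>v a" using lhom_zero[OF T is_vs_module_vec lin_isosD(1)[OF \<tau>]]
      by (simp add: module_vec_simps)
    moreover have "inj_on \<tau> (carrier ?T)" using lin_isosD(3)[OF \<tau>] by (simp add: bij_betw_def)
    moreover have "U \<in> carrier ?T" using vs_zero_closed[OF T] by (simp add: quot_module_def)
    moreover have "coset ?V U v \<in> carrier ?T" using vV by simp
    ultimately have "\<tau> (coset ?V U v) = 0\<^sub>v a \<longleftrightarrow> coset ?V U v = U" by (metis inj_on_eq_iff)
    then show ?thesis using coset_eq_zero_iff[OF U vV] by (simp add: Pv[OF v] p_def)
  qed
  have "\<exists>v\<in>carrier_vec n. P *\<^sub>v v = e" if e: "e \<in> carrier_vec a" for e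
  proof -
    have "e \<in> \<tau> ` carrier ?T" using lin_isosD(3)[OF \<tau>] e by (simp add: bij_betw_def module_vec_simps)
    then show ?thesis using Pv by (auto simp: p_def module_vec_simps)
  qed
  then obtain r where r: "\<And>e. e \<in> carrier_vec a \<Longrightarrow> r e \<in> carrier_vec n \<and> P *\<^sub>v r e = e" by metis
  define R where "R = mat n a (\<lambda>(i, j). r (unit_vec a j) $ i)"
  have R: "R \<in> carrier_mat n a" by (simp add: R_def)
  have P: "P \<in> carrier_mat a n" by (simp add: P_def)
  have colR: "col R j = r (unit_vec a j)" if "j < a" for j
  proof -
    have "dim_vec (r (unit_vec a j)) = n" using r[of "unit_vec a j"] by auto
    then show ?thesis by (intro eq_vecI) (use that in \<open>simp_all add: R_def\<close>)
  qed
  have "col (P * R) j = col (1\<^sub>m a) j" if "j < a" for j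
  proof -
    have "col (P * R) j = P *\<^sub>v col R j" by (rule col_mult2[OF P R that])
    then show ?thesis using that r[of "unit_vec a j"] by (simp add: colR)
  qed
  then have "P * R = 1\<^sub>m a"
    using P R by (intro mat_col_eqI) simp_all
  moreover have "n = a + b"
    using ldim_sub_quot[OF U fin_dim_module_vec] unfolding a_def b_def ldim_module_vec
    by (rule trans[OF _ add.commute])
  moreover have "B \<in> carrier_mat n b" by (simp add: B_def)
  ultimately have "subspace_matrices n U b B a P R"
    unfolding subspace_matrices_def
    using bij_betw_imp_inj_on[OF bij] bij_betw_imp_surj_on[OF bij] R P ker b_def by blast
  then show ?thesis by blast
qed

text \<open>What the matrices of the space of fixed vectors say about a Frobenius-stable subspace.\<close>

definition descends_to :: "nat \<Rightarrow> 'k::{field,finite} alg_closure vec set \<Rightarrow> 'k vec set \<Rightarrow> bool" where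
  "descends_to n W U \<longleftrightarrow> lsubspace W (module_vec TYPE('k alg_closure) n) \<and> F_vec ` W = W \<and>
     lsubspace U (module_vec TYPE('k) n) \<and> fixed_vecs n W = U"

lemma fixed_vecs_lsubspace:
  assumes W: "lsubspace W (module_vec TYPE('k::{field,finite} alg_closure) n)"
  shows "lsubspace (fixed_vecs n W) (module_vec TYPE('k) n)"
proof -
  have 0: "ac_vec (0\<^sub>v n :: 'k vec) = 0\<^sub>v n" by (rule to_ac_hom.vec_hom_zero)
  show ?thesis
    using W unfolding lsubspace_iff
    by (auto simp: fixed_vecs_def module_vec_simps ac_vec_add[of _ n] ac_vec_smult 0)
qed

lemma descends_toI:
  assumes W: "lsubspace W (module_vec TYPE('k::{field,finite} alg_closure) n)" and "F_vec ` W = W"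
  shows "descends_to n W (fixed_vecs n W)"
  using assms fixed_vecs_lsubspace[OF W] by (simp add: descends_to_def)

lemma zero_columns_image: "(\<lambda>d. (0\<^sub>m b 0 :: 'a::semiring_1 mat) *\<^sub>v d) ` carrier_vec 0 = {0\<^sub>v b}"
proof -
  have "(0\<^sub>m b 0 :: 'a mat) *\<^sub>v d = 0\<^sub>v b" if "d \<in> carrier_vec 0" for d
    by (rule eq_vecI) (use that in \<open>simp_all add: scalar_prod_def\<close>)
  moreover from this have "0\<^sub>v b \<in> (\<lambda>d. (0\<^sub>m b 0 :: 'a mat) *\<^sub>v d) ` carrier_vec 0"
    by (intro image_eqI[of _ _ "0\<^sub>v 0"]) simp_all
  ultimately show ?thesis by blast
qed

lemma descends_to_matrices:
  fixes U :: "'k::{field,finite} vec set"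
  assumes desc: "descends_to n W U" and mats: "subspace_matrices n U b B a P R"
  shows "bij_betw (\<lambda>d. ac_mat B *\<^sub>v d) (carrier_vec b) W"
    and "\<And>v. v \<in> carrier_vec n \<Longrightarrow> ac_mat P *\<^sub>v v = 0\<^sub>v a \<longleftrightarrow> v \<in> W"
proof -
  let ?K = "\<lambda>n. module_vec TYPE('k alg_closure) n"
  have W: "lsubspace W (?K n)" and FW: "F_vec ` W = W" and U: "fixed_vecs n W = U"
    using desc by (auto simp: descends_to_def)
  note B = subspace_matricesD(1)[OF mats] and inj = subspace_matricesD(2)[OF mats]
    and im = subspace_matricesD(3)[OF mats] and P = subspace_matricesD(4)[OF mats]
    and ker = subspace_matricesD(7)[OF mats]
  have B': "ac_mat B \<in> carrier_mat n b" and P': "ac_mat P \<in> carrier_mat a n" using B P by simp_all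
  have Weq: "W = (\<lambda>d. ac_mat B *\<^sub>v d) ` carrier_vec b"
    by (rule descent[OF W _ B]) (use FW im U in auto)
  have kerP: "lsubspace {v \<in> carrier_vec n. A *\<^sub>v v = 0\<^sub>v m} (?K n)" if A: "A \<in> carrier_mat m n" for A m n
    using A by (auto simp: lsubspace_iff module_vec_simps mult_add_distrib_mat_vec mult_mat_vec)
  have F0: "F_vec (0\<^sub>v m :: 'k alg_closure vec) = 0\<^sub>v m" for m by (rule frob_hom.vec_hom_zero)
  have ac0: "ac_vec (0\<^sub>v m :: 'k vec) = 0\<^sub>v m" for m by (rule to_ac_hom.vec_hom_zero)
  have stab: "F_vec v \<in> {v \<in> carrier_vec n. ac_mat A *\<^sub>v v = 0\<^sub>v m}"
    if A: "A \<in> carrier_mat m n" and v: "v \<in> {v \<in> carrier_vec n. ac_mat A *\<^sub>v v = 0\<^sub>v m}"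
    for A :: "'k mat" and v m n
  proof -
    have A': "ac_mat A \<in> carrier_mat m n" using A by simp
    show ?thesis using v frob_hom.mult_mat_vec_hom[OF A', of v] by (simp add: F0)
  qed
  have fix_ker: "fixed_vecs n {v \<in> carrier_vec n. ac_mat A *\<^sub>v v = 0\<^sub>v m} = {u \<in> carrier_vec n. A *\<^sub>v u = 0\<^sub>v m}"
    if A: "A \<in> carrier_mat m n" for A :: "'k mat" and m n
    using to_ac_hom.mult_mat_vec_hom[OF A] by (auto simp: fixed_vecs_def ac0) (metis ac0 ac_vec_inj)+
  have "{v \<in> carrier_vec n. ac_mat P *\<^sub>v v = 0\<^sub>v a} = (\<lambda>d. ac_mat B *\<^sub>v d) ` carrier_vec b"
  proof (rule descent[OF kerP[OF P'] _ B])
    show "(\<lambda>d. B *\<^sub>v d) ` carrier_vec b = fixed_vecs n {v \<in> carrier_vec n. ac_mat P *\<^sub>v v = 0\<^sub>v a}"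
      unfolding fix_ker[OF P] im using ker fixed_vecs_def U by blast
  qed (rule stab[OF P])
  then show "ac_mat P *\<^sub>v v = 0\<^sub>v a \<longleftrightarrow> v \<in> W" if "v \<in> carrier_vec n" for v
    unfolding Weq using that by blast
  \<comment> \<open>The kernel over the closure is spanned by the kernel over \<open>k\<close>, which is zero.\<close>
  have "{d \<in> carrier_vec b. ac_mat B *\<^sub>v d = 0\<^sub>v n} = (\<lambda>d. ac_mat (0\<^sub>m b 0 :: 'k mat) *\<^sub>v d) ` carrier_vec 0"
  proof (rule descent[OF kerP[OF B']])
    have B0: "B *\<^sub>v 0\<^sub>v b = 0\<^sub>v n" by (rule eq_vecI) (use B in simp_all)
    have "d = 0\<^sub>v b" if "d \<in> carrier_vec b" "B *\<^sub>v d = 0\<^sub>v n" for d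
      by (rule inj_onD[OF inj]) (simp_all only: that B0 zero_carrier_vec)
    then have "{d \<in> carrier_vec b. B *\<^sub>v d = 0\<^sub>v n} = {0\<^sub>v b}"
      using B0 by (intro equalityI subsetI) (simp_all add: zero_carrier_vec)
    moreover have "(\<lambda>d. (0\<^sub>m b 0 :: 'k mat) *\<^sub>v d) ` carrier_vec 0 = {0\<^sub>v b}"
      by (rule zero_columns_image)
    ultimately show "(\<lambda>d. (0\<^sub>m b 0 :: 'k mat) *\<^sub>v d) ` carrier_vec 0 =
        fixed_vecs b {d \<in> carrier_vec b. ac_mat B *\<^sub>v d = 0\<^sub>v n}"
      unfolding fix_ker[OF B] by simp
  qed (use stab[OF B] in auto)
  also have "ac_mat (0\<^sub>m b 0 :: 'k mat) = 0\<^sub>m b 0" by (rule eq_matI) simp_all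
  also have "(\<lambda>d. (0\<^sub>m b 0 :: 'k alg_closure mat) *\<^sub>v d) ` carrier_vec 0 = {0\<^sub>v b}" by (rule zero_columns_image)
  finally have "inj_on (\<lambda>d. ac_mat B *\<^sub>v d) (carrier (?K b))"
    by (intro lhom_injI[OF _ is_vs_module_vec mult_mat_vec_lhom[OF B']]) (auto simp: module_vec_simps)
  then show "bij_betw (\<lambda>d. ac_mat B *\<^sub>v d) (carrier_vec b) W"
    unfolding Weq by (simp add: bij_betw_def module_vec_simps)
qed

lemma F_vec_coset:
  fixes W :: "'k::{field,finite} alg_closure vec set"
  assumes W: "lsubspace W (module_vec TYPE('k alg_closure) n)" and FW: "F_vec ` W = W"
    and v: "v \<in> carrier_vec n"
  shows "F_vec ` coset (module_vec TYPE('k alg_closure) n) W v =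
    coset (module_vec TYPE('k alg_closure) n) W (F_vec v)"
proof -
  have sub: "W \<subseteq> carrier_vec n" using W by (simp add: lsubspace_iff module_vec_simps)
  have c: "coset (module_vec TYPE('k alg_closure) n) A u = (\<lambda>w. w + u) ` A" for A u
    by (auto simp: a_r_coset_def' module_vec_simps)
  have "F_vec ` coset (module_vec TYPE('k alg_closure) n) W v = (\<lambda>w. F_vec w + F_vec v) ` W"
    unfolding c image_image using sub v by (intro image_cong refl F_vec_add) auto
  also have "\<dots> = (\<lambda>w. w + F_vec v) ` F_vec ` W" by (simp only: image_image)
  finally show ?thesis by (simp only: FW c)
qed

text \<open>A Frobenius-stable subspace and its quotient both have equivariant coordinates, and every
  Frobenius-stable coset contains a fixed vector.\<close>

lemma descends_to_coords:
  fixes U :: "'k::{field,finite} vec set" and W n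
  defines "V \<equiv> module_vec TYPE('k alg_closure) n"
  assumes desc: "descends_to n W U"
  shows "ldim (V\<lparr>carrier := W\<rparr>) = ldim ((module_vec TYPE('k) n)\<lparr>carrier := U\<rparr>)"
    and "equiv_coords (V\<lparr>carrier := W\<rparr>) F_vec (ldim (V\<lparr>carrier := W\<rparr>)) \<noteq> {}"
    and "equiv_coords (quot_module V W) ((`) F_vec) (n - ldim (V\<lparr>carrier := W\<rparr>)) \<noteq> {}"
    and "\<And>v. v \<in> carrier_vec n \<Longrightarrow> F_vec v - v \<in> W \<Longrightarrow>
      \<exists>u\<in>carrier_vec n. coset V W v = coset V W (ac_vec u)"
proof -
  let ?K = "\<lambda>n. module_vec TYPE('k alg_closure) n"
  have W: "lsubspace W V" and FW: "F_vec ` W = W" and UW: "fixed_vecs n W = U"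
    and U: "lsubspace U (module_vec TYPE('k) n)"
    using desc by (auto simp: descends_to_def V_def)
  obtain b B a P R where D: "subspace_matrices n U b B a P R" using ex_subspace_matrices[OF U] by blast
  note B = subspace_matricesD(1)[OF D] and P = subspace_matricesD(4)[OF D]
    and R = subspace_matricesD(5)[OF D] and PR = subspace_matricesD(6)[OF D]
    and nab = subspace_matricesD(8)[OF D] and b = subspace_matricesD(9)[OF D]
    and mats = descends_to_matrices[OF desc D]
  have B': "ac_mat B \<in> carrier_mat n b" and P': "ac_mat P \<in> carrier_mat a n"
    and R': "ac_mat R \<in> carrier_mat n a" using B P R by simp_all
  have sub: "W \<subseteq> carrier_vec n" using W by (simp add: lsubspace_iff module_vec_simps V_def)
  have S: "is_vs (V\<lparr>carrier := W\<rparr>)" by (rule lsubspace_is_vs[OF W])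
  have T: "is_vs (quot_module V W)" by (rule is_vs_quot[OF W])
  have Bl: "(\<lambda>d. ac_mat B *\<^sub>v d) \<in> lhom (?K b) (V\<lparr>carrier := W\<rparr>)"
    using mult_mat_vec_lhom[OF B'] mats(1) unfolding V_def
    by (auto simp: lhom_iff module_vec_simps bij_betw_def)
  have Bb: "bij_betw (\<lambda>d. ac_mat B *\<^sub>v d) (carrier (?K b)) (carrier (V\<lparr>carrier := W\<rparr>))"
    using mats(1) by (simp add: module_vec_simps)
  have dimW: "ldim (V\<lparr>carrier := W\<rparr>) = b" using ldim_iso[OF _ _ S Bl Bb] by simp
  then show "ldim (V\<lparr>carrier := W\<rparr>) = ldim ((module_vec TYPE('k) n)\<lparr>carrier := U\<rparr>)"
    by (simp add: b)
  let ?\<theta> = "restrict (\<lambda>d. ac_mat B *\<^sub>v d) (carrier (?K b))"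
  have \<theta>: "?\<theta> \<in> lin_isos (?K b) (V\<lparr>carrier := W\<rparr>)" by (rule restrict_lin_isos[OF _ Bl Bb]) simp
  define \<rho> where "\<rho> = lin_inv (?K b) (V\<lparr>carrier := W\<rparr>) ?\<theta>"
  have \<rho>: "\<rho> \<in> lin_isos (V\<lparr>carrier := W\<rparr>) (?K b)" unfolding \<rho>_def by (rule lin_inv_isos[OF is_vs_module_vec S \<theta>])
  have \<rho>B: "\<rho> (ac_mat B *\<^sub>v d) = d" if "d \<in> carrier_vec b" for d
    using lin_inv_left[OF \<theta>, of d] that by (simp add: \<rho>_def module_vec_simps)
  have "\<rho> (F_vec w) = F_vec (\<rho> w)" if wW: "w \<in> W" for w
  proof -
    obtain d where d: "d \<in> carrier_vec b" "w = ac_mat B *\<^sub>v d" using bij_betw_imp_surj_on[OF mats(1)] wW by blast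
    then have "F_vec w = ac_mat B *\<^sub>v F_vec d" using frob_hom.mult_mat_vec_hom[OF B' d(1)] by simp
    then show ?thesis using d by (simp add: \<rho>B)
  qed
  then have "\<rho> \<in> equiv_coords (V\<lparr>carrier := W\<rparr>) F_vec b" using \<rho> by (simp add: equiv_coords_def)
  then show "equiv_coords (V\<lparr>carrier := W\<rparr>) F_vec (ldim (V\<lparr>carrier := W\<rparr>)) \<noteq> {}"
    unfolding dimW by blast
  have PRv: "ac_mat P *\<^sub>v (ac_mat R *\<^sub>v e) = e" if "e \<in> carrier_vec a" for e
  proof -
    have "ac_mat P * ac_mat R = 1\<^sub>m a"
      using to_ac_hom.mat_hom_mult[OF P R] by (simp add: PR to_ac_hom.mat_hom_one)
    then show ?thesis using assoc_mult_mat_vec[OF P' R' that] that by simp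
  qed
  have "\<exists>g. g \<in> lhom (quot_module V W) (?K a) \<and> bij_betw g (carrier (quot_module V W)) (carrier (?K a)) \<and>
     (\<forall>v\<in>carrier V. g (coset V W v) = ac_mat P *\<^sub>v v)"
  proof (rule quot_induced[OF W])
    show "(\<lambda>v. ac_mat P *\<^sub>v v) \<in> lhom V (?K a)" unfolding V_def by (rule mult_mat_vec_lhom[OF P'])
    show "(\<lambda>v. ac_mat P *\<^sub>v v) ` carrier V = carrier (?K a)"
    proof (intro equalityI subsetI)
      fix e assume "e \<in> carrier (?K a)"
      then have e: "e \<in> carrier_vec a" by (simp add: module_vec_simps)
      have "ac_mat R *\<^sub>v e \<in> carrier_vec n" using R' e by (rule mult_mat_vec_carrier)
      then show "e \<in> (\<lambda>v. ac_mat P *\<^sub>v v) ` carrier V"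
        using PRv[OF e] by (intro image_eqI[of _ _ "ac_mat R *\<^sub>v e"]) (simp_all add: V_def module_vec_simps)
    qed (use P in \<open>auto simp: V_def module_vec_simps\<close>)
  qed (use mats(2) in \<open>auto simp: V_def module_vec_simps\<close>)
  then obtain g where g: "g \<in> lhom (quot_module V W) (?K a)"
      "bij_betw g (carrier (quot_module V W)) (carrier (?K a))"
    and gv: "\<And>v. v \<in> carrier_vec n \<Longrightarrow> g (coset V W v) = ac_mat P *\<^sub>v v"
    by (auto simp: V_def module_vec_simps)
  have Vc: "carrier V = carrier_vec n" by (simp add: V_def module_vec_simps)
  have "restrict g (carrier (quot_module V W)) \<in> equiv_coords (quot_module V W) ((`) F_vec) a"
    unfolding equiv_coords_def
  proof (intro CollectI conjI ballI)
    show "restrict g (carrier (quot_module V W)) \<in> lin_isos (quot_module V W) (?K a)"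
      by (rule restrict_lin_isos[OF T g])
    fix c assume "c \<in> carrier (quot_module V W)"
    then obtain v where v: "v \<in> carrier_vec n" "c = coset V W v" by (auto simp: Vc)
    have "F_vec ` c = coset V W (F_vec v)"
      unfolding v(2) V_def by (rule F_vec_coset[OF W[unfolded V_def] FW v(1)])
    moreover have "F_vec v \<in> carrier_vec n" using v by simp
    ultimately show "restrict g (carrier (quot_module V W)) (F_vec ` c) =
        F_vec (restrict g (carrier (quot_module V W)) c)"
      using v frob_hom.mult_mat_vec_hom[OF P' v(1)] by (simp add: Vc gv)
  qed
  then show "equiv_coords (quot_module V W) ((`) F_vec) (n - ldim (V\<lparr>carrier := W\<rparr>)) \<noteq> {}"
    unfolding dimW using nab by auto
  fix v assume v: "v \<in> carrier_vec n" and Fv: "F_vec v - v \<in> W"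
  have Pv: "ac_mat P *\<^sub>v v \<in> carrier_vec a" using P' v by (rule mult_mat_vec_carrier)
  have "F_vec v - v \<in> carrier_vec n" using v by simp
  then have "ac_mat P *\<^sub>v (F_vec v - v) = 0\<^sub>v a" using mats(2) Fv by blast
  moreover have "ac_mat P *\<^sub>v (F_vec v - v) = ac_mat P *\<^sub>v F_vec v - ac_mat P *\<^sub>v v"
    by (rule mult_minus_distrib_mat_vec[OF P']) (use v in simp_all)
  moreover have "ac_mat P *\<^sub>v F_vec v = F_vec (ac_mat P *\<^sub>v v)"
    using frob_hom.mult_mat_vec_hom[OF P' v] by simp
  ultimately have diff: "F_vec (ac_mat P *\<^sub>v v) - ac_mat P *\<^sub>v v = 0\<^sub>v a" by simp
  have "F_vec (ac_mat P *\<^sub>v v) = ac_mat P *\<^sub>v v"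
  proof (rule eq_vecI)
    fix i assume "i < dim_vec (ac_mat P *\<^sub>v v)"
    then have i: "i < a" using P by simp
    have "(F_vec (ac_mat P *\<^sub>v v) - ac_mat P *\<^sub>v v) $ i = 0" unfolding diff using i by simp
    then show "F_vec (ac_mat P *\<^sub>v v) $ i = (ac_mat P *\<^sub>v v) $ i" using i Pv P by simp
  qed simp
  then have acp: "ac_vec (map_vec of_ac (ac_mat P *\<^sub>v v)) = ac_mat P *\<^sub>v v" by (rule ac_vec_of_ac)
  define p where "p = map_vec of_ac (ac_mat P *\<^sub>v v)"
  have p: "p \<in> carrier_vec a" using Pv by (simp add: p_def)
  define u where "u = R *\<^sub>v p"
  have u: "u \<in> carrier_vec n" unfolding u_def using R p by (rule mult_mat_vec_carrier)
  have "ac_vec u = ac_mat R *\<^sub>v ac_vec p" unfolding u_def by (rule to_ac_hom.mult_mat_vec_hom[OF R p])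
  then have "ac_mat P *\<^sub>v ac_vec u = ac_mat P *\<^sub>v v"
    using PRv[of "ac_vec p"] p acp by (simp add: p_def)
  then have "g (coset V W (ac_vec u)) = g (coset V W v)" using u v by (simp add: gv)
  then have "coset V W v = coset V W (ac_vec u)"
    using g(2) u v by (auto simp: bij_betw_def Vc dest!: inj_onD)
  then show "\<exists>u\<in>carrier_vec n. coset V W v = coset V W (ac_vec u)" using u by blast
qed

lemma ex_descends_to:
  fixes U :: "'k::{field,finite} vec set"
  assumes U: "lsubspace U (module_vec TYPE('k) n)"
  shows "\<exists>W. descends_to n W U"
proof -
  let ?K = "\<lambda>n. module_vec TYPE('k alg_closure) n"
  obtain b B a P R where D: "subspace_matrices n U b B a P R" using ex_subspace_matrices[OF U] by blast
  note B = subspace_matricesD(1)[OF D] and im = subspace_matricesD(3)[OF D]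
    and P = subspace_matricesD(4)[OF D] and ker = subspace_matricesD(7)[OF D]
  have B': "ac_mat B \<in> carrier_mat n b" and P': "ac_mat P \<in> carrier_mat a n" using B P by simp_all
  define W where "W = (\<lambda>d. ac_mat B *\<^sub>v d) ` carrier_vec b"
  have W: "lsubspace W (?K n)"
    unfolding W_def
    using lsubspace_image[of "carrier_vec b" "?K b", OF _ is_vs_module_vec mult_mat_vec_lhom[OF B']]
    by (simp add: lsubspace_iff module_vec_simps)
  have "F_vec ` W = (\<lambda>d. ac_mat B *\<^sub>v F_vec d) ` carrier_vec b"
    unfolding W_def image_image using frob_hom.mult_mat_vec_hom[OF B'] by (intro image_cong) simp_all
  also have "\<dots> = (\<lambda>d. ac_mat B *\<^sub>v d) ` F_vec ` carrier_vec b" by (simp only: image_image)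
  also have "F_vec ` carrier_vec b = (carrier_vec b :: 'k alg_closure vec set)"
    using F_vec_surj by (auto simp: image_iff)
  finally have FW: "F_vec ` W = W" by (simp only: W_def)
  have "ac_vec u \<in> W \<longleftrightarrow> u \<in> U" if u: "u \<in> carrier_vec n" for u
  proof
    assume "u \<in> U"
    then obtain d where "d \<in> carrier_vec b" "u = B *\<^sub>v d" using im by blast
    then show "ac_vec u \<in> W"
      unfolding W_def using to_ac_hom.mult_mat_vec_hom[OF B, of d] by (intro image_eqI[of _ _ "ac_vec d"]) simp_all
  next
    assume "ac_vec u \<in> W"
    then obtain d where d: "d \<in> carrier_vec b" "ac_vec u = ac_mat B *\<^sub>v d" unfolding W_def by blast
    have "P * B = 0\<^sub>m a b"
    proof (rule mat_eq_by_vec)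
      fix v :: "'k vec" assume v: "v \<in> carrier_vec b"
      have Bv: "B *\<^sub>v v \<in> carrier_vec n" using B v by (rule mult_mat_vec_carrier)
      have "B *\<^sub>v v \<in> U" using im v by blast
      then have "P *\<^sub>v (B *\<^sub>v v) = 0\<^sub>v a" using ker[OF Bv] by blast
      moreover have "0\<^sub>m a b *\<^sub>v v = 0\<^sub>v a" by (rule eq_vecI) (use v in simp_all)
      ultimately show "P * B *\<^sub>v v = 0\<^sub>m a b *\<^sub>v v" using assoc_mult_mat_vec[OF P B v] by simp
    qed (use P B in auto)
    moreover have "ac_mat (0\<^sub>m a b :: 'k mat) = 0\<^sub>m a b" by (rule eq_matI) simp_all
    ultimately have "ac_mat P * ac_mat B = 0\<^sub>m a b" using to_ac_hom.mat_hom_mult[OF P B] by simp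
    then have "ac_mat P *\<^sub>v ac_vec u = 0\<^sub>m a b *\<^sub>v d"
      using assoc_mult_mat_vec[OF P' B' d(1)] d(2) by simp
    also have "\<dots> = 0\<^sub>v a" by (rule eq_vecI) (use d in simp_all)
    finally have "ac_vec (P *\<^sub>v u) = ac_vec (0\<^sub>v a)"
      using to_ac_hom.mult_mat_vec_hom[OF P u] by (simp add: to_ac_hom.vec_hom_zero)
    then show "u \<in> U" using ker[OF u] ac_vec_inj by blast
  qed
  then have "fixed_vecs n W = U"
    using U by (auto simp: fixed_vecs_def lsubspace_iff module_vec_simps)
  then show ?thesis using W FW U unfolding descends_to_def by blast
qed

lemma descent_unique:
  fixes W W' :: "'k::{field,finite} alg_closure vec set"
  assumes W: "lsubspace W (module_vec TYPE('k alg_closure) n)" "\<And>w. w \<in> W \<Longrightarrow> F_vec w \<in> W"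
    and W': "lsubspace W' (module_vec TYPE('k alg_closure) n)" "\<And>w. w \<in> W' \<Longrightarrow> F_vec w \<in> W'"
    and eq: "fixed_vecs n W = fixed_vecs n W'"
  shows "W = W'"
proof -
  obtain b B a P R where D: "subspace_matrices n (fixed_vecs n W) b B a P R"
    using ex_subspace_matrices[OF fixed_vecs_lsubspace[OF W(1)]] by blast
  note B = subspace_matricesD(1)[OF D] and im = subspace_matricesD(3)[OF D]
  show ?thesis
    using descent[OF W B im] descent[OF W' B im[unfolded eq]] by simp
qed

lemma descends_to_unique:
  assumes W: "descends_to n W U" and W': "descends_to n W' U"
  shows "W = W'"
  by (rule descent_unique[of _ n]) (use W W' in \<open>auto simp: descends_to_def\<close>)

section \<open>Points over the finite field and their modules\<close>

context quiver
begin

text \<open>Unlike \<open>isoclass\<close>, this applies to representations on any type of vectors, such as quotients, and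
  still yields a class of \<open>kQ\<close>-modules.\<close>

definition mcl :: "('i, 'h, 'k::{field,finite}, 'v) quiver_rep \<Rightarrow> ('i, 'h, 'k) kQ_module set" where
  "mcl M = {N. is_rep Q N \<and> rep_iso Q M N}"

lemma isoclass_mcl: "isoclass Q M = mcl M"
  by (simp add: isoclass_def mcl_def)

lemma of_point_reps_over:
  "x \<in> rep_space_F Q \<alpha> \<Longrightarrow> (\<lambda>h. map_mat of_ac (x h)) \<in> reps_over TYPE('k::{field,finite}) \<alpha>"
  by (auto simp: rep_space_F_def rep_space_def reps_over_def)

lemma ac_of_point: "x \<in> rep_space_F Q \<alpha> \<Longrightarrow> h \<in> arcs Q \<Longrightarrow> ac_mat (map_mat of_ac (x h)) = x h"
  by (rule ac_mat_of_ac) (simp add: rep_space_F_def)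

lemma module_of_point_sel [simp]:
  "vsp (module_of_point \<alpha> (x :: ('h, 'k::{field,finite}) point)) i = module_vec TYPE('k) (\<alpha> i)"
  "vmap (module_of_point \<alpha> x) h v = map_mat of_ac (x h) *\<^sub>v v"
  by (simp_all add: module_of_point_def point_rep_def)

lemma is_rep_module_of_point: "x \<in> rep_space_F Q \<alpha> \<Longrightarrow> is_rep Q (module_of_point \<alpha> x)"
  unfolding module_of_point_def by (intro is_rep_point_rep of_point_reps_over)

lemma dimv_module_of_point: "\<alpha> \<in> dimvecs Q \<Longrightarrow> dimv Q (module_of_point \<alpha> x) = \<alpha>"
  unfolding module_of_point_def by (rule dimv_point_rep)

lemma point_of_reps_over:
  fixes y :: "'h \<Rightarrow> 'k::{field,finite} mat"
  assumes y: "y \<in> reps_over TYPE('k) \<alpha>"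
  shows "(\<lambda>h\<in>arcs Q. ac_mat (y h)) \<in> rep_space_F Q \<alpha>"
    and "rep_iso Q (module_of_point \<alpha> (\<lambda>h\<in>arcs Q. ac_mat (y h))) (point_rep \<alpha> y)"
proof -
  show 1: "(\<lambda>h\<in>arcs Q. ac_mat (y h)) \<in> rep_space_F Q \<alpha>"
    using y by (auto simp: rep_space_F_def rep_space_def reps_over_def)
  show "rep_iso Q (module_of_point \<alpha> (\<lambda>h\<in>arcs Q. ac_mat (y h))) (point_rep \<alpha> y)"
    by (rule rep_isoI[OF is_rep_module_of_point[OF 1], where f = "\<lambda>i v. v"])
      (auto intro: lhomI simp: bij_betw_def)
qed

lemma rep_has_point:
  assumes M: "is_rep Q (M :: ('i, 'h, 'k::{field,finite}, 'v) quiver_rep)"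
  shows "\<exists>x\<in>rep_space_F Q (dimv Q M). rep_iso Q (module_of_point (dimv Q M) x) M"
proof -
  obtain y where y: "y \<in> reps_over TYPE('k) (dimv Q M)" "rep_iso Q (point_rep (dimv Q M) y) M"
    using rep_has_coordinates[OF M] by blast
  note x = point_of_reps_over[OF y(1)]
  show ?thesis
    using rep_iso_trans[OF is_rep_module_of_point[OF x(1)] x(2) y(2)] x(1) by blast
qed

lemma mcl_eq_iff:
  assumes M: "is_rep Q M" and N: "is_rep Q N"
  shows "mcl M = mcl N \<longleftrightarrow> rep_iso Q M N"
proof
  assume eq: "mcl M = mcl N"
  obtain x where x: "x \<in> rep_space_F Q (dimv Q M)" "rep_iso Q (module_of_point (dimv Q M) x) M"
    using rep_has_point[OF M] by blast
  let ?P = "module_of_point (dimv Q M) x"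
  have P: "is_rep Q ?P" by (rule is_rep_module_of_point[OF x(1)])
  have "?P \<in> mcl M" using P rep_iso_sym[OF P M x(2)] by (simp add: mcl_def)
  then have "?P \<in> mcl N" using eq by simp
  then have "rep_iso Q N ?P" by (simp add: mcl_def)
  then have "rep_iso Q N M" using rep_iso_trans[OF N _ x(2)] by blast
  then show "rep_iso Q M N" by (rule rep_iso_sym[OF N M])
next
  assume iso: "rep_iso Q M N"
  show "mcl M = mcl N"
    using rep_iso_trans[OF M iso] rep_iso_trans[OF N rep_iso_sym[OF M N iso]] by (auto simp: mcl_def)
qed

lemma mcl_isoclasses:
  assumes M: "is_rep Q M"
  shows "mcl M \<in> isoclasses Q"
proof -
  obtain x where x: "x \<in> rep_space_F Q (dimv Q M)" "rep_iso Q (module_of_point (dimv Q M) x) M"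
    using rep_has_point[OF M] by blast
  note P = is_rep_module_of_point[OF x(1)]
  have "mcl M = isoclass Q (module_of_point (dimv Q M) x)"
    using x(2) mcl_eq_iff[OF P M] by (simp add: isoclass_mcl)
  then show ?thesis using P by (simp add: isoclasses_def)
qed

section \<open>The induction diagram on fixed points\<close>

text \<open>As \<open>\<rho>\<close> commutes with Frobenius, the structure maps written in the coordinates \<open>\<rho>\<close> have entries
  in \<open>k\<close>.\<close>

lemma transported_point:
  fixes N :: "('i, 'h, 'k::{field,finite} alg_closure, 'v) quiver_rep"
  assumes vs: "\<And>i. i \<in> verts Q \<Longrightarrow> is_vs (vsp N i)"
    and lin: "\<And>h. h \<in> arcs Q \<Longrightarrow> vmap N h \<in> lhom (vsp N (tail Q h)) (vsp N (head Q h))"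
    and \<rho>: "\<And>i. i \<in> verts Q \<Longrightarrow> \<rho> i \<in> equiv_coords (vsp N i) (\<Phi> i) (\<alpha> i)" and ext: "\<rho> \<in> extensional (verts Q)"
    and \<Phi>: "\<And>i v. i \<in> verts Q \<Longrightarrow> v \<in> carrier (vsp N i) \<Longrightarrow> \<Phi> i v \<in> carrier (vsp N i)"
    and comm: "\<And>h v. h \<in> arcs Q \<Longrightarrow> v \<in> carrier (vsp N (tail Q h)) \<Longrightarrow>
      vmap N h (\<Phi> (tail Q h) v) = \<Phi> (head Q h) (vmap N h v)"
  obtains y where "y \<in> rep_space_F Q \<alpha>"
    "(THE y. y \<in> rep_space Q \<alpha> \<and> \<rho> \<in> rep_hom Q N (point_rep \<alpha> y)) = y"
    "\<And>h v. h \<in> arcs Q \<Longrightarrow> v \<in> carrier (vsp N (tail Q h)) \<Longrightarrow> \<rho> (head Q h) (vmap N h v) = y h *\<^sub>v \<rho> (tail Q h) v"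
proof -
  let ?K = "\<lambda>i. module_vec TYPE('k alg_closure) (\<alpha> i)"
  have iso: "\<rho> i \<in> lin_isos (vsp N i) (?K i)" if "i \<in> verts Q" for i
    using \<rho>[OF that] by (simp add: equiv_coords_def)
  have equ: "\<rho> i (\<Phi> i v) = F_vec (\<rho> i v)" if "i \<in> verts Q" "v \<in> carrier (vsp N i)" for i v
    using \<rho>[OF that(1)] that(2) by (simp add: equiv_coords_def)
  define \<sigma> where "\<sigma> i = lin_inv (vsp N i) (?K i) (\<rho> i)" for i
  have \<sigma>: "\<sigma> i \<in> lin_isos (?K i) (vsp N i)" if "i \<in> verts Q" for i
    unfolding \<sigma>_def by (rule lin_inv_isos[OF vs[OF that] is_vs_module_vec iso[OF that]])
  have \<rho>\<sigma>: "\<rho> i (\<sigma> i d) = d" if "i \<in> verts Q" "d \<in> carrier_vec (\<alpha> i)" for i d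
    using lin_inv_right[OF iso[OF that(1)]] that(2) by (simp add: \<sigma>_def module_vec_simps)
  have \<sigma>\<rho>: "\<sigma> i (\<rho> i v) = v" if "i \<in> verts Q" "v \<in> carrier (vsp N i)" for i v
    using lin_inv_left[OF iso[OF that(1)] that(2)] by (simp add: \<sigma>_def)
  have \<rho>c: "\<rho> i v \<in> carrier_vec (\<alpha> i)" if "i \<in> verts Q" "v \<in> carrier (vsp N i)" for i v
    using lhom_closed[OF lin_isosD(1)[OF iso[OF that(1)]] that(2)] by (simp add: module_vec_simps)
  have \<sigma>c: "\<sigma> i d \<in> carrier (vsp N i)" if "i \<in> verts Q" "d \<in> carrier_vec (\<alpha> i)" for i d
    using lhom_closed[OF lin_isosD(1)[OF \<sigma>[OF that(1)]]] that(2) by (simp add: module_vec_simps)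
  define y where "y = (\<lambda>h\<in>arcs Q. mat_of_lhom (\<alpha> (head Q h)) (\<alpha> (tail Q h))
     (\<lambda>d. \<rho> (head Q h) (vmap N h (\<sigma> (tail Q h) d))))"
  have yc: "y h \<in> carrier_mat (\<alpha> (head Q h)) (\<alpha> (tail Q h))" if "h \<in> arcs Q" for h
    using that by (simp add: y_def)
  have yd: "y h *\<^sub>v d = \<rho> (head Q h) (vmap N h (\<sigma> (tail Q h) d))"
    if h: "h \<in> arcs Q" and d: "d \<in> carrier_vec (\<alpha> (tail Q h))" for h d
  proof -
    have t: "tail Q h \<in> verts Q" and hd: "head Q h \<in> verts Q" using h by auto
    show ?thesis
      using mat_of_lhom[OF lhom_comp[OF lhom_comp[OF lin_isosD(1)[OF \<sigma>[OF t]] lin[OF h]] lin_isosD(1)[OF iso[OF hd]]] d] h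
      by (simp add: y_def)
  qed
  have y\<rho>: "\<rho> (head Q h) (vmap N h v) = y h *\<^sub>v \<rho> (tail Q h) v"
    if h: "h \<in> arcs Q" and v: "v \<in> carrier (vsp N (tail Q h))" for h v
  proof -
    have t: "tail Q h \<in> verts Q" using h by auto
    show ?thesis using yd[OF h \<rho>c[OF t v]] \<sigma>\<rho>[OF t v] by simp
  qed
  have y: "y \<in> rep_space Q \<alpha>" using yc by (auto simp: rep_space_def y_def)
  have hom: "\<rho> \<in> rep_hom Q N (point_rep \<alpha> y)"
    unfolding rep_hom_def using lin_isosD(4)[OF iso] ext y\<rho> by (auto simp: PiE_def)
  have "F_mat (y h) = y h" if h: "h \<in> arcs Q" for h
  proof (rule mat_eq_by_vec[OF _ yc[OF h]])
    have t: "tail Q h \<in> verts Q" and hd: "head Q h \<in> verts Q" using h by auto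
    fix d :: "'k alg_closure vec" assume "d \<in> carrier_vec (\<alpha> (tail Q h))"
    then obtain e where e: "e \<in> carrier_vec (\<alpha> (tail Q h))" "F_vec e = d" using F_vec_surj by blast
    let ?v = "\<sigma> (tail Q h) e"
    have v: "?v \<in> carrier (vsp N (tail Q h))" by (rule \<sigma>c[OF t e(1)])
    have vh: "vmap N h ?v \<in> carrier (vsp N (head Q h))" by (rule lhom_closed[OF lin[OF h] v])
    have "F_mat (y h) *\<^sub>v d = F_vec (y h *\<^sub>v e)"
      using frob_hom.mult_mat_vec_hom[OF yc[OF h] e(1)] e(2) by simp
    also have "y h *\<^sub>v e = \<rho> (head Q h) (vmap N h ?v)" by (rule yd[OF h e(1)])
    also have "F_vec \<dots> = \<rho> (head Q h) (vmap N h (\<Phi> (tail Q h) ?v))"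
      using equ[OF hd vh] comm[OF h v] by simp
    also have "\<dots> = y h *\<^sub>v \<rho> (tail Q h) (\<Phi> (tail Q h) ?v)" by (rule y\<rho>[OF h \<Phi>[OF t v]])
    also have "\<dots> = y h *\<^sub>v d" using equ[OF t v] \<rho>\<sigma>[OF t e(1)] e(2) by simp
    finally show "F_mat (y h) *\<^sub>v d = y h *\<^sub>v d" .
  qed (use yc[OF h] in simp)
  then have yF: "y \<in> rep_space_F Q \<alpha>" using y by (simp add: rep_space_F_def)
  have "(THE y. y \<in> rep_space Q \<alpha> \<and> \<rho> \<in> rep_hom Q N (point_rep \<alpha> y)) = y"
  proof (rule the_equality)
    fix y' assume y': "y' \<in> rep_space Q \<alpha> \<and> \<rho> \<in> rep_hom Q N (point_rep \<alpha> y')"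
    show "y' = y"
    proof (rule extensionalityI[of _ "arcs Q"])
      fix h assume h: "h \<in> arcs Q"
      then have t: "tail Q h \<in> verts Q" by auto
      show "y' h = y h"
      proof (rule mat_eq_by_vec[OF _ yc[OF h]])
        show "y' h \<in> carrier_mat (\<alpha> (head Q h)) (\<alpha> (tail Q h))" using y' h by (auto simp: rep_space_def)
        fix d :: "'k alg_closure vec" assume d: "d \<in> carrier_vec (\<alpha> (tail Q h))"
        have "y' h *\<^sub>v d = \<rho> (head Q h) (vmap N h (\<sigma> (tail Q h) d))"
          using y' h \<sigma>c[OF t d] \<rho>\<sigma>[OF t d] by (simp add: rep_hom_def)
        then show "y' h *\<^sub>v d = y h *\<^sub>v d" by (simp add: yd[OF h d])
      qed
    qed (use y y' in \<open>auto simp: rep_space_def PiE_iff\<close>)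
  qed (use y hom in blast)
  then show thesis using that yF y\<rho> by blast
qed

definition fixed_flag :: "('i \<Rightarrow> nat) \<Rightarrow> ('i, 'k::{field,finite}) flag \<Rightarrow> 'i \<Rightarrow> 'k vec set" where
  "fixed_flag \<gamma> W = (\<lambda>i\<in>verts Q. fixed_vecs (\<gamma> i) (W i))"

lemma E_two_F_iff:
  assumes "z \<in> rep_space_F Q (\<alpha> + \<beta>)"
  shows "(z, W) \<in> E_two_F Q \<alpha> \<beta> \<longleftrightarrow> W \<in> subreps Q (point_rep (\<alpha> + \<beta>) z) \<and>
    (\<forall>i\<in>verts Q. ldim ((module_vec TYPE('k::{field,finite} alg_closure) ((\<alpha> + \<beta>) i))\<lparr>carrier := W i\<rparr>) = \<beta> i \<and>
       F_vec ` W i = W i)"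
proof -
  have "z \<in> rep_space Q (\<alpha> + \<beta>)" using assms by (simp add: rep_space_F_def)
  then show ?thesis
    using assms unfolding E_two_F_def E_two_def mem_Collect_eq case_prod_conv dimv_def
    by (simp cong: ball_cong) blast
qed

lemma E_two_F_descends:
  assumes z: "z \<in> rep_space_F Q (\<alpha> + \<beta>)" and W: "(z, W) \<in> E_two_F Q \<alpha> \<beta>" and i: "i \<in> verts Q"
  shows "descends_to ((\<alpha> + \<beta>) i) (W i) (fixed_flag (\<alpha> + \<beta>) W i)"
proof -
  have "W \<in> subreps Q (point_rep (\<alpha> + \<beta>) z)" and F: "F_vec ` W i = W i"
    using W i unfolding E_two_F_iff[OF z] by blast+
  then have "lsubspace (W i) (vsp (point_rep (\<alpha> + \<beta>) z) i)" using i by (intro subrepsD(1))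
  then show ?thesis using F i unfolding point_rep_sel fixed_flag_def by (simp only: restrict_apply' descends_toI)
qed

lemma fixed_flag_subreps:
  fixes z :: "('h, 'k::{field,finite}) point"
  assumes z: "z \<in> rep_space_F Q \<gamma>" and W: "W \<in> subreps Q (point_rep \<gamma> z)"
  shows "fixed_flag \<gamma> W \<in> subreps Q (module_of_point \<gamma> z)"
proof (rule subrepsI)
  fix i assume i: "i \<in> verts Q"
  show "lsubspace (fixed_flag \<gamma> W i) (vsp (module_of_point \<gamma> z) i)"
    using fixed_vecs_lsubspace subrepsD(1)[OF W i] i by (simp add: fixed_flag_def)
next
  fix h u assume h: "h \<in> arcs Q" and "u \<in> fixed_flag \<gamma> W (tail Q h)"
  then have u: "u \<in> carrier_vec (\<gamma> (tail Q h))" "ac_vec u \<in> W (tail Q h)"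
    by (auto simp: fixed_flag_def fixed_vecs_def)
  have A: "map_mat of_ac (z h) \<in> carrier_mat (\<gamma> (head Q h)) (\<gamma> (tail Q h))"
    using of_point_reps_over[OF z] h by (simp add: reps_over_def)
  have "ac_vec (map_mat of_ac (z h) *\<^sub>v u) = z h *\<^sub>v ac_vec u"
    using to_ac_hom.mult_mat_vec_hom[OF A u(1)] ac_of_point[OF z h] by simp
  moreover have "z h *\<^sub>v ac_vec u \<in> W (head Q h)" using subrepsD(3)[OF W h u(2)] by simp
  ultimately show "vmap (module_of_point \<gamma> z) h u \<in> fixed_flag \<gamma> W (head Q h)"
    using h mult_mat_vec_carrier[OF A u(1)] by (simp add: fixed_flag_def fixed_vecs_def)
qed (simp add: fixed_flag_def)

text \<open>By Galois descent, the flags of the induction diagram over a point are the subrepresentations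
  of its module.\<close>

lemma bij_betw_fixed_flag:
  fixes z :: "('h, 'k::{field,finite}) point"
  assumes z: "z \<in> rep_space_F Q (\<alpha> + \<beta>)" and \<beta>: "\<beta> \<in> dimvecs Q"
  shows "bij_betw (fixed_flag (\<alpha> + \<beta>)) {W. (z, W) \<in> E_two_F Q \<alpha> \<beta>}
    {U \<in> subreps Q (module_of_point (\<alpha> + \<beta>) z). dimv Q (sub_rep (module_of_point (\<alpha> + \<beta>) z) U) = \<beta>}"
proof -
  let ?\<gamma> = "\<alpha> + \<beta>" and ?M = "module_of_point (\<alpha> + \<beta>) z"
  have dims: "dimv Q (sub_rep ?M (fixed_flag ?\<gamma> W)) = \<beta> \<longleftrightarrow>
      (\<forall>i\<in>verts Q. ldim ((module_vec TYPE('k alg_closure) (?\<gamma> i))\<lparr>carrier := W i\<rparr>) = \<beta> i)"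
    if desc: "\<And>i. i \<in> verts Q \<Longrightarrow> descends_to (?\<gamma> i) (W i) (fixed_flag ?\<gamma> W i)" for W
    using \<beta> descends_to_coords(1)[OF desc] by (auto simp: dimv_def fun_eq_iff dimvecs_def)
  show ?thesis
    unfolding bij_betw_def
  proof
    show "inj_on (fixed_flag ?\<gamma>) {W. (z, W) \<in> E_two_F Q \<alpha> \<beta>}"
    proof (rule inj_onI)
      fix W W' assume "W \<in> {W. (z, W) \<in> E_two_F Q \<alpha> \<beta>}" "W' \<in> {W. (z, W) \<in> E_two_F Q \<alpha> \<beta>}"
      then have W: "(z, W) \<in> E_two_F Q \<alpha> \<beta>" and W': "(z, W') \<in> E_two_F Q \<alpha> \<beta>" by auto
      assume eq: "fixed_flag ?\<gamma> W = fixed_flag ?\<gamma> W'"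
      show "W = W'"
      proof (rule extensionalityI[of _ "verts Q"])
        fix i assume i: "i \<in> verts Q"
        show "W i = W' i"
          using descends_to_unique[OF E_two_F_descends[OF z W i], of "W' i"] E_two_F_descends[OF z W' i] eq by simp
      qed (use W W' in \<open>auto simp: E_two_F_iff[OF z] dest: subrepsD(4)\<close>)
    qed
    show "fixed_flag ?\<gamma> ` {W. (z, W) \<in> E_two_F Q \<alpha> \<beta>} = {U \<in> subreps Q ?M. dimv Q (sub_rep ?M U) = \<beta>}"
    proof (intro equalityI subsetI)
      fix U assume "U \<in> fixed_flag ?\<gamma> ` {W. (z, W) \<in> E_two_F Q \<alpha> \<beta>}"
      then obtain W where W: "(z, W) \<in> E_two_F Q \<alpha> \<beta>" and U: "U = fixed_flag ?\<gamma> W" by blast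
      have "W \<in> subreps Q (point_rep ?\<gamma> z)" using W by (simp add: E_two_F_iff[OF z])
      then have "U \<in> subreps Q ?M" unfolding U by (rule fixed_flag_subreps[OF z])
      moreover have "dimv Q (sub_rep ?M U) = \<beta>"
        unfolding U using dims[OF E_two_F_descends[OF z W]] W unfolding E_two_F_iff[OF z] by blast
      ultimately show "U \<in> {U \<in> subreps Q ?M. dimv Q (sub_rep ?M U) = \<beta>}" by blast
    next
      fix U assume "U \<in> {U \<in> subreps Q ?M. dimv Q (sub_rep ?M U) = \<beta>}"
      then have U: "U \<in> subreps Q ?M" and dU: "dimv Q (sub_rep ?M U) = \<beta>" by auto
      have "\<exists>W. descends_to (?\<gamma> i) W (U i)" if "i \<in> verts Q" for i
        using ex_descends_to subrepsD(1)[OF U that] by simp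
      then obtain W0 where W0: "\<And>i. i \<in> verts Q \<Longrightarrow> descends_to (?\<gamma> i) (W0 i) (U i)" by metis
      define W where "W = restrict W0 (verts Q)"
      have W: "descends_to (?\<gamma> i) (W i) (U i)" if "i \<in> verts Q" for i using W0 that by (simp add: W_def)
      have UW: "U = fixed_flag ?\<gamma> W"
      proof (rule extensionalityI[of _ "verts Q"])
        fix i assume i: "i \<in> verts Q"
        then show "U i = fixed_flag ?\<gamma> W i" using W[OF i] by (simp add: fixed_flag_def descends_to_def)
      qed (use subrepsD(4)[OF U] in \<open>auto simp: fixed_flag_def\<close>)
      have Wsub: "lsubspace (W i) (module_vec TYPE('k alg_closure) (?\<gamma> i))" and FW: "F_vec ` W i = W i"
        and Wfix: "fixed_vecs (?\<gamma> i) (W i) = U i" if "i \<in> verts Q" for i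
        using W[OF that] by (auto simp: descends_to_def)
      have Wc: "W i \<subseteq> carrier_vec (?\<gamma> i)" if "i \<in> verts Q" for i
        using Wsub[OF that] by (simp add: lsubspace_iff module_vec_simps)
      have "W \<in> subreps Q (point_rep ?\<gamma> z)"
      proof (rule subrepsI)
        fix h w assume h: "h \<in> arcs Q" and w: "w \<in> W (tail Q h)"
        then have t: "tail Q h \<in> verts Q" and hd: "head Q h \<in> verts Q" by auto
        have zh: "z h \<in> carrier_mat (?\<gamma> (head Q h)) (?\<gamma> (tail Q h))" and Fz: "F_mat (z h) = z h"
          using z h by (auto simp: rep_space_F_def rep_space_def)
        let ?T = "{w \<in> W (tail Q h). z h *\<^sub>v w \<in> W (head Q h)}"
        have "?T = W (tail Q h)"
        proof (rule descent_unique)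
          show "lsubspace ?T (module_vec TYPE('k alg_closure) (?\<gamma> (tail Q h)))"
          proof -
            have "z h *\<^sub>v 0\<^sub>v (?\<gamma> (tail Q h)) = 0\<^sub>v (?\<gamma> (head Q h))"
              by (rule eq_vecI) (use zh in simp_all)
            moreover have "z h *\<^sub>v (u + v) = z h *\<^sub>v u + z h *\<^sub>v v" if "u \<in> W (tail Q h)" "v \<in> W (tail Q h)" for u v
              using mult_add_distrib_mat_vec[OF zh] Wc[OF t] that by blast
            moreover have "z h *\<^sub>v (r \<cdot>\<^sub>v u) = r \<cdot>\<^sub>v (z h *\<^sub>v u)" if "u \<in> W (tail Q h)" for u r
              using mult_mat_vec[OF zh] Wc[OF t] that by blast
            ultimately show ?thesis
              using Wsub[OF t] Wsub[OF hd] by (auto simp: lsubspace_iff module_vec_simps)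
          qed
          show "F_vec w \<in> ?T" if "w \<in> ?T" for w
          proof -
            have w: "w \<in> W (tail Q h)" "z h *\<^sub>v w \<in> W (head Q h)" using that by auto
            have "z h *\<^sub>v F_vec w = F_vec (z h *\<^sub>v w)"
              using frob_hom.mult_mat_vec_hom[OF zh, of w] Wc[OF t] w(1) Fz by auto
            moreover have "F_vec (z h *\<^sub>v w) \<in> W (head Q h)" "F_vec w \<in> W (tail Q h)"
              using FW[OF hd] FW[OF t] w by auto
            ultimately show ?thesis by simp
          qed
          show "F_vec w \<in> W (tail Q h)" if "w \<in> W (tail Q h)" for w using FW[OF t] that by auto
          have "z h *\<^sub>v ac_vec u \<in> W (head Q h)" if u: "u \<in> U (tail Q h)" for u
          proof -
            have A: "map_mat of_ac (z h) \<in> carrier_mat (?\<gamma> (head Q h)) (?\<gamma> (tail Q h))" using zh by simp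
            have uc: "u \<in> carrier_vec (?\<gamma> (tail Q h))" using subrepsD(2)[OF U t] u by (auto simp: module_vec_simps)
            have "map_mat of_ac (z h) *\<^sub>v u \<in> fixed_vecs (?\<gamma> (head Q h)) (W (head Q h))"
              using subrepsD(3)[OF U h u] Wfix[OF hd] by simp
            then have "ac_vec (map_mat of_ac (z h) *\<^sub>v u) \<in> W (head Q h)" by (simp add: fixed_vecs_def)
            then show ?thesis
              using to_ac_hom.mult_mat_vec_hom[OF A uc] ac_of_point[OF z h] by simp
          qed
          then show "fixed_vecs (?\<gamma> (tail Q h)) ?T = fixed_vecs (?\<gamma> (tail Q h)) (W (tail Q h))"
            using Wfix[OF t] by (auto simp: fixed_vecs_def)
        qed (rule Wsub[OF t])
        then show "vmap (point_rep ?\<gamma> z) h w \<in> W (head Q h)" using w by auto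
      qed (use Wsub in \<open>simp_all add: W_def\<close>)
      moreover have "\<forall>i\<in>verts Q. ldim ((module_vec TYPE('k alg_closure) (?\<gamma> i))\<lparr>carrier := W i\<rparr>) = \<beta> i"
        using dU dims[of W] W unfolding UW by blast
      ultimately have "(z, W) \<in> E_two_F Q \<alpha> \<beta>" using FW by (simp add: E_two_F_iff[OF z])
      then show "U \<in> fixed_flag ?\<gamma> ` {W. (z, W) \<in> E_two_F Q \<alpha> \<beta>}" using UW by blast
    qed
  qed
qed

end

context quiver
begin

definition quot_coords :: "('i \<Rightarrow> nat) \<Rightarrow> ('i \<Rightarrow> nat) \<Rightarrow> ('i, 'k::{field,finite}) flag \<Rightarrow>
    ('i \<Rightarrow> 'k alg_closure vec set \<Rightarrow> 'k alg_closure vec) set" where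
  "quot_coords \<gamma> \<alpha> W = (\<Pi>\<^sub>E i\<in>verts Q.
     equiv_coords (quot_module (module_vec TYPE('k alg_closure) (\<gamma> i)) (W i)) ((`) F_vec) (\<alpha> i))"

definition sub_coords :: "('i \<Rightarrow> nat) \<Rightarrow> ('i \<Rightarrow> nat) \<Rightarrow> ('i, 'k::{field,finite}) flag \<Rightarrow>
    ('i \<Rightarrow> 'k alg_closure vec \<Rightarrow> 'k alg_closure vec) set" where
  "sub_coords \<gamma> \<beta> W = (\<Pi>\<^sub>E i\<in>verts Q.
     equiv_coords ((module_vec TYPE('k alg_closure) (\<gamma> i))\<lparr>carrier := W i\<rparr>) F_vec (\<beta> i))"

lemma E_one_F_fibre:
  assumes W: "(z, W) \<in> E_two_F Q \<alpha> \<beta>"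
  shows "{u \<in> E_one_F Q \<alpha> \<beta>. proj2 u = (z, W)} =
    (\<lambda>(\<rho>1, \<rho>2). (z, W, \<rho>1, \<rho>2)) ` (quot_coords (\<alpha> + \<beta>) \<alpha> W \<times> sub_coords (\<alpha> + \<beta>) \<beta> W)"
proof -
  have W2: "(z, W) \<in> E_two Q \<alpha> \<beta>" using W by (auto simp: E_two_F_def)
  have "(z, W, \<rho>1, \<rho>2) \<in> E_one_F Q \<alpha> \<beta> \<longleftrightarrow>
      \<rho>1 \<in> quot_coords (\<alpha> + \<beta>) \<alpha> W \<and> \<rho>2 \<in> sub_coords (\<alpha> + \<beta>) \<beta> W" for \<rho>1 \<rho>2
    unfolding E_one_F_def E_one_def quot_coords_def sub_coords_def equiv_coords_def mem_Collect_eq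
      case_prod_conv PiE_iff vsp_quot_rep sub_rep_sel point_rep_sel
    using W W2 by auto
  then show ?thesis by (auto simp: proj2_def)
qed

lemma GL_group_F_PiE: "GL_group_F Q \<alpha> = (\<Pi>\<^sub>E i\<in>verts Q. GL_F TYPE('k::{field,finite}) (\<alpha> i))"
  unfolding GL_group_F_def GL_group_def GL_F_def
  by (rule Set.set_eqI) (unfold PiE_iff mem_Collect_eq, blast)

lemma finite_GL_group_F: "finite (GL_group_F Q \<alpha> :: ('i \<Rightarrow> 'k::{field,finite} alg_closure mat) set)"
  unfolding GL_group_F_PiE by (intro finite_PiE finite_GL_F) simp

lemma card_GL_group_F_pos: "card (GL_group_F Q \<alpha> :: ('i \<Rightarrow> 'k::{field,finite} alg_closure mat) set) > 0"
proof -
  have "(\<lambda>i\<in>verts Q. 1\<^sub>m (\<alpha> i)) \<in> (GL_group_F Q \<alpha> :: ('i \<Rightarrow> 'k alg_closure mat) set)"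
    unfolding GL_group_F_PiE using one_GL_F by auto
  then show ?thesis using finite_GL_group_F by (auto simp: card_gt_0_iff)
qed

lemma card_PiE_equiv_coords:
  fixes V :: "'i \<Rightarrow> ('k::{field,finite} alg_closure, 'v) module"
  assumes "\<And>i. i \<in> verts Q \<Longrightarrow> is_vs (V i)"
    and "\<And>i v. i \<in> verts Q \<Longrightarrow> v \<in> carrier (V i) \<Longrightarrow> \<Phi> i v \<in> carrier (V i)"
    and "\<And>i. i \<in> verts Q \<Longrightarrow> equiv_coords (V i) (\<Phi> i) (\<alpha> i) \<noteq> {}"
  shows "card (\<Pi>\<^sub>E i\<in>verts Q. equiv_coords (V i) (\<Phi> i) (\<alpha> i)) =
    card (GL_group_F Q \<alpha> :: ('i \<Rightarrow> 'k alg_closure mat) set)"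
proof -
  have "card (equiv_coords (V i) (\<Phi> i) (\<alpha> i)) = card (GL_F TYPE('k) (\<alpha> i))" if i: "i \<in> verts Q" for i
  proof -
    obtain \<rho> where "\<rho> \<in> equiv_coords (V i) (\<Phi> i) (\<alpha> i)" using assms(3)[OF i] by blast
    then show ?thesis
      using bij_betw_same_card[OF bij_betw_equiv_coords[OF assms(1)[OF i] assms(2)[OF i]]] by simp
  qed
  then show ?thesis unfolding GL_group_F_PiE by (simp add: card_PiE cong: prod.cong)
qed

text \<open>Equivariant coordinates restrict to the fixed vectors, so the transported points have as modules
  the quotient and the subrepresentation that the flag cuts out over \<open>k\<close>.\<close>

lemma proj1_value:
  fixes z :: "('h, 'k::{field,finite}) point"
  assumes z: "z \<in> rep_space_F Q (\<alpha> + \<beta>)" and W: "(z, W) \<in> E_two_F Q \<alpha> \<beta>"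
    and \<rho>1: "\<rho>1 \<in> quot_coords (\<alpha> + \<beta>) \<alpha> W" and \<rho>2: "\<rho>2 \<in> sub_coords (\<alpha> + \<beta>) \<beta> W"
  obtains x y where "proj1 Q \<alpha> \<beta> (z, W, \<rho>1, \<rho>2) = (x, y)" "x \<in> rep_space_F Q \<alpha>" "y \<in> rep_space_F Q \<beta>"
    "rep_iso Q (quot_rep Q (module_of_point (\<alpha> + \<beta>) z) (fixed_flag (\<alpha> + \<beta>) W)) (module_of_point \<alpha> x)"
    "rep_iso Q (sub_rep (module_of_point (\<alpha> + \<beta>) z) (fixed_flag (\<alpha> + \<beta>) W)) (module_of_point \<beta> y)"
proof -
  let ?\<gamma> = "\<alpha> + \<beta>"
  let ?P = "point_rep ?\<gamma> z" and ?M = "module_of_point ?\<gamma> z" and ?U = "fixed_flag ?\<gamma> W"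
  let ?K = "\<lambda>i. module_vec TYPE('k alg_closure) (?\<gamma> i)"
  have Wsub: "W \<in> subreps Q ?P" using W unfolding E_two_F_iff[OF z] by blast
  have zover: "z \<in> reps_over TYPE('k alg_closure) ?\<gamma>"
    using z by (auto simp: reps_over_def rep_space_F_def rep_space_def)
  have P: "is_rep Q ?P" by (rule is_rep_point_rep[OF zover])
  have M: "is_rep Q ?M" by (rule is_rep_module_of_point[OF z])
  have U: "?U \<in> subreps Q ?M" by (rule fixed_flag_subreps[OF z Wsub])
  have Wls: "lsubspace (W i) (?K i)" and FW: "F_vec ` W i = W i" and Ui: "?U i = fixed_vecs (?\<gamma> i) (W i)"
    if "i \<in> verts Q" for i
    using E_two_F_descends[OF z W that] by (auto simp: descends_to_def)
  have Wc: "W i \<subseteq> carrier_vec (?\<gamma> i)" if "i \<in> verts Q" for i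
    using Wls[OF that] by (simp add: lsubspace_iff module_vec_simps)
  have zc: "z h \<in> carrier_mat (?\<gamma> (head Q h)) (?\<gamma> (tail Q h))" if "h \<in> arcs Q" for h
    using zover that by (simp add: reps_over_def)
  have zk: "map_mat of_ac (z h) \<in> carrier_mat (?\<gamma> (head Q h)) (?\<gamma> (tail Q h))" if "h \<in> arcs Q" for h
    using zc[OF that] by simp
  have zF: "z h *\<^sub>v F_vec v = F_vec (z h *\<^sub>v v)" if "h \<in> arcs Q" "v \<in> carrier_vec (?\<gamma> (tail Q h))" for h v
    using frob_hom.mult_mat_vec_hom[OF zc[OF that(1)] that(2)] z that(1) by (simp add: rep_space_F_def)
  have z_ac: "ac_vec (map_mat of_ac (z h) *\<^sub>v u) = z h *\<^sub>v ac_vec u"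
    if "h \<in> arcs Q" "u \<in> carrier_vec (?\<gamma> (tail Q h))" for h u
    using to_ac_hom.mult_mat_vec_hom[OF zk[OF that(1)] that(2)] ac_of_point[OF z that(1)] by simp
  have \<rho>1i: "\<rho>1 i \<in> equiv_coords (quot_module (?K i) (W i)) ((`) F_vec) (\<alpha> i)" if "i \<in> verts Q" for i
    using \<rho>1 that by (auto simp: quot_coords_def)
  have \<rho>2i: "\<rho>2 i \<in> equiv_coords ((?K i)\<lparr>carrier := W i\<rparr>) F_vec (\<beta> i)" if "i \<in> verts Q" for i
    using \<rho>2 that by (auto simp: sub_coords_def)
  have coset_F: "F_vec ` coset (?K i) (W i) v = coset (?K i) (W i) (F_vec v)"
    if "i \<in> verts Q" "v \<in> carrier_vec (?\<gamma> i)" for i v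
    by (rule F_vec_coset[OF Wls[OF that(1)] FW[OF that(1)] that(2)])
  have Kc: "carrier (?K i) = carrier_vec (?\<gamma> i)" for i by (simp add: module_vec_simps)
  have Q': "is_rep Q (quot_rep Q ?P W)" by (rule is_rep_quot_rep[OF P Wsub])
  have vq: "vmap (quot_rep Q ?P W) h (coset (?K (tail Q h)) (W (tail Q h)) v) =
      coset (?K (head Q h)) (W (head Q h)) (z h *\<^sub>v v)"
    if "h \<in> arcs Q" "v \<in> carrier_vec (?\<gamma> (tail Q h))" for h v
    using vmap_quot_rep[OF P Wsub that(1), of v] that(2) by (simp add: module_vec_simps)
  \<comment> \<open>The representation on the quotient.\<close>
  obtain x where x: "x \<in> rep_space_F Q \<alpha>"
    and THEx: "(THE y. y \<in> rep_space Q \<alpha> \<and> \<rho>1 \<in> rep_hom Q (quot_rep Q ?P W) (point_rep \<alpha> y)) = x"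
    and xv: "\<And>h v. h \<in> arcs Q \<Longrightarrow> v \<in> carrier (vsp (quot_rep Q ?P W) (tail Q h)) \<Longrightarrow>
      \<rho>1 (head Q h) (vmap (quot_rep Q ?P W) h v) = x h *\<^sub>v \<rho>1 (tail Q h) v"
  proof (rule transported_point[of "quot_rep Q ?P W" \<rho>1 "\<lambda>_. (`) F_vec" \<alpha>])
    show "\<rho>1 i \<in> equiv_coords (vsp (quot_rep Q ?P W) i) ((`) F_vec) (\<alpha> i)" if "i \<in> verts Q" for i
      using \<rho>1i[OF that] by simp
    show "\<rho>1 \<in> extensional (verts Q)" using \<rho>1 by (simp add: quot_coords_def PiE_iff)
    show "F_vec ` c \<in> carrier (vsp (quot_rep Q ?P W) i)"
      if i: "i \<in> verts Q" and c: "c \<in> carrier (vsp (quot_rep Q ?P W) i)" for i c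
    proof -
      obtain v where v: "v \<in> carrier_vec (?\<gamma> i)" "c = coset (?K i) (W i) v"
        using c unfolding vsp_quot_rep point_rep_sel quot_module_sel Kc by blast
      have "F_vec v \<in> carrier_vec (?\<gamma> i)" using v(1) by simp
      then show ?thesis unfolding v(2) coset_F[OF i v(1)] vsp_quot_rep point_rep_sel quot_module_sel Kc by blast
    qed
    show "vmap (quot_rep Q ?P W) h (F_vec ` c) = F_vec ` vmap (quot_rep Q ?P W) h c"
      if h: "h \<in> arcs Q" and c: "c \<in> carrier (vsp (quot_rep Q ?P W) (tail Q h))" for h c
    proof -
      have t: "tail Q h \<in> verts Q" and hd: "head Q h \<in> verts Q" using h by auto
      obtain v where v: "v \<in> carrier_vec (?\<gamma> (tail Q h))" "c = coset (?K (tail Q h)) (W (tail Q h)) v"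
        using c unfolding vsp_quot_rep point_rep_sel quot_module_sel Kc by blast
      have Fv: "F_vec v \<in> carrier_vec (?\<gamma> (tail Q h))" using v(1) by simp
      have zv: "z h *\<^sub>v v \<in> carrier_vec (?\<gamma> (head Q h))" by (rule mult_mat_vec_carrier[OF zc[OF h] v(1)])
      show ?thesis
        unfolding v(2) coset_F[OF t v(1)] vq[OF h Fv] vq[OF h v(1)] coset_F[OF hd zv] zF[OF h v(1)] by (rule refl)
    qed
  qed (use is_repD(1,3)[OF Q'] that in auto)
  have iso1: "\<rho>1 i \<in> lin_isos (quot_module (?K i) (W i)) (module_vec TYPE('k alg_closure) (\<alpha> i))"
    and equ1: "\<And>c. c \<in> carrier (quot_module (?K i) (W i)) \<Longrightarrow> \<rho>1 i (F_vec ` c) = F_vec (\<rho>1 i c)"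
    if "i \<in> verts Q" for i using \<rho>1i[OF that] by (auto simp: equiv_coords_def)
  define p where "p i v = \<rho>1 i (coset (?K i) (W i) v)" for i v
  have p: "p i \<in> lhom (?K i) (module_vec TYPE('k alg_closure) (\<alpha> i))" if "i \<in> verts Q" for i
    using lhom_comp[OF coset_lhom[OF Wls[OF that]] lin_isosD(1)[OF iso1[OF that]]] by (simp add: p_def[abs_def])
  have pc: "p i v \<in> carrier_vec (\<alpha> i)" if "i \<in> verts Q" "v \<in> carrier_vec (?\<gamma> i)" for i v
    using lhom_closed[OF p[OF that(1)], of v] that(2) by (simp add: module_vec_simps)
  have pF: "p i (F_vec v) = F_vec (p i v)" if "i \<in> verts Q" "v \<in> carrier_vec (?\<gamma> i)" for i v
    using equ1[OF that(1), of "coset (?K i) (W i) v"] coset_F[OF that] that(2) Kc by (simp add: p_def)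
  have p0: "p i v = 0\<^sub>v (\<alpha> i) \<longleftrightarrow> v \<in> W i" if i: "i \<in> verts Q" and v: "v \<in> carrier_vec (?\<gamma> i)" for i v
  proof -
    have T: "is_vs (quot_module (?K i) (W i))" by (rule is_vs_quot[OF Wls[OF i]])
    have 0: "\<rho>1 i (W i) = 0\<^sub>v (\<alpha> i)"
      using lhom_zero[OF T is_vs_module_vec lin_isosD(1)[OF iso1[OF i]]] by (simp add: module_vec_simps)
    have "W i \<in> carrier (quot_module (?K i) (W i))" using vs_zero_closed[OF T] by (simp add: quot_module_def)
    moreover have "coset (?K i) (W i) v \<in> carrier (quot_module (?K i) (W i))" using v Kc by simp
    ultimately have "p i v = \<rho>1 i (W i) \<longleftrightarrow> coset (?K i) (W i) v = W i"
      unfolding p_def using bij_betw_imp_inj_on[OF lin_isosD(3)[OF iso1[OF i]]] by (simp only: inj_on_eq_iff)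
    then show ?thesis using coset_eq_zero_iff[OF Wls[OF i], of v] v Kc 0 by simp
  qed
  have ac0: "ac_vec (0\<^sub>v m :: 'k vec) = 0\<^sub>v m" for m by (rule to_ac_hom.vec_hom_zero)
  define f where "f i u = map_vec of_ac (p i (ac_vec u))" for i u
  have f_ac: "ac_vec (f i u) = p i (ac_vec u)" if "i \<in> verts Q" "u \<in> carrier_vec (?\<gamma> i)" for i u
    unfolding f_def using pF[OF that(1), of "ac_vec u"] that(2) by (intro ac_vec_of_ac) simp
  have fc: "f i u \<in> carrier_vec (\<alpha> i)" if "i \<in> verts Q" "u \<in> carrier_vec (?\<gamma> i)" for i u
    using pc[OF that(1), of "ac_vec u"] that(2) by (simp add: f_def)
  have quot: "rep_iso Q (quot_rep Q ?M ?U) (module_of_point \<alpha> x)"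
  proof (rule rep_iso_quotI[OF M is_rep_module_of_point[OF x] U, where f = f])
    fix i assume i: "i \<in> verts Q"
    note pl = p[OF i]
    show "f i \<in> lhom (vsp ?M i) (vsp (module_of_point \<alpha> x) i)"
      unfolding module_of_point_sel
    proof (rule lhomI)
      fix u v :: "'k vec" and r :: 'k assume "u \<in> carrier (module_vec TYPE('k) (?\<gamma> i))"
      then have u: "u \<in> carrier_vec (?\<gamma> i)" by (simp add: module_vec_simps)
      show "f i u \<in> carrier (module_vec TYPE('k) (\<alpha> i))" using fc[OF i u] by (simp add: module_vec_simps)
      have "ac_vec (f i (r \<cdot>\<^sub>v u)) = ac_vec (r \<cdot>\<^sub>v f i u)"
        using f_ac[OF i, of "r \<cdot>\<^sub>v u"] f_ac[OF i u] u lhom_smult[OF pl, of "ac_vec u" "to_ac r"]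
        by (simp add: ac_vec_smult module_vec_simps)
      then show "f i (r \<odot>\<^bsub>module_vec TYPE('k) (?\<gamma> i)\<^esub> u) = r \<odot>\<^bsub>module_vec TYPE('k) (\<alpha> i)\<^esub> f i u"
        by (simp add: module_vec_simps ac_vec_inj)
      assume "v \<in> carrier (module_vec TYPE('k) (?\<gamma> i))"
      then have v: "v \<in> carrier_vec (?\<gamma> i)" by (simp add: module_vec_simps)
      have "ac_vec (f i (u + v)) = ac_vec (f i u + f i v)"
        using f_ac[OF i, of "u + v"] f_ac[OF i u] f_ac[OF i v] u v lhom_add[OF pl, of "ac_vec u" "ac_vec v"]
        by (simp add: ac_vec_add[OF u v] ac_vec_add[OF fc[OF i u] fc[OF i v]] module_vec_simps)
      then show "f i (u \<oplus>\<^bsub>module_vec TYPE('k) (?\<gamma> i)\<^esub> v) = f i u \<oplus>\<^bsub>module_vec TYPE('k) (\<alpha> i)\<^esub> f i v"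
        by (simp add: module_vec_simps ac_vec_inj)
    qed
    show "f i u = \<zero>\<^bsub>vsp (module_of_point \<alpha> x) i\<^esub> \<longleftrightarrow> u \<in> ?U i" if "u \<in> carrier (vsp ?M i)" for u
    proof -
      have u: "u \<in> carrier_vec (?\<gamma> i)" using that by (simp add: module_vec_simps)
      have "f i u = 0\<^sub>v (\<alpha> i) \<longleftrightarrow> ac_vec (f i u) = ac_vec (0\<^sub>v (\<alpha> i))" by (rule ac_vec_inj[symmetric])
      also have "\<dots> \<longleftrightarrow> ac_vec u \<in> W i" unfolding f_ac[OF i u] ac0 using u by (intro p0[OF i]) simp
      also have "\<dots> \<longleftrightarrow> u \<in> ?U i" unfolding Ui[OF i] fixed_vecs_def using u by blast
      finally show ?thesis by (simp add: module_vec_simps)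
    qed
    have "\<exists>u\<in>carrier_vec (?\<gamma> i). f i u = e" if e: "e \<in> carrier_vec (\<alpha> i)" for e
    proof -
      have "ac_vec e \<in> \<rho>1 i ` carrier (quot_module (?K i) (W i))"
        unfolding bij_betw_imp_surj_on[OF lin_isosD(3)[OF iso1[OF i]]] using e by (simp add: module_vec_simps)
      then obtain v where v: "v \<in> carrier_vec (?\<gamma> i)" "p i v = ac_vec e"
        unfolding quot_module_sel Kc p_def by (metis (no_types, lifting) imageE)
      have Fv: "F_vec v \<in> carrier_vec (?\<gamma> i)" using v by simp
      have "p i (F_vec v - v) = p i (F_vec v) - p i v"
      proof -
        have "v + (F_vec v - v) = F_vec v" using v by (intro eq_vecI) auto
        then have "p i (F_vec v) = p i v + p i (F_vec v - v)"
          using lhom_add[OF pl, of v "F_vec v - v"] v by (simp add: module_vec_simps)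
        then show ?thesis using pc[OF i v(1)] pc[OF i, of "F_vec v - v"] v by (intro eq_vecI) auto
      qed
      also have "\<dots> = 0\<^sub>v (\<alpha> i)" unfolding pF[OF i v(1)] v(2) using e by simp
      finally have "F_vec v - v \<in> W i" using p0[OF i, of "F_vec v - v"] v by simp
      then obtain u where u: "u \<in> carrier_vec (?\<gamma> i)" "coset (?K i) (W i) v = coset (?K i) (W i) (ac_vec u)"
        using descends_to_coords(4)[OF E_two_F_descends[OF z W i] v(1)] by blast
      then have "ac_vec (f i u) = ac_vec e" using f_ac[OF i u(1)] v(2) by (simp add: p_def)
      then show ?thesis using u(1) ac_vec_inj by blast
    qed
    then show "f i ` carrier (vsp ?M i) = carrier (vsp (module_of_point \<alpha> x) i)"
      using fc[OF i] unfolding module_of_point_sel module_vec_simps by blast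
  next
    fix h u assume h: "h \<in> arcs Q" and "u \<in> carrier (vsp ?M (tail Q h))"
    then have u: "u \<in> carrier_vec (?\<gamma> (tail Q h))" by (simp add: module_vec_simps)
    have t: "tail Q h \<in> verts Q" and hd: "head Q h \<in> verts Q" using h by auto
    have zu: "map_mat of_ac (z h) *\<^sub>v u \<in> carrier_vec (?\<gamma> (head Q h))" by (rule mult_mat_vec_carrier[OF zk[OF h] u])
    have xk: "map_mat of_ac (x h) \<in> carrier_mat (\<alpha> (head Q h)) (\<alpha> (tail Q h))"
      using of_point_reps_over[OF x] h by (simp add: reps_over_def)
    have au: "ac_vec u \<in> carrier_vec (?\<gamma> (tail Q h))" using u by simp
    have "ac_vec (f (head Q h) (map_mat of_ac (z h) *\<^sub>v u)) = p (head Q h) (z h *\<^sub>v ac_vec u)"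
      using f_ac[OF hd zu] z_ac[OF h u] by simp
    also have "\<dots> = x h *\<^sub>v p (tail Q h) (ac_vec u)"
    proof -
      have "coset (?K (tail Q h)) (W (tail Q h)) (ac_vec u) \<in> carrier (vsp (quot_rep Q ?P W) (tail Q h))"
        unfolding vsp_quot_rep point_rep_sel quot_module_sel Kc using au by blast
      from xv[OF h this] show ?thesis unfolding vq[OF h au] p_def .
    qed
    also have "\<dots> = ac_vec (map_mat of_ac (x h) *\<^sub>v f (tail Q h) u)"
      using to_ac_hom.mult_mat_vec_hom[OF xk fc[OF t u]] ac_of_point[OF x h] f_ac[OF t u] by simp
    finally show "f (head Q h) (vmap ?M h u) = vmap (module_of_point \<alpha> x) h (f (tail Q h) u)"
      unfolding module_of_point_sel by (simp only: ac_vec_inj)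
  qed
  \<comment> \<open>The representation on the subspace.\<close>
  obtain y where y: "y \<in> rep_space_F Q \<beta>"
    and THEy: "(THE y. y \<in> rep_space Q \<beta> \<and> \<rho>2 \<in> rep_hom Q (sub_rep ?P W) (point_rep \<beta> y)) = y"
    and yv: "\<And>h v. h \<in> arcs Q \<Longrightarrow> v \<in> carrier (vsp (sub_rep ?P W) (tail Q h)) \<Longrightarrow>
      \<rho>2 (head Q h) (vmap (sub_rep ?P W) h v) = y h *\<^sub>v \<rho>2 (tail Q h) v"
  proof (rule transported_point[of "sub_rep ?P W" \<rho>2 "\<lambda>_. F_vec" \<beta>])
    show "\<rho>2 i \<in> equiv_coords (vsp (sub_rep ?P W) i) F_vec (\<beta> i)" if "i \<in> verts Q" for i
      using \<rho>2i[OF that] by simp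
    show "\<rho>2 \<in> extensional (verts Q)" using \<rho>2 by (simp add: sub_coords_def PiE_iff)
    show "is_vs (vsp (sub_rep ?P W) i)" if "i \<in> verts Q" for i
      using lsubspace_is_vs[OF Wls[OF that]] by simp
    show "F_vec v \<in> carrier (vsp (sub_rep ?P W) i)"
      if i: "i \<in> verts Q" and "v \<in> carrier (vsp (sub_rep ?P W) i)" for i v
      using FW[OF i] that by auto
    show "vmap (sub_rep ?P W) h (F_vec v) = F_vec (vmap (sub_rep ?P W) h v)"
      if h: "h \<in> arcs Q" and v: "v \<in> carrier (vsp (sub_rep ?P W) (tail Q h))" for h v
      using zF[OF h, of v] Wc[of "tail Q h"] h v by auto
    show "vmap (sub_rep ?P W) h \<in> lhom (vsp (sub_rep ?P W) (tail Q h)) (vsp (sub_rep ?P W) (head Q h))"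
      if h: "h \<in> arcs Q" for h
    proof -
      have t: "tail Q h \<in> verts Q" using h by auto
      show ?thesis
        using subrepsD(2)[OF Wsub t] subrepsD(3)[OF Wsub h] lhom_add[OF is_repD(3)[OF P h]] lhom_smult[OF is_repD(3)[OF P h]]
        by (intro lhomI) (simp_all add: subset_iff)
    qed
  qed (use that in auto)
  have iso2: "\<rho>2 i \<in> lin_isos ((?K i)\<lparr>carrier := W i\<rparr>) (module_vec TYPE('k alg_closure) (\<beta> i))"
    and equ2: "\<And>w. w \<in> W i \<Longrightarrow> \<rho>2 i (F_vec w) = F_vec (\<rho>2 i w)"
    if "i \<in> verts Q" for i using \<rho>2i[OF that] by (auto simp: equiv_coords_def)
  have UW: "u \<in> carrier_vec (?\<gamma> i) \<and> ac_vec u \<in> W i" if "i \<in> verts Q" "u \<in> ?U i" for i u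
    using that Ui[OF that(1)] by (simp add: fixed_vecs_def)
  have r2c: "\<rho>2 i w \<in> carrier_vec (\<beta> i)" if "i \<in> verts Q" "w \<in> W i" for i w
    using lhom_closed[OF lin_isosD(1)[OF iso2[OF that(1)]], of w] that(2) by (simp add: module_vec_simps)
  define g where "g i u = map_vec of_ac (\<rho>2 i (ac_vec u))" for i u
  have g_ac: "ac_vec (g i u) = \<rho>2 i (ac_vec u)" if "i \<in> verts Q" "u \<in> ?U i" for i u
    unfolding g_def using equ2[OF that(1), of "ac_vec u"] UW[OF that] by (intro ac_vec_of_ac) simp
  have gc: "g i u \<in> carrier_vec (\<beta> i)" if "i \<in> verts Q" "u \<in> ?U i" for i u
    using r2c[OF that(1), of "ac_vec u"] UW[OF that] by (simp add: g_def)
  have sub: "rep_iso Q (sub_rep ?M ?U) (module_of_point \<beta> y)"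
  proof (rule rep_isoI[OF is_rep_sub_rep[OF M U], where f = g])
    fix i assume i: "i \<in> verts Q"
    note pl = lin_isosD(1)[OF iso2[OF i]]
    have Ucl: "u + v \<in> ?U i" "r \<cdot>\<^sub>v u \<in> ?U i" if "u \<in> ?U i" "v \<in> ?U i" for u v r
      using subrepsD(1)[OF U i] that by (auto simp: lsubspace_iff module_vec_simps)
    show "g i \<in> lhom (vsp (sub_rep ?M ?U) i) (vsp (module_of_point \<beta> y) i)"
      unfolding module_of_point_sel sub_rep_sel
    proof (rule lhomI)
      fix u v :: "'k vec" and r :: 'k assume "u \<in> carrier ((module_vec TYPE('k) (?\<gamma> i))\<lparr>carrier := ?U i\<rparr>)"
      then have uU: "u \<in> ?U i" by simp
      then have u: "u \<in> carrier_vec (?\<gamma> i)" "ac_vec u \<in> W i" using UW[OF i] by auto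
      show "g i u \<in> carrier (module_vec TYPE('k) (\<beta> i))" using gc[OF i uU] by (simp add: module_vec_simps)
      have "ac_vec (g i (r \<cdot>\<^sub>v u)) = ac_vec (r \<cdot>\<^sub>v g i u)"
        using g_ac[OF i Ucl(2)[OF uU uU], of r] g_ac[OF i uU] u lhom_smult[OF pl, of "ac_vec u" "to_ac r"]
        by (simp add: ac_vec_smult module_vec_simps)
      then show "g i (r \<odot>\<^bsub>(module_vec TYPE('k) (?\<gamma> i))\<lparr>carrier := ?U i\<rparr>\<^esub> u) = r \<odot>\<^bsub>module_vec TYPE('k) (\<beta> i)\<^esub> g i u"
        by (simp add: module_vec_simps ac_vec_inj)
      assume "v \<in> carrier ((module_vec TYPE('k) (?\<gamma> i))\<lparr>carrier := ?U i\<rparr>)"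
      then have vU: "v \<in> ?U i" by simp
      then have v: "v \<in> carrier_vec (?\<gamma> i)" "ac_vec v \<in> W i" using UW[OF i] by auto
      have "ac_vec (g i (u + v)) = ac_vec (g i u + g i v)"
        using g_ac[OF i Ucl(1)[OF uU vU]] g_ac[OF i uU] g_ac[OF i vU] u v lhom_add[OF pl, of "ac_vec u" "ac_vec v"]
        by (simp add: ac_vec_add[OF u(1) v(1)] ac_vec_add[OF gc[OF i uU] gc[OF i vU]] module_vec_simps)
      then show "g i (u \<oplus>\<^bsub>(module_vec TYPE('k) (?\<gamma> i))\<lparr>carrier := ?U i\<rparr>\<^esub> v) = g i u \<oplus>\<^bsub>module_vec TYPE('k) (\<beta> i)\<^esub> g i v"
        by (simp add: module_vec_simps ac_vec_inj)
    qed
    have inj: "inj_on (\<rho>2 i) (W i)" using bij_betw_imp_inj_on[OF lin_isosD(3)[OF iso2[OF i]]] by simp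
    have "inj_on (g i) (?U i)"
    proof (rule inj_onI)
      fix u v assume uv: "u \<in> ?U i" "v \<in> ?U i" and "g i u = g i v"
      then have "\<rho>2 i (ac_vec u) = \<rho>2 i (ac_vec v)" using g_ac[OF i uv(1)] g_ac[OF i uv(2)] by simp
      then have "ac_vec u = ac_vec v" using inj_onD[OF inj] UW[OF i uv(1)] UW[OF i uv(2)] by blast
      then show "u = v" by (simp only: ac_vec_inj)
    qed
    moreover have "\<exists>u\<in>?U i. g i u = e" if e: "e \<in> carrier_vec (\<beta> i)" for e
    proof -
      have "ac_vec e \<in> \<rho>2 i ` W i"
        using bij_betw_imp_surj_on[OF lin_isosD(3)[OF iso2[OF i]]] e by (simp add: module_vec_simps)
      then obtain w where w: "w \<in> W i" "\<rho>2 i w = ac_vec e" by (metis imageE)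
      have Fw: "F_vec w \<in> W i" using FW[OF i] w(1) by blast
      have "\<rho>2 i (F_vec w) = \<rho>2 i w" using equ2[OF i w(1)] w(2) by simp
      then have "F_vec w = w" using inj_onD[OF inj _ Fw w(1)] by blast
      then have aw: "ac_vec (map_vec of_ac w) = w" by (rule ac_vec_of_ac)
      have uU: "map_vec of_ac w \<in> ?U i"
        unfolding Ui[OF i] fixed_vecs_def using aw w(1) Wc[OF i] by auto
      have "ac_vec (g i (map_vec of_ac w)) = ac_vec e" using g_ac[OF i uU] aw w(2) by simp
      then show ?thesis using uU ac_vec_inj by blast
    qed
    ultimately show "bij_betw (g i) (carrier (vsp (sub_rep ?M ?U) i)) (carrier (vsp (module_of_point \<beta> y) i))"
      unfolding bij_betw_def using gc[OF i] by (simp add: module_vec_simps) blast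
  next
    fix h u assume h: "h \<in> arcs Q" and "u \<in> carrier (vsp (sub_rep ?M ?U) (tail Q h))"
    then have uU: "u \<in> ?U (tail Q h)" by simp
    have t: "tail Q h \<in> verts Q" and hd: "head Q h \<in> verts Q" using h by auto
    have u: "u \<in> carrier_vec (?\<gamma> (tail Q h))" "ac_vec u \<in> W (tail Q h)" using UW[OF t uU] by auto
    have zu: "map_mat of_ac (z h) *\<^sub>v u \<in> ?U (head Q h)"
      using subrepsD(3)[OF U h uU] unfolding module_of_point_sel .
    have yk: "map_mat of_ac (y h) \<in> carrier_mat (\<beta> (head Q h)) (\<beta> (tail Q h))"
      using of_point_reps_over[OF y] h by (simp add: reps_over_def)
    have "ac_vec (g (head Q h) (map_mat of_ac (z h) *\<^sub>v u)) = \<rho>2 (head Q h) (z h *\<^sub>v ac_vec u)"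
      using g_ac[OF hd zu] z_ac[OF h u(1)] by simp
    also have "\<dots> = y h *\<^sub>v \<rho>2 (tail Q h) (ac_vec u)"
      using yv[OF h, of "ac_vec u"] u by simp
    also have "\<dots> = ac_vec (map_mat of_ac (y h) *\<^sub>v g (tail Q h) u)"
      using to_ac_hom.mult_mat_vec_hom[OF yk gc[OF t uU]] ac_of_point[OF y h] g_ac[OF t uU] by simp
    finally show "g (head Q h) (vmap (sub_rep ?M ?U) h u) = vmap (module_of_point \<beta> y) h (g (tail Q h) u)"
      unfolding module_of_point_sel sub_rep_sel by (simp only: ac_vec_inj)
  qed
  have "proj1 Q \<alpha> \<beta> (z, W, \<rho>1, \<rho>2) = (x, y)" by (simp add: proj1_def THEx THEy)
  then show thesis using that x y quot sub by blast
qed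

text \<open>The fibres of \<open>p\<^sub>2\<close> are torsors, so the factor \<open>1 / |G\<^sub>\<alpha> \<times> G\<^sub>\<beta>|\<close> cancels and the product is a
  sum over subrepresentations.\<close>

lemma m_twisted_sum:
  fixes z :: "('h, 'k::{field,finite}) point" and v :: "'e::field_char_0"
  assumes \<beta>: "\<beta> \<in> dimvecs Q" and z: "z \<in> rep_space_F Q (\<alpha> + \<beta>)"
    and f: "\<And>x y. x \<in> rep_space_F Q \<alpha> \<Longrightarrow> y \<in> rep_space_F Q \<beta> \<Longrightarrow>
      f (x, y) = H (mcl (module_of_point \<alpha> x)) (mcl (module_of_point \<beta> y))"
  shows "m_twisted v Q \<alpha> \<beta> f z = v powi euler_form Q \<alpha> \<beta> *
    (\<Sum>U | U \<in> subreps Q (module_of_point (\<alpha> + \<beta>) z) \<and> dimv Q (sub_rep (module_of_point (\<alpha> + \<beta>) z) U) = \<beta>.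
       H (mcl (quot_rep Q (module_of_point (\<alpha> + \<beta>) z) U)) (mcl (sub_rep (module_of_point (\<alpha> + \<beta>) z) U)))"
proof -
  let ?\<gamma> = "\<alpha> + \<beta>" and ?M = "module_of_point (\<alpha> + \<beta>) z"
  let ?Ga = "GL_group_F Q \<alpha> :: ('i \<Rightarrow> 'k alg_closure mat) set"
  let ?Gb = "GL_group_F Q \<beta> :: ('i \<Rightarrow> 'k alg_closure mat) set"
  let ?val = "\<lambda>U. H (mcl (quot_rep Q ?M U)) (mcl (sub_rep ?M U))"
  have M: "is_rep Q ?M" by (rule is_rep_module_of_point[OF z])
  have inner: "push (E_one_F Q \<alpha> \<beta>) proj2 (f \<circ> proj1 Q \<alpha> \<beta>) (z, W) =
      of_nat (card (?Ga \<times> ?Gb)) * ?val (fixed_flag ?\<gamma> W)"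
    if W: "(z, W) \<in> E_two_F Q \<alpha> \<beta>" for W
  proof -
    let ?A = "quot_coords ?\<gamma> \<alpha> W" and ?B = "sub_coords ?\<gamma> \<beta> W"
    have Wsub: "W \<in> subreps Q (point_rep ?\<gamma> z)" using W unfolding E_two_F_iff[OF z] by blast
    have U: "fixed_flag ?\<gamma> W \<in> subreps Q ?M" by (rule fixed_flag_subreps[OF z Wsub])
    have val: "f (proj1 Q \<alpha> \<beta> (z, W, \<rho>1, \<rho>2)) = ?val (fixed_flag ?\<gamma> W)"
      if \<rho>: "\<rho>1 \<in> ?A" "\<rho>2 \<in> ?B" for \<rho>1 \<rho>2
    proof -
      obtain x y where xy: "proj1 Q \<alpha> \<beta> (z, W, \<rho>1, \<rho>2) = (x, y)" "x \<in> rep_space_F Q \<alpha>" "y \<in> rep_space_F Q \<beta>"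
        "rep_iso Q (quot_rep Q ?M (fixed_flag ?\<gamma> W)) (module_of_point \<alpha> x)"
        "rep_iso Q (sub_rep ?M (fixed_flag ?\<gamma> W)) (module_of_point \<beta> y)"
        using proj1_value[OF z W \<rho>] by blast
      have "mcl (quot_rep Q ?M (fixed_flag ?\<gamma> W)) = mcl (module_of_point \<alpha> x)"
        using mcl_eq_iff[OF is_rep_quot_rep[OF M U] is_rep_module_of_point[OF xy(2)]] xy(4) by blast
      moreover have "mcl (sub_rep ?M (fixed_flag ?\<gamma> W)) = mcl (module_of_point \<beta> y)"
        using mcl_eq_iff[OF is_rep_sub_rep[OF M U] is_rep_module_of_point[OF xy(3)]] xy(5) by blast
      ultimately show ?thesis using f[OF xy(2,3)] xy(1) by simp
    qed
    have dimW: "ldim ((module_vec TYPE('k alg_closure) (?\<gamma> i))\<lparr>carrier := W i\<rparr>) = \<beta> i" if "i \<in> verts Q" for i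
      using W that unfolding E_two_F_iff[OF z] by blast
    have ls: "lsubspace (W i) (module_vec TYPE('k alg_closure) (?\<gamma> i))" and FW: "F_vec ` W i = W i"
      if "i \<in> verts Q" for i using E_two_F_descends[OF z W that] by (auto simp: descends_to_def)
    have "card ?A = card ?Ga"
      unfolding quot_coords_def
    proof (rule card_PiE_equiv_coords)
      fix i assume i: "i \<in> verts Q"
      show "is_vs (quot_module (module_vec TYPE('k alg_closure) (?\<gamma> i)) (W i))" by (rule is_vs_quot[OF ls[OF i]])
      show "F_vec ` c \<in> carrier (quot_module (module_vec TYPE('k alg_closure) (?\<gamma> i)) (W i))"
        if cQ: "c \<in> carrier (quot_module (module_vec TYPE('k alg_closure) (?\<gamma> i)) (W i))" for c
      proof -
        obtain u where u: "u \<in> carrier_vec (?\<gamma> i)" "c = coset (module_vec TYPE('k alg_closure) (?\<gamma> i)) (W i) u"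
          using cQ unfolding quot_module_sel module_vec_simps by blast
        have "F_vec u \<in> carrier_vec (?\<gamma> i)" using u(1) by simp
        then show ?thesis
          unfolding u(2) F_vec_coset[OF ls[OF i] FW[OF i] u(1)] quot_module_sel module_vec_simps by blast
      qed
      show "equiv_coords (quot_module (module_vec TYPE('k alg_closure) (?\<gamma> i)) (W i)) ((`) F_vec) (\<alpha> i) \<noteq> {}"
        using descends_to_coords(3)[OF E_two_F_descends[OF z W i]] dimW[OF i] by simp
    qed
    moreover have "card ?B = card ?Gb"
      unfolding sub_coords_def
    proof (rule card_PiE_equiv_coords)
      fix i assume i: "i \<in> verts Q"
      show "is_vs ((module_vec TYPE('k alg_closure) (?\<gamma> i))\<lparr>carrier := W i\<rparr>)" by (rule lsubspace_is_vs[OF ls[OF i]])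
      show "F_vec w \<in> carrier ((module_vec TYPE('k alg_closure) (?\<gamma> i))\<lparr>carrier := W i\<rparr>)"
        if "w \<in> carrier ((module_vec TYPE('k alg_closure) (?\<gamma> i))\<lparr>carrier := W i\<rparr>)" for w
        using FW[OF i] that by auto
      show "equiv_coords ((module_vec TYPE('k alg_closure) (?\<gamma> i))\<lparr>carrier := W i\<rparr>) F_vec (\<beta> i) \<noteq> {}"
        using descends_to_coords(2)[OF E_two_F_descends[OF z W i]] dimW[OF i] by simp
    qed
    ultimately have card: "card (?A \<times> ?B) = card (?Ga \<times> ?Gb)" by (simp add: card_cartesian_product)
    have "push (E_one_F Q \<alpha> \<beta>) proj2 (f \<circ> proj1 Q \<alpha> \<beta>) (z, W) =
        (\<Sum>(\<rho>1, \<rho>2) \<in> ?A \<times> ?B. f (proj1 Q \<alpha> \<beta> (z, W, \<rho>1, \<rho>2)))"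
      unfolding push_def E_one_F_fibre[OF W]
      by (subst sum.reindex) (auto simp: inj_on_def case_prod_unfold intro!: sum.cong)
    also have "\<dots> = (\<Sum>_ \<in> ?A \<times> ?B. ?val (fixed_flag ?\<gamma> W))"
      by (rule sum.cong) (auto simp: val)
    also have "\<dots> = of_nat (card (?Ga \<times> ?Gb)) * ?val (fixed_flag ?\<gamma> W)" by (simp add: card)
    finally show ?thesis .
  qed
  let ?c = "of_nat (card (?Ga \<times> ?Gb)) :: 'e"
  have c: "?c \<noteq> 0" using card_GL_group_F_pos[of \<alpha>, where 'k = 'k] card_GL_group_F_pos[of \<beta>, where 'k = 'k]
    by (simp add: card_cartesian_product)
  have "push (E_two_F Q \<alpha> \<beta>) proj3 (push (E_one_F Q \<alpha> \<beta>) proj2 (f \<circ> proj1 Q \<alpha> \<beta>)) z =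
      (\<Sum>W | (z, W) \<in> E_two_F Q \<alpha> \<beta>. push (E_one_F Q \<alpha> \<beta>) proj2 (f \<circ> proj1 Q \<alpha> \<beta>) (z, W))"
  proof -
    have "{e. e \<in> E_two_F Q \<alpha> \<beta> \<and> proj3 e = z} = Pair z ` {W. (z, W) \<in> E_two_F Q \<alpha> \<beta>}"
      by (auto simp: proj3_def)
    then show ?thesis
      unfolding push_def[of "E_two_F Q \<alpha> \<beta>"] by (simp add: sum.reindex inj_on_def)
  qed
  also have "\<dots> = (\<Sum>W | (z, W) \<in> E_two_F Q \<alpha> \<beta>. ?c * ?val (fixed_flag ?\<gamma> W))"
    by (rule sum.cong) (simp_all add: inner)
  also have "\<dots> = ?c * (\<Sum>W | (z, W) \<in> E_two_F Q \<alpha> \<beta>. ?val (fixed_flag ?\<gamma> W))"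
    by (simp add: sum_distrib_left)
  also have "(\<Sum>W | (z, W) \<in> E_two_F Q \<alpha> \<beta>. ?val (fixed_flag ?\<gamma> W)) =
      (\<Sum>U | U \<in> subreps Q ?M \<and> dimv Q (sub_rep ?M U) = \<beta>. ?val U)"
    by (rule sum.reindex_bij_betw[OF bij_betw_fixed_flag[OF z \<beta>]])
  finally have eq: "push (E_two_F Q \<alpha> \<beta>) proj3 (push (E_one_F Q \<alpha> \<beta>) proj2 (f \<circ> proj1 Q \<alpha> \<beta>)) z =
    ?c * (\<Sum>U | U \<in> subreps Q ?M \<and> dimv Q (sub_rep ?M U) = \<beta>. ?val U)" .
  show ?thesis unfolding m_twisted_def scale_def eq using c by (simp only: mult.assoc[symmetric]) simp
qed

lemma m_twisted_outside:
  assumes "z \<notin> rep_space_F Q (\<alpha> + \<beta>)"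
  shows "m_twisted v Q \<alpha> \<beta> f z = 0"
proof -
  have "{e. e \<in> E_two_F Q \<alpha> \<beta> \<and> proj3 e = z} = {}"
    using assms by (auto simp: E_two_F_def proj3_def)
  then show ?thesis
    unfolding m_twisted_def scale_def push_def[of "E_two_F Q \<alpha> \<beta>"] by (simp only: sum.empty mult_zero_right)
qed

end

section \<open>Extensions as block matrices\<close>

lemma ext_equivI:
  assumes "(E, f, g) \<in> extensions Q M N" "(E', f', g') \<in> extensions Q M N" "\<phi> \<in> rep_hom Q E E'"
    and "\<And>i. i \<in> verts Q \<Longrightarrow> \<phi> i \<in> lin_isos (vsp E i) (vsp E' i)"
    and "\<And>i n. i \<in> verts Q \<Longrightarrow> n \<in> carrier (vsp N i) \<Longrightarrow> \<phi> i (f i n) = f' i n"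
    and "\<And>i e. i \<in> verts Q \<Longrightarrow> e \<in> carrier (vsp E i) \<Longrightarrow> g' i (\<phi> i e) = g i e"
  shows "((E, f, g), (E', f', g')) \<in> ext_equiv Q M N"
  using assms unfolding ext_equiv_def by blast

context quiver
begin

lemma is_isoI:
  assumes M: "is_rep Q M" and lin: "\<And>i. i \<in> verts Q \<Longrightarrow> f i \<in> lhom (vsp M i) (vsp N i)"
    and bij: "\<And>i. i \<in> verts Q \<Longrightarrow> bij_betw (f i) (carrier (vsp M i)) (carrier (vsp N i))"
    and comm: "\<And>h v. h \<in> arcs Q \<Longrightarrow> v \<in> carrier (vsp M (tail Q h)) \<Longrightarrow>
      f (head Q h) (vmap M h v) = vmap N h (f (tail Q h) v)"
  shows "is_iso M N (\<lambda>i. restrict (f i) (carrier (vsp M i)))"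
  unfolding is_iso_def
  using M lin bij comm by (auto intro!: restrict_lin_isos simp: is_repD(1) vmap_closed)

lemma is_iso_rep_hom: "is_iso M N f \<Longrightarrow> restrict f (verts Q) \<in> rep_hom Q M N"
  by (auto simp: rep_hom_def is_iso_def dest: lin_isosD)

lemma ext_equiv_iso:
  assumes E: "(E, f, g) \<in> extensions Q M N" and E': "(E', f', g') \<in> extensions Q M N" and \<theta>: "is_iso E E' \<theta>"
    and f: "\<And>i n. i \<in> verts Q \<Longrightarrow> n \<in> carrier (vsp N i) \<Longrightarrow> \<theta> i (f i n) = f' i n"
    and g: "\<And>i e. i \<in> verts Q \<Longrightarrow> e \<in> carrier (vsp E i) \<Longrightarrow> g' i (\<theta> i e) = g i e"
  shows "((E, f, g), (E', f', g')) \<in> ext_equiv Q M N"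
  by (rule ext_equivI[OF E E' is_iso_rep_hom[OF \<theta>]]) (simp_all add: is_isoD(1)[OF \<theta>] f g)

lemma ext_equivD:
  assumes "((E, f, g), (E', f', g')) \<in> ext_equiv Q M N"
  obtains \<theta> where "(E, f, g) \<in> extensions Q M N" "(E', f', g') \<in> extensions Q M N" "is_iso E E' \<theta>"
    "\<And>i n. i \<in> verts Q \<Longrightarrow> n \<in> carrier (vsp N i) \<Longrightarrow> \<theta> i (f i n) = f' i n"
    "\<And>i e. i \<in> verts Q \<Longrightarrow> e \<in> carrier (vsp E i) \<Longrightarrow> g' i (\<theta> i e) = g i e"
proof -
  obtain \<theta> where th: "(E, f, g) \<in> extensions Q M N" "(E', f', g') \<in> extensions Q M N" "\<theta> \<in> rep_hom Q E E'"
    "\<forall>i\<in>verts Q. \<theta> i \<in> lin_isos (vsp E i) (vsp E' i) \<and>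
        (\<forall>n\<in>carrier (vsp N i). \<theta> i (f i n) = f' i n) \<and> (\<forall>e\<in>carrier (vsp E i). g' i (\<theta> i e) = g i e)"
    using assms unfolding ext_equiv_def by blast
  then have "is_iso E E' \<theta>" unfolding is_iso_def rep_hom_def by blast
  then show thesis using that th by blast
qed

lemma extensionsD:
  assumes "(E, f, g) \<in> extensions Q M N"
  shows "is_rep Q E" "i \<in> verts Q \<Longrightarrow> f i \<in> lhom (vsp N i) (vsp E i)" "i \<in> verts Q \<Longrightarrow> g i \<in> lhom (vsp E i) (vsp M i)"
    "i \<in> verts Q \<Longrightarrow> inj_on (f i) (carrier (vsp N i))"
    "i \<in> verts Q \<Longrightarrow> f i ` carrier (vsp N i) = {e \<in> carrier (vsp E i). g i e = \<zero>\<^bsub>vsp M i\<^esub>}"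
    "i \<in> verts Q \<Longrightarrow> g i ` carrier (vsp E i) = carrier (vsp M i)"
    "h \<in> arcs Q \<Longrightarrow> n \<in> carrier (vsp N (tail Q h)) \<Longrightarrow> f (head Q h) (vmap N h n) = vmap E h (f (tail Q h) n)"
    "h \<in> arcs Q \<Longrightarrow> e \<in> carrier (vsp E (tail Q h)) \<Longrightarrow> g (head Q h) (vmap E h e) = vmap M h (g (tail Q h) e)"
  using assms by (auto simp: extensions_def rep_hom_def PiE_iff dest: lin_mapsD(1))

lemma equiv_ext_equiv: "equiv (extensions Q M N) (ext_equiv Q M N)"
proof (rule equivI)
  show "ext_equiv Q M N \<subseteq> extensions Q M N \<times> extensions Q M N" by (auto simp: ext_equiv_def)
  show "refl_on (extensions Q M N) (ext_equiv Q M N)"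
  proof (rule refl_onI)
    fix \<xi> assume "\<xi> \<in> extensions Q M N"
    moreover obtain E f g where \<xi>: "\<xi> = (E, f, g)" by (cases \<xi>)
    ultimately have E: "(E, f, g) \<in> extensions Q M N" by simp
    note D = extensionsD[OF E]
    have "is_iso E E (\<lambda>i. restrict (\<lambda>v. v) (carrier (vsp E i)))"
      by (rule is_isoI[OF D(1)]) (auto intro: lhomI simp: bij_betw_def)
    then show "(\<xi>, \<xi>) \<in> ext_equiv Q M N"
      unfolding \<xi> by (rule ext_equiv_iso[OF E E]) (simp_all add: lhom_closed[OF D(2)])
  qed
  show "sym (ext_equiv Q M N)"
  proof (rule symI)
    fix \<xi> \<xi>' assume rel: "(\<xi>, \<xi>') \<in> ext_equiv Q M N"
    obtain E f g E' f' g' where \<xi>: "\<xi> = (E, f, g)" "\<xi>' = (E', f', g')" by (cases \<xi>, cases \<xi>')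
    obtain \<theta> where E: "(E, f, g) \<in> extensions Q M N" and E': "(E', f', g') \<in> extensions Q M N" and \<theta>: "is_iso E E' \<theta>"
      and f: "\<And>i n. i \<in> verts Q \<Longrightarrow> n \<in> carrier (vsp N i) \<Longrightarrow> \<theta> i (f i n) = f' i n"
      and g: "\<And>i e. i \<in> verts Q \<Longrightarrow> e \<in> carrier (vsp E i) \<Longrightarrow> g' i (\<theta> i e) = g i e"
      using ext_equivD[OF rel[unfolded \<xi>]] by metis
    let ?\<theta> = "\<lambda>i. lin_inv (vsp E i) (vsp E' i) (\<theta> i)"
    have inv: "is_iso E' E ?\<theta>" by (rule is_iso_inv[OF extensionsD(1)[OF E] extensionsD(1)[OF E'] \<theta>])
    show "(\<xi>', \<xi>) \<in> ext_equiv Q M N"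
      unfolding \<xi>
    proof (rule ext_equiv_iso[OF E' E inv])
      fix i n assume i: "i \<in> verts Q" and n: "n \<in> carrier (vsp N i)"
      show "?\<theta> i (f' i n) = f i n"
        using lin_inv_left[OF is_isoD(1)[OF \<theta> i] lhom_closed[OF extensionsD(2)[OF E i] n]] f[OF i n] by simp
    next
      fix i e assume i: "i \<in> verts Q" and e: "e \<in> carrier (vsp E' i)"
      show "g i (?\<theta> i e) = g' i e"
        using g[OF i is_isoD(4)[OF inv i e]] lin_inv_right[OF is_isoD(1)[OF \<theta> i] e] by simp
    qed
  qed
  show "trans (ext_equiv Q M N)"
  proof (rule transI)
    fix \<xi> \<xi>' \<xi>'' assume rel: "(\<xi>, \<xi>') \<in> ext_equiv Q M N" and rel': "(\<xi>', \<xi>'') \<in> ext_equiv Q M N"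
    obtain E f g E' f' g' E'' f'' g'' where \<xi>: "\<xi> = (E, f, g)" "\<xi>' = (E', f', g')" "\<xi>'' = (E'', f'', g'')"
      by (cases \<xi>, cases \<xi>', cases \<xi>'')
    obtain \<theta> where E: "(E, f, g) \<in> extensions Q M N" and \<theta>: "is_iso E E' \<theta>"
      and f: "\<And>i n. i \<in> verts Q \<Longrightarrow> n \<in> carrier (vsp N i) \<Longrightarrow> \<theta> i (f i n) = f' i n"
      and g: "\<And>i e. i \<in> verts Q \<Longrightarrow> e \<in> carrier (vsp E i) \<Longrightarrow> g' i (\<theta> i e) = g i e"
      using ext_equivD[OF rel[unfolded \<xi>]] by metis
    obtain \<theta>' where E'': "(E'', f'', g'') \<in> extensions Q M N" and \<theta>': "is_iso E' E'' \<theta>'"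
      and f': "\<And>i n. i \<in> verts Q \<Longrightarrow> n \<in> carrier (vsp N i) \<Longrightarrow> \<theta>' i (f' i n) = f'' i n"
      and g': "\<And>i e. i \<in> verts Q \<Longrightarrow> e \<in> carrier (vsp E' i) \<Longrightarrow> g'' i (\<theta>' i e) = g' i e"
      using ext_equivD[OF rel'[unfolded \<xi>]] by metis
    have "is_iso E E'' (\<lambda>i. restrict (\<lambda>v. \<theta>' i (\<theta> i v)) (carrier (vsp E i)))"
    proof (rule is_isoI[OF extensionsD(1)[OF E]])
      fix i assume i: "i \<in> verts Q"
      show "(\<lambda>v. \<theta>' i (\<theta> i v)) \<in> lhom (vsp E i) (vsp E'' i)"
        by (rule lhom_comp[OF is_isoD(2)[OF \<theta> i] is_isoD(2)[OF \<theta>' i]])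
      show "bij_betw (\<lambda>v. \<theta>' i (\<theta> i v)) (carrier (vsp E i)) (carrier (vsp E'' i))"
        using bij_betw_trans[OF is_isoD(3)[OF \<theta> i] is_isoD(3)[OF \<theta>' i]] by (simp add: o_def)
    qed (simp_all add: is_isoD(4,5)[OF \<theta>] is_isoD(5)[OF \<theta>'])
    then show "(\<xi>, \<xi>'') \<in> ext_equiv Q M N"
      unfolding \<xi>
      by (rule ext_equiv_iso[OF E E''])
        (simp_all add: lhom_closed[OF extensionsD(2)[OF E]] f f' g g' is_isoD(4)[OF \<theta>])
  qed
qed

end

lemma append_vec_cases:
  assumes "v \<in> carrier_vec (n + m)"
  obtains a b where "a \<in> carrier_vec n" "b \<in> carrier_vec m" "v = a @\<^sub>v b"
  using assms that[of "vec_first v n" "vec_last v m"] by simp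

lemma vec_first_append [simp]: "a \<in> carrier_vec n \<Longrightarrow> vec_first (a @\<^sub>v b) n = a"
  by (rule eq_vecI) (auto simp: vec_first_def)

lemma vec_last_append [simp]: "a \<in> carrier_vec n \<Longrightarrow> b \<in> carrier_vec m \<Longrightarrow> vec_last (a @\<^sub>v b) m = b"
  by (rule eq_vecI) (auto simp: vec_last_def)

lemma vec_first_lhom: "(\<lambda>v. vec_first v n) \<in> lhom (module_vec TYPE('a::field) (n + m)) (module_vec TYPE('a) n)"
  by (rule lhomI) (auto simp: module_vec_simps vec_first_def intro!: eq_vecI)

lemma vec_last_lhom: "(\<lambda>v. vec_last v m) \<in> lhom (module_vec TYPE('a::field) (n + m)) (module_vec TYPE('a) m)"
  by (rule lhomI) (auto simp: module_vec_simps vec_last_def intro!: eq_vecI)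

lemma append_zero_lhom: "(\<lambda>v. v @\<^sub>v 0\<^sub>v m) \<in> lhom (module_vec TYPE('a::field) n) (module_vec TYPE('a) (n + m))"
  by (rule lhomI) (auto simp: module_vec_simps intro!: eq_vecI)

lemma zero_append_lhom: "(\<lambda>v. 0\<^sub>v n @\<^sub>v v) \<in> lhom (module_vec TYPE('a::field) m) (module_vec TYPE('a) (n + m))"
  by (rule lhomI) (auto simp: module_vec_simps intro!: eq_vecI)

definition block_mat :: "'a::field mat \<Rightarrow> 'a mat \<Rightarrow> 'a mat \<Rightarrow> 'a mat" where
  "block_mat A w D = four_block_mat A (0\<^sub>m (dim_row A) (dim_col D)) w D"

lemma block_mat_carrier:
  "A \<in> carrier_mat n' n \<Longrightarrow> D \<in> carrier_mat m' m \<Longrightarrow> block_mat A w D \<in> carrier_mat (n' + m') (n + m)"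
  by (simp add: block_mat_def four_block_carrier_mat)

lemma block_mat_mult:
  assumes "A \<in> carrier_mat n' n" "w \<in> carrier_mat m' n" "D \<in> carrier_mat m' m" "a \<in> carrier_vec n" "d \<in> carrier_vec m"
  shows "block_mat A w D *\<^sub>v (a @\<^sub>v d) = (A *\<^sub>v a) @\<^sub>v (w *\<^sub>v a + D *\<^sub>v d)"
proof -
  have "0\<^sub>m n' m *\<^sub>v d = 0\<^sub>v n'" by (rule eq_vecI) (use assms in simp_all)
  moreover have "dim_row A = n'" "dim_col D = m" "A *\<^sub>v a \<in> carrier_vec n'" using assms by auto
  ultimately show ?thesis
    unfolding block_mat_def
    using four_block_mat_mult_vec[OF assms(1) zero_carrier_mat[of n' m] assms(2,3,4,5)] by simp
qed

text \<open>Over points \<open>A\<close>, \<open>D\<close> with modules isomorphic to \<open>M\<close>, \<open>N\<close>, every choice of lower left blocks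
  gives an extension of \<open>M\<close> by \<open>N\<close>.\<close>

locale block_extensions = quiver Q for Q :: "('i, 'h) pre_digraph" +
  fixes \<alpha> \<beta> :: "'i \<Rightarrow> nat" and A D :: "'h \<Rightarrow> 'k::{field,finite} mat" and M N :: "('i, 'h, 'k) kQ_module"
    and \<phi> \<psi> :: "'i \<Rightarrow> 'k vec \<Rightarrow> 'k vec"
  assumes A: "A \<in> reps_over TYPE('k) \<alpha>" and D: "D \<in> reps_over TYPE('k) \<beta>"
    and M: "is_rep Q M" and N: "is_rep Q N"
    and \<phi>: "is_iso (point_rep \<alpha> A) M \<phi>" and \<psi>: "is_iso (point_rep \<beta> D) N \<psi>"
begin

definition Blocks :: "('h \<Rightarrow> 'k mat) set" where
  "Blocks = (\<Pi>\<^sub>E h\<in>arcs Q. carrier_mat (\<beta> (head Q h)) (\<alpha> (tail Q h)))"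

definition Gauge :: "('i \<Rightarrow> 'k mat) set" where
  "Gauge = (\<Pi>\<^sub>E i\<in>verts Q. carrier_mat (\<beta> i) (\<alpha> i))"

definition gauge_act :: "('i \<Rightarrow> 'k mat) \<Rightarrow> ('h \<Rightarrow> 'k mat) \<Rightarrow> 'h \<Rightarrow> 'k mat" where
  "gauge_act c w = (\<lambda>h\<in>arcs Q. w h + (c (head Q h) * A h - D h * c (tail Q h)))"

definition mid :: "('h \<Rightarrow> 'k mat) \<Rightarrow> ('i, 'h, 'k) kQ_module" where
  "mid w = point_rep (\<alpha> + \<beta>) (\<lambda>h. block_mat (A h) (w h) (D h))"

definition \<psi>' :: "'i \<Rightarrow> 'k vec \<Rightarrow> 'k vec" where
  "\<psi>' i = lin_inv (module_vec TYPE('k) (\<beta> i)) (vsp N i) (\<psi> i)"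

definition \<phi>' :: "'i \<Rightarrow> 'k vec \<Rightarrow> 'k vec" where
  "\<phi>' i = lin_inv (module_vec TYPE('k) (\<alpha> i)) (vsp M i) (\<phi> i)"

definition ext_in :: "'i \<Rightarrow> 'k vec \<Rightarrow> 'k vec" where
  "ext_in = (\<lambda>i\<in>verts Q. \<lambda>n\<in>carrier (vsp N i). 0\<^sub>v (\<alpha> i) @\<^sub>v \<psi>' i n)"

definition ext_out :: "'i \<Rightarrow> 'k vec \<Rightarrow> 'k vec" where
  "ext_out = (\<lambda>i\<in>verts Q. \<lambda>v\<in>carrier_vec (\<alpha> i + \<beta> i). \<phi> i (vec_first v (\<alpha> i)))"

definition ext_of :: "('h \<Rightarrow> 'k mat) \<Rightarrow> ('i, 'h, 'k) kQ_module \<times> ('i \<Rightarrow> 'k vec \<Rightarrow> 'k vec) \<times> ('i \<Rightarrow> 'k vec \<Rightarrow> 'k vec)" where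
  "ext_of w = (mid w, ext_in, ext_out)"

lemma Ac: "h \<in> arcs Q \<Longrightarrow> A h \<in> carrier_mat (\<alpha> (head Q h)) (\<alpha> (tail Q h))"
  and Dc: "h \<in> arcs Q \<Longrightarrow> D h \<in> carrier_mat (\<beta> (head Q h)) (\<beta> (tail Q h))"
  and Blc: "w \<in> Blocks \<Longrightarrow> h \<in> arcs Q \<Longrightarrow> w h \<in> carrier_mat (\<beta> (head Q h)) (\<alpha> (tail Q h))"
  and Gac: "c \<in> Gauge \<Longrightarrow> i \<in> verts Q \<Longrightarrow> c i \<in> carrier_mat (\<beta> i) (\<alpha> i)"
  using A D by (auto simp: reps_over_def Blocks_def Gauge_def)

lemma \<phi>_props:
  assumes i: "i \<in> verts Q"
  shows "\<phi> i \<in> lhom (module_vec TYPE('k) (\<alpha> i)) (vsp M i)" "\<phi>' i \<in> lhom (vsp M i) (module_vec TYPE('k) (\<alpha> i))"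
    "a \<in> carrier_vec (\<alpha> i) \<Longrightarrow> \<phi> i a \<in> carrier (vsp M i)" "m \<in> carrier (vsp M i) \<Longrightarrow> \<phi>' i m \<in> carrier_vec (\<alpha> i)"
    "a \<in> carrier_vec (\<alpha> i) \<Longrightarrow> \<phi>' i (\<phi> i a) = a" "m \<in> carrier (vsp M i) \<Longrightarrow> \<phi> i (\<phi>' i m) = m"
    "a \<in> carrier_vec (\<alpha> i) \<Longrightarrow> b \<in> carrier_vec (\<alpha> i) \<Longrightarrow> \<phi> i a = \<phi> i b \<longleftrightarrow> a = b"
    "\<phi> i (0\<^sub>v (\<alpha> i)) = \<zero>\<^bsub>vsp M i\<^esub>"
proof -
  have iso: "\<phi> i \<in> lin_isos (module_vec TYPE('k) (\<alpha> i)) (vsp M i)" using is_isoD(1)[OF \<phi> i] by simp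
  show l: "\<phi> i \<in> lhom (module_vec TYPE('k) (\<alpha> i)) (vsp M i)" by (rule lin_isosD(1)[OF iso])
  show l': "\<phi>' i \<in> lhom (vsp M i) (module_vec TYPE('k) (\<alpha> i))"
    unfolding \<phi>'_def by (rule lin_isosD(1)[OF lin_inv_isos[OF is_vs_module_vec is_repD(1)[OF M i] iso]])
  show "a \<in> carrier_vec (\<alpha> i) \<Longrightarrow> \<phi> i a \<in> carrier (vsp M i)" using lhom_closed[OF l] by (simp add: module_vec_simps)
  show "m \<in> carrier (vsp M i) \<Longrightarrow> \<phi>' i m \<in> carrier_vec (\<alpha> i)" using lhom_closed[OF l'] by (simp add: module_vec_simps)
  show left: "a \<in> carrier_vec (\<alpha> i) \<Longrightarrow> \<phi>' i (\<phi> i a) = a" for a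
    unfolding \<phi>'_def using lin_inv_left[OF iso] by (simp add: module_vec_simps)
  show "m \<in> carrier (vsp M i) \<Longrightarrow> \<phi> i (\<phi>' i m) = m" unfolding \<phi>'_def by (rule lin_inv_right[OF iso])
  show "a \<in> carrier_vec (\<alpha> i) \<Longrightarrow> b \<in> carrier_vec (\<alpha> i) \<Longrightarrow> \<phi> i a = \<phi> i b \<longleftrightarrow> a = b"
    using left by metis
  show "\<phi> i (0\<^sub>v (\<alpha> i)) = \<zero>\<^bsub>vsp M i\<^esub>"
    using lhom_zero[OF is_vs_module_vec is_repD(1)[OF M i] l] by (simp add: module_vec_simps)
qed

lemma \<psi>_props:
  assumes i: "i \<in> verts Q"
  shows "\<psi> i \<in> lhom (module_vec TYPE('k) (\<beta> i)) (vsp N i)" "\<psi>' i \<in> lhom (vsp N i) (module_vec TYPE('k) (\<beta> i))"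
    "b \<in> carrier_vec (\<beta> i) \<Longrightarrow> \<psi> i b \<in> carrier (vsp N i)" "n \<in> carrier (vsp N i) \<Longrightarrow> \<psi>' i n \<in> carrier_vec (\<beta> i)"
    "b \<in> carrier_vec (\<beta> i) \<Longrightarrow> \<psi>' i (\<psi> i b) = b" "n \<in> carrier (vsp N i) \<Longrightarrow> \<psi> i (\<psi>' i n) = n"
proof -
  have iso: "\<psi> i \<in> lin_isos (module_vec TYPE('k) (\<beta> i)) (vsp N i)" using is_isoD(1)[OF \<psi> i] by simp
  show l: "\<psi> i \<in> lhom (module_vec TYPE('k) (\<beta> i)) (vsp N i)" by (rule lin_isosD(1)[OF iso])
  show l': "\<psi>' i \<in> lhom (vsp N i) (module_vec TYPE('k) (\<beta> i))"
    unfolding \<psi>'_def by (rule lin_isosD(1)[OF lin_inv_isos[OF is_vs_module_vec is_repD(1)[OF N i] iso]])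
  show "b \<in> carrier_vec (\<beta> i) \<Longrightarrow> \<psi> i b \<in> carrier (vsp N i)" using lhom_closed[OF l] by (simp add: module_vec_simps)
  show "n \<in> carrier (vsp N i) \<Longrightarrow> \<psi>' i n \<in> carrier_vec (\<beta> i)" using lhom_closed[OF l'] by (simp add: module_vec_simps)
  show "b \<in> carrier_vec (\<beta> i) \<Longrightarrow> \<psi>' i (\<psi> i b) = b"
    unfolding \<psi>'_def using lin_inv_left[OF iso] by (simp add: module_vec_simps)
  show "n \<in> carrier (vsp N i) \<Longrightarrow> \<psi> i (\<psi>' i n) = n" unfolding \<psi>'_def by (rule lin_inv_right[OF iso])
qed

lemma \<phi>_comm: "h \<in> arcs Q \<Longrightarrow> a \<in> carrier_vec (\<alpha> (tail Q h)) \<Longrightarrow> \<phi> (head Q h) (A h *\<^sub>v a) = vmap M h (\<phi> (tail Q h) a)"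
  and \<psi>_comm: "h \<in> arcs Q \<Longrightarrow> b \<in> carrier_vec (\<beta> (tail Q h)) \<Longrightarrow> \<psi> (head Q h) (D h *\<^sub>v b) = vmap N h (\<psi> (tail Q h) b)"
  using is_isoD(5)[OF \<phi>, of h a] is_isoD(5)[OF \<psi>, of h b] by (simp_all add: module_vec_simps)

lemma \<psi>'_comm: "h \<in> arcs Q \<Longrightarrow> n \<in> carrier (vsp N (tail Q h)) \<Longrightarrow> \<psi>' (head Q h) (vmap N h n) = D h *\<^sub>v \<psi>' (tail Q h) n"
proof -
  assume h: "h \<in> arcs Q" and n: "n \<in> carrier (vsp N (tail Q h))"
  have t: "tail Q h \<in> verts Q" and hd: "head Q h \<in> verts Q" using h by auto
  note c = \<psi>_props(4)[OF t n]
  show ?thesis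
    using \<psi>_comm[OF h c] \<psi>_props(6)[OF t n] \<psi>_props(5)[OF hd mult_mat_vec_carrier[OF Dc[OF h] c]] by simp
qed

lemma mid_reps_over: "(\<lambda>h. block_mat (A h) (w h) (D h)) \<in> reps_over TYPE('k) (\<alpha> + \<beta>)"
  using block_mat_carrier[OF Ac Dc] by (simp add: reps_over_def)

lemma is_rep_mid: "is_rep Q (mid w)"
  unfolding mid_def by (rule is_rep_point_rep[OF mid_reps_over])

lemma mid_sel [simp]: "vsp (mid w) i = module_vec TYPE('k) (\<alpha> i + \<beta> i)"
  "vmap (mid w) h v = block_mat (A h) (w h) (D h) *\<^sub>v v"
  by (simp_all add: mid_def)

lemma ext_of_extensions:
  assumes w: "w \<in> Blocks"
  shows "ext_of w \<in> extensions Q M N"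
proof -
  let ?V = "\<lambda>i. module_vec TYPE('k) (\<alpha> i + \<beta> i)"
  have in_lin: "(\<lambda>n. 0\<^sub>v (\<alpha> i) @\<^sub>v \<psi>' i n) \<in> lhom (vsp N i) (?V i)" if "i \<in> verts Q" for i
    by (rule lhom_comp[OF \<psi>_props(2)[OF that] zero_append_lhom])
  have out_lin: "(\<lambda>v. \<phi> i (vec_first v (\<alpha> i))) \<in> lhom (?V i) (vsp M i)" if "i \<in> verts Q" for i
    by (rule lhom_comp[OF vec_first_lhom \<phi>_props(1)[OF that]])
  have "ext_in \<in> rep_hom Q N (mid w)"
    unfolding rep_hom_def
  proof (intro CollectI conjI ballI)
    show "ext_in \<in> (\<Pi>\<^sub>E i\<in>verts Q. lin_maps (vsp N i) (vsp (mid w) i))"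
      unfolding ext_in_def using restrict_lin_maps[OF is_repD(1)[OF N] in_lin] by simp
    fix h n assume h: "h \<in> arcs Q" and n: "n \<in> carrier (vsp N (tail Q h))"
    have t: "tail Q h \<in> verts Q" and hd: "head Q h \<in> verts Q" using h by auto
    note c = \<psi>_props(4)[OF t n]
    have z: "A h *\<^sub>v 0\<^sub>v (\<alpha> (tail Q h)) = 0\<^sub>v (\<alpha> (head Q h))" "w h *\<^sub>v 0\<^sub>v (\<alpha> (tail Q h)) = 0\<^sub>v (\<beta> (head Q h))"
      by (rule eq_vecI; use Ac[OF h] Blc[OF w h] in simp)+
    have "D h *\<^sub>v \<psi>' (tail Q h) n \<in> carrier_vec (\<beta> (head Q h))" by (rule mult_mat_vec_carrier[OF Dc[OF h] c])
    then show "ext_in (head Q h) (vmap N h n) = vmap (mid w) h (ext_in (tail Q h) n)"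
      using block_mat_mult[OF Ac[OF h] Blc[OF w h] Dc[OF h] zero_carrier_vec c] vmap_closed[OF N h n] t hd n
      by (simp add: ext_in_def \<psi>'_comm[OF h n] z)
  qed
  moreover have "ext_out \<in> rep_hom Q (mid w) M"
    unfolding rep_hom_def
  proof (intro CollectI conjI ballI)
    show "ext_out \<in> (\<Pi>\<^sub>E i\<in>verts Q. lin_maps (vsp (mid w) i) (vsp M i))"
      unfolding ext_out_def using restrict_lin_maps[OF is_vs_module_vec out_lin] by (simp add: module_vec_simps)
    fix h v assume h: "h \<in> arcs Q" and "v \<in> carrier (vsp (mid w) (tail Q h))"
    then have "v \<in> carrier_vec (\<alpha> (tail Q h) + \<beta> (tail Q h))" by (simp add: module_vec_simps)
    then obtain a b where a: "a \<in> carrier_vec (\<alpha> (tail Q h))" and b: "b \<in> carrier_vec (\<beta> (tail Q h))" and v: "v = a @\<^sub>v b"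
      by (rule append_vec_cases)
    have "w h *\<^sub>v a + D h *\<^sub>v b \<in> carrier_vec (\<beta> (head Q h))" and Aa: "A h *\<^sub>v a \<in> carrier_vec (\<alpha> (head Q h))"
      using mult_mat_vec_carrier[OF Blc[OF w h] a] mult_mat_vec_carrier[OF Dc[OF h] b] mult_mat_vec_carrier[OF Ac[OF h] a]
      by simp_all
    then show "ext_out (head Q h) (vmap (mid w) h v) = vmap M h (ext_out (tail Q h) v)"
      using block_mat_mult[OF Ac[OF h] Blc[OF w h] Dc[OF h] a b] h a b
      by (simp add: ext_out_def v \<phi>_comm[OF h a])
  qed
  moreover have "inj_on (ext_in i) (carrier (vsp N i)) \<and>
      ext_in i ` carrier (vsp N i) = {e \<in> carrier (vsp (mid w) i). ext_out i e = \<zero>\<^bsub>vsp M i\<^esub>} \<and>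
      ext_out i ` carrier (vsp (mid w) i) = carrier (vsp M i)" if i: "i \<in> verts Q" for i
  proof (intro conjI)
    note ps = \<psi>_props[OF i] and ph = \<phi>_props[OF i]
    show "inj_on (ext_in i) (carrier (vsp N i))"
    proof (rule inj_onI)
      fix m n assume mn: "m \<in> carrier (vsp N i)" "n \<in> carrier (vsp N i)" and "ext_in i m = ext_in i n"
      then have "\<psi>' i m = \<psi>' i n"
        using i by (simp add: ext_in_def append_vec_eq[OF zero_carrier_vec zero_carrier_vec])
      then show "m = n" using ps(6) mn by metis
    qed
    show "ext_in i ` carrier (vsp N i) = {e \<in> carrier (vsp (mid w) i). ext_out i e = \<zero>\<^bsub>vsp M i\<^esub>}"
    proof (intro equalityI subsetI)
      fix e assume "e \<in> ext_in i ` carrier (vsp N i)"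
      then show "e \<in> {e \<in> carrier (vsp (mid w) i). ext_out i e = \<zero>\<^bsub>vsp M i\<^esub>}"
        using i ps(4) by (auto simp: ext_in_def ext_out_def module_vec_simps ph(8))
    next
      fix e assume "e \<in> {e \<in> carrier (vsp (mid w) i). ext_out i e = \<zero>\<^bsub>vsp M i\<^esub>}"
      then have e: "e \<in> carrier_vec (\<alpha> i + \<beta> i)" and 0: "\<phi> i (vec_first e (\<alpha> i)) = \<zero>\<^bsub>vsp M i\<^esub>"
        using i by (auto simp: ext_out_def module_vec_simps)
      obtain a b where a: "a \<in> carrier_vec (\<alpha> i)" and b: "b \<in> carrier_vec (\<beta> i)" and v: "e = a @\<^sub>v b"
        using append_vec_cases[OF e] .
      have "a = 0\<^sub>v (\<alpha> i)" using 0 a ph(7)[OF a zero_carrier_vec] by (simp add: v ph(8))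
      then have "e = ext_in i (\<psi> i b)" using i ps(3)[OF b] ps(5)[OF b] by (simp add: ext_in_def v)
      then show "e \<in> ext_in i ` carrier (vsp N i)" using ps(3)[OF b] by blast
    qed
    show "ext_out i ` carrier (vsp (mid w) i) = carrier (vsp M i)"
    proof (intro equalityI subsetI)
      fix m assume m: "m \<in> carrier (vsp M i)"
      have "ext_out i (\<phi>' i m @\<^sub>v 0\<^sub>v (\<beta> i)) = m"
        using i ph(4)[OF m] by (simp add: ext_out_def ph(6)[OF m])
      moreover have "\<phi>' i m @\<^sub>v 0\<^sub>v (\<beta> i) \<in> carrier (vsp (mid w) i)" using ph(4)[OF m] by (simp add: module_vec_simps)
      ultimately show "m \<in> ext_out i ` carrier (vsp (mid w) i)" by (metis imageI)
    qed (use i ph(3) in \<open>auto simp: ext_out_def module_vec_simps\<close>)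
  qed
  ultimately show ?thesis
    using is_rep_mid by (simp add: extensions_def ext_of_def)
qed

text \<open>Choosing a linear section of \<open>E \<longrightarrow> M\<close> at each vertex puts an extension into block form.\<close>

lemma ext_of_surj:
  assumes E: "(E, f, g) \<in> extensions Q M N"
  shows "\<exists>w\<in>Blocks. (ext_of w, (E, f, g)) \<in> ext_equiv Q M N"
proof -
  note X = extensionsD[OF E]
  let ?K = "\<lambda>n. module_vec TYPE('k) n"
  have Evs: "is_vs (vsp E i)" if "i \<in> verts Q" for i by (rule is_repD(1)[OF X(1) that])
  have Mvs: "is_vs (vsp M i)" if "i \<in> verts Q" for i by (rule is_repD(1)[OF M that])
  have "\<exists>s. s \<in> lhom (?K (\<alpha> i)) (vsp E i) \<and> (\<forall>a\<in>carrier_vec (\<alpha> i). g i (s a) = \<phi> i a)" if i: "i \<in> verts Q" for i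
  proof -
    have "\<exists>e\<in>carrier (vsp E i). g i e = \<phi> i (unit_vec (\<alpha> i) j)" for j
      using X(6)[OF i] \<phi>_props(3)[OF i, of "unit_vec (\<alpha> i) j"] by (metis imageE unit_vec_carrier)
    then obtain t where t: "\<And>j. t j \<in> carrier (vsp E i)" "\<And>j. g i (t j) = \<phi> i (unit_vec (\<alpha> i) j)" by metis
    have s: "lcomb (vsp E i) (\<alpha> i) t \<in> lhom (?K (\<alpha> i)) (vsp E i)" by (rule lcomb_lhom[OF Evs[OF i] t(1)])
    have "g i (lcomb (vsp E i) (\<alpha> i) t a) = \<phi> i a" if a: "a \<in> carrier_vec (\<alpha> i)" for a
      by (rule lhom_vec_eqI[OF Mvs[OF i] lhom_comp[OF s X(3)[OF i]] \<phi>_props(1)[OF i] _ a])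
        (simp add: lcomb_unit_vec[OF Evs[OF i] t(1)] t(2))
    then show ?thesis using s by blast
  qed
  then obtain s where s: "\<And>i. i \<in> verts Q \<Longrightarrow> s i \<in> lhom (?K (\<alpha> i)) (vsp E i)"
    and gs: "\<And>i a. i \<in> verts Q \<Longrightarrow> a \<in> carrier_vec (\<alpha> i) \<Longrightarrow> g i (s i a) = \<phi> i a" by metis
  define \<theta> where "\<theta> i v = s i (vec_first v (\<alpha> i)) \<oplus>\<^bsub>vsp E i\<^esub> f i (\<psi> i (vec_last v (\<beta> i)))" for i v
  have sc: "s i a \<in> carrier (vsp E i)" if "i \<in> verts Q" "a \<in> carrier_vec (\<alpha> i)" for i a
    using lhom_closed[OF s[OF that(1)]] that(2) by (simp add: module_vec_simps)
  have fc: "f i n \<in> carrier (vsp E i)" if "i \<in> verts Q" "n \<in> carrier (vsp N i)" for i n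
    by (rule lhom_closed[OF X(2)[OF that(1)] that(2)])
  have s0: "s i (0\<^sub>v (\<alpha> i)) = \<zero>\<^bsub>vsp E i\<^esub>" if "i \<in> verts Q" for i
    using lhom_zero[OF is_vs_module_vec Evs[OF that] s[OF that]] by (simp add: module_vec_simps)
  have f0: "f i (\<psi> i (0\<^sub>v (\<beta> i))) = \<zero>\<^bsub>vsp E i\<^esub>" if "i \<in> verts Q" for i
    using lhom_zero[OF is_vs_module_vec Evs[OF that] lhom_comp[OF \<psi>_props(1)[OF that] X(2)[OF that]]]
    by (simp add: module_vec_simps)
  have gf: "g i (f i n) = \<zero>\<^bsub>vsp M i\<^esub>" if "i \<in> verts Q" "n \<in> carrier (vsp N i)" for i n
    using X(5)[OF that(1)] that(2) by blast
  have \<theta>c: "\<theta> i (a @\<^sub>v b) = s i a \<oplus>\<^bsub>vsp E i\<^esub> f i (\<psi> i b)"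
    if "a \<in> carrier_vec (\<alpha> i)" "b \<in> carrier_vec (\<beta> i)" for i a b using that by (simp add: \<theta>_def)
  have \<theta>0: "\<theta> i (0\<^sub>v (\<alpha> i) @\<^sub>v b) = f i (\<psi> i b)" if "i \<in> verts Q" "b \<in> carrier_vec (\<beta> i)" for i b
    using that vs_zero_add(1)[OF Evs[OF that(1)] fc[OF that(1) \<psi>_props(3)[OF that]]] by (simp add: \<theta>c s0)
  have g\<theta>: "g i (\<theta> i (a @\<^sub>v b)) = \<phi> i a" if i: "i \<in> verts Q" and a: "a \<in> carrier_vec (\<alpha> i)" and b: "b \<in> carrier_vec (\<beta> i)" for i a b
  proof -
    note n = \<psi>_props(3)[OF i b]
    show ?thesis
      unfolding \<theta>c[OF a b] lhom_add[OF X(3)[OF i] sc[OF i a] fc[OF i n]] gs[OF i a] gf[OF i n]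
      by (rule vs_zero_add(2)[OF Mvs[OF i] \<phi>_props(3)[OF i a]])
  qed
  have \<theta>l: "\<theta> i \<in> lhom (?K (\<alpha> i + \<beta> i)) (vsp E i)" if i: "i \<in> verts Q" for i
  proof -
    interpret E: vectorspace class_ring "vsp E i" by (rule Evs[OF i])
    have 1: "(\<lambda>v. s i (vec_first v (\<alpha> i))) \<in> lhom (?K (\<alpha> i + \<beta> i)) (vsp E i)"
      by (rule lhom_comp[OF vec_first_lhom s[OF i]])
    have 2: "(\<lambda>v. f i (\<psi> i (vec_last v (\<beta> i)))) \<in> lhom (?K (\<alpha> i + \<beta> i)) (vsp E i)"
      by (rule lhom_comp[OF lhom_comp[OF vec_last_lhom \<psi>_props(1)[OF i]] X(2)[OF i]])
    show ?thesis
    proof (rule lhomI)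
      fix u v :: "'k vec" and r assume u: "u \<in> carrier (?K (\<alpha> i + \<beta> i))"
      show "\<theta> i u \<in> carrier (vsp E i)" using lhom_closed[OF 1 u] lhom_closed[OF 2 u] by (simp add: \<theta>_def)
      show "\<theta> i (r \<odot>\<^bsub>?K (\<alpha> i + \<beta> i)\<^esub> u) = r \<odot>\<^bsub>vsp E i\<^esub> \<theta> i u"
        unfolding \<theta>_def lhom_smult[OF 1 u] lhom_smult[OF 2 u]
        using E.smult_r_distr[OF _ lhom_closed[OF 1 u] lhom_closed[OF 2 u]] by (simp add: class_ring_simps)
      assume v: "v \<in> carrier (?K (\<alpha> i + \<beta> i))"
      show "\<theta> i (u \<oplus>\<^bsub>?K (\<alpha> i + \<beta> i)\<^esub> v) = \<theta> i u \<oplus>\<^bsub>vsp E i\<^esub> \<theta> i v"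
        unfolding \<theta>_def lhom_add[OF 1 u v] lhom_add[OF 2 u v]
        using lhom_closed[OF 1 u] lhom_closed[OF 2 u] lhom_closed[OF 1 v] lhom_closed[OF 2 v]
        by (simp add: E.add.m_ac)
    qed
  qed
  have \<theta>b: "bij_betw (\<theta> i) (carrier (?K (\<alpha> i + \<beta> i))) (carrier (vsp E i))" if i: "i \<in> verts Q" for i
    unfolding bij_betw_def
  proof
    show "inj_on (\<theta> i) (carrier (?K (\<alpha> i + \<beta> i)))"
    proof (rule lhom_injI[OF is_vs_module_vec Evs[OF i] \<theta>l[OF i]])
      fix v assume "v \<in> carrier (?K (\<alpha> i + \<beta> i))" and 0: "\<theta> i v = \<zero>\<^bsub>vsp E i\<^esub>"
      then have "v \<in> carrier_vec (\<alpha> i + \<beta> i)" by (simp add: module_vec_simps)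
      then obtain a b where a: "a \<in> carrier_vec (\<alpha> i)" and b: "b \<in> carrier_vec (\<beta> i)" and v: "v = a @\<^sub>v b"
        by (rule append_vec_cases)
      have "\<phi> i a = \<zero>\<^bsub>vsp M i\<^esub>"
        using g\<theta>[OF i a b] 0 lhom_zero[OF Evs[OF i] Mvs[OF i] X(3)[OF i]] by (simp add: v)
      then have a0: "a = 0\<^sub>v (\<alpha> i)" using \<phi>_props(7)[OF i a zero_carrier_vec] \<phi>_props(8)[OF i] by simp
      then have "f i (\<psi> i b) = f i (\<psi> i (0\<^sub>v (\<beta> i)))" using 0 \<theta>0[OF i b] f0[OF i] by (simp add: v)
      then have "\<psi> i b = \<psi> i (0\<^sub>v (\<beta> i))"
        using inj_onD[OF X(4)[OF i]] \<psi>_props(3)[OF i] b zero_carrier_vec by blast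
      then have "b = 0\<^sub>v (\<beta> i)" using \<psi>_props(5)[OF i] b zero_carrier_vec by metis
      then show "v = \<zero>\<^bsub>?K (\<alpha> i + \<beta> i)\<^esub>" unfolding v a0 module_vec_simps by (intro eq_vecI) auto
    qed
    show "\<theta> i ` carrier (?K (\<alpha> i + \<beta> i)) = carrier (vsp E i)"
    proof (intro equalityI subsetI)
      fix e assume e: "e \<in> carrier (vsp E i)"
      define a where "a = \<phi>' i (g i e)"
      have ge: "g i e \<in> carrier (vsp M i)" by (rule lhom_closed[OF X(3)[OF i] e])
      have a: "a \<in> carrier_vec (\<alpha> i)" unfolding a_def by (rule \<phi>_props(4)[OF i ge])
      have "g i (e \<ominus>\<^bsub>vsp E i\<^esub> s i a) = g i e \<ominus>\<^bsub>vsp M i\<^esub> g i e"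
        unfolding lhom_minus[OF Evs[OF i] Mvs[OF i] X(3)[OF i] e sc[OF i a]] gs[OF i a]
        by (simp add: a_def \<phi>_props(6)[OF i ge])
      also have "\<dots> = \<zero>\<^bsub>vsp M i\<^esub>" by (rule vs_minus_self[OF Mvs[OF i] ge])
      finally have "e \<ominus>\<^bsub>vsp E i\<^esub> s i a \<in> f i ` carrier (vsp N i)"
        unfolding X(5)[OF i] using vs_minus_closed[OF Evs[OF i] e sc[OF i a]] by simp
      then obtain n where n: "n \<in> carrier (vsp N i)" "f i n = e \<ominus>\<^bsub>vsp E i\<^esub> s i a" by (metis imageE)
      interpret E: vectorspace class_ring "vsp E i" by (rule Evs[OF i])
      have "\<theta> i (a @\<^sub>v \<psi>' i n) = s i a \<oplus>\<^bsub>vsp E i\<^esub> (e \<ominus>\<^bsub>vsp E i\<^esub> s i a)"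
        unfolding \<theta>c[OF a \<psi>_props(4)[OF i n(1)]] \<psi>_props(6)[OF i n(1)] n(2) by (rule refl)
      also have "\<dots> = e"
        using vs_minus_add(1)[OF Evs[OF i] e sc[OF i a]] E.a_comm[OF sc[OF i a] vs_minus_closed[OF Evs[OF i] e sc[OF i a]]] by simp
      finally have "\<theta> i (a @\<^sub>v \<psi>' i n) = e" .
      then show "e \<in> \<theta> i ` carrier (?K (\<alpha> i + \<beta> i))"
        using a \<psi>_props(4)[OF i n(1)] by (intro image_eqI[of _ _ "a @\<^sub>v \<psi>' i n"]) (simp_all add: module_vec_simps)
    qed (use lhom_closed[OF \<theta>l[OF i]] in auto)
  qed
  \<comment> \<open>The transported structure maps, in the coordinates \<open>\<theta>\<close>, are block matrices.\<close>
  define \<tau> where "\<tau> i = inv_into (carrier (?K (\<alpha> i + \<beta> i))) (\<theta> i)" for i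
  have \<tau>l: "\<tau> i \<in> lhom (vsp E i) (?K (\<alpha> i + \<beta> i))" if "i \<in> verts Q" for i
    unfolding \<tau>_def by (rule lhom_inv_into[OF is_vs_module_vec \<theta>l[OF that] \<theta>b[OF that]])
  have \<theta>\<tau>: "\<theta> i (\<tau> i e) = e" if "i \<in> verts Q" "e \<in> carrier (vsp E i)" for i e
    unfolding \<tau>_def by (rule bij_betw_inv_into_right[OF \<theta>b[OF that(1)] that(2)])
  have \<tau>\<theta>: "\<tau> i (\<theta> i v) = v" if "i \<in> verts Q" "v \<in> carrier_vec (\<alpha> i + \<beta> i)" for i v
    unfolding \<tau>_def using that(2) by (intro bij_betw_inv_into_left[OF \<theta>b[OF that(1)]]) (simp add: module_vec_simps)
  define T where "T h v = \<tau> (head Q h) (vmap E h (\<theta> (tail Q h) v))" for h v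
  define w where "w = (\<lambda>h\<in>arcs Q. mat_of_lhom (\<beta> (head Q h)) (\<alpha> (tail Q h))
    (\<lambda>a. vec_last (T h (a @\<^sub>v 0\<^sub>v (\<beta> (tail Q h)))) (\<beta> (head Q h))))"
  have w: "w \<in> Blocks" by (simp add: w_def Blocks_def)
  have Tblock: "\<theta> (head Q h) (block_mat (A h) (w h) (D h) *\<^sub>v v) = vmap E h (\<theta> (tail Q h) v)"
    if h: "h \<in> arcs Q" and v: "v \<in> carrier_vec (\<alpha> (tail Q h) + \<beta> (tail Q h))" for h v
  proof -
    have t: "tail Q h \<in> verts Q" and hd: "head Q h \<in> verts Q" using h by auto
    let ?t = "tail Q h" and ?h = "head Q h"
    have Tl: "T h \<in> lhom (?K (\<alpha> ?t + \<beta> ?t)) (?K (\<alpha> ?h + \<beta> ?h))"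
      using lhom_comp[OF lhom_comp[OF \<theta>l[OF t] is_repD(3)[OF X(1) h]] \<tau>l[OF hd]] by (simp add: T_def[abs_def])
    have \<theta>T: "\<theta> ?h (T h u) = vmap E h (\<theta> ?t u)" if "u \<in> carrier_vec (\<alpha> ?t + \<beta> ?t)" for u
      unfolding T_def using that lhom_closed[OF is_repD(3)[OF X(1) h] lhom_closed[OF \<theta>l[OF t]]]
      by (intro \<theta>\<tau>[OF hd]) (simp add: module_vec_simps)
    obtain a b where a: "a \<in> carrier_vec (\<alpha> ?t)" and b: "b \<in> carrier_vec (\<beta> ?t)" and vab: "v = a @\<^sub>v b"
      using append_vec_cases[OF v] .
    have a0: "a @\<^sub>v 0\<^sub>v (\<beta> ?t) \<in> carrier_vec (\<alpha> ?t + \<beta> ?t)" and b0: "0\<^sub>v (\<alpha> ?t) @\<^sub>v b \<in> carrier_vec (\<alpha> ?t + \<beta> ?t)"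
      using a b by simp_all
    have Db: "D h *\<^sub>v b \<in> carrier_vec (\<beta> ?h)" and Aa: "A h *\<^sub>v a \<in> carrier_vec (\<alpha> ?h)"
      by (rule mult_mat_vec_carrier[OF Dc[OF h] b], rule mult_mat_vec_carrier[OF Ac[OF h] a])
    have Tb: "T h (0\<^sub>v (\<alpha> ?t) @\<^sub>v b) = 0\<^sub>v (\<alpha> ?h) @\<^sub>v (D h *\<^sub>v b)"
    proof -
      have "vmap E h (\<theta> ?t (0\<^sub>v (\<alpha> ?t) @\<^sub>v b)) = \<theta> ?h (0\<^sub>v (\<alpha> ?h) @\<^sub>v (D h *\<^sub>v b))"
        unfolding \<theta>0[OF t b] \<theta>0[OF hd Db] \<psi>_comm[OF h b] by (rule X(7)[OF h \<psi>_props(3)[OF t b], symmetric])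
      then show ?thesis unfolding T_def using Db by (simp add: \<tau>\<theta>[OF hd])
    qed
    have "T h (a @\<^sub>v 0\<^sub>v (\<beta> ?t)) \<in> carrier_vec (\<alpha> ?h + \<beta> ?h)"
      using lhom_closed[OF Tl] a0 by (simp add: module_vec_simps)
    then obtain a' b' where a': "a' \<in> carrier_vec (\<alpha> ?h)" and b': "b' \<in> carrier_vec (\<beta> ?h)"
      and Ta: "T h (a @\<^sub>v 0\<^sub>v (\<beta> ?t)) = a' @\<^sub>v b'" by (rule append_vec_cases)
    have "\<phi> ?h a' = g ?h (\<theta> ?h (a' @\<^sub>v b'))" by (rule g\<theta>[OF hd a' b', symmetric])
    also have "\<dots> = g ?h (vmap E h (\<theta> ?t (a @\<^sub>v 0\<^sub>v (\<beta> ?t))))" using \<theta>T[OF a0] by (simp add: Ta)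
    also have "\<dots> = vmap M h (g ?t (\<theta> ?t (a @\<^sub>v 0\<^sub>v (\<beta> ?t))))"
      using lhom_closed[OF \<theta>l[OF t]] a0 by (intro X(8)[OF h]) (simp add: module_vec_simps)
    also have "\<dots> = \<phi> ?h (A h *\<^sub>v a)" using g\<theta>[OF t a zero_carrier_vec] \<phi>_comm[OF h a] by simp
    finally have a'A: "a' = A h *\<^sub>v a" using \<phi>_props(7)[OF hd a' Aa] by simp
    have wl: "(\<lambda>a. vec_last (T h (a @\<^sub>v 0\<^sub>v (\<beta> ?t))) (\<beta> ?h)) \<in> lhom (?K (\<alpha> ?t)) (?K (\<beta> ?h))"
      by (rule lhom_comp[OF lhom_comp[OF append_zero_lhom Tl] vec_last_lhom])
    have "w h *\<^sub>v a = b'"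
      using mat_of_lhom[OF wl a] h a' b' by (simp add: w_def Ta)
    then have "block_mat (A h) (w h) (D h) *\<^sub>v v = (A h *\<^sub>v a) @\<^sub>v (b' + D h *\<^sub>v b)"
      unfolding vab using block_mat_mult[OF Ac[OF h] Blc[OF w h] Dc[OF h] a b] by simp
    also have "\<dots> = (a' @\<^sub>v b') + (0\<^sub>v (\<alpha> ?h) @\<^sub>v (D h *\<^sub>v b))"
      using append_vec_add[OF a' zero_carrier_vec b' Db] a' by (simp add: a'A)
    also have "\<dots> = T h ((a @\<^sub>v 0\<^sub>v (\<beta> ?t)) + (0\<^sub>v (\<alpha> ?t) @\<^sub>v b))"
      using lhom_add[OF Tl, of "a @\<^sub>v 0\<^sub>v (\<beta> ?t)" "0\<^sub>v (\<alpha> ?t) @\<^sub>v b"] a0 b0 by (simp add: Ta Tb module_vec_simps)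
    also have "(a @\<^sub>v 0\<^sub>v (\<beta> ?t)) + (0\<^sub>v (\<alpha> ?t) @\<^sub>v b) = v"
      using append_vec_add[OF a zero_carrier_vec zero_carrier_vec b] a b by (simp add: vab)
    finally show ?thesis using \<theta>T[OF v] by simp
  qed
  have iso: "is_iso (mid w) E (\<lambda>i. restrict (\<theta> i) (carrier (vsp (mid w) i)))"
    by (rule is_isoI[OF is_rep_mid]) (simp_all add: \<theta>l \<theta>b[unfolded module_vec_simps(3)] Tblock module_vec_simps(3))
  have "(ext_of w, (E, f, g)) \<in> ext_equiv Q M N"
    unfolding ext_of_def
  proof (rule ext_equiv_iso[OF ext_of_extensions[OF w, unfolded ext_of_def] E iso])
    fix i n assume i: "i \<in> verts Q" and n: "n \<in> carrier (vsp N i)"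
    show "restrict (\<theta> i) (carrier (vsp (mid w) i)) (ext_in i n) = f i n"
      using i n \<psi>_props(4)[OF i n] \<psi>_props(6)[OF i n] by (simp add: ext_in_def module_vec_simps \<theta>0)
  next
    fix i e assume i: "i \<in> verts Q" and "e \<in> carrier (vsp (mid w) i)"
    then have e: "e \<in> carrier_vec (\<alpha> i + \<beta> i)" by (simp add: module_vec_simps)
    obtain a b where ab: "a \<in> carrier_vec (\<alpha> i)" "b \<in> carrier_vec (\<beta> i)" "e = a @\<^sub>v b" using append_vec_cases[OF e] .
    show "g i (restrict (\<theta> i) (carrier (vsp (mid w) i)) e) = ext_out i e"
      using i e ab g\<theta>[OF i ab(1,2)] by (simp add: ext_out_def module_vec_simps)
  qed
  then show ?thesis using w by blast
qed

end

context block_extensions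
begin

lemma gauge_act_Blocks: "w \<in> Blocks \<Longrightarrow> c \<in> Gauge \<Longrightarrow> gauge_act c w \<in> Blocks"
  by (auto simp: gauge_act_def Blocks_def PiE_iff intro!: add_carrier_mat minus_carrier_mat mult_carrier_mat Dc Gac)

lemma gauge_act_mult:
  assumes w: "w \<in> Blocks" and c: "c \<in> Gauge" and h: "h \<in> arcs Q" and a: "a \<in> carrier_vec (\<alpha> (tail Q h))"
  shows "gauge_act c w h *\<^sub>v a = w h *\<^sub>v a + (c (head Q h) *\<^sub>v (A h *\<^sub>v a) - D h *\<^sub>v (c (tail Q h) *\<^sub>v a))"
proof -
  have t: "tail Q h \<in> verts Q" and hd: "head Q h \<in> verts Q" using h by auto
  note ca = Gac[OF c hd] Ac[OF h] Dc[OF h] Gac[OF c t] Blc[OF w h]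
  have 1: "c (head Q h) * A h \<in> carrier_mat (\<beta> (head Q h)) (\<alpha> (tail Q h))"
    and 2: "D h * c (tail Q h) \<in> carrier_mat (\<beta> (head Q h)) (\<alpha> (tail Q h))"
    by (rule mult_carrier_mat[OF ca(1,2)], rule mult_carrier_mat[OF ca(3,4)])
  have "gauge_act c w h *\<^sub>v a = w h *\<^sub>v a + (c (head Q h) * A h - D h * c (tail Q h)) *\<^sub>v a"
    using h add_mult_distrib_mat_vec[OF ca(5) minus_carrier_mat[OF 2] a] by (simp add: gauge_act_def)
  also have "(c (head Q h) * A h - D h * c (tail Q h)) *\<^sub>v a = (c (head Q h) * A h) *\<^sub>v a - (D h * c (tail Q h)) *\<^sub>v a"
    by (rule minus_mult_distrib_mat_vec[OF 1 2 a])
  finally show ?thesis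
    by (simp only: assoc_mult_mat_vec[OF ca(1,2) a] assoc_mult_mat_vec[OF ca(3,4) a])
qed

text \<open>Isomorphisms of extensions in block form are given by unipotent block matrices.\<close>

lemma ext_equiv_gauge:
  assumes w: "w \<in> Blocks" and c: "c \<in> Gauge"
  shows "(ext_of w, ext_of (gauge_act c w)) \<in> ext_equiv Q M N"
proof -
  let ?K = "\<lambda>n. module_vec TYPE('k) n"
  let ?w = "gauge_act c w"
  have w': "?w \<in> Blocks" by (rule gauge_act_Blocks[OF w c])
  define U where "U i = block_mat (1\<^sub>m (\<alpha> i)) (c i) (1\<^sub>m (\<beta> i))" for i
  have Uv: "U i *\<^sub>v (a @\<^sub>v b) = a @\<^sub>v (c i *\<^sub>v a + b)"
    if "i \<in> verts Q" "a \<in> carrier_vec (\<alpha> i)" "b \<in> carrier_vec (\<beta> i)" for i a b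
    unfolding U_def using block_mat_mult[OF one_carrier_mat Gac[OF c that(1)] one_carrier_mat that(2,3)] that by simp
  have Uc: "U i \<in> carrier_mat (\<alpha> i + \<beta> i) (\<alpha> i + \<beta> i)" for i
    unfolding U_def by (rule block_mat_carrier) simp_all
  have iso: "is_iso (mid w) (mid ?w) (\<lambda>i. restrict (\<lambda>v. U i *\<^sub>v v) (carrier (vsp (mid w) i)))"
  proof (rule is_isoI[OF is_rep_mid])
    fix i assume i: "i \<in> verts Q"
    show "(\<lambda>v. U i *\<^sub>v v) \<in> lhom (vsp (mid w) i) (vsp (mid ?w) i)" using mult_mat_vec_lhom[OF Uc[of i]] by simp
    have "bij_betw (\<lambda>v. U i *\<^sub>v v) (carrier_vec (\<alpha> i + \<beta> i)) (carrier_vec (\<alpha> i + \<beta> i))"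
      unfolding bij_betw_def
    proof
      show inj: "inj_on (\<lambda>v. U i *\<^sub>v v) (carrier_vec (\<alpha> i + \<beta> i))"
      proof (rule inj_onI)
        fix u v assume u: "u \<in> carrier_vec (\<alpha> i + \<beta> i)" and v: "v \<in> carrier_vec (\<alpha> i + \<beta> i)" and eq: "U i *\<^sub>v u = U i *\<^sub>v v"
        obtain a b where a: "a \<in> carrier_vec (\<alpha> i)" "b \<in> carrier_vec (\<beta> i)" "u = a @\<^sub>v b" using append_vec_cases[OF u] .
        obtain a' b' where a': "a' \<in> carrier_vec (\<alpha> i)" "b' \<in> carrier_vec (\<beta> i)" "v = a' @\<^sub>v b'" using append_vec_cases[OF v] .
        have "a = a'" and eb: "c i *\<^sub>v a + b = c i *\<^sub>v a' + b'"
          using eq append_vec_eq[OF a(1) a'(1)] unfolding a(3) a'(3) Uv[OF i a(1,2)] Uv[OF i a'(1,2)] by blast+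
        have ca: "c i *\<^sub>v a \<in> carrier_vec (\<beta> i)" by (rule mult_mat_vec_carrier[OF Gac[OF c i] a(1)])
        have cancel: "(c i *\<^sub>v a + d) - c i *\<^sub>v a = d" if "d \<in> carrier_vec (\<beta> i)" for d
          by (rule eq_vecI) (use that ca Gac[OF c i] in simp_all)
        have "b = (c i *\<^sub>v a + b) - c i *\<^sub>v a" by (rule cancel[OF a(2), symmetric])
        also have "c i *\<^sub>v a + b = c i *\<^sub>v a + b'" using eb unfolding \<open>a = a'\<close> .
        also have "(c i *\<^sub>v a + b') - c i *\<^sub>v a = b'" by (rule cancel[OF a'(2)])
        finally have "b = b'" .
        then show "u = v" using \<open>a = a'\<close> a(3) a'(3) by simp
      qed
      show "(\<lambda>v. U i *\<^sub>v v) ` carrier_vec (\<alpha> i + \<beta> i) = carrier_vec (\<alpha> i + \<beta> i)"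
        by (rule endo_inj_surj[OF finite_carrier_vec _ inj]) (use mult_mat_vec_carrier[OF Uc] in blast)
    qed
    then show "bij_betw (\<lambda>v. U i *\<^sub>v v) (carrier (vsp (mid w) i)) (carrier (vsp (mid ?w) i))" by (simp add: module_vec_simps)
  next
    fix h v assume h: "h \<in> arcs Q" and "v \<in> carrier (vsp (mid w) (tail Q h))"
    then have v: "v \<in> carrier_vec (\<alpha> (tail Q h) + \<beta> (tail Q h))" by (simp add: module_vec_simps)
    have t: "tail Q h \<in> verts Q" and hd: "head Q h \<in> verts Q" using h by auto
    obtain a b where a: "a \<in> carrier_vec (\<alpha> (tail Q h))" and b: "b \<in> carrier_vec (\<beta> (tail Q h))" and vab: "v = a @\<^sub>v b"
      using append_vec_cases[OF v] .
    have cs: "A h *\<^sub>v a \<in> carrier_vec (\<alpha> (head Q h))" "w h *\<^sub>v a \<in> carrier_vec (\<beta> (head Q h))"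
      "D h *\<^sub>v b \<in> carrier_vec (\<beta> (head Q h))" "c (tail Q h) *\<^sub>v a \<in> carrier_vec (\<beta> (tail Q h))"
      by (rule mult_mat_vec_carrier[OF Ac[OF h] a] mult_mat_vec_carrier[OF Blc[OF w h] a]
          mult_mat_vec_carrier[OF Dc[OF h] b] mult_mat_vec_carrier[OF Gac[OF c t] a])+
    have cs': "c (head Q h) *\<^sub>v (A h *\<^sub>v a) \<in> carrier_vec (\<beta> (head Q h))"
      "D h *\<^sub>v (c (tail Q h) *\<^sub>v a) \<in> carrier_vec (\<beta> (head Q h))"
      by (rule mult_mat_vec_carrier[OF Gac[OF c hd] cs(1)] mult_mat_vec_carrier[OF Dc[OF h] cs(4)])+
    have cab: "c (tail Q h) *\<^sub>v a + b \<in> carrier_vec (\<beta> (tail Q h))" using cs(4) b by simp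
    have wDb: "w h *\<^sub>v a + D h *\<^sub>v b \<in> carrier_vec (\<beta> (head Q h))" using cs by simp
    have "U (head Q h) *\<^sub>v (block_mat (A h) (w h) (D h) *\<^sub>v v) =
        (A h *\<^sub>v a) @\<^sub>v (c (head Q h) *\<^sub>v (A h *\<^sub>v a) + (w h *\<^sub>v a + D h *\<^sub>v b))"
      unfolding vab block_mat_mult[OF Ac[OF h] Blc[OF w h] Dc[OF h] a b] by (rule Uv[OF hd cs(1) wDb])
    also have "c (head Q h) *\<^sub>v (A h *\<^sub>v a) + (w h *\<^sub>v a + D h *\<^sub>v b) =
        ?w h *\<^sub>v a + D h *\<^sub>v (c (tail Q h) *\<^sub>v a + b)"
      unfolding gauge_act_mult[OF w c h a] mult_add_distrib_mat_vec[OF Dc[OF h] cs(4) b]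
      by (rule eq_vecI) (use cs cs' in simp_all)
    finally show "U (head Q h) *\<^sub>v vmap (mid w) h v = vmap (mid ?w) h (U (tail Q h) *\<^sub>v v)"
      using block_mat_mult[OF Ac[OF h] Blc[OF w' h] Dc[OF h] a cab] by (simp add: vab Uv[OF t a b])
  qed
  show ?thesis
    unfolding ext_of_def
  proof (rule ext_equiv_iso[OF ext_of_extensions[OF w, unfolded ext_of_def] ext_of_extensions[OF w', unfolded ext_of_def] iso])
    fix i n assume i: "i \<in> verts Q" and n: "n \<in> carrier (vsp N i)"
    have "c i *\<^sub>v 0\<^sub>v (\<alpha> i) = 0\<^sub>v (\<beta> i)" by (rule eq_vecI) (use Gac[OF c i] in simp_all)
    then show "restrict (\<lambda>v. U i *\<^sub>v v) (carrier (vsp (mid w) i)) (ext_in i n) = ext_in i n"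
      using i n \<psi>_props(4)[OF i n] by (simp add: ext_in_def module_vec_simps Uv[OF i zero_carrier_vec])
  next
    fix i e assume i: "i \<in> verts Q" and "e \<in> carrier (vsp (mid w) i)"
    then have e: "e \<in> carrier_vec (\<alpha> i + \<beta> i)" by (simp add: module_vec_simps)
    obtain a b where ab: "a \<in> carrier_vec (\<alpha> i)" "b \<in> carrier_vec (\<beta> i)" "e = a @\<^sub>v b" using append_vec_cases[OF e] .
    have "c i *\<^sub>v a \<in> carrier_vec (\<beta> i)" by (rule mult_mat_vec_carrier[OF Gac[OF c i] ab(1)])
    then show "ext_out i (restrict (\<lambda>v. U i *\<^sub>v v) (carrier (vsp (mid w) i)) e) = ext_out i e"
      using i ab by (simp add: ext_out_def module_vec_simps Uv[OF i ab(1,2)])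
  qed
qed

lemma ext_equiv_imp_gauge:
  assumes w: "w \<in> Blocks" and w': "w' \<in> Blocks" and eqv: "(ext_of w, ext_of w') \<in> ext_equiv Q M N"
  shows "\<exists>c\<in>Gauge. w' = gauge_act c w"
proof -
  let ?K = "\<lambda>n. module_vec TYPE('k) n"
  obtain \<theta> where \<theta>: "is_iso (mid w) (mid w') \<theta>"
    and f: "\<And>i n. i \<in> verts Q \<Longrightarrow> n \<in> carrier (vsp N i) \<Longrightarrow> \<theta> i (ext_in i n) = ext_in i n"
    and g: "\<And>i e. i \<in> verts Q \<Longrightarrow> e \<in> carrier (vsp (mid w) i) \<Longrightarrow> ext_out i (\<theta> i e) = ext_out i e"
    using ext_equivD[OF eqv[unfolded ext_of_def]] by metis
  have \<theta>l: "\<theta> i \<in> lhom (?K (\<alpha> i + \<beta> i)) (?K (\<alpha> i + \<beta> i))" if "i \<in> verts Q" for i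
    using is_isoD(2)[OF \<theta> that] by simp
  have \<theta>c: "\<theta> i v \<in> carrier_vec (\<alpha> i + \<beta> i)" if "i \<in> verts Q" "v \<in> carrier_vec (\<alpha> i + \<beta> i)" for i v
    using lhom_closed[OF \<theta>l[OF that(1)]] that(2) by (simp add: module_vec_simps)
  have \<theta>b: "\<theta> i (0\<^sub>v (\<alpha> i) @\<^sub>v b) = 0\<^sub>v (\<alpha> i) @\<^sub>v b" if i: "i \<in> verts Q" and b: "b \<in> carrier_vec (\<beta> i)" for i b
    using f[OF i \<psi>_props(3)[OF i b]] i \<psi>_props(3)[OF i b] \<psi>_props(5)[OF i b] by (simp add: ext_in_def)
  define c where "c = (\<lambda>i\<in>verts Q. mat_of_lhom (\<beta> i) (\<alpha> i) (\<lambda>a. vec_last (\<theta> i (a @\<^sub>v 0\<^sub>v (\<beta> i))) (\<beta> i)))"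
  have c: "c \<in> Gauge" by (simp add: c_def Gauge_def)
  have \<theta>a: "\<theta> i (a @\<^sub>v 0\<^sub>v (\<beta> i)) = a @\<^sub>v (c i *\<^sub>v a)" if i: "i \<in> verts Q" and a: "a \<in> carrier_vec (\<alpha> i)" for i a
  proof -
    have a0: "a @\<^sub>v 0\<^sub>v (\<beta> i) \<in> carrier_vec (\<alpha> i + \<beta> i)" using a by simp
    obtain a' b' where a': "a' \<in> carrier_vec (\<alpha> i)" and b': "b' \<in> carrier_vec (\<beta> i)" and eq: "\<theta> i (a @\<^sub>v 0\<^sub>v (\<beta> i)) = a' @\<^sub>v b'"
      using append_vec_cases[OF \<theta>c[OF i a0]] .
    have "\<phi> i a' = \<phi> i a" using g[OF i, of "a @\<^sub>v 0\<^sub>v (\<beta> i)"] i a a0 a' b' by (simp add: ext_out_def module_vec_simps eq)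
    then have "a' = a" using \<phi>_props(7)[OF i a' a] by simp
    moreover have "c i *\<^sub>v a = b'"
      using mat_of_lhom[OF lhom_comp[OF lhom_comp[OF append_zero_lhom \<theta>l[OF i]] vec_last_lhom] a] i a' b' by (simp add: c_def eq)
    ultimately show ?thesis by (simp add: eq)
  qed
  have "w' h = gauge_act c w h" if h: "h \<in> arcs Q" for h
  proof (rule mat_eq_by_vec[OF Blc[OF w' h] Blc[OF gauge_act_Blocks[OF w c] h]])
    fix a :: "'k vec" assume a: "a \<in> carrier_vec (\<alpha> (tail Q h))"
    let ?t = "tail Q h" and ?h = "head Q h"
    have t: "?t \<in> verts Q" and hd: "?h \<in> verts Q" using h by auto
    have z: "D h *\<^sub>v 0\<^sub>v (\<beta> ?t) = 0\<^sub>v (\<beta> ?h)" by (rule eq_vecI) (use Dc[OF h] in simp_all)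
    have cs: "A h *\<^sub>v a \<in> carrier_vec (\<alpha> ?h)" "w h *\<^sub>v a \<in> carrier_vec (\<beta> ?h)" "w' h *\<^sub>v a \<in> carrier_vec (\<beta> ?h)"
      "c ?t *\<^sub>v a \<in> carrier_vec (\<beta> ?t)"
      by (rule mult_mat_vec_carrier[OF Ac[OF h] a] mult_mat_vec_carrier[OF Blc[OF w h] a]
          mult_mat_vec_carrier[OF Blc[OF w' h] a] mult_mat_vec_carrier[OF Gac[OF c t] a])+
    have cs': "c ?h *\<^sub>v (A h *\<^sub>v a) \<in> carrier_vec (\<beta> ?h)" "D h *\<^sub>v (c ?t *\<^sub>v a) \<in> carrier_vec (\<beta> ?h)"
      by (rule mult_mat_vec_carrier[OF Gac[OF c hd] cs(1)] mult_mat_vec_carrier[OF Dc[OF h] cs(4)])+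
    have a0: "a @\<^sub>v 0\<^sub>v (\<beta> ?t) \<in> carrier_vec (\<alpha> ?t + \<beta> ?t)" using a by simp
    have "\<theta> ?h (block_mat (A h) (w h) (D h) *\<^sub>v (a @\<^sub>v 0\<^sub>v (\<beta> ?t))) =
        block_mat (A h) (w' h) (D h) *\<^sub>v \<theta> ?t (a @\<^sub>v 0\<^sub>v (\<beta> ?t))"
      using is_isoD(5)[OF \<theta> h, of "a @\<^sub>v 0\<^sub>v (\<beta> ?t)"] a0 by (simp add: module_vec_simps)
    also have "\<dots> = (A h *\<^sub>v a) @\<^sub>v (w' h *\<^sub>v a + D h *\<^sub>v (c ?t *\<^sub>v a))"
      unfolding \<theta>a[OF t a] by (rule block_mat_mult[OF Ac[OF h] Blc[OF w' h] Dc[OF h] a cs(4)])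
    also have "block_mat (A h) (w h) (D h) *\<^sub>v (a @\<^sub>v 0\<^sub>v (\<beta> ?t)) = (A h *\<^sub>v a) @\<^sub>v (w h *\<^sub>v a)"
      unfolding block_mat_mult[OF Ac[OF h] Blc[OF w h] Dc[OF h] a zero_carrier_vec] z using cs(2) by simp
    also have "(A h *\<^sub>v a) @\<^sub>v (w h *\<^sub>v a) = ((A h *\<^sub>v a) @\<^sub>v 0\<^sub>v (\<beta> ?h)) + (0\<^sub>v (\<alpha> ?h) @\<^sub>v (w h *\<^sub>v a))"
      using append_vec_add[OF cs(1) zero_carrier_vec zero_carrier_vec cs(2)] cs by simp
    also have "\<theta> ?h \<dots> = \<theta> ?h ((A h *\<^sub>v a) @\<^sub>v 0\<^sub>v (\<beta> ?h)) + \<theta> ?h (0\<^sub>v (\<alpha> ?h) @\<^sub>v (w h *\<^sub>v a))"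
      using lhom_add[OF \<theta>l[OF hd]] cs by (simp add: module_vec_simps)
    also have "\<dots> = (A h *\<^sub>v a) @\<^sub>v (c ?h *\<^sub>v (A h *\<^sub>v a) + w h *\<^sub>v a)"
      unfolding \<theta>a[OF hd cs(1)] \<theta>b[OF hd cs(2)] using append_vec_add[OF cs(1) zero_carrier_vec cs'(1) cs(2)] cs by simp
    finally have eq: "c ?h *\<^sub>v (A h *\<^sub>v a) + w h *\<^sub>v a = w' h *\<^sub>v a + D h *\<^sub>v (c ?t *\<^sub>v a)"
      using append_vec_eq[OF cs(1) cs(1)] by blast
    show "w' h *\<^sub>v a = gauge_act c w h *\<^sub>v a"
      unfolding gauge_act_mult[OF w c h a]
    proof (rule eq_vecI)
      fix i assume "i < dim_vec (w h *\<^sub>v a + (c ?h *\<^sub>v (A h *\<^sub>v a) - D h *\<^sub>v (c ?t *\<^sub>v a)))"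
      then have i: "i < \<beta> ?h" using cs' Dc[OF h] by simp
      have dims: "dim_vec (w' h *\<^sub>v a) = \<beta> ?h" "dim_vec (w h *\<^sub>v a) = \<beta> ?h"
        "dim_vec (c ?h *\<^sub>v (A h *\<^sub>v a)) = \<beta> ?h" "dim_vec (D h *\<^sub>v (c ?t *\<^sub>v a)) = \<beta> ?h"
        using cs cs' by (simp_all only: carrier_vecD)
      have "(c ?h *\<^sub>v (A h *\<^sub>v a)) $ i + (w h *\<^sub>v a) $ i = (w' h *\<^sub>v a) $ i + (D h *\<^sub>v (c ?t *\<^sub>v a)) $ i"
        using arg_cong[OF eq, of "\<lambda>v :: 'k vec. v $ i"] i dims by (simp only: index_add_vec)
      then have "(w' h *\<^sub>v a) $ i = (w h *\<^sub>v a) $ i + ((c ?h *\<^sub>v (A h *\<^sub>v a)) $ i - (D h *\<^sub>v (c ?t *\<^sub>v a)) $ i)"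
        by (simp only: algebra_simps)
      then show "(w' h *\<^sub>v a) $ i = (w h *\<^sub>v a + (c ?h *\<^sub>v (A h *\<^sub>v a) - D h *\<^sub>v (c ?t *\<^sub>v a))) $ i"
        using i dims by (simp only: index_add_vec index_minus_vec)
    qed (use cs cs' in \<open>simp only: carrier_vecD index_add_vec index_minus_vec\<close>)
  qed
  moreover have "w' \<in> extensional (arcs Q)" using w' by (simp add: Blocks_def PiE_iff)
  ultimately have "w' = gauge_act c w"
    by (intro extensionalityI[of _ "arcs Q"]) (simp_all add: gauge_act_def)
  then show ?thesis using c by blast
qed

definition Intertwiners :: "('i \<Rightarrow> 'k mat) set" where
  "Intertwiners = {c \<in> Gauge. \<forall>h\<in>arcs Q. c (head Q h) * A h = D h * c (tail Q h)}"

lemma finite_Blocks: "finite Blocks"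
  and finite_Gauge: "finite Gauge"
  unfolding Blocks_def Gauge_def by (auto intro: finite_PiE)

lemma Gauge_nonempty: "Gauge \<noteq> {}"
  unfolding Gauge_def by (auto simp: PiE_eq_empty_iff)

definition ext_class where "ext_class w = ext_equiv Q M N `` {ext_of w}"

lemma ext_class_eq_iff:
  assumes "w \<in> Blocks" "w' \<in> Blocks"
  shows "ext_class w = ext_class w' \<longleftrightarrow> w' \<in> (\<lambda>c. gauge_act c w) ` Gauge"
proof -
  have "ext_class w = ext_class w' \<longleftrightarrow> (ext_of w, ext_of w') \<in> ext_equiv Q M N"
    unfolding ext_class_def
    by (rule eq_equiv_class_iff[OF equiv_ext_equiv ext_of_extensions[OF assms(1)] ext_of_extensions[OF assms(2)]])
  then show ?thesis using ext_equiv_gauge[OF assms(1)] ext_equiv_imp_gauge[OF assms] by blast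
qed

lemma Ext1_eq: "Ext1 Q M N = ext_class ` Blocks"
proof (intro equalityI subsetI)
  fix \<xi> assume "\<xi> \<in> Ext1 Q M N"
  then obtain e where e: "e \<in> extensions Q M N" "\<xi> = ext_equiv Q M N `` {e}"
    unfolding Ext1_def by (auto elim: quotientE)
  obtain E f g where e3: "e = (E, f, g)" by (cases e)
  obtain w where w: "w \<in> Blocks" "(ext_of w, e) \<in> ext_equiv Q M N" using ext_of_surj e(1) unfolding e3 by blast
  then show "\<xi> \<in> ext_class ` Blocks"
    using equiv_class_eq[OF equiv_ext_equiv w(2)] unfolding ext_class_def e(2) by blast
qed (auto simp: Ext1_def ext_class_def intro!: quotientI ext_of_extensions)

text \<open>Differences of two gauge parameters with the same effect are intertwiners.\<close>

lemma card_gauge_fibre: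
  assumes w: "w \<in> Blocks" and w': "w' \<in> (\<lambda>c. gauge_act c w) ` Gauge"
  shows "card {c \<in> Gauge. gauge_act c w = w'} = card Intertwiners"
proof -
  obtain c0 where c0: "c0 \<in> Gauge" "w' = gauge_act c0 w" using w' by blast
  have key: "gauge_act c w = gauge_act c0 w \<longleftrightarrow> (\<lambda>i\<in>verts Q. c i - c0 i) \<in> Intertwiners" if c: "c \<in> Gauge" for c
  proof -
    have "gauge_act c w h = gauge_act c0 w h \<longleftrightarrow>
        (c (head Q h) - c0 (head Q h)) * A h = D h * (c (tail Q h) - c0 (tail Q h))" if h: "h \<in> arcs Q" for h
    proof -
      have t: "tail Q h \<in> verts Q" and hd: "head Q h \<in> verts Q" using h by auto
      note ca = Gac[OF c hd] Gac[OF c0(1) hd] Ac[OF h] Dc[OF h] Gac[OF c t] Gac[OF c0(1) t] Blc[OF w h]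
      define P where "P = c (head Q h) * A h"
      define P0 where "P0 = c0 (head Q h) * A h"
      define R where "R = D h * c (tail Q h)"
      define R0 where "R0 = D h * c0 (tail Q h)"
      have car: "P \<in> carrier_mat (\<beta> (head Q h)) (\<alpha> (tail Q h))" "P0 \<in> carrier_mat (\<beta> (head Q h)) (\<alpha> (tail Q h))"
        "R \<in> carrier_mat (\<beta> (head Q h)) (\<alpha> (tail Q h))" "R0 \<in> carrier_mat (\<beta> (head Q h)) (\<alpha> (tail Q h))"
        unfolding P_def P0_def R_def R0_def by (rule mult_carrier_mat[OF ca(1,3)] mult_carrier_mat[OF ca(2,3)]
          mult_carrier_mat[OF ca(4,5)] mult_carrier_mat[OF ca(4,6)])+
      have "gauge_act c w h = gauge_act c0 w h \<longleftrightarrow> w h + (P - R) = w h + (P0 - R0)"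
        using h by (simp add: gauge_act_def P_def P0_def R_def R0_def)
      also have "\<dots> \<longleftrightarrow> P - P0 = R - R0"
      proof -
        have "(w h + (P - R)) $$ (i, j) = (w h + (P0 - R0)) $$ (i, j) \<longleftrightarrow> (P - P0) $$ (i, j) = (R - R0) $$ (i, j)"
          if "i < \<beta> (head Q h)" "j < \<alpha> (tail Q h)" for i j
          using that car ca(7) by (auto simp: algebra_simps)
        then show ?thesis using car ca(7) by (auto simp: mat_eq_iff)
      qed
      also have "P - P0 = (c (head Q h) - c0 (head Q h)) * A h"
        unfolding P_def P0_def by (rule minus_mult_distrib_mat[OF ca(1,2,3), symmetric])
      also have "R - R0 = D h * (c (tail Q h) - c0 (tail Q h))"
        unfolding R_def R0_def by (rule mult_minus_distrib_mat[OF ca(4,5,6), symmetric])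
      finally show ?thesis .
    qed
    then have "(\<forall>h\<in>arcs Q. gauge_act c w h = gauge_act c0 w h) \<longleftrightarrow> (\<lambda>i\<in>verts Q. c i - c0 i) \<in> Intertwiners"
      unfolding Intertwiners_def using Gac[OF c0(1)] by (auto simp: Gauge_def intro!: minus_carrier_mat)
    moreover have "gauge_act c w = gauge_act c0 w \<longleftrightarrow> (\<forall>h\<in>arcs Q. gauge_act c w h = gauge_act c0 w h)"
      unfolding gauge_act_def fun_eq_iff by auto
    ultimately show ?thesis by simp
  qed
  have "bij_betw (\<lambda>c. \<lambda>i\<in>verts Q. c i - c0 i) {c \<in> Gauge. gauge_act c w = w'} Intertwiners"
  proof (rule bij_betw_byWitness[where f' = "\<lambda>d. \<lambda>i\<in>verts Q. d i + c0 i"])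
    have cancel: "(\<lambda>i\<in>verts Q. (\<lambda>i\<in>verts Q. c i - c0 i) i + c0 i) = c" if c: "c \<in> Gauge" for c
    proof (rule extensionalityI[of _ "verts Q"])
      fix i assume i: "i \<in> verts Q"
      show "(\<lambda>i\<in>verts Q. (\<lambda>i\<in>verts Q. c i - c0 i) i + c0 i) i = c i"
        using i Gac[OF c i] Gac[OF c0(1) i] by (intro eq_matI) auto
    qed (use c in \<open>simp_all add: Gauge_def PiE_iff\<close>)
    have cancel': "(\<lambda>i\<in>verts Q. (\<lambda>i\<in>verts Q. d i + c0 i) i - c0 i) = d" if d: "d \<in> Gauge" for d
    proof (rule extensionalityI[of _ "verts Q"])
      fix i assume i: "i \<in> verts Q"
      show "(\<lambda>i\<in>verts Q. (\<lambda>i\<in>verts Q. d i + c0 i) i - c0 i) i = d i"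
        using i Gac[OF d i] Gac[OF c0(1) i] by (intro eq_matI) auto
    qed (use d in \<open>simp_all add: Gauge_def PiE_iff\<close>)
    have plus: "(\<lambda>i\<in>verts Q. d i + c0 i) \<in> Gauge" if "d \<in> Gauge" for d
      using Gac[OF that] Gac[OF c0(1)] by (auto simp: Gauge_def intro!: add_carrier_mat)
    show "\<forall>c\<in>{c \<in> Gauge. gauge_act c w = w'}. (\<lambda>i\<in>verts Q. (\<lambda>i\<in>verts Q. c i - c0 i) i + c0 i) = c"
      using cancel by blast
    show "\<forall>d\<in>Intertwiners. (\<lambda>i\<in>verts Q. (\<lambda>i\<in>verts Q. d i + c0 i) i - c0 i) = d"
      using cancel' by (auto simp: Intertwiners_def)
    show "(\<lambda>c. \<lambda>i\<in>verts Q. c i - c0 i) ` {c \<in> Gauge. gauge_act c w = w'} \<subseteq> Intertwiners"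
      using key c0(2) by blast
    show "(\<lambda>d. \<lambda>i\<in>verts Q. d i + c0 i) ` Intertwiners \<subseteq> {c \<in> Gauge. gauge_act c w = w'}"
    proof (rule image_subsetI)
      fix d assume d: "d \<in> Intertwiners"
      then have dG: "d \<in> Gauge" by (simp add: Intertwiners_def)
      have "gauge_act (\<lambda>i\<in>verts Q. d i + c0 i) w = w'"
        unfolding c0(2) key[OF plus[OF dG]] cancel'[OF dG] by (rule d)
      then show "(\<lambda>i\<in>verts Q. d i + c0 i) \<in> {c \<in> Gauge. gauge_act c w = w'}" using plus[OF dG] by blast
    qed
  qed
  then show ?thesis by (rule bij_betw_same_card)
qed

text \<open>The fibre is an orbit of the gauge group, whose stabilisers consist of the intertwiners.\<close>

lemma card_ext_class_fibre:
  assumes w: "w \<in> Blocks"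
  shows "card {w' \<in> Blocks. ext_class w' = ext_class w} * card Intertwiners = card Gauge"
proof -
  have eq: "{w' \<in> Blocks. ext_class w' = ext_class w} = (\<lambda>c. gauge_act c w) ` Gauge" (is "?F = _")
    using ext_class_eq_iff[OF w] gauge_act_Blocks[OF w] by blast
  have "card Gauge = (\<Sum>w'\<in>?F. card {c \<in> Gauge. gauge_act c w = w'})"
    unfolding eq using sum.image_gen[OF finite_Gauge, of "\<lambda>_. 1 :: nat" "\<lambda>c. gauge_act c w"] by simp
  also have "\<dots> = (\<Sum>w'\<in>?F. card Intertwiners)"
    unfolding eq by (rule sum.cong[OF refl card_gauge_fibre[OF w]])
  finally show ?thesis by simp
qed

text \<open>In the coordinates \<open>\<phi>\<close> and \<open>\<psi>\<close>, an intertwiner is a morphism from \<open>M\<close> to \<open>N\<close>.\<close>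

lemma card_Intertwiners: "card Intertwiners = card (rep_hom Q M N)"
proof -
  let ?K = "\<lambda>n. module_vec TYPE('k) n"
  define \<Theta> where "\<Theta> c = (\<lambda>i\<in>verts Q. \<lambda>m\<in>carrier (vsp M i). \<psi> i (c i *\<^sub>v \<phi>' i m))" for c
  have lin: "(\<lambda>m. \<psi> i (c i *\<^sub>v \<phi>' i m)) \<in> lhom (vsp M i) (vsp N i)" if "c \<in> Gauge" "i \<in> verts Q" for c i
    by (rule lhom_comp[OF lhom_comp[OF \<phi>_props(2)[OF that(2)] mult_mat_vec_lhom[OF Gac[OF that]]] \<psi>_props(1)[OF that(2)]])
  have val: "\<Theta> c i (\<phi> i a) = \<psi> i (c i *\<^sub>v a)" if "i \<in> verts Q" "a \<in> carrier_vec (\<alpha> i)" for c i a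
    using that \<phi>_props(3,5)[OF that(1)] by (simp add: \<Theta>_def)
  have "bij_betw \<Theta> Intertwiners (rep_hom Q M N)"
    unfolding bij_betw_def
  proof
    show "inj_on \<Theta> Intertwiners"
    proof (rule inj_onI)
      fix c c' assume "c \<in> Intertwiners" "c' \<in> Intertwiners"
      then have c: "c \<in> Gauge" and c': "c' \<in> Gauge" by (simp_all add: Intertwiners_def)
      assume eq: "\<Theta> c = \<Theta> c'"
      show "c = c'"
      proof (rule extensionalityI[of _ "verts Q"])
        fix i assume i: "i \<in> verts Q"
        show "c i = c' i"
        proof (rule mat_eq_by_vec[OF Gac[OF c i] Gac[OF c' i]])
          fix a :: "'k vec" assume a: "a \<in> carrier_vec (\<alpha> i)"
          have "\<psi> i (c i *\<^sub>v a) = \<psi> i (c' i *\<^sub>v a)" unfolding val[OF i a, symmetric] eq by (rule refl)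
          then have "\<psi>' i (\<psi> i (c i *\<^sub>v a)) = \<psi>' i (\<psi> i (c' i *\<^sub>v a))" by (rule arg_cong)
          then show "c i *\<^sub>v a = c' i *\<^sub>v a"
            unfolding \<psi>_props(5)[OF i mult_mat_vec_carrier[OF Gac[OF c i] a]]
              \<psi>_props(5)[OF i mult_mat_vec_carrier[OF Gac[OF c' i] a]] .
        qed
      qed (use c c' in \<open>simp_all add: Gauge_def PiE_iff\<close>)
    qed
    show "\<Theta> ` Intertwiners = rep_hom Q M N"
    proof (intro equalityI subsetI)
      fix \<eta> assume "\<eta> \<in> \<Theta> ` Intertwiners"
      then obtain c where cI: "c \<in> Intertwiners" and \<eta>: "\<eta> = \<Theta> c" by blast
      then have c: "c \<in> Gauge" and tw: "\<And>h. h \<in> arcs Q \<Longrightarrow> c (head Q h) * A h = D h * c (tail Q h)"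
        by (simp_all add: Intertwiners_def)
      show "\<eta> \<in> rep_hom Q M N"
        unfolding rep_hom_def
      proof (intro CollectI conjI ballI)
        show "\<eta> \<in> (\<Pi>\<^sub>E i\<in>verts Q. lin_maps (vsp M i) (vsp N i))"
          unfolding \<eta> \<Theta>_def using restrict_lin_maps[OF is_repD(1)[OF M] lin[OF c]] by simp
        fix h m assume h: "h \<in> arcs Q" and m: "m \<in> carrier (vsp M (tail Q h))"
        have t: "tail Q h \<in> verts Q" and hd: "head Q h \<in> verts Q" using h by auto
        define a where "a = \<phi>' (tail Q h) m"
        have a: "a \<in> carrier_vec (\<alpha> (tail Q h))" and ma: "m = \<phi> (tail Q h) a"
          unfolding a_def using \<phi>_props(4,6)[OF t m] by simp_all
        have Aa: "A h *\<^sub>v a \<in> carrier_vec (\<alpha> (head Q h))" by (rule mult_mat_vec_carrier[OF Ac[OF h] a])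
        have ca: "c (tail Q h) *\<^sub>v a \<in> carrier_vec (\<beta> (tail Q h))" by (rule mult_mat_vec_carrier[OF Gac[OF c t] a])
        have "\<eta> (head Q h) (vmap M h m) = \<psi> (head Q h) (c (head Q h) *\<^sub>v (A h *\<^sub>v a))"
          unfolding \<eta> ma \<phi>_comm[OF h a, symmetric] by (rule val[OF hd Aa])
        also have "c (head Q h) *\<^sub>v (A h *\<^sub>v a) = D h *\<^sub>v (c (tail Q h) *\<^sub>v a)"
          using assoc_mult_mat_vec[OF Gac[OF c hd] Ac[OF h] a] assoc_mult_mat_vec[OF Dc[OF h] Gac[OF c t] a] tw[OF h] by simp
        also have "\<psi> (head Q h) \<dots> = vmap N h (\<eta> (tail Q h) m)"
          unfolding \<psi>_comm[OF h ca] \<eta> ma val[OF t a] by (rule refl)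
        finally show "\<eta> (head Q h) (vmap M h m) = vmap N h (\<eta> (tail Q h) m)" .
      qed
    next
      fix \<eta> assume \<eta>: "\<eta> \<in> rep_hom Q M N"
      then have \<eta>l: "\<And>i. i \<in> verts Q \<Longrightarrow> \<eta> i \<in> lin_maps (vsp M i) (vsp N i)" and \<eta>e: "\<eta> \<in> extensional (verts Q)"
        and \<eta>c: "\<And>h m. h \<in> arcs Q \<Longrightarrow> m \<in> carrier (vsp M (tail Q h)) \<Longrightarrow> \<eta> (head Q h) (vmap M h m) = vmap N h (\<eta> (tail Q h) m)"
        by (auto simp: rep_hom_def PiE_iff)
      define c where "c = (\<lambda>i\<in>verts Q. mat_of_lhom (\<beta> i) (\<alpha> i) (\<lambda>a. \<psi>' i (\<eta> i (\<phi> i a))))"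
      have c: "c \<in> Gauge" by (simp add: c_def Gauge_def)
      have ca: "c i *\<^sub>v a = \<psi>' i (\<eta> i (\<phi> i a))" if "i \<in> verts Q" "a \<in> carrier_vec (\<alpha> i)" for i a
        using mat_of_lhom[OF lhom_comp[OF lhom_comp[OF \<phi>_props(1)[OF that(1)] lin_mapsD(1)[OF \<eta>l[OF that(1)]]] \<psi>_props(2)[OF that(1)]] that(2)] that(1)
        by (simp add: c_def)
      have "c (head Q h) * A h = D h * c (tail Q h)" if h: "h \<in> arcs Q" for h
      proof -
        have t: "tail Q h \<in> verts Q" and hd: "head Q h \<in> verts Q" using h by auto
        show ?thesis
        proof (rule mat_eq_by_vec[OF mult_carrier_mat[OF Gac[OF c hd] Ac[OF h]] mult_carrier_mat[OF Dc[OF h] Gac[OF c t]]])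
          fix a :: "'k vec" assume a: "a \<in> carrier_vec (\<alpha> (tail Q h))"
          have Aa: "A h *\<^sub>v a \<in> carrier_vec (\<alpha> (head Q h))" by (rule mult_mat_vec_carrier[OF Ac[OF h] a])
          have \<eta>a: "\<eta> (tail Q h) (\<phi> (tail Q h) a) \<in> carrier (vsp N (tail Q h))"
            by (rule lhom_closed[OF lin_mapsD(1)[OF \<eta>l[OF t]] \<phi>_props(3)[OF t a]])
          have "(c (head Q h) * A h) *\<^sub>v a = \<psi>' (head Q h) (\<eta> (head Q h) (\<phi> (head Q h) (A h *\<^sub>v a)))"
            unfolding assoc_mult_mat_vec[OF Gac[OF c hd] Ac[OF h] a] by (rule ca[OF hd Aa])
          also have "\<eta> (head Q h) (\<phi> (head Q h) (A h *\<^sub>v a)) = vmap N h (\<eta> (tail Q h) (\<phi> (tail Q h) a))"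
            unfolding \<phi>_comm[OF h a] by (rule \<eta>c[OF h \<phi>_props(3)[OF t a]])
          also have "\<psi>' (head Q h) \<dots> = D h *\<^sub>v (c (tail Q h) *\<^sub>v a)"
            unfolding \<psi>'_comm[OF h \<eta>a] ca[OF t a] by (rule refl)
          also have "\<dots> = (D h * c (tail Q h)) *\<^sub>v a" by (rule assoc_mult_mat_vec[OF Dc[OF h] Gac[OF c t] a, symmetric])
          finally show "(c (head Q h) * A h) *\<^sub>v a = (D h * c (tail Q h)) *\<^sub>v a" .
        qed
      qed
      then have cI: "c \<in> Intertwiners" using c by (simp add: Intertwiners_def)
      have "\<Theta> c = \<eta>"
      proof (rule extensionalityI[of _ "verts Q"])
        fix i assume i: "i \<in> verts Q"
        show "\<Theta> c i = \<eta> i"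
        proof (rule extensionalityI[of _ "carrier (vsp M i)"])
          fix m assume m: "m \<in> carrier (vsp M i)"
          have \<eta>m: "\<eta> i m \<in> carrier (vsp N i)" by (rule lhom_closed[OF lin_mapsD(1)[OF \<eta>l[OF i]] m])
          show "\<Theta> c i m = \<eta> i m"
            using val[OF i \<phi>_props(4)[OF i m], of c]
            unfolding ca[OF i \<phi>_props(4)[OF i m]] \<phi>_props(6)[OF i m] \<psi>_props(6)[OF i \<eta>m] .
        qed (use i lin_mapsD(2)[OF \<eta>l[OF i]] in \<open>simp_all add: \<Theta>_def\<close>)
      qed (use \<eta>e in \<open>simp_all add: \<Theta>_def\<close>)
      then show "\<eta> \<in> \<Theta> ` Intertwiners" using cI by blast
    qed
  qed
  then show ?thesis by (rule bij_betw_same_card)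
qed

lemma card_Gauge: "card Gauge = CARD('k) ^ (\<Sum>i\<in>verts Q. \<alpha> i * \<beta> i)"
proof -
  have "card (carrier_mat m n :: 'k mat set) = CARD('k) ^ (n * m)" for m n
  proof -
    have "bij_betw (\<lambda>B. \<lambda>ij\<in>{..<m} \<times> {..<n}. B $$ ij) (carrier_mat m n :: 'k mat set) ({..<m} \<times> {..<n} \<rightarrow>\<^sub>E UNIV)"
      by (rule bij_betw_byWitness[where f' = "\<lambda>g. mat m n g"])
        (auto simp: fun_eq_iff PiE_def extensional_def restrict_def)
    then have "card (carrier_mat m n :: 'k mat set) = card ({..<m} \<times> {..<n} \<rightarrow>\<^sub>E (UNIV :: 'k set))"
      by (rule bij_betw_same_card)
    then show ?thesis by (simp add: card_PiE card_cartesian_product mult.commute)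
  qed
  then show ?thesis by (simp add: Gauge_def card_PiE power_sum)
qed

end

section \<open>Sums over subrepresentations\<close>

context quiver
begin

definition cdim :: "('i, 'h, 'k::{field,finite}) kQ_module set \<Rightarrow> 'i \<Rightarrow> nat" where
  "cdim c = dimv Q (representative c)"

lemma representative_isoclass:
  assumes c: "c \<in> isoclasses Q"
  shows "is_rep Q (representative c)" "mcl (representative c) = c"
proof -
  obtain M where M: "is_rep Q M" and cM: "c = isoclass Q M" using c by (auto simp: isoclasses_def)
  have "M \<in> c" using M rep_iso_refl[OF M] by (simp add: cM isoclass_def)
  then have r: "representative c \<in> c" unfolding representative_def by (rule someI)
  then show rep: "is_rep Q (representative c)" by (simp add: cM isoclass_def)
  have "rep_iso Q M (representative c)" using r by (simp add: cM isoclass_def)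
  then show "mcl (representative c) = c" using mcl_eq_iff[OF M rep] by (simp add: cM isoclass_mcl)
qed

lemma rep_iso_representative_iff:
  "c \<in> isoclasses Q \<Longrightarrow> is_rep Q M \<Longrightarrow> rep_iso Q M (representative c) \<longleftrightarrow> mcl M = c"
  using mcl_eq_iff[of M "representative c"] representative_isoclass[of c] by simp

lemma cdim_mcl: "is_rep Q M \<Longrightarrow> cdim (mcl M) = dimv Q M"
  unfolding cdim_def
  using dimv_iso[of M "representative (mcl M)"] representative_isoclass[OF mcl_isoclasses] rep_iso_representative_iff[OF mcl_isoclasses]
  by metis

lemma cdim_dimvecs: "cdim c \<in> dimvecs Q"
  unfolding cdim_def by (rule dimv_dimvecs)

lemma isoclass_has_point:
  assumes c: "c \<in> isoclasses Q"
  shows "\<exists>x\<in>rep_space_F Q (cdim c). mcl (module_of_point (cdim c) x) = c"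
proof -
  note r = representative_isoclass[OF c]
  obtain x where x: "x \<in> rep_space_F Q (cdim c)" "rep_iso Q (module_of_point (cdim c) x) (representative c)"
    using rep_has_point[OF r(1)] unfolding cdim_def by blast
  then show ?thesis using mcl_eq_iff[OF is_rep_module_of_point[OF x(1)] r(1)] r(2) by blast
qed

lemma finite_rep_space_F: "finite (rep_space_F Q \<alpha> :: ('h, 'k::{field,finite}) point set)"
proof (rule finite_subset)
  show "finite (\<Pi>\<^sub>E h\<in>arcs Q. ac_mat ` (carrier_mat (\<alpha> (head Q h)) (\<alpha> (tail Q h)) :: 'k mat set))"
    by (intro finite_PiE finite_imageI finite_carrier_mat) simp
  show "rep_space_F Q \<alpha> \<subseteq> (\<Pi>\<^sub>E h\<in>arcs Q. ac_mat ` (carrier_mat (\<alpha> (head Q h)) (\<alpha> (tail Q h)) :: 'k mat set))"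
  proof
    fix x :: "('h, 'k) point" assume x: "x \<in> rep_space_F Q \<alpha>"
    have "x h \<in> ac_mat ` carrier_mat (\<alpha> (head Q h)) (\<alpha> (tail Q h))" if h: "h \<in> arcs Q" for h
      using ac_of_point[OF x h] of_point_reps_over[OF x] h
      by (intro image_eqI[of _ _ "map_mat of_ac (x h)"]) (simp_all add: reps_over_def)
    moreover have "x \<in> extensional (arcs Q)" using x by (simp add: rep_space_F_def rep_space_def PiE_iff)
    ultimately show "x \<in> (\<Pi>\<^sub>E h\<in>arcs Q. ac_mat ` carrier_mat (\<alpha> (head Q h)) (\<alpha> (tail Q h)))" by (simp add: PiE_iff)
  qed
qed

lemma finite_isoclasses_cdim: "finite {c :: ('i, 'h, 'k::{field,finite}) kQ_module set. c \<in> isoclasses Q \<and> cdim c = \<gamma>}"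
proof (rule finite_subset)
  show "{c. c \<in> isoclasses Q \<and> cdim c = \<gamma>} \<subseteq>
      (\<lambda>x. mcl (module_of_point \<gamma> x)) ` (rep_space_F Q \<gamma> :: ('h, 'k) point set)"
    using isoclass_has_point by blast
qed (intro finite_imageI finite_rep_space_F)

lemma cdim_zero_unique:
  assumes c: "c \<in> isoclasses Q" "cdim c = 0" and d: "d \<in> isoclasses Q" "cdim d = 0"
  shows "c = d"
proof -
  obtain x where x: "x \<in> rep_space_F Q 0" "mcl (module_of_point 0 x) = c" using isoclass_has_point[OF c(1)] c(2) by auto
  obtain y where y: "y \<in> rep_space_F Q 0" "mcl (module_of_point 0 y) = d" using isoclass_has_point[OF d(1)] d(2) by auto
  have "x = y"
  proof (rule extensionalityI[of _ "arcs Q"])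
    fix h assume h: "h \<in> arcs Q"
    have "x h \<in> carrier_mat 0 0" "y h \<in> carrier_mat 0 0"
      using x(1) y(1) h by (auto simp: rep_space_F_def rep_space_def)
    then show "x h = y h" by (intro eq_matI) auto
  qed (use x y in \<open>auto simp: rep_space_F_def rep_space_def PiE_iff\<close>)
  then show ?thesis using x y by simp
qed

lemma is_rep_zero_rep: "is_rep Q (zero_rep :: ('i, 'h, 'k::field) kQ_module)"
  by (rule is_repI) (auto simp: zero_rep_def intro: lhomI)

lemma zero_class: "isoclass Q zero_rep \<in> isoclasses Q" "cdim (isoclass Q (zero_rep :: ('i, 'h, 'k::{field,finite}) kQ_module)) = 0"
proof -
  show "isoclass Q zero_rep \<in> isoclasses Q" using is_rep_zero_rep by (auto simp: isoclasses_def)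
  show "cdim (isoclass Q (zero_rep :: ('i, 'h, 'k) kQ_module)) = 0"
    unfolding isoclass_mcl cdim_mcl[OF is_rep_zero_rep] by (auto simp: dimv_def zero_rep_def fun_eq_iff)
qed

lemma eq_zero_class_iff: "c \<in> isoclasses Q \<Longrightarrow> c = isoclass Q zero_rep \<longleftrightarrow> cdim c = 0"
  using cdim_zero_unique zero_class by blast

lemma sum_subreps_iso:
  fixes H :: "('i, 'h, 'k::{field,finite}) kQ_module set \<Rightarrow> ('i, 'h, 'k) kQ_module set \<Rightarrow> 'c::comm_monoid_add"
    and L :: "('i, 'h, 'k, 'v) quiver_rep" and L' :: "('i, 'h, 'k, 'w) quiver_rep"
  assumes L: "is_rep Q L" and L': "is_rep Q L'" and iso: "rep_iso Q L L'"
  shows "(\<Sum>U\<in>subreps Q L. H (mcl (quot_rep Q L U)) (mcl (sub_rep L U))) =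
    (\<Sum>U\<in>subreps Q L'. H (mcl (quot_rep Q L' U)) (mcl (sub_rep L' U)))"
proof -
  obtain f where f: "is_iso L L' f" using iso by (auto simp: rep_iso_iff)
  have "mcl (quot_rep Q L U) = mcl (quot_rep Q L' (image_subrep f U))" if U: "U \<in> subreps Q L" for U
    using quot_rep_image_subrep[OF L L' f U]
      mcl_eq_iff[OF is_rep_quot_rep[OF L U] is_rep_quot_rep[OF L' image_subrep_subreps[OF L L' f U]]] by blast
  moreover have "mcl (sub_rep L U) = mcl (sub_rep L' (image_subrep f U))" if U: "U \<in> subreps Q L" for U
    using sub_rep_image_subrep[OF L L' f U]
      mcl_eq_iff[OF is_rep_sub_rep[OF L U] is_rep_sub_rep[OF L' image_subrep_subreps[OF L L' f U]]] by blast
  ultimately have "(\<Sum>U\<in>subreps Q L. H (mcl (quot_rep Q L U)) (mcl (sub_rep L U))) =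
      (\<Sum>U\<in>subreps Q L. (\<lambda>U. H (mcl (quot_rep Q L' U)) (mcl (sub_rep L' U))) (image_subrep f U))"
    by (intro sum.cong) simp_all
  also have "\<dots> = (\<Sum>U\<in>subreps Q L'. H (mcl (quot_rep Q L' U)) (mcl (sub_rep L' U)))"
    by (rule sum.reindex_bij_betw[OF bij_betw_image_subrep[OF L L' f]])
  finally show ?thesis .
qed

lemma sum_hall_numbers:
  fixes H :: "('i, 'h, 'k::{field,finite}) kQ_module set \<Rightarrow> ('i, 'h, 'k) kQ_module set \<Rightarrow> 'c::comm_semiring_1"
  assumes L: "is_rep Q L" and A: "finite A" "A \<subseteq> isoclasses Q" and B: "finite B" "B \<subseteq> isoclasses Q"
  shows "(\<Sum>a\<in>A. \<Sum>b\<in>B. H a b * of_nat (hall_number Q L (representative a) (representative b))) =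
    (\<Sum>U\<in>subreps Q L. if mcl (quot_rep Q L U) \<in> A \<and> mcl (sub_rep L U) \<in> B
       then H (mcl (quot_rep Q L U)) (mcl (sub_rep L U)) else 0)"
proof -
  let ?q = "\<lambda>U. mcl (quot_rep Q L U)" and ?s = "\<lambda>U. mcl (sub_rep L U)"
  have fin: "finite (subreps Q L)" by (rule finite_subreps[OF L])
  have hn: "of_nat (hall_number Q L (representative a) (representative b)) =
      (\<Sum>U\<in>subreps Q L. if ?q U = a \<and> ?s U = b then 1 else (0 :: 'c))" if "a \<in> A" "b \<in> B" for a b
  proof -
    have "a \<in> isoclasses Q" "b \<in> isoclasses Q" using A B that by auto
    then have "{U \<in> subreps Q L. rep_iso Q (sub_rep L U) (representative b) \<and> rep_iso Q (quot_rep Q L U) (representative a)}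
        = {U \<in> subreps Q L. ?q U = a \<and> ?s U = b}"
      using rep_iso_representative_iff[OF _ is_rep_sub_rep[OF L]] rep_iso_representative_iff[OF _ is_rep_quot_rep[OF L]]
      by blast
    then show ?thesis unfolding hall_number_def using fin by (simp add: sum.If_cases Int_def)
  qed
  have "(\<Sum>a\<in>A. \<Sum>b\<in>B. H a b * of_nat (hall_number Q L (representative a) (representative b))) =
      (\<Sum>a\<in>A. \<Sum>b\<in>B. \<Sum>U\<in>subreps Q L. if ?q U = a \<and> ?s U = b then H a b else 0)"
    by (intro sum.cong refl) (simp add: hn sum_distrib_left if_distrib[of "\<lambda>t. _ * t"] cong: if_cong)
  also have "\<dots> = (\<Sum>a\<in>A. \<Sum>U\<in>subreps Q L. \<Sum>b\<in>B. if ?q U = a \<and> ?s U = b then H a b else 0)"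
    by (rule sum.cong[OF refl sum.swap])
  also have "\<dots> = (\<Sum>U\<in>subreps Q L. \<Sum>a\<in>A. \<Sum>b\<in>B. if ?q U = a \<and> ?s U = b then H a b else 0)"
    by (rule sum.swap)
  also have "\<dots> = (\<Sum>U\<in>subreps Q L. if ?q U \<in> A \<and> ?s U \<in> B then H (?q U) (?s U) else 0)"
  proof (rule sum.cong[OF refl])
    fix U
    have "(\<Sum>a\<in>A. \<Sum>b\<in>B. if ?q U = a \<and> ?s U = b then H a b else 0) =
        (\<Sum>a\<in>A. if ?q U = a then (\<Sum>b\<in>B. if ?s U = b then H a b else 0) else 0)"
      by (intro sum.cong) auto
    then show "(\<Sum>a\<in>A. \<Sum>b\<in>B. if ?q U = a \<and> ?s U = b then H a b else 0) =
        (if ?q U \<in> A \<and> ?s U \<in> B then H (?q U) (?s U) else 0)"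
      using A(1) B(1) by (simp add: sum.delta' if_distrib cong: if_cong)
  qed
  finally show ?thesis .
qed

text \<open>Sorting the subrepresentations by their class and that of the quotient yields the Hall numbers.\<close>

lemma hall_mult_sum:
  assumes F: "F \<in> hall_space Q" and G: "G \<in> hall_space Q"
    and L: "is_rep Q (L :: ('i, 'h, 'k::{field,finite}, 'v) quiver_rep)"
  shows "hall_mult v Q F G (mcl L) = (\<Sum>U\<in>subreps Q L.
    v powi euler_form Q (dimv Q (quot_rep Q L U)) (dimv Q (sub_rep L U)) *
    (F (mcl (quot_rep Q L U)) * G (mcl (sub_rep L U))))"
proof -
  let ?c = "mcl L" and ?R = "representative (mcl L)"
  let ?H = "\<lambda>a b. F a * G b * v powi class_euler Q a b"
  have c: "?c \<in> isoclasses Q" by (rule mcl_isoclasses[OF L])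
  note R = representative_isoclass[OF c]
  have fin: "finite {a. F a \<noteq> 0}" "{a. F a \<noteq> 0} \<subseteq> isoclasses Q" "finite {b. G b \<noteq> 0}" "{b. G b \<noteq> 0} \<subseteq> isoclasses Q"
    using F G by (auto simp: hall_space_def)
  have "hall_mult v Q F G ?c = (\<Sum>a | F a \<noteq> 0. \<Sum>b | G b \<noteq> 0. ?H a b * of_nat (hall_number Q ?R (representative a) (representative b)))"
    using c by (simp add: hall_mult_def)
  also have "\<dots> = (\<Sum>U\<in>subreps Q ?R. ?H (mcl (quot_rep Q ?R U)) (mcl (sub_rep ?R U)))"
    unfolding sum_hall_numbers[OF R(1) fin] by (intro sum.cong) auto
  also have "\<dots> = (\<Sum>U\<in>subreps Q L. ?H (mcl (quot_rep Q L U)) (mcl (sub_rep L U)))"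
    by (rule sum_subreps_iso[OF R(1) L]) (use mcl_eq_iff[OF R(1) L] R(2) in blast)
  also have "\<dots> = (\<Sum>U\<in>subreps Q L. v powi euler_form Q (dimv Q (quot_rep Q L U)) (dimv Q (sub_rep L U)) *
    (F (mcl (quot_rep Q L U)) * G (mcl (sub_rep L U))))"
    by (intro sum.cong refl)
      (simp add: class_euler_def cdim_mcl is_rep_quot_rep[OF L] is_rep_sub_rep[OF L] flip: cdim_def)
  finally show ?thesis .
qed

section \<open>Counting filtrations\<close>

lemma rep_iso_cong:
  assumes "\<And>i. i \<in> verts Q \<Longrightarrow> vsp M i = vsp N i" "\<And>h. h \<in> arcs Q \<Longrightarrow> vmap M h = vmap N h"
  shows "rep_iso Q M L \<longleftrightarrow> rep_iso Q N L"
  unfolding rep_iso_iff is_iso_def using assms by (intro ex_cong1) (simp cong: ball_cong)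

definition whole :: "('i, 'h, 'k::field, 'v) quiver_rep \<Rightarrow> 'i \<Rightarrow> 'v set" where
  "whole N = (\<lambda>i\<in>verts Q. carrier (vsp N i))"

definition null :: "('i, 'h, 'k::field, 'v) quiver_rep \<Rightarrow> 'i \<Rightarrow> 'v set" where
  "null N = (\<lambda>i\<in>verts Q. {\<zero>\<^bsub>vsp N i\<^esub>})"

lemma whole_subreps: "is_rep Q N \<Longrightarrow> whole N \<in> subreps Q N"
  by (rule subrepsI)
    (auto simp: whole_def lsubspace_iff is_repD vs_zero_closed vs_add_closed vs_smult_closed vmap_closed)

lemma null_subreps:
  assumes N: "is_rep Q N"
  shows "null N \<in> subreps Q N"
proof (rule subrepsI)
  fix i assume i: "i \<in> verts Q"
  interpret V: vectorspace class_ring "vsp N i" by (rule is_repD(1)[OF N i])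
  show "lsubspace (null N i) (vsp N i)"
    using i V.vectorspace_axioms V.smult_r_null by (auto simp: null_def lsubspace_iff class_ring_simps)
next
  fix h v assume h: "h \<in> arcs Q" and "v \<in> null N (tail Q h)"
  then show "vmap N h v \<in> null N (head Q h)"
    using lhom_zero[OF is_repD(1)[OF N] is_repD(1)[OF N] is_repD(3)[OF N h]] by (simp add: null_def)
qed (simp add: null_def)

lemma subreps_sub_rep:
  assumes U: "U \<in> subreps Q N"
  shows "W \<in> subreps Q (sub_rep N U) \<longleftrightarrow> W \<in> subreps Q N \<and> (\<forall>i\<in>verts Q. W i \<subseteq> U i)"
proof -
  have "lsubspace (W i) (vsp (sub_rep N U) i) \<longleftrightarrow> lsubspace (W i) (vsp N i) \<and> W i \<subseteq> U i" if i: "i \<in> verts Q" for i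
    using subrepsD(1)[OF U i] lsubspace_is_vs[OF subrepsD(1)[OF U i]] by (auto simp: lsubspace_iff)
  then show ?thesis by (auto simp: subreps_def PiE_iff)
qed

lemma rep_iso_quot_null:
  assumes N: "is_rep Q N"
  shows "rep_iso Q (quot_rep Q N (null N)) N"
  by (rule rep_iso_quotI[OF N N null_subreps[OF N], where f = "\<lambda>i v. v"]) (auto intro: lhomI simp: null_def)

lemma filtrations_Nil:
  assumes N: "is_rep Q N"
  shows "filtrations Q N [] = (if dimv Q N = 0 then {[null N]} else {})"
proof -
  have "(\<forall>i\<in>verts Q. carrier (vsp N i) = {\<zero>\<^bsub>vsp N i\<^esub>}) \<longleftrightarrow> dimv Q N = 0"
  proof -
    have "carrier (vsp N i) = {\<zero>\<^bsub>vsp N i\<^esub>} \<longleftrightarrow> ldim (vsp N i) = 0" if i: "i \<in> verts Q" for i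
    proof
      note V = is_repD(1)[OF N i] and fd = is_repD(2)[OF N i]
      let ?K = "\<lambda>n. module_vec TYPE('a) n"
      obtain \<theta> where \<theta>: "\<theta> \<in> lin_isos (?K (ldim (vsp N i))) (vsp N i)" using coordinates_exist[OF V fd] by blast
      have im: "\<theta> ` carrier_vec (ldim (vsp N i)) = carrier (vsp N i)"
        using lin_isosD(3)[OF \<theta>] by (simp add: bij_betw_def module_vec_simps)
      {
        assume c: "carrier (vsp N i) = {\<zero>\<^bsub>vsp N i\<^esub>}"
        have f: "(\<lambda>_. \<zero>\<^bsub>vsp N i\<^esub>) \<in> lhom (?K 0) (vsp N i)"
          using V c vs_add_closed[OF V] vs_smult_closed[OF V] vs_zero_closed[OF V] by (intro lhomI) (auto simp: module_vec_simps)
        have "bij_betw (\<lambda>_ :: 'a vec. \<zero>\<^bsub>vsp N i\<^esub>) (carrier (?K 0)) (carrier (vsp N i))"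
          unfolding c using zero_carrier_vec[of 0, where 'a = 'a]
          by (auto simp: bij_betw_def inj_on_def module_vec_simps intro!: image_eqI[of _ _ "0\<^sub>v 0"])
        then show "ldim (vsp N i) = 0" using ldim_iso[OF _ _ V f] by simp
      next
        assume d: "ldim (vsp N i) = 0"
        have "carrier_vec 0 = {0\<^sub>v 0 :: 'a vec}" by auto
        then have "carrier (vsp N i) = {\<theta> (0\<^sub>v 0)}" using im unfolding d by (metis image_empty image_insert)
        then show "carrier (vsp N i) = {\<zero>\<^bsub>vsp N i\<^esub>}" using vs_zero_closed[OF V] by auto
      }
    qed
    then show ?thesis by (auto simp: dimv_def fun_eq_iff)
  qed
  moreover have "Xs = [null N]" if Xs: "Xs \<in> filtrations Q N []" for Xs
  proof -
    obtain W where W: "Xs = [W]" using Xs by (auto simp: filtrations_def length_Suc_conv)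
    then have "W \<in> extensional (verts Q)" "\<forall>j\<in>verts Q. W j = {\<zero>\<^bsub>vsp N j\<^esub>}"
      using Xs subrepsD(4) by (auto simp: filtrations_def)
    then have "W = null N" by (intro extensionalityI[of _ "verts Q"]) (auto simp: null_def)
    then show ?thesis using W by simp
  qed
  moreover have "[null N] \<in> filtrations Q N [] \<longleftrightarrow> (\<forall>i\<in>verts Q. carrier (vsp N i) = {\<zero>\<^bsub>vsp N i\<^esub>})"
    using null_subreps[OF N] by (auto simp: filtrations_def null_def)
  ultimately show ?thesis by auto
qed

text \<open>Removing the top step of a filtration leaves a filtration of its largest proper member.\<close>

lemma filtrations_Cons:
  assumes N: "is_rep Q N"
  shows "filtrations Q N (M # Ms) = (\<lambda>(U, Ys). Ys @ [whole N]) `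
    (SIGMA U : {U \<in> subreps Q N. rep_iso Q (quot_rep Q N U) M}. filtrations Q (sub_rep N U) Ms)"
proof -
  let ?r = "length Ms"
  have quot_top: "rep_iso Q (quot_rep Q (sub_rep N (whole N)) U) M \<longleftrightarrow> rep_iso Q (quot_rep Q N U) M" for U
  proof (rule rep_iso_cong)
    have v: "vsp (sub_rep N (whole N)) i = vsp N i" if "i \<in> verts Q" for i
      using that by (simp add: whole_def)
    show "vsp (quot_rep Q (sub_rep N (whole N)) U) i = vsp (quot_rep Q N U) i" if "i \<in> verts Q" for i
      using v[OF that] by simp
    show "vmap (quot_rep Q (sub_rep N (whole N)) U) h = vmap (quot_rep Q N U) h" if "h \<in> arcs Q" for h
      using v[of "head Q h"] that by (simp add: quot_rep_def)
  qed
  have step: "Ys @ [whole N] \<in> filtrations Q N (M # Ms)"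
    if U: "U \<in> subreps Q N" "rep_iso Q (quot_rep Q N U) M" and Ys: "Ys \<in> filtrations Q (sub_rep N U) Ms" for U Ys
  proof -
    have len: "length Ys = Suc ?r" and sub: "set Ys \<subseteq> subreps Q (sub_rep N U)"
      and ends: "\<And>j. j \<in> verts Q \<Longrightarrow> (Ys ! 0) j = {\<zero>\<^bsub>vsp N j\<^esub>} \<and> (Ys ! ?r) j = U j"
      and mono: "\<And>i j. i < ?r \<Longrightarrow> j \<in> verts Q \<Longrightarrow> (Ys ! i) j \<subseteq> (Ys ! Suc i) j"
      and quot: "\<And>i. i < ?r \<Longrightarrow> rep_iso Q (quot_rep Q (sub_rep N (Ys ! Suc i)) (Ys ! i)) (Ms ! (?r - i - 1))"
      using Ys by (auto simp: filtrations_def)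
    have last: "Ys ! ?r = U"
    proof (rule extensionalityI[of _ "verts Q"])
      have "Ys ! ?r \<in> subreps Q (sub_rep N U)" using sub len by (metis lessI nth_mem subsetD)
      then show "Ys ! ?r \<in> extensional (verts Q)" by (rule subrepsD(4))
    qed (use ends subrepsD(4)[OF U(1)] in auto)
    show ?thesis
      unfolding filtrations_def
    proof (intro CollectI conjI allI ballI impI)
      show "length (Ys @ [whole N]) = Suc (length (M # Ms))" using len by simp
      show "set (Ys @ [whole N]) \<subseteq> subreps Q N" using sub whole_subreps[OF N] subreps_sub_rep[OF U(1)] by auto
      fix j assume j: "j \<in> verts Q"
      show "((Ys @ [whole N]) ! 0) j = {\<zero>\<^bsub>vsp N j\<^esub>}" using len ends[OF j] by (simp add: nth_append)
      show "((Ys @ [whole N]) ! length (M # Ms)) j = carrier (vsp N j)" using len j by (simp add: nth_append whole_def)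
    next
      fix i j assume i: "i < length (M # Ms)" and j: "j \<in> verts Q"
      show "((Ys @ [whole N]) ! i) j \<subseteq> ((Ys @ [whole N]) ! Suc i) j"
        using i j len mono[of i j] last subrepsD(2)[OF U(1) j] by (auto simp: nth_append whole_def less_Suc_eq)
    next
      fix i assume i: "i < length (M # Ms)"
      show "rep_iso Q (quot_rep Q (sub_rep N ((Ys @ [whole N]) ! Suc i)) ((Ys @ [whole N]) ! i)) ((M # Ms) ! (length (M # Ms) - i - 1))"
      proof (cases "i = ?r")
        case True
        then show ?thesis using len last quot_top U(2) by (simp add: nth_append)
      next
        case False
        then have "i < ?r" using i by simp
        then have "(M # Ms) ! (length (M # Ms) - i - 1) = Ms ! (?r - i - 1)"
          using nth_Cons_pos[of "?r - i" M Ms] by (simp del: nth_Cons_pos)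
        then show ?thesis using quot[OF \<open>i < ?r\<close>] \<open>i < ?r\<close> len by (simp add: nth_append)
      qed
    qed
  qed
  have split: "\<exists>U Ys. Xs = Ys @ [whole N] \<and> U \<in> subreps Q N \<and> rep_iso Q (quot_rep Q N U) M \<and> Ys \<in> filtrations Q (sub_rep N U) Ms"
    if Xs: "Xs \<in> filtrations Q N (M # Ms)" for Xs
  proof -
    have len: "length Xs = Suc (Suc ?r)" and sub: "set Xs \<subseteq> subreps Q N"
      and ends: "\<And>j. j \<in> verts Q \<Longrightarrow> (Xs ! 0) j = {\<zero>\<^bsub>vsp N j\<^esub>} \<and> (Xs ! Suc ?r) j = carrier (vsp N j)"
      and mono: "\<And>i j. i < Suc ?r \<Longrightarrow> j \<in> verts Q \<Longrightarrow> (Xs ! i) j \<subseteq> (Xs ! Suc i) j"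
      and quot: "\<And>i. i < Suc ?r \<Longrightarrow> rep_iso Q (quot_rep Q (sub_rep N (Xs ! Suc i)) (Xs ! i)) ((M # Ms) ! (Suc ?r - i - 1))"
      using Xs by (auto simp: filtrations_def)
    have mem: "Xs ! i \<in> subreps Q N" if "i \<le> Suc ?r" for i using sub len that by (simp add: subset_iff)
    define U where "U = Xs ! ?r"
    have U: "U \<in> subreps Q N" unfolding U_def by (rule mem) simp
    have top: "Xs ! Suc ?r = whole N"
      by (rule extensionalityI[of _ "verts Q"]) (use ends subrepsD(4)[OF mem] in \<open>auto simp: whole_def\<close>)
    define Ys where "Ys = take (Suc ?r) Xs"
    have Ys_nth: "Ys ! i = Xs ! i" if "i \<le> ?r" for i using that by (simp add: Ys_def)
    have XsYs: "Xs = Ys @ [whole N]"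
      using len take_Suc_conv_app_nth[of "Suc ?r" Xs] by (simp add: Ys_def top)
    have le_U: "(Xs ! i) j \<subseteq> U j" if "i \<le> ?r" "j \<in> verts Q" for i j
      using that(1)
    proof (induction i rule: inc_induct)
      case (step n)
      then show ?case using mono[of n j] that(2) by force
    qed (simp add: U_def)
    have "Ys \<in> filtrations Q (sub_rep N U) Ms"
      unfolding filtrations_def
    proof (intro CollectI conjI allI ballI impI)
      show "length Ys = Suc ?r" using len by (simp add: Ys_def)
      show "set Ys \<subseteq> subreps Q (sub_rep N U)"
      proof
        fix W assume "W \<in> set Ys"
        then obtain i where "i < length Ys" "W = Ys ! i" by (auto simp: in_set_conv_nth)
        then have "i \<le> ?r" "W = Xs ! i" using len Ys_nth by (auto simp: Ys_def)
        then show "W \<in> subreps Q (sub_rep N U)" using mem le_U by (simp add: subreps_sub_rep[OF U])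
      qed
      fix j assume j: "j \<in> verts Q"
      show "(Ys ! 0) j = {\<zero>\<^bsub>vsp (sub_rep N U) j\<^esub>}" "(Ys ! ?r) j = carrier (vsp (sub_rep N U) j)"
        using ends[OF j] by (simp_all add: Ys_nth U_def)
    next
      fix i j assume "i < ?r" "j \<in> verts Q"
      then show "(Ys ! i) j \<subseteq> (Ys ! Suc i) j" using mono[of i j] by (simp add: Ys_nth)
    next
      fix i assume i: "i < ?r"
      then have "(M # Ms) ! (Suc ?r - i - 1) = Ms ! (?r - i - 1)"
        using nth_Cons_pos[of "?r - i" M Ms] by (simp del: nth_Cons_pos)
      then show "rep_iso Q (quot_rep Q (sub_rep (sub_rep N U) (Ys ! Suc i)) (Ys ! i)) (Ms ! (?r - i - 1))"
        using quot[of i] i by (simp add: Ys_nth)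
    qed
    moreover have "rep_iso Q (quot_rep Q N U) M" using quot[of ?r] by (simp add: top quot_top U_def)
    ultimately show ?thesis using XsYs U by blast
  qed
  show ?thesis using step split by fastforce
qed

lemma finite_filtrations: "is_rep Q N \<Longrightarrow> finite (filtrations Q (N :: ('i, 'h, 'k::{field,finite}) kQ_module) Ms)"
  by (rule finite_subset[OF _ finite_lists_length_eq[OF finite_subreps, of N "Suc (length Ms)"]])
    (auto simp: filtrations_def)

definition filt :: "('i, 'h, 'k::{field,finite}) kQ_module \<Rightarrow> ('i, 'h, 'k) kQ_module set list \<Rightarrow> nat" where
  "filt N as = card (filtrations Q N (map representative as))"

lemma filt_Nil: "is_rep Q N \<Longrightarrow> filt N [] = (if dimv Q N = 0 then 1 else 0)"
  by (simp add: filt_def filtrations_Nil)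

lemma filt_Cons:
  assumes N: "is_rep Q N" and a: "a \<in> isoclasses Q"
  shows "filt N (a # as) = (\<Sum>U\<in>subreps Q N. if mcl (quot_rep Q N U) = a then filt (sub_rep N U) as else 0)"
proof -
  let ?S = "{U \<in> subreps Q N. rep_iso Q (quot_rep Q N U) (representative a)}"
  let ?F = "\<lambda>U. filtrations Q (sub_rep N U) (map representative as)"
  have "inj_on (\<lambda>(U, Ys). Ys @ [whole N]) (SIGMA U : ?S. ?F U)"
  proof (rule inj_onI)
    fix p p' assume "p \<in> (SIGMA U : ?S. ?F U)" "p' \<in> (SIGMA U : ?S. ?F U)"
      and eq0: "(case p of (U, Ys) \<Rightarrow> Ys @ [whole N]) = (case p' of (U, Ys) \<Rightarrow> Ys @ [whole N])"
    then obtain U Ys U' Ys' where p: "p = (U, Ys)" "p' = (U', Ys')" and Ys: "Ys \<in> ?F U" and Ys': "Ys' \<in> ?F U'"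
      and U: "U \<in> subreps Q N" and U': "U' \<in> subreps Q N" by blast
    have eq: "Ys = Ys'" using eq0 by (simp add: p)
    have "U = U'"
    proof (rule extensionalityI[of _ "verts Q"])
      fix j assume "j \<in> verts Q"
      then show "U j = U' j" using Ys Ys' eq by (auto simp: filtrations_def)
    qed (use subrepsD(4)[OF U] subrepsD(4)[OF U'] in auto)
    then show "p = p'" using eq by (simp add: p)
  qed
  then have "filt N (a # as) = card (SIGMA U : ?S. ?F U)"
    unfolding filt_def by (simp add: filtrations_Cons[OF N] card_image)
  also have "\<dots> = (\<Sum>U\<in>?S. filt (sub_rep N U) as)"
    unfolding filt_def
    by (rule card_SigmaI) (use finite_subreps[OF N] finite_filtrations[OF is_rep_sub_rep[OF N]] in auto)
  also have "?S = {U \<in> subreps Q N. mcl (quot_rep Q N U) = a}"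
    using rep_iso_representative_iff[OF a is_rep_quot_rep[OF N]] by blast
  also have "(\<Sum>U\<in>{U \<in> subreps Q N. mcl (quot_rep Q N U) = a}. filt (sub_rep N U) as) =
      (\<Sum>U\<in>subreps Q N. if mcl (quot_rep Q N U) = a then filt (sub_rep N U) as else 0)"
    by (rule sum.inter_filter[OF finite_subreps[OF N]])
  finally show ?thesis .
qed

lemma filt_mcl:
  fixes N :: "('i, 'h, 'k::{field,finite}) kQ_module"
  assumes N: "is_rep Q N" and as: "set as \<subseteq> isoclasses Q"
  shows "filt N as = filt (representative (mcl N)) as"
proof -
  have "filt N as = filt N' as" if "is_rep Q N" "is_rep Q N'" "rep_iso Q N N'" for N N' :: "('i, 'h, 'k) kQ_module"
    using that as
  proof (induction as arbitrary: N N')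
    case Nil
    then show ?case using dimv_iso[OF Nil.prems(1,2,3)] by (simp add: filt_Nil)
  next
    case (Cons a as)
    let ?H = "\<lambda>c d. if c = a then filt (representative d) as else 0"
    have a: "a \<in> isoclasses Q" and as: "set as \<subseteq> isoclasses Q" using Cons.prems by auto
    have *: "filt L (a # as) = (\<Sum>U\<in>subreps Q L. ?H (mcl (quot_rep Q L U)) (mcl (sub_rep L U)))"
      if L: "is_rep Q L" for L :: "('i, 'h, 'k) kQ_module"
    proof -
      have "filt (sub_rep L U) as = filt (representative (mcl (sub_rep L U))) as" if U: "U \<in> subreps Q L" for U
      proof (rule Cons.IH[OF is_rep_sub_rep[OF L U] _ _ as])
        note c = mcl_isoclasses[OF is_rep_sub_rep[OF L U]]
        show "is_rep Q (representative (mcl (sub_rep L U)))" by (rule representative_isoclass(1)[OF c])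
        show "rep_iso Q (sub_rep L U) (representative (mcl (sub_rep L U)))"
          using rep_iso_representative_iff[OF c is_rep_sub_rep[OF L U]] by blast
      qed
      then show ?thesis unfolding filt_Cons[OF L a] by (intro sum.cong) auto
    qed
    show ?case unfolding *[OF Cons.prems(1)] *[OF Cons.prems(2)] by (rule sum_subreps_iso[OF Cons.prems(1-3)])
  qed
  note c = mcl_isoclasses[OF N]
  show ?thesis
    using \<open>\<And>N' N. is_rep Q N \<Longrightarrow> is_rep Q N' \<Longrightarrow> rep_iso Q N N' \<Longrightarrow> filt N as = filt N' as\<close>[OF N representative_isoclass(1)[OF c]]
      rep_iso_representative_iff[OF c N] by blast
qed

lemma filt_nonzero_dim:
  assumes "is_rep Q N" "set as \<subseteq> isoclasses Q" "filt N as \<noteq> 0"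
  shows "sum_list (map cdim as) = dimv Q N"
  using assms
proof (induction as arbitrary: N)
  case Nil
  then show ?case by (simp add: filt_Nil zero_fun_def split: if_splits)
next
  case (Cons a as)
  have "a \<in> isoclasses Q" using Cons.prems by simp
  then have "(\<Sum>U\<in>subreps Q N. if mcl (quot_rep Q N U) = a then filt (sub_rep N U) as else 0) \<noteq> 0"
    using Cons.prems(3) filt_Cons[OF Cons.prems(1)] by simp
  then obtain U where U: "U \<in> subreps Q N" "(if mcl (quot_rep Q N U) = a then filt (sub_rep N U) as else 0) \<noteq> 0"
    by (rule sum.not_neutral_contains_not_neutral)
  then have U: "U \<in> subreps Q N" "mcl (quot_rep Q N U) = a" "filt (sub_rep N U) as \<noteq> 0"
    by (simp_all split: if_splits)
  have "sum_list (map cdim as) = dimv Q (sub_rep N U)"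
    using Cons.IH[OF is_rep_sub_rep[OF Cons.prems(1) U(1)] _ U(3)] Cons.prems(2) by simp
  moreover have "cdim a = dimv Q (quot_rep Q N U)"
    using cdim_mcl[OF is_rep_quot_rep[OF Cons.prems(1) U(1)]] U(2) by simp
  ultimately show ?case using dimv_sub_quot[OF Cons.prems(1) U(1)] by simp
qed

end

section \<open>The comultiplication as a count of block matrices\<close>

context block_extensions
begin

lemma mcl_mid_cong:
  assumes "ext_class w = ext_class w'" "w \<in> Blocks" "w' \<in> Blocks"
  shows "mcl (mid w) = mcl (mid w')"
proof -
  have "(ext_of w, ext_of w') \<in> ext_equiv Q M N"
    using assms eq_equiv_class_iff[OF equiv_ext_equiv ext_of_extensions[OF assms(2)] ext_of_extensions[OF assms(3)]]
    unfolding ext_class_def by blast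
  then obtain \<theta> where "is_iso (mid w) (mid w') \<theta>" unfolding ext_of_def by (rule ext_equivD)
  then show ?thesis using mcl_eq_iff[OF is_rep_mid is_rep_mid] rep_iso_iff by blast
qed

lemma Ext1_middle_eq:
  assumes L: "is_rep Q L"
  shows "Ext1_middle Q M N L = ext_class ` {w \<in> Blocks. mcl (mid w) = mcl L}"
proof -
  have "(\<exists>(E, f, g)\<in>ext_class w. rep_iso Q E L) \<longleftrightarrow> mcl (mid w) = mcl L" if w: "w \<in> Blocks" for w
  proof
    assume "\<exists>(E, f, g)\<in>ext_class w. rep_iso Q E L"
    then obtain E f g where E: "(ext_of w, (E, f, g)) \<in> ext_equiv Q M N" and L': "rep_iso Q E L"
      unfolding ext_class_def by blast
    then obtain \<theta> where ext: "(E, f, g) \<in> extensions Q M N" and "is_iso (mid w) E \<theta>"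
      unfolding ext_of_def by (metis ext_equivD)
    then have "rep_iso Q (mid w) E" unfolding rep_iso_iff by blast
    then have "rep_iso Q (mid w) L" using rep_iso_trans[OF is_rep_mid _ L'] by blast
    then show "mcl (mid w) = mcl L" using mcl_eq_iff[OF is_rep_mid L] by blast
  next
    assume "mcl (mid w) = mcl L"
    then have "rep_iso Q (mid w) L" using mcl_eq_iff[OF is_rep_mid L] by blast
    moreover have "ext_of w \<in> ext_class w"
      unfolding ext_class_def by (rule equiv_class_self[OF equiv_ext_equiv ext_of_extensions[OF w]])
    ultimately show "\<exists>(E, f, g)\<in>ext_class w. rep_iso Q E L" unfolding ext_of_def by blast
  qed
  then show ?thesis unfolding Ext1_middle_def Ext1_eq by blast
qed

text \<open>All extension classes are represented by the same number of blocks.\<close>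

lemma card_middle:
  assumes L: "is_rep Q L"
  shows "card {w \<in> Blocks. mcl (mid w) = mcl L} * card (rep_hom Q M N) = card Gauge * card (Ext1_middle Q M N L)"
proof -
  let ?S = "{w \<in> Blocks. mcl (mid w) = mcl L}"
  have fin: "finite ?S" using finite_Blocks by simp
  have "card ?S = (\<Sum>\<xi>\<in>ext_class ` ?S. card {w \<in> ?S. ext_class w = \<xi>})"
    using sum.image_gen[OF fin, of "\<lambda>_. 1 :: nat" ext_class] by simp
  then have "card ?S * card (rep_hom Q M N) = (\<Sum>\<xi>\<in>ext_class ` ?S. card {w \<in> ?S. ext_class w = \<xi>} * card Intertwiners)"
    by (simp add: sum_distrib_right card_Intertwiners)
  also have "\<dots> = (\<Sum>\<xi>\<in>ext_class ` ?S. card Gauge)"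
  proof (rule sum.cong[OF refl])
    fix \<xi> assume "\<xi> \<in> ext_class ` ?S"
    then obtain w where w: "w \<in> Blocks" "mcl (mid w) = mcl L" "\<xi> = ext_class w" by blast
    have "{w' \<in> ?S. ext_class w' = \<xi>} = {w' \<in> Blocks. ext_class w' = ext_class w}"
      using mcl_mid_cong[OF _ _ w(1)] w by auto
    then show "card {w' \<in> ?S. ext_class w' = \<xi>} * card Intertwiners = card Gauge"
      using card_ext_class_fibre[OF w(1)] by simp
  qed
  finally show ?thesis by (simp add: Ext1_middle_eq[OF L] mult.commute)
qed

lemma Blocks_nonempty: "Blocks \<noteq> {}"
  unfolding Blocks_def by (auto simp: PiE_eq_empty_iff)

lemma h_number_eq:
  assumes L: "is_rep Q L"
  shows "h_number Q L M N = of_nat (card {w \<in> Blocks. mcl (mid w) = mcl L}) / of_nat (card Gauge)"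
proof -
  have G: "card Gauge \<noteq> 0" using finite_Gauge Gauge_nonempty by simp
  obtain w where "w \<in> Blocks" using Blocks_nonempty by blast
  then have H: "card (rep_hom Q M N) \<noteq> 0"
    using card_ext_class_fibre[of w] G unfolding card_Intertwiners by (metis mult_0_right)
  have "complex_of_nat (card {w \<in> Blocks. mcl (mid w) = mcl L}) * of_nat (card (rep_hom Q M N)) =
      of_nat (card Gauge) * of_nat (card (Ext1_middle Q M N L))"
    using arg_cong[OF card_middle[OF L], of complex_of_nat] by (simp only: of_nat_mult)
  then show ?thesis using G H unfolding h_number_def by (simp add: field_simps)
qed

lemma dimv_mid: "\<alpha> \<in> dimvecs Q \<Longrightarrow> \<beta> \<in> dimvecs Q \<Longrightarrow> dimv Q (mid w) = \<alpha> + \<beta>"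
  unfolding mid_def by (rule dimv_point_rep) (auto simp: dimvecs_def)

lemma sum_h_number:
  assumes F: "F \<in> hall_space Q"
  shows "(\<Sum>c | F c \<noteq> 0. F c * h_number Q (representative c) M N) =
    (\<Sum>w\<in>Blocks. F (mcl (mid w))) / of_nat (card Gauge)"
proof -
  have fin: "finite {c. F c \<noteq> 0}" and sub: "{c. F c \<noteq> 0} \<subseteq> isoclasses Q" using F by (auto simp: hall_space_def)
  have "(\<Sum>c | F c \<noteq> 0. F c * h_number Q (representative c) M N) =
      (\<Sum>c | F c \<noteq> 0. (\<Sum>w\<in>Blocks. if mcl (mid w) = c then F c else 0) / of_nat (card Gauge))"
  proof (rule sum.cong[OF refl])
    fix c assume "c \<in> {c. F c \<noteq> 0}"
    then have c: "c \<in> isoclasses Q" using sub by blast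
    have "(\<Sum>w\<in>Blocks. if mcl (mid w) = c then F c else 0) = of_nat (card {w \<in> Blocks. mcl (mid w) = c}) * F c"
      using finite_Blocks by (simp add: sum.If_cases Int_def)
    then show "F c * h_number Q (representative c) M N = (\<Sum>w\<in>Blocks. if mcl (mid w) = c then F c else 0) / of_nat (card Gauge)"
      using h_number_eq[OF representative_isoclass(1)[OF c]] representative_isoclass(2)[OF c] by simp
  qed
  also have "\<dots> = (\<Sum>w\<in>Blocks. \<Sum>c | F c \<noteq> 0. if mcl (mid w) = c then F c else 0) / of_nat (card Gauge)"
    unfolding sum_divide_distrib[symmetric] by (subst sum.swap) (rule refl)
  also have "(\<Sum>w\<in>Blocks. \<Sum>c | F c \<noteq> 0. if mcl (mid w) = c then F c else 0) = (\<Sum>w\<in>Blocks. F (mcl (mid w)))"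
    using fin by (intro sum.cong refl) (simp add: sum.delta')
  finally show ?thesis .
qed

definition block_point :: "('h \<Rightarrow> 'k mat) \<Rightarrow> ('h, 'k) point" where
  "block_point w = (\<lambda>h\<in>arcs Q. ac_mat (block_mat (A h) (w h) (D h)))"

lemma block_point_rep_space: "block_point w \<in> rep_space_F Q (\<alpha> + \<beta>)"
  unfolding block_point_def by (rule point_of_reps_over(1)[OF mid_reps_over])

lemma mcl_block_point: "mcl (module_of_point (\<alpha> + \<beta>) (block_point w)) = mcl (mid w)"
  using point_of_reps_over(2)[OF mid_reps_over] mcl_eq_iff[OF is_rep_module_of_point[OF block_point_rep_space] is_rep_mid]
  unfolding block_point_def mid_def by blast

lemma block_mat_index:
  assumes "h \<in> arcs Q" "w \<in> Blocks" "i < \<alpha> (head Q h) + \<beta> (head Q h)" "j < \<alpha> (tail Q h) + \<beta> (tail Q h)"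
  shows "block_mat (A h) (w h) (D h) $$ (i, j) =
    (if i < \<alpha> (head Q h) then if j < \<alpha> (tail Q h) then A h $$ (i, j) else 0
     else if j < \<alpha> (tail Q h) then w h $$ (i - \<alpha> (head Q h), j) else D h $$ (i - \<alpha> (head Q h), j - \<alpha> (tail Q h)))"
  using assms Ac[OF assms(1)] Dc[OF assms(1)] by (auto simp: block_mat_def)

lemma std_flag_iff:
  "i \<in> verts Q \<Longrightarrow> v \<in> std_flag Q \<alpha> \<beta> i \<longleftrightarrow> (v :: 'b::field alg_closure vec) \<in> carrier_vec (\<alpha> i + \<beta> i) \<and> (\<forall>j<\<alpha> i. v $ j = 0)"
  by (simp add: std_flag_def)

text \<open>A point stabilises the standard flag iff it is block lower triangular, and \<open>\<kappa>\<close> reads off the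
  diagonal blocks.\<close>

lemma bij_betw_block_point:
  assumes x: "x \<in> rep_space_F Q \<alpha>" and y: "y \<in> rep_space_F Q \<beta>"
    and Ax: "\<And>h. h \<in> arcs Q \<Longrightarrow> x h = ac_mat (A h)" and Dy: "\<And>h. h \<in> arcs Q \<Longrightarrow> y h = ac_mat (D h)"
  shows "bij_betw block_point Blocks {z \<in> stab_space_F Q \<alpha> \<beta>. kappa Q \<alpha> \<beta> z = (x, y)}"
  unfolding bij_betw_def
proof
  have idx: "block_point w h $$ (i, j) = to_ac (block_mat (A h) (w h) (D h) $$ (i, j))"
    if "h \<in> arcs Q" "i < \<alpha> (head Q h) + \<beta> (head Q h)" "j < \<alpha> (tail Q h) + \<beta> (tail Q h)" for w h i j
    using that block_mat_carrier[OF Ac[OF that(1)] Dc[OF that(1)], of "w h"] by (simp add: block_point_def)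
  show "inj_on block_point Blocks"
  proof (rule inj_onI)
    fix w w' assume w: "w \<in> Blocks" and w': "w' \<in> Blocks" and eq: "block_point w = block_point w'"
    show "w = w'"
    proof (rule extensionalityI[of _ "arcs Q"])
      fix h assume h: "h \<in> arcs Q"
      show "w h = w' h"
      proof (rule eq_matI)
        fix i j assume "i < dim_row (w' h)" "j < dim_col (w' h)"
        then have i: "\<alpha> (head Q h) + i < \<alpha> (head Q h) + \<beta> (head Q h)" and j: "j < \<alpha> (tail Q h)"
          using Blc[OF w' h] by auto
        have j': "j < \<alpha> (tail Q h) + \<beta> (tail Q h)" using j by simp
        have "to_ac (block_mat (A h) (w h) (D h) $$ (\<alpha> (head Q h) + i, j)) =
            to_ac (block_mat (A h) (w' h) (D h) $$ (\<alpha> (head Q h) + i, j))"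
          using idx[OF h i j', of w] idx[OF h i j', of w'] eq by simp
        then show "w h $$ (i, j) = w' h $$ (i, j)"
          using block_mat_index[OF h w i j'] block_mat_index[OF h w' i j'] j by simp
      qed (use Blc[OF w h] Blc[OF w' h] in auto)
    qed (use w w' in \<open>auto simp: Blocks_def PiE_iff\<close>)
  qed
  show "block_point ` Blocks = {z \<in> stab_space_F Q \<alpha> \<beta>. kappa Q \<alpha> \<beta> z = (x, y)}"
  proof (intro equalityI subsetI)
    fix z assume "z \<in> block_point ` Blocks"
    then obtain w where w: "w \<in> Blocks" and z: "z = block_point w" by blast
    have zF: "z \<in> rep_space_F Q (\<alpha> + \<beta>)" unfolding z by (rule block_point_rep_space)
    have zc: "z h \<in> carrier_mat (\<alpha> (head Q h) + \<beta> (head Q h)) (\<alpha> (tail Q h) + \<beta> (tail Q h))" if "h \<in> arcs Q" for h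
      using zF that by (auto simp: rep_space_F_def rep_space_def)
    have "std_flag Q \<alpha> \<beta> \<in> subreps Q (point_rep (\<alpha> + \<beta>) z)"
    proof (rule subrepsI)
      fix i assume i: "i \<in> verts Q"
      show "lsubspace (std_flag Q \<alpha> \<beta> i) (vsp (point_rep (\<alpha> + \<beta>) z) i)"
        by (auto simp: lsubspace_iff std_flag_iff[OF i] module_vec_simps)
    next
      fix h and v :: "'k alg_closure vec" assume h: "h \<in> arcs Q" and "v \<in> std_flag Q \<alpha> \<beta> (tail Q h)"
      then have v: "v \<in> carrier_vec (\<alpha> (tail Q h) + \<beta> (tail Q h))" and v0: "\<And>j. j < \<alpha> (tail Q h) \<Longrightarrow> v $ j = 0"
        using std_flag_iff[of "tail Q h" v] by auto
      have "(z h *\<^sub>v v) $ i = 0" if i: "i < \<alpha> (head Q h)" for i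
      proof -
        have "z h $$ (i, j) * v $ j = 0" if j: "j < \<alpha> (tail Q h) + \<beta> (tail Q h)" for j
          using idx[OF h _ j, of i w] block_mat_index[OF h w _ j, of i] i v0[of j] by (cases "j < \<alpha> (tail Q h)") (simp_all add: z)
        then have "(\<Sum>j = 0..<\<alpha> (tail Q h) + \<beta> (tail Q h). z h $$ (i, j) * v $ j) = 0"
          by (intro sum.neutral) simp
        then show ?thesis using zc[OF h] v i by (simp add: scalar_prod_def)
      qed
      then show "vmap (point_rep (\<alpha> + \<beta>) z) h v \<in> std_flag Q \<alpha> \<beta> (head Q h)"
        using h mult_mat_vec_carrier[OF zc[OF h] v] std_flag_iff[of "head Q h" "z h *\<^sub>v v"] by simp
    qed (simp add: std_flag_def)
    then have "z \<in> stab_space_F Q \<alpha> \<beta>" using zF by (simp add: stab_space_F_def)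
    moreover have "(\<lambda>h\<in>arcs Q. mat (\<alpha> (head Q h)) (\<alpha> (tail Q h)) (\<lambda>(r, c). z h $$ (r, c))) = x"
    proof (rule extensionalityI[of _ "arcs Q"])
      fix h assume h: "h \<in> arcs Q"
      show "(\<lambda>h\<in>arcs Q. mat (\<alpha> (head Q h)) (\<alpha> (tail Q h)) (\<lambda>(r, c). z h $$ (r, c))) h = x h"
        unfolding restrict_apply'[OF h] Ax[OF h]
      proof (rule eq_matI)
        fix i j assume "i < dim_row (ac_mat (A h))" "j < dim_col (ac_mat (A h))"
        then have i: "i < \<alpha> (head Q h)" and j: "j < \<alpha> (tail Q h)" using Ac[OF h] by auto
        then show "mat (\<alpha> (head Q h)) (\<alpha> (tail Q h)) (\<lambda>(r, c). z h $$ (r, c)) $$ (i, j) = ac_mat (A h) $$ (i, j)"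
          using idx[OF h, of i j w] block_mat_index[OF h w, of i j] Ac[OF h] by (simp add: z)
      qed (use Ac[OF h] in auto)
    qed (use x in \<open>auto simp: rep_space_F_def rep_space_def PiE_iff\<close>)
    moreover have "(\<lambda>h\<in>arcs Q. mat (\<beta> (head Q h)) (\<beta> (tail Q h)) (\<lambda>(r, c). z h $$ (\<alpha> (head Q h) + r, \<alpha> (tail Q h) + c))) = y"
    proof (rule extensionalityI[of _ "arcs Q"])
      fix h assume h: "h \<in> arcs Q"
      show "(\<lambda>h\<in>arcs Q. mat (\<beta> (head Q h)) (\<beta> (tail Q h)) (\<lambda>(r, c). z h $$ (\<alpha> (head Q h) + r, \<alpha> (tail Q h) + c))) h = y h"
        unfolding restrict_apply'[OF h] Dy[OF h]
      proof (rule eq_matI)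
        fix i j assume "i < dim_row (ac_mat (D h))" "j < dim_col (ac_mat (D h))"
        then have i: "i < \<beta> (head Q h)" and j: "j < \<beta> (tail Q h)" using Dc[OF h] by auto
        then show "mat (\<beta> (head Q h)) (\<beta> (tail Q h)) (\<lambda>(r, c). z h $$ (\<alpha> (head Q h) + r, \<alpha> (tail Q h) + c)) $$ (i, j) = ac_mat (D h) $$ (i, j)"
          using idx[OF h, of "\<alpha> (head Q h) + i" "\<alpha> (tail Q h) + j" w]
            block_mat_index[OF h w, of "\<alpha> (head Q h) + i" "\<alpha> (tail Q h) + j"] Dc[OF h] by (simp add: z)
      qed (use Dc[OF h] in auto)
    qed (use y in \<open>auto simp: rep_space_F_def rep_space_def PiE_iff\<close>)
    ultimately show "z \<in> {z \<in> stab_space_F Q \<alpha> \<beta>. kappa Q \<alpha> \<beta> z = (x, y)}" by (simp add: kappa_def)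
  next
    fix z assume "z \<in> {z \<in> stab_space_F Q \<alpha> \<beta>. kappa Q \<alpha> \<beta> z = (x, y)}"
    then have zF: "z \<in> rep_space_F Q (\<alpha> + \<beta>)" and flag: "std_flag Q \<alpha> \<beta> \<in> subreps Q (point_rep (\<alpha> + \<beta>) z)"
      and kx: "(\<lambda>h\<in>arcs Q. mat (\<alpha> (head Q h)) (\<alpha> (tail Q h)) (\<lambda>(r, c). z h $$ (r, c))) = x"
      and ky: "(\<lambda>h\<in>arcs Q. mat (\<beta> (head Q h)) (\<beta> (tail Q h)) (\<lambda>(r, c). z h $$ (\<alpha> (head Q h) + r, \<alpha> (tail Q h) + c))) = y"
      by (auto simp: stab_space_F_def kappa_def)
    have zc: "z h \<in> carrier_mat (\<alpha> (head Q h) + \<beta> (head Q h)) (\<alpha> (tail Q h) + \<beta> (tail Q h))" if "h \<in> arcs Q" for h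
      using zF that by (auto simp: rep_space_F_def rep_space_def)
    define w where "w = (\<lambda>h\<in>arcs Q. mat (\<beta> (head Q h)) (\<alpha> (tail Q h)) (\<lambda>(r, c). of_ac (z h $$ (\<alpha> (head Q h) + r, c))))"
    have w: "w \<in> Blocks" by (auto simp: w_def Blocks_def)
    have "z = block_point w"
    proof (rule extensionalityI[of _ "arcs Q"])
      fix h assume h: "h \<in> arcs Q"
      have t: "tail Q h \<in> verts Q" and hd: "head Q h \<in> verts Q" using h by auto
      show "z h = block_point w h"
      proof (rule eq_matI)
        fix i j assume "i < dim_row (block_point w h)" "j < dim_col (block_point w h)"
        then have i: "i < \<alpha> (head Q h) + \<beta> (head Q h)" and j: "j < \<alpha> (tail Q h) + \<beta> (tail Q h)"
          using block_mat_carrier[OF Ac[OF h] Dc[OF h], of "w h"] h by (auto simp: block_point_def)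
        show "z h $$ (i, j) = block_point w h $$ (i, j)"
        proof (cases "i < \<alpha> (head Q h)")
          case iT: True
          show ?thesis
          proof (cases "j < \<alpha> (tail Q h)")
            case True
            have "x h $$ (i, j) = z h $$ (i, j)" using kx[symmetric] h iT True by simp
            then show ?thesis
              using idx[OF h i j, of w] block_mat_index[OF h w i j] iT True Ax[OF h] Ac[OF h] by simp
          next
            case False
            have "unit_vec (\<alpha> (tail Q h) + \<beta> (tail Q h)) j \<in> std_flag Q \<alpha> \<beta> (tail Q h)"
              using False j by (auto simp: std_flag_iff[OF t])
            then have "z h *\<^sub>v unit_vec (\<alpha> (tail Q h) + \<beta> (tail Q h)) j \<in> std_flag Q \<alpha> \<beta> (head Q h)"
              using subrepsD(3)[OF flag h] by simp
            then have "(z h *\<^sub>v unit_vec (\<alpha> (tail Q h) + \<beta> (tail Q h)) j) $ i = 0"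
              using iT by (simp add: std_flag_iff[OF hd])
            then have "z h $$ (i, j) = 0" using mat_unit_vec[OF zc[OF h] j] zc[OF h] i j by simp
            then show ?thesis using idx[OF h i j, of w] block_mat_index[OF h w i j] iT False by simp
          qed
        next
          case iF: False
          show ?thesis
          proof (cases "j < \<alpha> (tail Q h)")
            case True
            have "frob (z h $$ (i, j)) = F_mat (z h) $$ (i, j)" using zc[OF h] i j by simp
            also have "\<dots> = z h $$ (i, j)" using zF h by (simp add: rep_space_F_def)
            finally have "to_ac (of_ac (z h $$ (i, j))) = z h $$ (i, j)" by (auto simp: frob_fixed_iff)
            moreover have "w h $$ (i - \<alpha> (head Q h), j) = of_ac (z h $$ (i, j))"
              using h i iF True by (simp add: w_def)
            ultimately show ?thesis using idx[OF h i j, of w] block_mat_index[OF h w i j] iF True by simp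
          next
            case False
            have "y h $$ (i - \<alpha> (head Q h), j - \<alpha> (tail Q h)) = z h $$ (i, j)" using ky[symmetric] h i j iF False by simp
            moreover have "i - \<alpha> (head Q h) < \<beta> (head Q h)" "j - \<alpha> (tail Q h) < \<beta> (tail Q h)" using i j iF False by auto
            ultimately show ?thesis
              using idx[OF h i j, of w] block_mat_index[OF h w i j] iF False Dy[OF h] Dc[OF h] by simp
          qed
        qed
      qed (use zc[OF h] block_mat_carrier[OF Ac[OF h] Dc[OF h], of "w h"] h in \<open>auto simp: block_point_def\<close>)
    qed (use zF in \<open>auto simp: rep_space_F_def rep_space_def PiE_iff block_point_def\<close>)
    then show "z \<in> block_point ` Blocks" using w by blast
  qed
qed

end

context quiver
begin

lemma ex_block_extensions:
  fixes x y :: "('h, 'k::{field,finite}) point"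
  assumes x: "x \<in> rep_space_F Q \<alpha>" and y: "y \<in> rep_space_F Q \<beta>"
  shows "\<exists>\<phi> \<psi>. block_extensions Q \<alpha> \<beta> (\<lambda>h. map_mat of_ac (x h)) (\<lambda>h. map_mat of_ac (y h))
    (representative (mcl (module_of_point \<alpha> x))) (representative (mcl (module_of_point \<beta> y))) \<phi> \<psi>"
proof -
  note Mx = is_rep_module_of_point[OF x] and My = is_rep_module_of_point[OF y]
  note r = representative_isoclass(1)[OF mcl_isoclasses[OF Mx]] representative_isoclass(1)[OF mcl_isoclasses[OF My]]
  obtain \<phi> where \<phi>: "is_iso (module_of_point \<alpha> x) (representative (mcl (module_of_point \<alpha> x))) \<phi>"
    using rep_iso_representative_iff[OF mcl_isoclasses[OF Mx] Mx] rep_iso_iff by blast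
  obtain \<psi> where \<psi>: "is_iso (module_of_point \<beta> y) (representative (mcl (module_of_point \<beta> y))) \<psi>"
    using rep_iso_representative_iff[OF mcl_isoclasses[OF My] My] rep_iso_iff by blast
  show ?thesis
    using \<phi> \<psi> r of_point_reps_over[OF x] of_point_reps_over[OF y]
    unfolding block_extensions_def block_extensions_axioms_def module_of_point_def
    by (auto intro: quiver_axioms)
qed

text \<open>Both sides sum over the block triangular points with diagonal blocks \<open>x\<close> and \<open>y\<close>.\<close>

lemma delta_twisted_eq:
  fixes x y :: "('h, 'k::{field,finite}) point"
  assumes \<alpha>: "\<alpha> \<in> dimvecs Q" and \<beta>: "\<beta> \<in> dimvecs Q" and x: "x \<in> rep_space_F Q \<alpha>" and y: "y \<in> rep_space_F Q \<beta>"
    and F: "F \<in> hall_space Q" and f: "\<And>z. z \<in> rep_space_F Q (\<alpha> + \<beta>) \<Longrightarrow> f z = F (mcl (module_of_point (\<alpha> + \<beta>) z))"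
  shows "delta_twisted v Q \<alpha> \<beta> f (x, y) = v powi euler_form Q \<alpha> \<beta> *
    hall_comult_untwisted Q F (mcl (module_of_point \<alpha> x), mcl (module_of_point \<beta> y))"
proof -
  let ?M = "representative (mcl (module_of_point \<alpha> x))" and ?N = "representative (mcl (module_of_point \<beta> y))"
  obtain \<phi> \<psi> where "block_extensions Q \<alpha> \<beta> (\<lambda>h. map_mat of_ac (x h)) (\<lambda>h. map_mat of_ac (y h)) ?M ?N \<phi> \<psi>"
    using ex_block_extensions[OF x y] by blast
  then interpret block_extensions Q \<alpha> \<beta> "\<lambda>h. map_mat of_ac (x h)" "\<lambda>h. map_mat of_ac (y h)" ?M ?N \<phi> \<psi> .
  have "push (stab_space_F Q \<alpha> \<beta>) (kappa Q \<alpha> \<beta>) f (x, y) = (\<Sum>w\<in>Blocks. f (block_point w))"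
    unfolding push_def
    using sum.reindex_bij_betw[OF bij_betw_block_point[OF x y], of f] ac_of_point[OF x] ac_of_point[OF y] by simp
  also have "\<dots> = (\<Sum>w\<in>Blocks. F (mcl (mid w)))"
    using f block_point_rep_space mcl_block_point by simp
  finally have sum: "push (stab_space_F Q \<alpha> \<beta>) (kappa Q \<alpha> \<beta>) f (x, y) = (\<Sum>w\<in>Blocks. F (mcl (mid w)))" .
  have "of_nat CARD('k) powi - (\<Sum>i\<in>verts Q. int (\<alpha> i) * int (\<beta> i)) = inverse (complex_of_nat (card Gauge))"
  proof -
    have "(\<Sum>i\<in>verts Q. int (\<alpha> i) * int (\<beta> i)) = int (\<Sum>i\<in>verts Q. \<alpha> i * \<beta> i)" by simp
    then show ?thesis unfolding card_Gauge by (simp only: power_int_minus power_int_of_nat of_nat_power)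
  qed
  moreover have "hall_comult_untwisted Q F (mcl (module_of_point \<alpha> x), mcl (module_of_point \<beta> y)) =
      (\<Sum>w\<in>Blocks. F (mcl (mid w))) / of_nat (card Gauge)"
    using mcl_isoclasses[OF is_rep_module_of_point[OF x]] mcl_isoclasses[OF is_rep_module_of_point[OF y]] sum_h_number[OF F]
    by (simp add: hall_comult_untwisted_def)
  ultimately show ?thesis
    by (simp add: delta_twisted_def scale_def sum divide_inverse)
qed

lemma h_number_nonzero_dim:
  fixes a b c :: "('i, 'h, 'k::{field,finite}) kQ_module set"
  assumes a: "a \<in> isoclasses Q" and b: "b \<in> isoclasses Q" and c: "c \<in> isoclasses Q"
    and nz: "h_number Q (representative c) (representative a) (representative b) \<noteq> 0"
  shows "cdim c = cdim a + cdim b"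
proof -
  obtain x where x: "x \<in> rep_space_F Q (cdim a)" "mcl (module_of_point (cdim a) x) = a" using isoclass_has_point[OF a] by blast
  obtain y where y: "y \<in> rep_space_F Q (cdim b)" "mcl (module_of_point (cdim b) y) = b" using isoclass_has_point[OF b] by blast
  obtain \<phi> \<psi> where "block_extensions Q (cdim a) (cdim b) (\<lambda>h. map_mat of_ac (x h)) (\<lambda>h. map_mat of_ac (y h))
      (representative a) (representative b) \<phi> \<psi>"
    using ex_block_extensions[OF x(1) y(1)] unfolding x(2) y(2) by blast
  then interpret block_extensions Q "cdim a" "cdim b" "\<lambda>h. map_mat of_ac (x h)" "\<lambda>h. map_mat of_ac (y h)"
    "representative a" "representative b" \<phi> \<psi> .
  have "{w \<in> Blocks. mcl (mid w) = mcl (representative c)} \<noteq> {}"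
    using nz unfolding h_number_eq[OF representative_isoclass(1)[OF c]] by (metis card.empty div_0 of_nat_0)
  then obtain w where "mcl (mid w) = c" using representative_isoclass(2)[OF c] by auto
  then show ?thesis using cdim_mcl[OF is_rep_mid, of w] dimv_mid[OF cdim_dimvecs cdim_dimvecs, of w] by simp
qed

lemma hall_comult_untwisted_finite_sum:
  assumes "finite S" "{c. F c \<noteq> 0} \<subseteq> S"
  shows "hall_comult_untwisted Q F (a, b) = (if a \<in> isoclasses Q \<and> b \<in> isoclasses Q then
    (\<Sum>c\<in>S. F c * h_number Q (representative c) (representative a) (representative b)) else 0)"
  unfolding hall_comult_untwisted_def using assms by (auto intro!: sum.mono_neutral_left)

text \<open>The dimension vector of the middle term is the sum of the outer ones, and only finitely many
  classes have a given dimension vector.\<close>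

lemma hall_comult_untwisted_hall_space:
  fixes F :: "('i, 'h, 'k::{field,finite}) kQ_module set \<Rightarrow> complex"
  assumes F: "F \<in> hall_space Q"
  shows "(\<lambda>d. hall_comult_untwisted Q F (a, d)) \<in> hall_space Q"
proof -
  have fin: "finite {c. F c \<noteq> 0}" and sub: "{c. F c \<noteq> 0} \<subseteq> isoclasses Q" using F by (auto simp: hall_space_def)
  have "{d. hall_comult_untwisted Q F (a, d) \<noteq> 0} \<subseteq>
      (\<Union>c\<in>{c. F c \<noteq> 0}. {d. d \<in> isoclasses Q \<and> cdim d = cdim c - cdim a})"
  proof
    fix d assume "d \<in> {d. hall_comult_untwisted Q F (a, d) \<noteq> 0}"
    then have nz: "hall_comult_untwisted Q F (a, d) \<noteq> 0" by simp
    then have ad: "a \<in> isoclasses Q" "d \<in> isoclasses Q" by (auto simp: hall_comult_untwisted_def split: if_splits)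
    have "(\<Sum>c | F c \<noteq> 0. F c * h_number Q (representative c) (representative a) (representative d)) \<noteq> 0"
      using nz ad by (simp add: hall_comult_untwisted_def)
    then obtain c where c: "c \<in> {c. F c \<noteq> 0}" "F c * h_number Q (representative c) (representative a) (representative d) \<noteq> 0"
      by (rule sum.not_neutral_contains_not_neutral)
    then have "cdim c = cdim a + cdim d" using h_number_nonzero_dim[OF ad, of c] sub by auto
    then have "cdim d = cdim c - cdim a" by (simp add: fun_eq_iff)
    then show "d \<in> (\<Union>c\<in>{c. F c \<noteq> 0}. {d. d \<in> isoclasses Q \<and> cdim d = cdim c - cdim a})" using c(1) ad by blast
  qed
  moreover have "finite (\<Union>c\<in>{c. F c \<noteq> 0}. {d :: ('i, 'h, 'k) kQ_module set. d \<in> isoclasses Q \<and> cdim d = cdim c - cdim a})"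
    using fin finite_isoclasses_cdim by blast
  ultimately show ?thesis unfolding hall_space_def by (auto intro: finite_subset)
qed

end

section \<open>Orbits and isomorphism classes\<close>

lemma inv_ring_mat:
  assumes "g \<in> carrier_mat n n" "g' \<in> carrier_mat n n" "g * g' = 1\<^sub>m n" "g' * g = 1\<^sub>m n"
  shows "inv\<^bsub>ring_mat TYPE('a::field) n ()\<^esub> g = (g' :: 'a mat)"
proof -
  interpret ring "ring_mat TYPE('a) n ()" by (rule ring_mat)
  show ?thesis by (rule inv_char) (use assms in \<open>simp_all add: ring_mat_simps\<close>)
qed

lemma Units_ring_matD:
  assumes "g \<in> Units (ring_mat TYPE('a::field) n ())"
  obtains g' where "g \<in> carrier_mat n n" "g' \<in> carrier_mat n n" "g * g' = 1\<^sub>m n" "g' * g = 1\<^sub>m n"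
proof -
  have "g \<in> carrier_mat n n" "\<exists>g'. g' \<in> carrier_mat n n \<and> g * g' = 1\<^sub>m n \<and> g' * g = 1\<^sub>m n"
    using assms unfolding Units_def ring_mat_simps by blast+
  then show thesis using that by blast
qed

text \<open>The inverse of a matrix fixed by Frobenius is fixed as well, so both have entries in \<open>k\<close>.\<close>

lemma GL_F_descends:
  fixes g :: "'k::{field,finite} alg_closure mat"
  assumes g: "g \<in> GL_F TYPE('k) n"
  obtains c d :: "'k mat" where "c \<in> carrier_mat n n" "d \<in> carrier_mat n n" "c * d = 1\<^sub>m n" "d * c = 1\<^sub>m n"
    "g = ac_mat c" "inv\<^bsub>ring_mat TYPE('k alg_closure) n ()\<^esub> g = ac_mat d"
proof -
  have Fg: "F_mat g = g" and U: "g \<in> Units (ring_mat TYPE('k alg_closure) n ())" using g by (auto simp: GL_F_def)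
  obtain g' where gc: "g \<in> carrier_mat n n" and g'c: "g' \<in> carrier_mat n n" and inv: "g * g' = 1\<^sub>m n" "g' * g = 1\<^sub>m n"
    using Units_ring_matD[OF U] by blast
  have Fg'c: "F_mat g' \<in> carrier_mat n n" using g'c by simp
  have "F_mat g' = F_mat g' * (g * g')" using inv(1) Fg'c by simp
  also have "\<dots> = (F_mat g' * F_mat g) * g'" unfolding Fg by (rule assoc_mult_mat[OF Fg'c gc g'c, symmetric])
  also have "F_mat g' * F_mat g = 1\<^sub>m n"
    unfolding frob_hom.mat_hom_mult[OF g'c gc, symmetric] inv(2) by (rule frob_hom.mat_hom_one)
  also have "1\<^sub>m n * g' = g'" by (rule left_mult_one_mat[OF g'c])
  finally have Fg': "F_mat g' = g'" .
  let ?c = "map_mat of_ac g" and ?d = "map_mat of_ac g'"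
  have c: "?c \<in> carrier_mat n n" and d: "?d \<in> carrier_mat n n" using gc g'c by simp_all
  have ac: "ac_mat ?c = g" "ac_mat ?d = g'" using ac_mat_of_ac[OF Fg] ac_mat_of_ac[OF Fg'] by simp_all
  have "ac_mat (?c * ?d) = ac_mat (1\<^sub>m n)" "ac_mat (?d * ?c) = ac_mat (1\<^sub>m n)"
    unfolding to_ac_hom.mat_hom_mult[OF c d] to_ac_hom.mat_hom_mult[OF d c] ac inv
    by (rule to_ac_hom.mat_hom_one[symmetric])+
  then have "?c * ?d = 1\<^sub>m n" "?d * ?c = 1\<^sub>m n" unfolding ac_mat_inj .
  then show thesis using that[OF c d] ac inv_ring_mat[OF gc g'c inv] by metis
qed

context quiver
begin

lemma GL_act_rep_iso:
  fixes x :: "('h, 'k::{field,finite}) point"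
  assumes g: "g \<in> GL_group_F Q \<alpha>" and x: "x \<in> rep_space_F Q \<alpha>"
  shows "GL_act Q \<alpha> g x \<in> rep_space_F Q \<alpha>"
    and "rep_iso Q (module_of_point \<alpha> x) (module_of_point \<alpha> (GL_act Q \<alpha> g x))"
proof -
  have "\<exists>c d. c \<in> carrier_mat (\<alpha> i) (\<alpha> i) \<and> d \<in> carrier_mat (\<alpha> i) (\<alpha> i) \<and> c * d = 1\<^sub>m (\<alpha> i) \<and> d * c = 1\<^sub>m (\<alpha> i) \<and>
      g i = ac_mat c \<and> inv\<^bsub>ring_mat TYPE('k alg_closure) (\<alpha> i) ()\<^esub> (g i) = ac_mat d" if i: "i \<in> verts Q" for i
  proof -
    have "g i \<in> GL_F TYPE('k) (\<alpha> i)" using g i unfolding GL_group_F_PiE by (rule PiE_mem)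
    then show ?thesis using GL_F_descends by metis
  qed
  then obtain c d where cd: "\<And>i. i \<in> verts Q \<Longrightarrow> c i \<in> carrier_mat (\<alpha> i) (\<alpha> i) \<and> d i \<in> carrier_mat (\<alpha> i) (\<alpha> i) \<and>
      c i * d i = 1\<^sub>m (\<alpha> i) \<and> d i * c i = 1\<^sub>m (\<alpha> i) \<and>
      g i = ac_mat (c i) \<and> inv\<^bsub>ring_mat TYPE('k alg_closure) (\<alpha> i) ()\<^esub> (g i) = ac_mat (d i)"
    by metis
  define y where "y h = c (head Q h) * map_mat of_ac (x h) * d (tail Q h)" for h
  have xc: "map_mat of_ac (x h) \<in> carrier_mat (\<alpha> (head Q h)) (\<alpha> (tail Q h))" if "h \<in> arcs Q" for h
    using of_point_reps_over[OF x] that by (simp add: reps_over_def)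
  have y: "y \<in> reps_over TYPE('k) \<alpha>"
    unfolding reps_over_def
  proof (intro CollectI ballI)
    fix h assume h: "h \<in> arcs Q"
    then show "y h \<in> carrier_mat (\<alpha> (head Q h)) (\<alpha> (tail Q h))"
      unfolding y_def using cd[of "head Q h"] cd[of "tail Q h"]
      by (intro mult_carrier_mat[OF mult_carrier_mat[OF _ xc[OF h]]]) auto
  qed
  have act: "GL_act Q \<alpha> g x = (\<lambda>h\<in>arcs Q. ac_mat (y h))"
    unfolding GL_act_def
  proof (rule restrict_ext)
    fix h assume h: "h \<in> arcs Q"
    then have t: "tail Q h \<in> verts Q" and hd: "head Q h \<in> verts Q" by auto
    note ct = conjunct1[OF conjunct2[OF cd[OF t]]] and ch = conjunct1[OF cd[OF hd]]
    have "ac_mat (y h) = ac_mat (c (head Q h)) * x h * ac_mat (d (tail Q h))"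
      unfolding y_def to_ac_hom.mat_hom_mult[OF mult_carrier_mat[OF ch xc[OF h]] ct]
        to_ac_hom.mat_hom_mult[OF ch xc[OF h]] ac_of_point[OF x h] ..
    then show "g (head Q h) * x h * inv\<^bsub>ring_mat TYPE('k alg_closure) (\<alpha> (tail Q h)) ()\<^esub> (g (tail Q h)) = ac_mat (y h)"
    proof -
      have "inv\<^bsub>ring_mat TYPE('k alg_closure) (\<alpha> (tail Q h)) ()\<^esub> (g (tail Q h)) = ac_mat (d (tail Q h))"
        and "g (head Q h) = ac_mat (c (head Q h))"
        using cd[OF t] cd[OF hd] by blast+
      then show ?thesis by (simp only: \<open>ac_mat (y h) = _\<close>)
    qed
  qed
  show "GL_act Q \<alpha> g x \<in> rep_space_F Q \<alpha>" unfolding act by (rule point_of_reps_over(1)[OF y])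
  have "rep_iso Q (module_of_point \<alpha> x) (point_rep \<alpha> y)"
  proof (rule rep_isoI[OF is_rep_module_of_point[OF x], where f = "\<lambda>i v. c i *\<^sub>v v"])
    fix i assume i: "i \<in> verts Q"
    note C = cd[OF i]
    show "(\<lambda>v. c i *\<^sub>v v) \<in> lhom (vsp (module_of_point \<alpha> x) i) (vsp (point_rep \<alpha> y) i)"
      using mult_mat_vec_lhom[of "c i"] C by simp
    have "c i \<in> Units (ring_mat TYPE('k) (\<alpha> i) ())" using C by (auto simp: Units_def ring_mat_simps)
    then show "bij_betw (\<lambda>v. c i *\<^sub>v v) (carrier (vsp (module_of_point \<alpha> x) i)) (carrier (vsp (point_rep \<alpha> y) i))"
      unfolding Units_ring_mat_iff by (simp add: module_vec_simps)
  next
    fix h and v :: "'k vec" assume h: "h \<in> arcs Q" and "v \<in> carrier (vsp (module_of_point \<alpha> x) (tail Q h))"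
    then have v: "v \<in> carrier_vec (\<alpha> (tail Q h))" by (simp add: module_vec_simps)
    have t: "tail Q h \<in> verts Q" and hd: "head Q h \<in> verts Q" using h by auto
    note ct = conjunct1[OF cd[OF t]] and dt = conjunct1[OF conjunct2[OF cd[OF t]]] and ch = conjunct1[OF cd[OF hd]]
    note cx = mult_carrier_mat[OF ch xc[OF h]]
    have cv: "c (tail Q h) *\<^sub>v v \<in> carrier_vec (\<alpha> (tail Q h))" by (rule mult_mat_vec_carrier[OF ct v])
    have "y h *\<^sub>v (c (tail Q h) *\<^sub>v v) = (c (head Q h) * map_mat of_ac (x h)) *\<^sub>v (d (tail Q h) *\<^sub>v (c (tail Q h) *\<^sub>v v))"
      unfolding y_def by (rule assoc_mult_mat_vec[OF cx dt cv])
    also have "d (tail Q h) *\<^sub>v (c (tail Q h) *\<^sub>v v) = v"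
      unfolding assoc_mult_mat_vec[OF dt ct v, symmetric] using cd[OF t] v by simp
    also have "(c (head Q h) * map_mat of_ac (x h)) *\<^sub>v v = c (head Q h) *\<^sub>v (map_mat of_ac (x h) *\<^sub>v v)"
      by (rule assoc_mult_mat_vec[OF ch xc[OF h] v])
    finally show "c (head Q h) *\<^sub>v vmap (module_of_point \<alpha> x) h v = vmap (point_rep \<alpha> y) h (c (tail Q h) *\<^sub>v v)" by simp
  qed
  then show "rep_iso Q (module_of_point \<alpha> x) (module_of_point \<alpha> (GL_act Q \<alpha> g x))"
    using rep_iso_trans[OF is_rep_module_of_point[OF x]] rep_iso_sym[OF is_rep_module_of_point is_rep_point_rep[OF y] point_of_reps_over(2)[OF y]]
      point_of_reps_over(1)[OF y] unfolding act by blast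
qed

text \<open>The matrices of an isomorphism between the modules form the required group element.\<close>

lemma rep_iso_GL_act:
  fixes x y :: "('h, 'k::{field,finite}) point"
  assumes x: "x \<in> rep_space_F Q \<alpha>" and y: "y \<in> rep_space_F Q \<alpha>"
    and iso: "rep_iso Q (module_of_point \<alpha> x) (module_of_point \<alpha> y)"
  shows "\<exists>g\<in>GL_group_F Q \<alpha>. GL_act Q \<alpha> g x = y"
proof -
  obtain f where f: "is_iso (module_of_point \<alpha> x) (module_of_point \<alpha> y) f" using iso by (auto simp: rep_iso_iff)
  define c where "c i = mat_of_lhom (\<alpha> i) (\<alpha> i) (f i)" for i
  have c: "c i \<in> carrier_mat (\<alpha> i) (\<alpha> i)" for i by (simp add: c_def)
  have cv: "c i *\<^sub>v v = f i v" if "i \<in> verts Q" "v \<in> carrier_vec (\<alpha> i)" for i v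
    unfolding c_def using is_isoD(2)[OF f that(1)] that(2) by (intro mat_of_lhom) simp_all
  have "\<exists>d. d \<in> carrier_mat (\<alpha> i) (\<alpha> i) \<and> c i * d = 1\<^sub>m (\<alpha> i) \<and> d * c i = 1\<^sub>m (\<alpha> i)" if i: "i \<in> verts Q" for i
  proof -
    have "bij_betw (f i) (carrier_vec (\<alpha> i)) (carrier_vec (\<alpha> i))"
      using is_isoD(3)[OF f i] by (simp add: module_vec_simps)
    then have "bij_betw (\<lambda>v. c i *\<^sub>v v) (carrier_vec (\<alpha> i)) (carrier_vec (\<alpha> i))"
      by (rule bij_betw_cong[THEN iffD1, rotated]) (simp add: cv[OF i])
    then have "c i \<in> Units (ring_mat TYPE('k) (\<alpha> i) ())" using c by (simp add: Units_ring_mat_iff)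
    then show ?thesis using Units_ring_matD by metis
  qed
  then obtain d where d: "\<And>i. i \<in> verts Q \<Longrightarrow> d i \<in> carrier_mat (\<alpha> i) (\<alpha> i)"
      and cd: "\<And>i. i \<in> verts Q \<Longrightarrow> c i * d i = 1\<^sub>m (\<alpha> i)" and dc: "\<And>i. i \<in> verts Q \<Longrightarrow> d i * c i = 1\<^sub>m (\<alpha> i)" by metis
  define g where "g = (\<lambda>i\<in>verts Q. ac_mat (c i))"
  have acd: "ac_mat (c i) * ac_mat (d i) = 1\<^sub>m (\<alpha> i)" "ac_mat (d i) * ac_mat (c i) = 1\<^sub>m (\<alpha> i)" if i: "i \<in> verts Q" for i
    unfolding to_ac_hom.mat_hom_mult[OF c d[OF i], symmetric] to_ac_hom.mat_hom_mult[OF d[OF i] c, symmetric] cd[OF i] dc[OF i]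
    by (rule to_ac_hom.mat_hom_one)+
  have ac_c: "ac_mat (c i) \<in> carrier_mat (\<alpha> i) (\<alpha> i)" for i using c by simp
  have ac_d: "ac_mat (d i) \<in> carrier_mat (\<alpha> i) (\<alpha> i)" if "i \<in> verts Q" for i using d[OF that] by simp
  have "ac_mat (c i) \<in> GL_F TYPE('k) (\<alpha> i)" if i: "i \<in> verts Q" for i
    using ac_c[of i] ac_d[OF i] acd[OF i] by (auto simp: GL_F_def Units_def ring_mat_simps simp del: map_carrier_mat)
  then have g: "g \<in> GL_group_F Q \<alpha>" unfolding GL_group_F_PiE by (auto simp: g_def)
  have "GL_act Q \<alpha> g x = y"
  proof (rule extensionalityI[of _ "arcs Q"])
    fix h assume h: "h \<in> arcs Q"
    then have t: "tail Q h \<in> verts Q" and hd: "head Q h \<in> verts Q" by auto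
    let ?x = "map_mat of_ac (x h)" and ?y = "map_mat of_ac (y h)"
    have xc: "?x \<in> carrier_mat (\<alpha> (head Q h)) (\<alpha> (tail Q h))" and yc: "?y \<in> carrier_mat (\<alpha> (head Q h)) (\<alpha> (tail Q h))"
      using of_point_reps_over[OF x] of_point_reps_over[OF y] h by (simp_all add: reps_over_def)
    have "c (head Q h) * ?x = ?y * c (tail Q h)"
    proof (rule mat_eq_by_vec[OF mult_carrier_mat[OF c xc] mult_carrier_mat[OF yc c]])
      fix v :: "'k vec" assume v: "v \<in> carrier_vec (\<alpha> (tail Q h))"
      have xv: "?x *\<^sub>v v \<in> carrier_vec (\<alpha> (head Q h))" by (rule mult_mat_vec_carrier[OF xc v])
      have "(c (head Q h) * ?x) *\<^sub>v v = f (head Q h) (?x *\<^sub>v v)"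
        unfolding assoc_mult_mat_vec[OF c xc v] by (rule cv[OF hd xv])
      also have "\<dots> = ?y *\<^sub>v f (tail Q h) v"
        using is_isoD(5)[OF f h, of v] v by (simp add: module_vec_simps)
      also have "\<dots> = (?y * c (tail Q h)) *\<^sub>v v"
        unfolding assoc_mult_mat_vec[OF yc c v] cv[OF t v] ..
      finally show "(c (head Q h) * ?x) *\<^sub>v v = (?y * c (tail Q h)) *\<^sub>v v" .
    qed
    then have "ac_mat (c (head Q h)) * x h = y h * ac_mat (c (tail Q h))"
      using to_ac_hom.mat_hom_mult[OF c xc] to_ac_hom.mat_hom_mult[OF yc c] ac_of_point[OF x h] ac_of_point[OF y h] by metis
    then have "ac_mat (c (head Q h)) * x h * ac_mat (d (tail Q h)) = y h * ac_mat (c (tail Q h)) * ac_mat (d (tail Q h))" by simp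
    also have "\<dots> = y h * (ac_mat (c (tail Q h)) * ac_mat (d (tail Q h)))"
      by (rule assoc_mult_mat[OF _ ac_c ac_d[OF t]]) (use y h in \<open>auto simp: rep_space_F_def rep_space_def\<close>)
    also have "\<dots> = y h"
      unfolding acd(1)[OF t] by (rule right_mult_one_mat) (use y h in \<open>auto simp: rep_space_F_def rep_space_def\<close>)
    finally show "GL_act Q \<alpha> g x h = y h"
      using h t hd inv_ring_mat[OF ac_c ac_d[OF t] acd[OF t]] by (simp add: GL_act_def g_def)
  qed (use y in \<open>auto simp: GL_act_def rep_space_F_def rep_space_def PiE_iff\<close>)
  then show ?thesis using g by blast
qed

definition pullback :: "(('i, 'h, 'k::{field,finite}) kQ_module set \<Rightarrow> 'e::field) \<Rightarrow> ('i, 'h, 'k, 'e) cf" where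
  "pullback F = (\<lambda>(\<alpha>, z). if \<alpha> \<in> dimvecs Q \<and> z \<in> rep_space_F Q \<alpha> then F (mcl (module_of_point \<alpha> z)) else 0)"

lemma pullback_apply:
  "\<alpha> \<in> dimvecs Q \<Longrightarrow> z \<in> rep_space_F Q \<alpha> \<Longrightarrow> pullback F (\<alpha>, z) = F (mcl (module_of_point \<alpha> z))"
  by (simp add: pullback_def)

definition class_point :: "('i, 'h, 'k::{field,finite}) kQ_module set \<Rightarrow> ('i \<Rightarrow> nat) \<times> ('h, 'k) point" where
  "class_point c = (cdim c, SOME x. x \<in> rep_space_F Q (cdim c) \<and> mcl (module_of_point (cdim c) x) = c)"

text \<open>By invariance, this is the value at every point of the class.\<close>

definition class_value :: "('i, 'h, 'k::{field,finite}, 'e::field) cf \<Rightarrow> ('i, 'h, 'k) kQ_module set \<Rightarrow> 'e" where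
  "class_value f = (\<lambda>c. if c \<in> isoclasses Q then f (class_point c) else 0)"

lemma class_point:
  fixes c :: "('i, 'h, 'k::{field,finite}) kQ_module set"
  assumes c: "c \<in> isoclasses Q"
  obtains x where "class_point c = (cdim c, x)" "x \<in> rep_space_F Q (cdim c)" "mcl (module_of_point (cdim c) x) = c"
proof -
  have "\<exists>x. x \<in> rep_space_F Q (cdim c) \<and> mcl (module_of_point (cdim c) x) = c" using isoclass_has_point[OF c] by blast
  from someI_ex[OF this] show thesis using that unfolding class_point_def by blast
qed

lemma class_value_pullback:
  assumes "\<And>c. c \<notin> isoclasses Q \<Longrightarrow> F c = 0"
  shows "class_value (pullback F) = F"
proof
  fix c
  show "class_value (pullback F) c = F c"
  proof (cases "c \<in> isoclasses Q")
    case True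
    then obtain x where "class_point c = (cdim c, x)" "x \<in> rep_space_F Q (cdim c)" "mcl (module_of_point (cdim c) x) = c"
      by (rule class_point)
    then show ?thesis using True by (simp add: class_value_def pullback_apply[OF cdim_dimvecs])
  qed (simp add: class_value_def assms)
qed

lemma pullback_CF:
  fixes F :: "('i, 'h, 'k::{field,finite}) kQ_module set \<Rightarrow> 'e::field"
  assumes fin: "finite {c. F c \<noteq> 0}"
  shows "pullback F \<in> CF Q"
proof -
  have "{\<alpha>. \<exists>x. pullback F (\<alpha>, x) \<noteq> 0} \<subseteq> cdim ` {c. F c \<noteq> 0}"
  proof
    fix \<alpha> assume "\<alpha> \<in> {\<alpha>. \<exists>x. pullback F (\<alpha>, x) \<noteq> 0}"
    then obtain x where \<alpha>: "\<alpha> \<in> dimvecs Q" and x: "x \<in> rep_space_F Q \<alpha>" and nz: "F (mcl (module_of_point \<alpha> x)) \<noteq> 0"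
      by (auto simp: pullback_def split: if_splits)
    have "\<alpha> = cdim (mcl (module_of_point \<alpha> x))"
      using cdim_mcl[OF is_rep_module_of_point[OF x]] dimv_module_of_point[OF \<alpha>, of x] by simp
    then show "\<alpha> \<in> cdim ` {c. F c \<noteq> 0}" using nz by (rule image_eqI[OF _ CollectI])
  qed
  then have "finite {\<alpha>. \<exists>x. pullback F (\<alpha>, x) \<noteq> 0}" by (rule finite_subset[OF _ finite_imageI[OF fin]])
  moreover have "pullback F (\<alpha>, GL_act Q \<alpha> g x) = pullback F (\<alpha>, x)"
    if g: "g \<in> GL_group_F Q \<alpha>" and x: "x \<in> rep_space_F Q \<alpha>" and \<alpha>: "\<alpha> \<in> dimvecs Q" for \<alpha> g and x :: "('h, 'k) point"
    using GL_act_rep_iso[OF g x] mcl_eq_iff[OF is_rep_module_of_point[OF x] is_rep_module_of_point[OF GL_act_rep_iso(1)[OF g x]]] \<alpha> x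
    by (simp add: pullback_apply)
  ultimately show ?thesis by (auto simp: CF_def CF_comp_def pullback_def[of F])
qed

lemma pullback_class_value:
  fixes f :: "('i, 'h, 'k::{field,finite}, 'e::field) cf"
  assumes f: "f \<in> CF Q"
  shows "pullback (class_value f) = f" "finite {c. class_value f c \<noteq> 0}"
proof -
  show "pullback (class_value f) = f"
  proof
    fix p :: "('i \<Rightarrow> nat) \<times> ('h, 'k) point"
    obtain \<alpha> z where p: "p = (\<alpha>, z)" by (cases p)
    show "pullback (class_value f) p = f p"
    proof (cases "\<alpha> \<in> dimvecs Q \<and> z \<in> rep_space_F Q \<alpha>")
      case True
      then have \<alpha>: "\<alpha> \<in> dimvecs Q" and z: "z \<in> rep_space_F Q \<alpha>" by auto
      let ?c = "mcl (module_of_point \<alpha> z)"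
      have d: "cdim ?c = \<alpha>" using cdim_mcl[OF is_rep_module_of_point[OF z]] dimv_module_of_point[OF \<alpha>] by simp
      have c: "?c \<in> isoclasses Q" by (rule mcl_isoclasses[OF is_rep_module_of_point[OF z]])
      obtain x where x: "class_point ?c = (\<alpha>, x)" "x \<in> rep_space_F Q \<alpha>" "mcl (module_of_point \<alpha> x) = ?c"
        using class_point[OF c] unfolding d by metis
      obtain g where g: "g \<in> GL_group_F Q \<alpha>" "GL_act Q \<alpha> g z = x"
        using rep_iso_GL_act[OF z x(2)] mcl_eq_iff[OF is_rep_module_of_point[OF z] is_rep_module_of_point[OF x(2)]] x(3) by metis
      have "f (\<alpha>, x) = f (\<alpha>, z)" using f \<alpha> z g by (auto simp: CF_def CF_comp_def)
      then show ?thesis using c x(1) by (simp add: p pullback_apply[OF \<alpha> z] class_value_def)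
    next
      case False
      then show ?thesis using f by (auto simp: p pullback_def CF_def CF_comp_def)
    qed
  qed
  have fin: "finite {\<alpha>. \<exists>x. f (\<alpha>, x) \<noteq> 0}" using f by (simp add: CF_def)
  have "{c. class_value f c \<noteq> 0} \<subseteq> (\<Union>\<alpha>\<in>{\<alpha>. \<exists>x. f (\<alpha>, x) \<noteq> 0}. {c. c \<in> isoclasses Q \<and> cdim c = \<alpha>})"
    by (auto simp: class_value_def class_point_def split: if_splits)
  moreover have "finite (\<Union>\<alpha>\<in>{\<alpha>. \<exists>x. f (\<alpha>, x) \<noteq> 0}. {c :: ('i, 'h, 'k) kQ_module set. c \<in> isoclasses Q \<and> cdim c = \<alpha>})"
    using fin finite_isoclasses_cdim by blast
  ultimately show "finite {c. class_value f c \<noteq> 0}" by (rule finite_subset)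
qed

lemma orbit_fun_pullback:
  assumes M: "is_rep Q (M :: ('i, 'h, 'k::{field,finite}) kQ_module)"
  shows "orbit_fun Q M = pullback (\<lambda>c. if c = isoclass Q M then 1 else 0)"
  using mcl_eq_iff[OF is_rep_module_of_point M] unfolding isoclass_mcl
  by (auto simp: orbit_fun_def pullback_def fun_eq_iff)

end

section \<open>Iterated products and coproducts\<close>

text \<open>The exponent of \<open>v\<close> collected when a twisted operation is iterated.\<close>

fun cross_euler :: "('i, 'h) pre_digraph \<Rightarrow> ('i \<Rightarrow> nat) list \<Rightarrow> int" where
  "cross_euler Q [] = 0"
| "cross_euler Q (\<alpha> # \<alpha>s) = euler_form Q \<alpha> (sum_list \<alpha>s) + cross_euler Q \<alpha>s"

context quiver
begin

lemma euler_form_add_right: "euler_form Q \<alpha> (\<beta> + \<gamma>) = euler_form Q \<alpha> \<beta> + euler_form Q \<alpha> \<gamma>"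
  by (simp add: euler_form_def algebra_simps sum.distrib)

lemma euler_form_zero_right [simp]: "euler_form Q \<alpha> 0 = 0"
  by (simp add: euler_form_def)

lemma sum_class_euler:
  fixes as :: "('i, 'h, 'k::{field,finite}) kQ_module set list"
  shows "(\<Sum>j<length as. \<Sum>i<j. class_euler Q (as ! i) (as ! j)) = cross_euler Q (map cdim as)"
proof (induction as)
  case (Cons a as)
  have "(\<Sum>j<length as. euler_form Q (cdim a) (cdim (as ! j))) = euler_form Q (cdim a) (sum_list (map cdim as))"
    for a and as :: "('i, 'h, 'k) kQ_module set list"
  proof (induction as)
    case Nil
    show ?case by (simp only: list.size lessThan_0 sum.empty list.map sum_list.Nil euler_form_zero_right)
  next
    case (Cons b as)
    then show ?case
      by (simp only: length_Cons sum.lessThan_Suc_shift nth_Cons_0 nth_Cons_Suc list.map sum_list.Cons euler_form_add_right)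
  qed
  moreover have "class_euler Q b c = euler_form Q (cdim b) (cdim c)" for b c :: "('i, 'h, 'k) kQ_module set"
    by (simp add: class_euler_def cdim_def)
  ultimately show ?case
    using Cons by (simp add: sum.lessThan_Suc_shift sum.distrib del: sum.lessThan_Suc)
qed simp

lemma sum_list_dimvecs: "set \<alpha>s \<subseteq> dimvecs Q \<Longrightarrow> sum_list \<alpha>s \<in> dimvecs Q"
  by (induction \<alpha>s) (auto simp: dimvecs_def)

lemma hall_comult_untwisted_linear:
  fixes G :: "'m \<Rightarrow> ('i, 'h, 'k::{field,finite}) kQ_module set \<Rightarrow> complex"
  assumes S: "finite S" and G: "\<And>m. m \<in> S \<Longrightarrow> G m \<in> hall_space Q"
  shows "hall_comult_untwisted Q (\<lambda>c. \<Sum>m\<in>S. k m * G m c) (a, d) = (\<Sum>m\<in>S. k m * hall_comult_untwisted Q (G m) (a, d))"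
proof -
  let ?B = "\<Union>m\<in>S. {c. G m c \<noteq> 0}" and ?h = "\<lambda>c. h_number Q (representative c) (representative a) (representative d)"
  have B: "finite ?B" using S G by (auto simp: hall_space_def)
  have sub: "{c. (\<Sum>m\<in>S. k m * G m c) \<noteq> 0} \<subseteq> ?B"
  proof
    fix c assume "c \<in> {c. (\<Sum>m\<in>S. k m * G m c) \<noteq> 0}"
    then have "(\<Sum>m\<in>S. k m * G m c) \<noteq> 0" by simp
    then obtain m where "m \<in> S" "k m * G m c \<noteq> 0" by (rule sum.not_neutral_contains_not_neutral)
    then show "c \<in> ?B" by auto
  qed
  have "(\<Sum>c\<in>?B. (\<Sum>m\<in>S. k m * G m c) * ?h c) = (\<Sum>m\<in>S. k m * (\<Sum>c\<in>?B. G m c * ?h c))"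
    unfolding sum_distrib_right sum_distrib_left by (subst sum.swap) (simp add: mult.assoc)
  moreover have "hall_comult_untwisted Q (G m) (a, d) =
      (if a \<in> isoclasses Q \<and> d \<in> isoclasses Q then (\<Sum>c\<in>?B. G m c * ?h c) else 0)" if "m \<in> S" for m
    using that by (intro hall_comult_untwisted_finite_sum[OF B]) auto
  ultimately show ?thesis
    unfolding hall_comult_untwisted_finite_sum[OF B sub] by (cases "a \<in> isoclasses Q \<and> d \<in> isoclasses Q") auto
qed

lemma hall_comult_iter_linear:
  fixes G :: "'m \<Rightarrow> ('i, 'h, 'k::{field,finite}) kQ_module set \<Rightarrow> complex"
  assumes S: "finite S" and G: "\<And>m. m \<in> S \<Longrightarrow> G m \<in> hall_space Q"
  shows "hall_comult_iter Q (\<lambda>c. \<Sum>m\<in>S. k m * G m c) as = (\<Sum>m\<in>S. k m * hall_comult_iter Q (G m) as)"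
  using G
proof (induction as arbitrary: G)
  case (Cons a as)
  show ?case
  proof (cases as)
    case (Cons b bs)
    have "hall_comult_iter Q (\<lambda>d. \<Sum>m\<in>S. k m * hall_comult_untwisted Q (G m) (a, d)) as =
        (\<Sum>m\<in>S. k m * hall_comult_iter Q (\<lambda>d. hall_comult_untwisted Q (G m) (a, d)) as)"
      by (rule Cons.IH[OF hall_comult_untwisted_hall_space]) (rule Cons.prems)
    then show ?thesis unfolding Cons by (simp add: hall_comult_untwisted_linear[OF S Cons.prems])
  qed simp
qed simp

abbreviation point_classes :: "('i \<Rightarrow> nat) list \<Rightarrow> ('h, 'k::{field,finite}) point list \<Rightarrow>
    ('i, 'h, 'k) kQ_module set list" where
  "point_classes \<alpha>s xs \<equiv> map2 (\<lambda>\<alpha> x. mcl (module_of_point \<alpha> x)) \<alpha>s xs"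

text \<open>Splitting off the first factor contributes its Euler form with the sum of all later factors.\<close>

lemma delta_iter_classes:
  fixes v :: complex
  assumes v: "v \<noteq> 0" and "\<alpha>s \<noteq> []" "set \<alpha>s \<subseteq> dimvecs Q" "list_all2 (\<lambda>\<alpha> x. x \<in> rep_space_F Q \<alpha>) \<alpha>s xs"
    and "F \<in> hall_space Q" "\<And>z. z \<in> rep_space_F Q (sum_list \<alpha>s) \<Longrightarrow> f z = F (mcl (module_of_point (sum_list \<alpha>s) z))"
  shows "delta_iter v Q \<alpha>s f xs = v powi cross_euler Q \<alpha>s * hall_comult_iter Q F (point_classes \<alpha>s xs)"
  using assms(2-)
proof (induction \<alpha>s arbitrary: xs F f)
  case (Cons \<alpha> \<alpha>s)
  obtain x ys where xs: "xs = x # ys" and x: "x \<in> rep_space_F Q \<alpha>" and ys: "list_all2 (\<lambda>\<alpha> x. x \<in> rep_space_F Q \<alpha>) \<alpha>s ys"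
    using Cons.prems(3) by (auto simp: list_all2_Cons1)
  show ?case
  proof (cases \<alpha>s)
    case Nil
    then show ?thesis using xs ys x Cons.prems(5)[of x] by simp
  next
    case (Cons \<beta> \<gamma>s)
    let ?\<sigma> = "sum_list \<alpha>s" and ?a = "mcl (module_of_point \<alpha> x)"
    let ?k = "v powi euler_form Q \<alpha> ?\<sigma>"
    let ?F = "\<lambda>d. hall_comult_untwisted Q F (?a, d)"
    have dims: "\<alpha> \<in> dimvecs Q" "set \<alpha>s \<subseteq> dimvecs Q" using Cons.prems(2) by auto
    obtain y ys' where ys': "ys = y # ys'" using ys Cons by (auto simp: list_all2_Cons1)
    have F1: "?F \<in> hall_space Q" by (rule hall_comult_untwisted_hall_space[OF Cons.prems(4)])
    then have F2: "(\<lambda>d. ?k * ?F d) \<in> hall_space Q" using v by (simp add: hall_space_def)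
    have f: "delta_twisted v Q \<alpha> ?\<sigma> f (x, z) = ?k * ?F (mcl (module_of_point ?\<sigma> z))" if z: "z \<in> rep_space_F Q ?\<sigma>" for z
      by (rule delta_twisted_eq[OF dims(1) sum_list_dimvecs[OF dims(2)] x z Cons.prems(4)])
        (use Cons.prems(5) in \<open>simp only: sum_list.Cons\<close>)
    have "delta_iter v Q (\<alpha> # \<alpha>s) f xs = delta_iter v Q \<alpha>s (\<lambda>y. delta_twisted v Q \<alpha> ?\<sigma> f (x, y)) ys"
      unfolding xs Cons by (rule delta_iter.simps(2))
    also have "\<dots> = v powi cross_euler Q \<alpha>s * hall_comult_iter Q (\<lambda>d. ?k * ?F d) (point_classes \<alpha>s ys)"
      by (rule Cons.IH[OF _ dims(2) ys F2 f], simp add: Cons, assumption)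
    also have "hall_comult_iter Q (\<lambda>d. ?k * ?F d) (point_classes \<alpha>s ys) = ?k * hall_comult_iter Q ?F (point_classes \<alpha>s ys)"
      using hall_comult_iter_linear[of "{()}" "\<lambda>_. ?F" "\<lambda>_. ?k"] F1 by simp
    also have "hall_comult_iter Q ?F (point_classes \<alpha>s ys) = hall_comult_iter Q F (point_classes (\<alpha> # \<alpha>s) xs)"
      by (simp add: xs ys' Cons)
    finally show ?thesis using v by (simp add: power_int_add)
  qed
qed simp

definition class_lists :: "('i \<Rightarrow> nat) list \<Rightarrow> ('i, 'h, 'k::{field,finite}) kQ_module set list set" where
  "class_lists \<alpha>s = {as. set as \<subseteq> isoclasses Q \<and> map cdim as = \<alpha>s}"

lemma class_lists_Cons:
  "class_lists (\<alpha> # \<alpha>s) = (\<lambda>(a, as). a # as) ` ({a. a \<in> isoclasses Q \<and> cdim a = \<alpha>} \<times> class_lists \<alpha>s)"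
  by (auto simp: class_lists_def map_eq_Cons_conv image_iff)

lemma class_lists_Nil: "class_lists [] = {[]}"
  by (auto simp: class_lists_def)

lemma finite_class_lists: "finite (class_lists \<alpha>s :: ('i, 'h, 'k::{field,finite}) kQ_module set list set)"
  by (induction \<alpha>s) (simp_all add: class_lists_Nil class_lists_Cons finite_isoclasses_cdim)

lemma sum_class_lists_Cons:
  "(\<Sum>as\<in>class_lists (\<alpha> # \<alpha>s). g as) =
   (\<Sum>a | a \<in> isoclasses Q \<and> cdim a = \<alpha>. \<Sum>as\<in>class_lists \<alpha>s. g (a # as))"
  unfolding class_lists_Cons sum.cartesian_product
  by (subst sum.reindex) (auto simp: inj_on_def intro!: sum.cong)

lemma filt_single:
  fixes N :: "('i, 'h, 'k::{field,finite}) kQ_module"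
  assumes N: "is_rep Q N" and a: "a \<in> isoclasses Q"
  shows "filt N [a] = (if mcl N = a then 1 else 0)"
proof -
  have sub: "filt (sub_rep N U) [] = (if U = null N then 1 else 0)" if U: "U \<in> subreps Q N" for U
  proof (cases "U = null N")
    case True
    have "dimv Q N = dimv Q (quot_rep Q N (null N)) + dimv Q (sub_rep N U)"
      using dimv_sub_quot[OF N U] True by simp
    moreover have "dimv Q (quot_rep Q N (null N)) = dimv Q N"
      by (rule dimv_iso[OF is_rep_quot_rep[OF N null_subreps[OF N]] N rep_iso_quot_null[OF N]])
    ultimately have "dimv Q (sub_rep N U) = 0" by simp
    then show ?thesis using filt_Nil[OF is_rep_sub_rep[OF N U]] True by simp
  next
    case False
    have "dimv Q (sub_rep N U) \<noteq> 0"
    proof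
      assume "dimv Q (sub_rep N U) = 0"
      then have "[null (sub_rep N U)] \<in> filtrations Q (sub_rep N U) []"
        using filtrations_Nil[OF is_rep_sub_rep[OF N U]] by simp
      then have "U i = {\<zero>\<^bsub>vsp N i\<^esub>}" if "i \<in> verts Q" for i
        using that by (auto simp: filtrations_def null_def)
      then have "U = null N"
        using subrepsD(4)[OF U] by (intro extensionalityI[of _ "verts Q"]) (auto simp: null_def)
      then show False using False by simp
    qed
    then show ?thesis using filt_Nil[OF is_rep_sub_rep[OF N U]] False by simp
  qed
  have "filt N [a] = (\<Sum>U\<in>subreps Q N. if U = null N then if mcl (quot_rep Q N U) = a then 1 else 0 else 0)"
    unfolding filt_Cons[OF N a] by (intro sum.cong refl) (simp add: sub sub[OF null_subreps[OF N]])
  also have "\<dots> = (if mcl (quot_rep Q N (null N)) = a then 1 else 0)"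
    using finite_subreps[OF N] null_subreps[OF N] by (simp add: sum.delta)
  also have "mcl (quot_rep Q N (null N)) = mcl N"
    using mcl_eq_iff[OF is_rep_quot_rep[OF N null_subreps[OF N]] N] rep_iso_quot_null[OF N] by blast
  finally show ?thesis .
qed

text \<open>Peeling off the first factor of the iterated product sums over the subrepresentations \<open>U\<close> of
  the next step of a filtration, whose quotient is the first factor.\<close>

lemma m_iter_classes:
  fixes v :: complex and z :: "('h, 'k::{field,finite}) point"
  assumes v: "v \<noteq> 0" and "\<alpha>s \<noteq> []" "set \<alpha>s \<subseteq> dimvecs Q" "z \<in> rep_space_F Q (sum_list \<alpha>s)"
    and "\<And>xs. list_all2 (\<lambda>\<alpha> x. x \<in> rep_space_F Q \<alpha>) \<alpha>s xs \<Longrightarrow> G xs = H (point_classes \<alpha>s xs)"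
  shows "m_iter v Q \<alpha>s G z = v powi cross_euler Q \<alpha>s *
    (\<Sum>as\<in>class_lists \<alpha>s. H as * of_nat (filt (module_of_point (sum_list \<alpha>s) z) as))"
  using assms(2-)
proof (induction \<alpha>s arbitrary: z G H)
  case (Cons \<alpha> \<alpha>s)
  have dims: "\<alpha> \<in> dimvecs Q" "set \<alpha>s \<subseteq> dimvecs Q" using Cons.prems(2) by auto
  show ?case
  proof (cases \<alpha>s)
    case Nil
    have z: "z \<in> rep_space_F Q \<alpha>" using Cons.prems(3) Nil by simp
    let ?M = "module_of_point \<alpha> z"
    note M = is_rep_module_of_point[OF z]
    have "(\<Sum>as\<in>class_lists [\<alpha>]. H as * of_nat (filt ?M as)) =
        (\<Sum>a | a \<in> isoclasses Q \<and> cdim a = \<alpha>. if a = mcl ?M then H [mcl ?M] else 0)"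
      unfolding sum_class_lists_Cons class_lists_Nil by (intro sum.cong refl) (auto simp: filt_single[OF M])
    also have "\<dots> = H [mcl ?M]"
      using mcl_isoclasses[OF M] cdim_mcl[OF M] dimv_module_of_point[OF dims(1), of z]
      by (subst sum.delta[OF finite_isoclasses_cdim]) simp
    finally show ?thesis using Cons.prems(4)[of "[z]"] z Nil by simp
  next
    case (Cons \<beta> \<gamma>s)
    let ?\<sigma> = "sum_list \<alpha>s"
    have z: "z \<in> rep_space_F Q (\<alpha> + ?\<sigma>)" using Cons.prems(3) unfolding sum_list.Cons .
    let ?M = "module_of_point (\<alpha> + ?\<sigma>) z"
    note M = is_rep_module_of_point[OF z] and \<sigma> = sum_list_dimvecs[OF dims(2)]
    define K where "K a b = v powi cross_euler Q \<alpha>s * (\<Sum>as\<in>class_lists \<alpha>s. H (a # as) * of_nat (filt (representative b) as))"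
      for a b
    have K: "K a (mcl N) = v powi cross_euler Q \<alpha>s * (\<Sum>as\<in>class_lists \<alpha>s. H (a # as) * of_nat (filt N as))"
      if N: "is_rep Q N" for a and N :: "('i, 'h, 'k) kQ_module"
      unfolding K_def by (intro arg_cong[of _ _ "(*) _"] sum.cong refl) (simp add: filt_mcl[OF N] class_lists_def)
    have "m_iter v Q \<alpha>s (\<lambda>ys. G (x # ys)) y = K (mcl (module_of_point \<alpha> x)) (mcl (module_of_point ?\<sigma> y))"
      if x: "x \<in> rep_space_F Q \<alpha>" and y: "y \<in> rep_space_F Q ?\<sigma>" for x y :: "('h, 'k) point"
      unfolding K[OF is_rep_module_of_point[OF y]]
    proof (rule Cons.IH[OF _ dims(2) y, of "\<lambda>ys. G (x # ys)" "\<lambda>as. H (mcl (module_of_point \<alpha> x) # as)"])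
      show "\<alpha>s \<noteq> []" by (simp add: Cons)
      fix ys :: "('h, 'k) point list" assume ys: "list_all2 (\<lambda>\<alpha> x. x \<in> rep_space_F Q \<alpha>) \<alpha>s ys"
      then show "G (x # ys) = H (mcl (module_of_point \<alpha> x) # point_classes \<alpha>s ys)"
        using Cons.prems(4)[of "x # ys"] x by simp
    qed
    then have "m_twisted v Q \<alpha> ?\<sigma> (\<lambda>(x, y). m_iter v Q \<alpha>s (\<lambda>ys. G (x # ys)) y) z = v powi euler_form Q \<alpha> ?\<sigma> *
        (\<Sum>U | U \<in> subreps Q ?M \<and> dimv Q (sub_rep ?M U) = ?\<sigma>. K (mcl (quot_rep Q ?M U)) (mcl (sub_rep ?M U)))"
      by (intro m_twisted_sum[OF \<sigma> z]) simp
    also have "(\<Sum>U | U \<in> subreps Q ?M \<and> dimv Q (sub_rep ?M U) = ?\<sigma>. K (mcl (quot_rep Q ?M U)) (mcl (sub_rep ?M U))) =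
        (\<Sum>U\<in>subreps Q ?M. if cdim (mcl (quot_rep Q ?M U)) = \<alpha> then K (mcl (quot_rep Q ?M U)) (mcl (sub_rep ?M U)) else 0)"
    proof (subst sum.inter_filter[OF finite_subreps[OF M], symmetric], rule sum.cong)
      have "dimv Q (sub_rep ?M U) = ?\<sigma> \<longleftrightarrow> cdim (mcl (quot_rep Q ?M U)) = \<alpha>" if U: "U \<in> subreps Q ?M" for U
      proof -
        have "\<alpha> + ?\<sigma> = dimv Q (quot_rep Q ?M U) + dimv Q (sub_rep ?M U)"
          using dimv_sub_quot[OF M U] dimv_module_of_point[of "\<alpha> + ?\<sigma>" z] dims(1) \<sigma> by (simp add: dimvecs_def)
        then show ?thesis unfolding cdim_mcl[OF is_rep_quot_rep[OF M U]] by (metis add_left_imp_eq add_right_imp_eq)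
      qed
      then show "{U \<in> subreps Q ?M. dimv Q (sub_rep ?M U) = ?\<sigma>} = {U \<in> subreps Q ?M. cdim (mcl (quot_rep Q ?M U)) = \<alpha>}" by blast
    qed simp
    also have "\<dots> = v powi cross_euler Q \<alpha>s *
        (\<Sum>U\<in>subreps Q ?M. \<Sum>as\<in>class_lists \<alpha>s. \<Sum>a | a \<in> isoclasses Q \<and> cdim a = \<alpha>.
           if mcl (quot_rep Q ?M U) = a then H (a # as) * of_nat (filt (sub_rep ?M U) as) else 0)"
      unfolding sum_distrib_left[of "v powi cross_euler Q \<alpha>s" _ "subreps Q ?M"]
    proof (rule sum.cong[OF refl])
      fix U assume U: "U \<in> subreps Q ?M"
      have "(\<Sum>a | a \<in> isoclasses Q \<and> cdim a = \<alpha>. if mcl (quot_rep Q ?M U) = a then H (a # as) * of_nat (filt (sub_rep ?M U) as) else 0)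
          = (if cdim (mcl (quot_rep Q ?M U)) = \<alpha> then H (mcl (quot_rep Q ?M U) # as) * of_nat (filt (sub_rep ?M U) as) else 0)" for as
        using mcl_isoclasses[OF is_rep_quot_rep[OF M U]] by (subst sum.delta'[OF finite_isoclasses_cdim]) simp
      then show "(if cdim (mcl (quot_rep Q ?M U)) = \<alpha> then K (mcl (quot_rep Q ?M U)) (mcl (sub_rep ?M U)) else 0) =
          v powi cross_euler Q \<alpha>s * (\<Sum>as\<in>class_lists \<alpha>s. \<Sum>a | a \<in> isoclasses Q \<and> cdim a = \<alpha>.
            if mcl (quot_rep Q ?M U) = a then H (a # as) * of_nat (filt (sub_rep ?M U) as) else 0)"
        by (simp add: K[OF is_rep_sub_rep[OF M U]])
    qed
    also have "(\<Sum>U\<in>subreps Q ?M. \<Sum>as\<in>class_lists \<alpha>s. \<Sum>a | a \<in> isoclasses Q \<and> cdim a = \<alpha>.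
           if mcl (quot_rep Q ?M U) = a then H (a # as) * of_nat (filt (sub_rep ?M U) as) else 0) =
        (\<Sum>a | a \<in> isoclasses Q \<and> cdim a = \<alpha>. \<Sum>as\<in>class_lists \<alpha>s. \<Sum>U\<in>subreps Q ?M.
           if mcl (quot_rep Q ?M U) = a then H (a # as) * of_nat (filt (sub_rep ?M U) as) else 0)"
      unfolding sum.swap[of _ "class_lists \<alpha>s" "{a. a \<in> isoclasses Q \<and> cdim a = \<alpha>}"]
        sum.swap[of _ "{a. a \<in> isoclasses Q \<and> cdim a = \<alpha>}" "subreps Q ?M"] sum.swap[of _ "class_lists \<alpha>s" "subreps Q ?M"] ..
    also have "\<dots> = (\<Sum>a | a \<in> isoclasses Q \<and> cdim a = \<alpha>. \<Sum>as\<in>class_lists \<alpha>s. H (a # as) * of_nat (filt ?M (a # as)))"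
    proof (intro sum.cong refl)
      fix a :: "('i, 'h, 'k) kQ_module set" and as assume "a \<in> {a. a \<in> isoclasses Q \<and> cdim a = \<alpha>}"
      then have "a \<in> isoclasses Q" by simp
      from filt_Cons[OF M this, of as]
      show "(\<Sum>U\<in>subreps Q ?M. if mcl (quot_rep Q ?M U) = a then H (a # as) * of_nat (filt (sub_rep ?M U) as) else 0) =
          H (a # as) * of_nat (filt ?M (a # as))"
        by (simp add: sum_distrib_left if_distrib of_nat_sum cong: if_cong)
    qed
    finally have "m_twisted v Q \<alpha> ?\<sigma> (\<lambda>(x, y). m_iter v Q \<alpha>s (\<lambda>ys. G (x # ys)) y) z =
        v powi cross_euler Q (\<alpha> # \<alpha>s) * (\<Sum>as\<in>class_lists (\<alpha> # \<alpha>s). H as * of_nat (filt ?M as))"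
      by (simp only: sum_class_lists_Cons cross_euler.simps power_int_add[OF disjI1[OF v]] mult.assoc)
    moreover have "m_iter v Q (\<alpha> # \<alpha>s) G z = m_twisted v Q \<alpha> ?\<sigma> (\<lambda>(x, y). m_iter v Q \<alpha>s (\<lambda>ys. G (x # ys)) y) z"
      unfolding Cons by (simp only: m_iter.simps(3))
    ultimately show ?thesis by (simp only: sum_list.Cons)
  qed
qed simp

end

section \<open>Comparison of the operations with complex coefficients\<close>

context quiver
begin

lemma finite_dimvecs_le: "finite {\<alpha> \<in> dimvecs Q. \<forall>i. \<alpha> i \<le> \<gamma> i}"
proof (rule finite_subset)
  show "{\<alpha> \<in> dimvecs Q. \<forall>i. \<alpha> i \<le> \<gamma> i} \<subseteq> (\<lambda>f i. if i \<in> verts Q then f i else 0) ` (\<Pi>\<^sub>E i\<in>verts Q. {..\<gamma> i})"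
  proof
    fix \<alpha> assume "\<alpha> \<in> {\<alpha> \<in> dimvecs Q. \<forall>i. \<alpha> i \<le> \<gamma> i}"
    then show "\<alpha> \<in> (\<lambda>f i. if i \<in> verts Q then f i else 0) ` (\<Pi>\<^sub>E i\<in>verts Q. {..\<gamma> i})"
      by (intro image_eqI[of _ _ "restrict \<alpha> (verts Q)"]) (auto simp: dimvecs_def)
  qed
qed (simp add: finite_PiE)

lemma finite_splittings: "finite {(\<alpha>, \<beta>). \<alpha> \<in> dimvecs Q \<and> \<beta> \<in> dimvecs Q \<and> \<alpha> + \<beta> = \<gamma>}"
  by (rule finite_subset[OF _ finite_cartesian_product[OF finite_dimvecs_le[of \<gamma>] finite_dimvecs_le[of \<gamma>]]]) auto

lemma elem_le_sum_list: "\<alpha> \<in> set \<alpha>s \<Longrightarrow> (\<alpha> :: 'i \<Rightarrow> nat) i \<le> sum_list \<alpha>s i"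
  by (induction \<alpha>s) (auto simp: trans_le_add2)

definition decompositions :: "('i \<Rightarrow> nat) \<Rightarrow> ('i \<Rightarrow> nat) list set" where
  "decompositions \<gamma> = {\<alpha>s. \<alpha>s \<noteq> [] \<and> set \<alpha>s \<subseteq> dimvecs Q - {0} \<and> sum_list \<alpha>s = \<gamma>}"

lemma finite_decompositions: "finite (decompositions \<gamma>)"
proof (rule finite_subset)
  have len: "length \<alpha>s \<le> (\<Sum>i\<in>verts Q. sum_list \<alpha>s i)" if "set \<alpha>s \<subseteq> dimvecs Q - {0}" for \<alpha>s
    using that
  proof (induction \<alpha>s)
    case (Cons \<alpha> \<alpha>s)
    then have "\<alpha> \<in> dimvecs Q" "\<alpha> \<noteq> 0" by auto
    then obtain i where i: "\<alpha> i \<noteq> 0" by (auto simp: fun_eq_iff)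
    then have "i \<in> verts Q" using \<open>\<alpha> \<in> dimvecs Q\<close> by (auto simp: dimvecs_def)
    then have "0 < (\<Sum>i\<in>verts Q. \<alpha> i)" using i by (intro sum_pos2[of _ i]) auto
    then show ?case using Cons by (simp add: sum.distrib)
  qed simp
  show "decompositions \<gamma> \<subseteq> {\<alpha>s. set \<alpha>s \<subseteq> {\<alpha> \<in> dimvecs Q. \<forall>i. \<alpha> i \<le> \<gamma> i} \<and> length \<alpha>s \<le> (\<Sum>i\<in>verts Q. \<gamma> i)}"
  proof
    fix \<alpha>s assume "\<alpha>s \<in> decompositions \<gamma>"
    then have "set \<alpha>s \<subseteq> dimvecs Q - {0}" and \<gamma>: "\<gamma> = sum_list \<alpha>s" by (auto simp: decompositions_def)
    then show "\<alpha>s \<in> {\<alpha>s. set \<alpha>s \<subseteq> {\<alpha> \<in> dimvecs Q. \<forall>i. \<alpha> i \<le> \<gamma> i} \<and> length \<alpha>s \<le> (\<Sum>i\<in>verts Q. \<gamma> i)}"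
      using len elem_le_sum_list unfolding \<gamma> by blast
  qed
qed (rule finite_lists_length_le[OF finite_dimvecs_le])

text \<open>Both sides sum over the subrepresentations of the module of the point; on the left they are sorted
  by the dimension vectors of the quotient and the subrepresentation.\<close>

lemma CF_mult_pullback:
  fixes F G :: "('i, 'h, 'k::{field,finite}) kQ_module set \<Rightarrow> complex"
  assumes F: "F \<in> hall_space Q" and G: "G \<in> hall_space Q"
  shows "CF_mult v Q (pullback F) (pullback G) = pullback (hall_mult v Q F G)"
proof
  fix p :: "('i \<Rightarrow> nat) \<times> ('h, 'k) point"
  obtain \<gamma> z where p: "p = (\<gamma>, z)" by (cases p)
  let ?P = "{(\<alpha>, \<beta>). \<alpha> \<in> dimvecs Q \<and> \<beta> \<in> dimvecs Q \<and> \<alpha> + \<beta> = \<gamma>}"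
  let ?f = "\<lambda>\<alpha> \<beta>. \<lambda>(x, y). pullback F (\<alpha>, x) * pullback G (\<beta>, y)"
  have lhs: "CF_mult v Q (pullback F) (pullback G) p = (\<Sum>(\<alpha>, \<beta>)\<in>?P. m_twisted v Q \<alpha> \<beta> (?f \<alpha> \<beta>) z)"
    by (simp only: CF_mult_def p prod.case)
  show "CF_mult v Q (pullback F) (pullback G) p = pullback (hall_mult v Q F G) p"
  proof (cases "\<gamma> \<in> dimvecs Q \<and> z \<in> rep_space_F Q \<gamma>")
    case True
    then have \<gamma>: "\<gamma> \<in> dimvecs Q" and z: "z \<in> rep_space_F Q \<gamma>" by auto
    let ?M = "module_of_point \<gamma> z"
    let ?q = "quot_rep Q ?M" and ?s = "sub_rep ?M"
    note M = is_rep_module_of_point[OF z]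
    let ?g = "\<lambda>U. v powi euler_form Q (dimv Q (?q U)) (dimv Q (?s U)) * (F (mcl (?q U)) * G (mcl (?s U)))"
    let ?D = "\<lambda>U. (dimv Q (?q U), dimv Q (?s U))"
    have tot: "dimv Q (?q U) + dimv Q (?s U) = \<gamma>" if "U \<in> subreps Q ?M" for U
      using dimv_sub_quot[OF M that] dimv_module_of_point[OF \<gamma>, of z] by simp
    have fixed: "m_twisted v Q \<alpha> \<beta> (?f \<alpha> \<beta>) z = (\<Sum>U | U \<in> subreps Q ?M \<and> ?D U = (\<alpha>, \<beta>). ?g U)"
      if \<alpha>: "\<alpha> \<in> dimvecs Q" and \<beta>: "\<beta> \<in> dimvecs Q" and ab: "\<alpha> + \<beta> = \<gamma>" for \<alpha> \<beta>
    proof -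
      have zab: "z \<in> rep_space_F Q (\<alpha> + \<beta>)" unfolding ab by (rule z)
      have "m_twisted v Q \<alpha> \<beta> (?f \<alpha> \<beta>) z = v powi euler_form Q \<alpha> \<beta> *
          (\<Sum>U | U \<in> subreps Q ?M \<and> dimv Q (?s U) = \<beta>. F (mcl (?q U)) * G (mcl (?s U)))"
        by (rule m_twisted_sum[OF \<beta> zab, of "?f \<alpha> \<beta>" "\<lambda>a b. F a * G b" v, unfolded ab])
          (simp add: pullback_apply[OF \<alpha>] pullback_apply[OF \<beta>])
      also have "{U. U \<in> subreps Q ?M \<and> dimv Q (?s U) = \<beta>} = {U. U \<in> subreps Q ?M \<and> ?D U = (\<alpha>, \<beta>)}"
      proof -
        have "dimv Q (?s U) = \<beta> \<longleftrightarrow> ?D U = (\<alpha>, \<beta>)" if U: "U \<in> subreps Q ?M" for U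
          using tot[OF U] unfolding ab[symmetric] by (metis add_right_imp_eq prod.inject)
        then show ?thesis by blast
      qed
      finally show ?thesis unfolding sum_distrib_left by (simp only: prod.inject) (rule sum.cong, auto)
    qed
    have "(\<Sum>(\<alpha>, \<beta>)\<in>?P. m_twisted v Q \<alpha> \<beta> (?f \<alpha> \<beta>) z) = (\<Sum>p\<in>?P. \<Sum>U | U \<in> subreps Q ?M \<and> ?D U = p. ?g U)"
    proof (rule sum.cong[OF refl])
      fix p assume "p \<in> ?P"
      then obtain \<alpha> \<beta> where p: "p = (\<alpha>, \<beta>)" and ab: "\<alpha> \<in> dimvecs Q" "\<beta> \<in> dimvecs Q" "\<alpha> + \<beta> = \<gamma>" by blast
      show "(case p of (\<alpha>, \<beta>) \<Rightarrow> m_twisted v Q \<alpha> \<beta> (?f \<alpha> \<beta>) z) = (\<Sum>U | U \<in> subreps Q ?M \<and> ?D U = p. ?g U)"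
        unfolding p prod.case by (rule fixed[OF ab])
    qed
    also have "\<dots> = (\<Sum>U\<in>subreps Q ?M. ?g U)"
    proof (rule sum.group[OF finite_subreps[OF M] finite_splittings], rule image_subsetI)
      fix U assume U: "U \<in> subreps Q ?M"
      show "?D U \<in> ?P" unfolding mem_Collect_eq prod.case by (intro conjI dimv_dimvecs tot[OF U])
    qed
    also have "\<dots> = hall_mult v Q F G (mcl ?M)" by (rule hall_mult_sum[OF F G M, symmetric])
    finally show ?thesis unfolding lhs unfolding p pullback_apply[OF \<gamma> z] .
  next
    case False
    have outside: "m_twisted v Q \<alpha> \<beta> (?f \<alpha> \<beta>) z = 0" if "\<alpha> \<in> dimvecs Q" "\<beta> \<in> dimvecs Q" "\<alpha> + \<beta> = \<gamma>" for \<alpha> \<beta>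
    proof (rule m_twisted_outside)
      have "\<alpha> + \<beta> \<in> dimvecs Q" using that(1,2) by (simp add: dimvecs_def)
      then show "z \<notin> rep_space_F Q (\<alpha> + \<beta>)" using False unfolding that(3) by blast
    qed
    have "(\<Sum>(\<alpha>, \<beta>)\<in>?P. m_twisted v Q \<alpha> \<beta> (?f \<alpha> \<beta>) z) = 0"
    proof (rule sum.neutral, rule ballI)
      fix p assume "p \<in> ?P"
      then obtain \<alpha> \<beta> where p: "p = (\<alpha>, \<beta>)" and ab: "\<alpha> \<in> dimvecs Q" "\<beta> \<in> dimvecs Q" "\<alpha> + \<beta> = \<gamma>" by blast
      show "(case p of (\<alpha>, \<beta>) \<Rightarrow> m_twisted v Q \<alpha> \<beta> (?f \<alpha> \<beta>) z) = 0"
        unfolding p prod.case by (rule outside[OF ab])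
    qed
    then show ?thesis unfolding lhs using False by (auto simp: p pullback_def)
  qed
qed

lemma hall_mult_hall_space:
  fixes F G :: "('i, 'h, 'k::{field,finite}) kQ_module set \<Rightarrow> complex"
  assumes F: "F \<in> hall_space Q" and G: "G \<in> hall_space Q"
  shows "hall_mult v Q F G \<in> hall_space Q"
proof -
  let ?T = "\<Union>a\<in>{a. F a \<noteq> 0}. \<Union>b\<in>{b. G b \<noteq> 0}. {c. c \<in> isoclasses Q \<and> cdim c = cdim a + cdim b}"
  have "{c. hall_mult v Q F G c \<noteq> 0} \<subseteq> ?T"
  proof
    fix c assume "c \<in> {c. hall_mult v Q F G c \<noteq> 0}"
    then have nz: "hall_mult v Q F G c \<noteq> 0" by simp
    then have c: "c \<in> isoclasses Q" by (auto simp: hall_mult_def split: if_splits)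
    let ?M = "representative c"
    note M = representative_isoclass(1)[OF c]
    have "hall_mult v Q F G (mcl ?M) \<noteq> 0" using nz representative_isoclass(2)[OF c] by simp
    then obtain U where U: "U \<in> subreps Q ?M" and "F (mcl (quot_rep Q ?M U)) \<noteq> 0" "G (mcl (sub_rep ?M U)) \<noteq> 0"
      unfolding hall_mult_sum[OF F G M] by (auto elim!: sum.not_neutral_contains_not_neutral)
    moreover have "cdim c = cdim (mcl (quot_rep Q ?M U)) + cdim (mcl (sub_rep ?M U))"
      using dimv_sub_quot[OF M U]
      unfolding cdim_mcl[OF is_rep_quot_rep[OF M U]] cdim_mcl[OF is_rep_sub_rep[OF M U]] cdim_def[of c] .
    ultimately show "c \<in> ?T" using c by blast
  qed
  moreover have "finite ?T" using F G finite_isoclasses_cdim by (auto simp: hall_space_def)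
  ultimately have "finite {c. hall_mult v Q F G c \<noteq> 0}" by (rule finite_subset)
  then show ?thesis by (auto simp: hall_space_def hall_mult_def split: if_splits)
qed

lemma class_basis_expansion:
  assumes "F \<in> hall_space Q"
  shows "F = (\<lambda>c. \<Sum>m | F m \<noteq> 0. F m * class_basis m c)"
proof
  fix c
  have fin: "finite {m. F m \<noteq> 0}" using assms by (simp add: hall_space_def)
  have "(\<Sum>m | F m \<noteq> 0. F m * class_basis m c) = (\<Sum>m | F m \<noteq> 0. if c = m then F m else 0)"
    by (rule sum.cong) (auto simp: class_basis_def)
  then show "F c = (\<Sum>m | F m \<noteq> 0. F m * class_basis m c)" using sum.delta'[OF fin, of c F] by simp
qed

lemma class_basis_hall_space: "m \<in> isoclasses Q \<Longrightarrow> class_basis m \<in> hall_space Q"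
  by (auto simp: hall_space_def class_basis_def)

text \<open>The lists of nonzero classes admitting a filtration of \<open>n\<close> have dimension vectors summing up to
  that of \<open>n\<close>; this makes the formal sum finite and sorts it by lists of dimension vectors.\<close>

lemma hall_antipode_coeff_sum:
  fixes m n :: "('i, 'h, 'k::{field,finite}) kQ_module set"
  assumes n: "n \<in> isoclasses Q"
  shows "hall_antipode_coeff v Q m n = (if m = isoclass Q zero_rep \<and> n = isoclass Q zero_rep then 1 else 0) +
    (\<Sum>\<alpha>s\<in>decompositions (cdim n). \<Sum>as\<in>class_lists \<alpha>s.
      (-1) ^ length \<alpha>s * v powi (2 * cross_euler Q \<alpha>s) * hall_comult_iter Q (class_basis m) as * of_nat (filt (representative n) as))"
proof -
  let ?g = "\<lambda>as. if as \<noteq> [] \<and> set as \<subseteq> isoclasses Q - {isoclass Q zero_rep} then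
        (-1) ^ length as * v powi (2 * (\<Sum>j<length as. \<Sum>i<j. class_euler Q (as ! i) (as ! j))) *
        hall_comult_iter Q (class_basis m) as *
        of_nat (card (filtrations Q (representative n) (map representative as))) else 0"
  let ?S = "\<Union>\<alpha>s\<in>decompositions (cdim n). class_lists \<alpha>s :: ('i, 'h, 'k) kQ_module set list set"
  note r = representative_isoclass(1)[OF n]
  have fin: "finite ?S" by (intro finite_UN_I finite_decompositions finite_class_lists)
  have "{as. ?g as \<noteq> 0} \<subseteq> ?S"
  proof
    fix as assume "as \<in> {as. ?g as \<noteq> 0}"
    then have as: "as \<noteq> []" "set as \<subseteq> isoclasses Q - {isoclass Q zero_rep}" and nz: "filt (representative n) as \<noteq> 0"
      by (auto simp: filt_def split: if_splits)
    have "cdim a \<in> dimvecs Q - {0}" if "a \<in> set as" for a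
      using as(2) that eq_zero_class_iff[of a] cdim_dimvecs[of a] by blast
    then have "map cdim as \<in> decompositions (cdim n)"
      using as filt_nonzero_dim[OF r _ nz] by (auto simp: decompositions_def cdim_def)
    moreover have "as \<in> class_lists (map cdim as)" using as by (auto simp: class_lists_def)
    ultimately show "as \<in> ?S" by blast
  qed
  then have "Sum_any ?g = sum ?g ?S" by (rule Sum_any.expand_superset[OF fin])
  also have "\<dots> = (\<Sum>\<alpha>s\<in>decompositions (cdim n). \<Sum>as\<in>class_lists \<alpha>s. ?g as)"
    by (rule sum.UNION_disjoint[OF finite_decompositions]) (use finite_class_lists in \<open>auto simp: class_lists_def\<close>)
  also have "\<dots> = (\<Sum>\<alpha>s\<in>decompositions (cdim n). \<Sum>as\<in>class_lists \<alpha>s.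
      (-1) ^ length \<alpha>s * v powi (2 * cross_euler Q \<alpha>s) * hall_comult_iter Q (class_basis m) as * of_nat (filt (representative n) as))"
  proof (intro sum.cong refl)
    fix \<alpha>s and as :: "('i, 'h, 'k) kQ_module set list"
    assume \<alpha>s: "\<alpha>s \<in> decompositions (cdim n)" and as: "as \<in> class_lists \<alpha>s"
    have 1: "map cdim as = \<alpha>s" "length as = length \<alpha>s" "set as \<subseteq> isoclasses Q" using as by (auto simp: class_lists_def)
    have 2: "as \<noteq> []" using \<alpha>s 1 by (auto simp: decompositions_def)
    have "isoclass Q zero_rep \<notin> set as"
    proof
      assume "isoclass Q zero_rep \<in> set as"
      then have "0 \<in> set \<alpha>s" unfolding 1(1)[symmetric] using zero_class(2) by force
      then show False using \<alpha>s by (auto simp: decompositions_def)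
    qed
    then have "set as \<subseteq> isoclasses Q - {isoclass Q zero_rep}" using 1(3) by blast
    then show "?g as = (-1) ^ length \<alpha>s * v powi (2 * cross_euler Q \<alpha>s) * hall_comult_iter Q (class_basis m) as * of_nat (filt (representative n) as)"
      using 2 unfolding sum_class_euler by (simp add: 1 filt_def)
  qed
  finally show ?thesis unfolding hall_antipode_coeff_def by simp
qed

end

context quiver
begin

lemma decompositions_zero: "decompositions 0 = {}"
proof -
  have "\<alpha> = 0" if "\<alpha> \<in> set \<alpha>s" "sum_list \<alpha>s = 0" for \<alpha> :: "'i \<Rightarrow> nat" and \<alpha>s
    using elem_le_sum_list[OF that(1)] unfolding that(2) by (auto simp: fun_eq_iff)
  then have "\<alpha>s = []" if "set \<alpha>s \<subseteq> dimvecs Q - {0}" "sum_list \<alpha>s = 0" for \<alpha>s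
    using that by (cases \<alpha>s) fastforce+
  then show ?thesis unfolding decompositions_def by blast
qed

lemma hall_antipode_sum:
  fixes F :: "('i, 'h, 'k::{field,finite}) kQ_module set \<Rightarrow> complex"
  assumes F: "F \<in> hall_space Q" and n: "n \<in> isoclasses Q"
  shows "hall_antipode v Q F n = (if cdim n = 0 then F n else
    (\<Sum>\<alpha>s\<in>decompositions (cdim n). \<Sum>as\<in>class_lists \<alpha>s.
      (-1) ^ length \<alpha>s * v powi (2 * cross_euler Q \<alpha>s) * hall_comult_iter Q F as * of_nat (filt (representative n) as)))"
proof -
  let ?S = "{m. F m \<noteq> 0}"
  have fin: "finite ?S" and sub: "?S \<subseteq> isoclasses Q" using F by (auto simp: hall_space_def)
  have hall: "hall_antipode v Q F n = (\<Sum>m\<in>?S. F m * hall_antipode_coeff v Q m n)"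
    using n by (simp add: hall_antipode_def)
  show ?thesis
  proof (cases "cdim n = 0")
    case True
    then have z: "n = isoclass Q zero_rep" using eq_zero_class_iff[OF n] by simp
    have "hall_antipode_coeff v Q m n = class_basis m n" for m
      unfolding hall_antipode_coeff_sum[OF n] True decompositions_zero by (auto simp: class_basis_def z)
    then show ?thesis unfolding hall using True fun_cong[OF class_basis_expansion[OF F], of n] by simp
  next
    case False
    then have z: "n \<noteq> isoclass Q zero_rep" using eq_zero_class_iff[OF n] by simp
    let ?k = "\<lambda>\<alpha>s. (-1) ^ length \<alpha>s * v powi (2 * cross_euler Q \<alpha>s)"
    let ?f = "\<lambda>as. of_nat (filt (representative n) as) :: complex"
    have lin: "hall_comult_iter Q F as = (\<Sum>m\<in>?S. F m * hall_comult_iter Q (class_basis m) as)" for as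
      using hall_comult_iter_linear[OF fin, of class_basis F as] class_basis_hall_space sub
      unfolding class_basis_expansion[OF F, symmetric] by blast
    have "hall_antipode v Q F n = (\<Sum>m\<in>?S. \<Sum>\<alpha>s\<in>decompositions (cdim n). \<Sum>as\<in>class_lists \<alpha>s.
        F m * (?k \<alpha>s * hall_comult_iter Q (class_basis m) as * ?f as))"
      unfolding hall hall_antipode_coeff_sum[OF n] by (simp add: z sum_distrib_left)
    also have "\<dots> = (\<Sum>\<alpha>s\<in>decompositions (cdim n). \<Sum>m\<in>?S. \<Sum>as\<in>class_lists \<alpha>s.
        F m * (?k \<alpha>s * hall_comult_iter Q (class_basis m) as * ?f as))"
      by (rule sum.swap)
    also have "\<dots> = (\<Sum>\<alpha>s\<in>decompositions (cdim n). \<Sum>as\<in>class_lists \<alpha>s. \<Sum>m\<in>?S.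
        F m * (?k \<alpha>s * hall_comult_iter Q (class_basis m) as * ?f as))"
      by (rule sum.cong[OF refl]) (rule sum.swap)
    also have "\<dots> = (\<Sum>\<alpha>s\<in>decompositions (cdim n). \<Sum>as\<in>class_lists \<alpha>s. ?k \<alpha>s * hall_comult_iter Q F as * ?f as)"
      unfolding lin sum_distrib_left sum_distrib_right by (intro sum.cong refl) (simp only: mult_ac)
    finally show ?thesis using False by simp
  qed
qed

lemma m_iter_delta_iter:
  fixes v :: complex and z :: "('h, 'k::{field,finite}) point"
  assumes v: "v \<noteq> 0" and F: "F \<in> hall_space Q" and \<gamma>: "\<gamma> \<in> dimvecs Q" and z: "z \<in> rep_space_F Q \<gamma>"
    and \<alpha>s: "\<alpha>s \<in> decompositions \<gamma>"
  shows "m_iter v Q \<alpha>s (delta_iter v Q \<alpha>s (\<lambda>x. pullback F (\<gamma>, x))) z =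
    (\<Sum>as\<in>class_lists \<alpha>s. v powi (2 * cross_euler Q \<alpha>s) * hall_comult_iter Q F as *
      of_nat (filt (representative (mcl (module_of_point \<gamma> z))) as))"
proof -
  have ne: "\<alpha>s \<noteq> []" and dims: "set \<alpha>s \<subseteq> dimvecs Q" and sum: "sum_list \<alpha>s = \<gamma>"
    using \<alpha>s by (auto simp: decompositions_def)
  note M = is_rep_module_of_point[OF z]
  have "m_iter v Q \<alpha>s (delta_iter v Q \<alpha>s (\<lambda>x. pullback F (\<gamma>, x))) z = v powi cross_euler Q \<alpha>s *
      (\<Sum>as\<in>class_lists \<alpha>s. (v powi cross_euler Q \<alpha>s * hall_comult_iter Q F as) * of_nat (filt (module_of_point (sum_list \<alpha>s) z) as))"
  proof (rule m_iter_classes[OF v ne dims, of z _ "\<lambda>as. v powi cross_euler Q \<alpha>s * hall_comult_iter Q F as"])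
    show "z \<in> rep_space_F Q (sum_list \<alpha>s)" unfolding sum by (rule z)
    fix xs :: "('h, 'k) point list"
    assume xs: "list_all2 (\<lambda>\<alpha> x. x \<in> rep_space_F Q \<alpha>) \<alpha>s xs"
    show "delta_iter v Q \<alpha>s (\<lambda>x. pullback F (\<gamma>, x)) xs =
        v powi cross_euler Q \<alpha>s * hall_comult_iter Q F (point_classes \<alpha>s xs)"
      by (rule delta_iter_classes[OF v ne dims xs F]) (simp add: sum pullback_apply[OF \<gamma>])
  qed
  also have "\<dots> = (\<Sum>as\<in>class_lists \<alpha>s. v powi (2 * cross_euler Q \<alpha>s) * hall_comult_iter Q F as *
      of_nat (filt (representative (mcl (module_of_point \<gamma> z))) as))"
    unfolding sum_distrib_left sum
  proof (rule sum.cong[OF refl])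
    fix as :: "('i, 'h, 'k) kQ_module set list" assume "as \<in> class_lists \<alpha>s"
    then have as: "set as \<subseteq> isoclasses Q" by (simp add: class_lists_def)
    show "v powi cross_euler Q \<alpha>s * (v powi cross_euler Q \<alpha>s * hall_comult_iter Q F as * of_nat (filt (module_of_point \<gamma> z) as)) =
        v powi (2 * cross_euler Q \<alpha>s) * hall_comult_iter Q F as * of_nat (filt (representative (mcl (module_of_point \<gamma> z))) as)"
      unfolding filt_mcl[OF M as, symmetric] mult_2 power_int_add[OF disjI1[OF v]] by (simp only: mult.assoc)
  qed
  finally show ?thesis .
qed

lemma CF_antipode_pullback:
  fixes F :: "('i, 'h, 'k::{field,finite}) kQ_module set \<Rightarrow> complex"
  assumes v: "v \<noteq> 0" and F: "F \<in> hall_space Q"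
  shows "CF_antipode v Q (pullback F) = pullback (hall_antipode v Q F)"
proof
  fix p :: "('i \<Rightarrow> nat) \<times> ('h, 'k) point"
  obtain \<gamma> z where p: "p = (\<gamma>, z)" by (cases p)
  have lhs: "CF_antipode v Q (pullback F) p = (if \<gamma> = 0 then pullback F (\<gamma>, z) else
      (\<Sum>\<alpha>s\<in>decompositions \<gamma>. (-1) ^ length \<alpha>s * m_iter v Q \<alpha>s (delta_iter v Q \<alpha>s (\<lambda>x. pullback F (\<gamma>, x))) z))"
    by (simp only: CF_antipode_def decompositions_def p prod.case)
  show "CF_antipode v Q (pullback F) p = pullback (hall_antipode v Q F) p"
  proof (cases "\<gamma> \<in> dimvecs Q \<and> z \<in> rep_space_F Q \<gamma>")
    case True
    then have \<gamma>: "\<gamma> \<in> dimvecs Q" and z: "z \<in> rep_space_F Q \<gamma>" by auto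
    note M = is_rep_module_of_point[OF z]
    have d: "cdim (mcl (module_of_point \<gamma> z)) = \<gamma>" using cdim_mcl[OF M] dimv_module_of_point[OF \<gamma>, of z] by simp
    show ?thesis
      unfolding lhs unfolding p pullback_apply[OF \<gamma> z] hall_antipode_sum[OF F mcl_isoclasses[OF M]] d
      by (auto intro!: sum.cong simp: m_iter_delta_iter[OF v F \<gamma> z] sum_distrib_left mult.assoc)
  next
    case False
    have "m_iter v Q \<alpha>s (delta_iter v Q \<alpha>s (\<lambda>x. pullback F (\<gamma>, x))) z = 0" if \<alpha>s: "\<alpha>s \<in> decompositions \<gamma>" for \<alpha>s
    proof -
      have ne: "\<alpha>s \<noteq> []" and dims: "set \<alpha>s \<subseteq> dimvecs Q" and sum: "sum_list \<alpha>s = \<gamma>"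
        using \<alpha>s by (auto simp: decompositions_def)
      have z: "z \<notin> rep_space_F Q (sum_list \<alpha>s)" using sum_list_dimvecs[OF dims] False unfolding sum by blast
      obtain \<alpha> \<beta>s where \<alpha>\<beta>: "\<alpha>s = \<alpha> # \<beta>s" using ne by (cases \<alpha>s) auto
      show ?thesis
      proof (cases \<beta>s)
        case Nil
        then show ?thesis using False by (auto simp: \<alpha>\<beta> pullback_def)
      next
        case (Cons \<beta> \<gamma>s)
        have "z \<notin> rep_space_F Q (\<alpha> + sum_list (\<beta> # \<gamma>s))" using z unfolding \<alpha>\<beta> Cons sum_list.Cons[of \<alpha>] .
        then show ?thesis unfolding \<alpha>\<beta> Cons m_iter.simps(3) by (rule m_twisted_outside)
      qed
    qed
    then show ?thesis unfolding lhs using False by (auto simp: p pullback_def)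
  qed
qed

lemma delta_twisted_zero: "delta_twisted v Q \<alpha> \<beta> (\<lambda>_. 0) p = 0"
  by (simp add: delta_twisted_def scale_def push_def)

lemma delta_iter_zero: "delta_iter v Q \<alpha>s (\<lambda>_. 0) xs = 0"
proof (induction \<alpha>s arbitrary: xs)
  case (Cons \<alpha> \<alpha>s)
  then show ?case
    by (cases \<alpha>s; cases xs rule: remdups_adj.cases) (simp_all add: delta_twisted_zero)
qed simp

lemma m_iter_zero: "m_iter v Q \<alpha>s (\<lambda>_. 0) z = 0"
proof (induction \<alpha>s arbitrary: z)
  case (Cons \<alpha> \<alpha>s)
  then show ?case
    by (cases \<alpha>s) (simp_all add: m_twisted_def scale_def push_def o_def case_prod_beta)
qed simp

lemma hall_antipode_hall_space:
  fixes F :: "('i, 'h, 'k::{field,finite}) kQ_module set \<Rightarrow> complex"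
  assumes v: "v \<noteq> 0" and F: "F \<in> hall_space Q"
  shows "hall_antipode v Q F \<in> hall_space Q"
proof -
  have "{n. hall_antipode v Q F n \<noteq> 0} \<subseteq> (\<Union>m\<in>{m. F m \<noteq> 0}. {n. n \<in> isoclasses Q \<and> cdim n = cdim m})"
  proof
    fix n assume "n \<in> {n. hall_antipode v Q F n \<noteq> 0}"
    then have nz: "hall_antipode v Q F n \<noteq> 0" by simp
    then have n: "n \<in> isoclasses Q" by (auto simp: hall_antipode_def split: if_splits)
    obtain z where z: "z \<in> rep_space_F Q (cdim n)" "mcl (module_of_point (cdim n) z) = n" using isoclass_has_point[OF n] by blast
    have "\<exists>m. F m \<noteq> 0 \<and> cdim m = cdim n"
    proof (rule ccontr)
      assume none: "\<nexists>m. F m \<noteq> 0 \<and> cdim m = cdim n"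
      have pb: "pullback F (cdim n, x) = 0" for x
      proof (cases "x \<in> rep_space_F Q (cdim n)")
        case True
        have "cdim (mcl (module_of_point (cdim n) x)) = cdim n"
          unfolding cdim_mcl[OF is_rep_module_of_point[OF True]] by (rule dimv_module_of_point[OF cdim_dimvecs])
        then show ?thesis using none unfolding pullback_apply[OF cdim_dimvecs True] by blast
      qed (simp add: pullback_def)
      have di: "delta_iter v Q \<alpha>s (\<lambda>_ :: ('h, 'k) point. 0) = (\<lambda>_. 0)" for \<alpha>s
        by (rule ext) (rule delta_iter_zero)
      have "CF_antipode v Q (pullback F) (cdim n, z) = 0"
        unfolding CF_antipode_def prod.case pb di m_iter_zero by (simp only: mult_zero_right sum.neutral_const if_cancel)
      then show False using nz z(2) pullback_apply[OF cdim_dimvecs z(1), of "hall_antipode v Q F"] by (simp add: CF_antipode_pullback[OF v F])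
    qed
    then show "n \<in> (\<Union>m\<in>{m. F m \<noteq> 0}. {n. n \<in> isoclasses Q \<and> cdim n = cdim m})" using n by auto
  qed
  moreover have "finite (\<Union>m\<in>{m. F m \<noteq> 0}. {n :: ('i, 'h, 'k) kQ_module set. n \<in> isoclasses Q \<and> cdim n = cdim m})"
    using F finite_isoclasses_cdim by (auto simp: hall_space_def)
  ultimately have "finite {n. hall_antipode v Q F n \<noteq> 0}" by (rule finite_subset)
  then show ?thesis by (auto simp: hall_space_def hall_antipode_def split: if_splits)
qed

lemma kappa_rep_space_F:
  assumes z: "z \<in> stab_space_F Q \<alpha> \<beta>"
  shows "fst (kappa Q \<alpha> \<beta> z) \<in> rep_space_F Q \<alpha>" "snd (kappa Q \<alpha> \<beta> z) \<in> rep_space_F Q \<beta>"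
proof -
  have zF: "z \<in> rep_space_F Q (\<alpha> + \<beta>)" using z by (simp add: stab_space_F_def)
  have fixed: "frob (z h $$ (i, j)) = z h $$ (i, j)"
    if h: "h \<in> arcs Q" and ij: "i < \<alpha> (head Q h) + \<beta> (head Q h)" "j < \<alpha> (tail Q h) + \<beta> (tail Q h)" for h i j
  proof -
    have c: "z h \<in> carrier_mat (\<alpha> (head Q h) + \<beta> (head Q h)) (\<alpha> (tail Q h) + \<beta> (tail Q h))" and F: "F_mat (z h) = z h"
      using zF h by (auto simp: rep_space_F_def rep_space_def)
    have "F_mat (z h) $$ (i, j) = frob (z h $$ (i, j))" by (rule index_map_mat(1)) (use c ij in simp_all)
    then show ?thesis unfolding F by (rule sym)
  qed
  show "fst (kappa Q \<alpha> \<beta> z) \<in> rep_space_F Q \<alpha>" "snd (kappa Q \<alpha> \<beta> z) \<in> rep_space_F Q \<beta>"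
    by (auto simp: kappa_def rep_space_F_def rep_space_def fixed intro!: eq_matI)
qed

definition pullback2 :: "(('i, 'h, 'k::{field,finite}) kQ_module set \<times> ('i, 'h, 'k) kQ_module set \<Rightarrow> 'e::field) \<Rightarrow>
    (('i \<Rightarrow> nat) \<times> ('h, 'k) point) \<times> (('i \<Rightarrow> nat) \<times> ('h, 'k) point) \<Rightarrow> 'e" where
  "pullback2 u = (\<lambda>((\<alpha>, x), (\<beta>, y)).
     if \<alpha> \<in> dimvecs Q \<and> x \<in> rep_space_F Q \<alpha> \<and> \<beta> \<in> dimvecs Q \<and> y \<in> rep_space_F Q \<beta>
     then u (mcl (module_of_point \<alpha> x), mcl (module_of_point \<beta> y)) else 0)"

lemma CF_comult_pullback:
  fixes F :: "('i, 'h, 'k::{field,finite}) kQ_module set \<Rightarrow> complex"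
  assumes F: "F \<in> hall_space Q"
  shows "CF_comult v Q (pullback F) = pullback2 (hall_comult v Q F)"
proof
  fix p :: "(('i \<Rightarrow> nat) \<times> ('h, 'k) point) \<times> (('i \<Rightarrow> nat) \<times> ('h, 'k) point)"
  obtain \<alpha> x \<beta> y where p: "p = ((\<alpha>, x), (\<beta>, y))" by (metis prod.exhaust)
  show "CF_comult v Q (pullback F) p = pullback2 (hall_comult v Q F) p"
  proof (cases "\<alpha> \<in> dimvecs Q \<and> \<beta> \<in> dimvecs Q")
    case True
    then have \<alpha>: "\<alpha> \<in> dimvecs Q" and \<beta>: "\<beta> \<in> dimvecs Q" by auto
    then have \<alpha>\<beta>: "\<alpha> + \<beta> \<in> dimvecs Q" by (simp add: dimvecs_def)
    have lhs: "CF_comult v Q (pullback F) p = delta_twisted v Q \<alpha> \<beta> (\<lambda>z. pullback F (\<alpha> + \<beta>, z)) (x, y)"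
      using \<alpha> \<beta> by (simp only: CF_comult_def p prod.case simp_thms if_True)
    show ?thesis
    proof (cases "x \<in> rep_space_F Q \<alpha> \<and> y \<in> rep_space_F Q \<beta>")
      case True
      then have x: "x \<in> rep_space_F Q \<alpha>" and y: "y \<in> rep_space_F Q \<beta>" by auto
      have "class_euler Q (mcl (module_of_point \<alpha> x)) (mcl (module_of_point \<beta> y)) = euler_form Q \<alpha> \<beta>"
        using cdim_mcl[OF is_rep_module_of_point[OF x]] cdim_mcl[OF is_rep_module_of_point[OF y]]
          dimv_module_of_point[OF \<alpha>, of x] dimv_module_of_point[OF \<beta>, of y] by (simp add: class_euler_def cdim_def)
      moreover have "delta_twisted v Q \<alpha> \<beta> (\<lambda>z. pullback F (\<alpha> + \<beta>, z)) (x, y) =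
          v powi euler_form Q \<alpha> \<beta> * hall_comult_untwisted Q F (mcl (module_of_point \<alpha> x), mcl (module_of_point \<beta> y))"
        by (rule delta_twisted_eq[OF \<alpha> \<beta> x y F]) (rule pullback_apply[OF \<alpha>\<beta>])
      ultimately show ?thesis
        unfolding lhs using \<alpha> \<beta> x y by (simp add: p pullback2_def hall_comult_def)
    next
      case False
      have "{z. z \<in> stab_space_F Q \<alpha> \<beta> \<and> kappa Q \<alpha> \<beta> z = (x, y)} = {}"
        using kappa_rep_space_F[of _ \<alpha> \<beta>] False by force
      then have "delta_twisted v Q \<alpha> \<beta> (\<lambda>z. pullback F (\<alpha> + \<beta>, z)) (x, y) = 0"
        unfolding delta_twisted_def scale_def push_def by (simp only: sum.empty mult_zero_right)
      then show ?thesis unfolding lhs using False by (auto simp: p pullback2_def)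
    qed
  qed (auto simp: p CF_comult_def pullback2_def)
qed

lemma finite_hall_comult_support:
  fixes F :: "('i, 'h, 'k::{field,finite}) kQ_module set \<Rightarrow> complex"
  assumes F: "F \<in> hall_space Q"
  shows "finite {p. hall_comult v Q F p \<noteq> 0}"
proof (rule finite_subset)
  let ?C = "\<lambda>\<gamma>. {a :: ('i, 'h, 'k) kQ_module set. a \<in> isoclasses Q \<and> cdim a = \<gamma>}"
  let ?T = "\<Union>c\<in>{c. F c \<noteq> 0}. \<Union>(\<alpha>, \<beta>)\<in>{(\<alpha>, \<beta>). \<alpha> \<in> dimvecs Q \<and> \<beta> \<in> dimvecs Q \<and> \<alpha> + \<beta> = cdim c}. ?C \<alpha> \<times> ?C \<beta>"
  show "{p. hall_comult v Q F p \<noteq> 0} \<subseteq> ?T"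
  proof
    fix p assume p: "p \<in> {p. hall_comult v Q F p \<noteq> 0}"
    obtain a b where ab: "p = (a, b)" by (cases p)
    have nz: "hall_comult_untwisted Q F (a, b) \<noteq> 0" using p by (auto simp: ab hall_comult_def)
    then have cl: "a \<in> isoclasses Q" "b \<in> isoclasses Q" by (auto simp: hall_comult_untwisted_def split: if_splits)
    have "(\<Sum>c | F c \<noteq> 0. F c * h_number Q (representative c) (representative a) (representative b)) \<noteq> 0"
      using nz cl by (simp add: hall_comult_untwisted_def)
    then obtain c where c: "c \<in> {c. F c \<noteq> 0}" "F c * h_number Q (representative c) (representative a) (representative b) \<noteq> 0"
      by (rule sum.not_neutral_contains_not_neutral)
    then have "cdim a + cdim b = cdim c" using h_number_nonzero_dim[OF cl, of c] F by (auto simp: hall_space_def)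
    then show "p \<in> ?T" using c(1) cl cdim_dimvecs by (auto simp: ab)
  qed
  show "finite ?T"
    using F finite_splittings finite_isoclasses_cdim by (auto simp: hall_space_def)
qed

end

section \<open>Transport of coefficients\<close>

lemma field_hom_of_field_iso:
  assumes "field_iso \<iota>"
  shows "field_hom \<iota>"
proof
  have add: "\<iota> (x + y) = \<iota> x + \<iota> y" for x y using assms by (simp add: field_iso_def)
  show "\<iota> 0 = 0" using add_cancel_right_right[of "\<iota> 0" "\<iota> 0"] add[of 0 0] by (metis add_0)
qed (use assms in \<open>simp_all add: field_iso_def\<close>)

locale coefficient_iso = quiver Q + field_hom \<iota>
  for Q :: "('i, 'h) pre_digraph" and \<iota> :: "'e::field_char_0 \<Rightarrow> complex" +
  fixes v :: 'e
  assumes bij: "bij \<iota>" and v_nonzero: "v \<noteq> 0"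
begin

lemma \<iota>_inject: "\<iota> x = \<iota> y \<longleftrightarrow> x = y"
  using bij by (auto simp: bij_def inj_def)

lemma \<iota>_inv [simp]: "\<iota> (inv_into UNIV \<iota> z) = z"
  using bij by (simp add: bij_is_surj surj_f_inv_f)

lemma \<iota>_v_nonzero: "\<iota> v \<noteq> 0"
  using v_nonzero \<iota>_inject[of v 0] by simp

lemma \<iota>_powi: "\<iota> (x powi n) = \<iota> x powi n"
  by (simp add: power_int_def hom_power hom_inverse)

lemma \<iota>_m_twisted: "\<iota> (m_twisted v Q \<alpha> \<beta> f z) = m_twisted (\<iota> v) Q \<alpha> \<beta> (\<lambda>p. \<iota> (f p)) z"
  by (simp add: m_twisted_def scale_def push_def o_def hom_mult hom_sum hom_inverse hom_of_nat \<iota>_powi)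

lemma \<iota>_delta_twisted: "\<iota> (delta_twisted v Q \<alpha> \<beta> f p) = delta_twisted (\<iota> v) Q \<alpha> \<beta> (\<lambda>z. \<iota> (f z)) p"
  by (simp add: delta_twisted_def scale_def push_def hom_mult hom_sum hom_of_nat \<iota>_powi)

lemma \<iota>_m_iter: "\<iota> (m_iter v Q \<alpha>s f z) = m_iter (\<iota> v) Q \<alpha>s (\<lambda>xs. \<iota> (f xs)) z"
proof (induction \<alpha>s arbitrary: f z)
  case (Cons \<alpha> \<alpha>s)
  then show ?case by (cases \<alpha>s) (simp_all add: \<iota>_m_twisted prod.case_distrib[of \<iota>])
qed simp

lemma \<iota>_delta_iter: "\<iota> (delta_iter v Q \<alpha>s f xs) = delta_iter (\<iota> v) Q \<alpha>s (\<lambda>z. \<iota> (f z)) xs"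
proof (induction \<alpha>s arbitrary: f xs)
  case (Cons \<alpha> \<alpha>s)
  then show ?case by (cases \<alpha>s; cases xs rule: remdups_adj.cases) (simp_all add: \<iota>_delta_twisted)
qed simp

lemma \<iota>_CF_mult: "\<iota> (CF_mult v Q f g p) = CF_mult (\<iota> v) Q (\<lambda>p. \<iota> (f p)) (\<lambda>p. \<iota> (g p)) p"
  by (cases p) (simp add: CF_mult_def hom_sum \<iota>_m_twisted hom_mult prod.case_distrib[of \<iota>])

lemma \<iota>_CF_comult: "\<iota> (CF_comult v Q f p) = CF_comult (\<iota> v) Q (\<lambda>p. \<iota> (f p)) p"
  by (simp add: CF_comult_def case_prod_beta \<iota>_delta_twisted)

lemma \<iota>_CF_antipode: "\<iota> (CF_antipode v Q f p) = CF_antipode (\<iota> v) Q (\<lambda>p. \<iota> (f p)) p"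
proof -
  have "\<iota> ((-1) ^ n) = (-1) ^ n" for n by (simp add: hom_power hom_uminus)
  then show ?thesis by (simp add: CF_antipode_def case_prod_beta hom_sum hom_mult \<iota>_m_iter \<iota>_delta_iter)
qed

text \<open>This is \<open>\<Phi>\<close>.\<close>

definition to_hall :: "('i, 'h, 'k::{field,finite}, 'e) cf \<Rightarrow> ('i, 'h, 'k) kQ_module set \<Rightarrow> complex" where
  "to_hall f = (\<lambda>c. \<iota> (class_value f c))"

lemma \<iota>_pullback: "\<iota> (pullback F p) = pullback (\<lambda>c. \<iota> (F c)) p"
  by (simp add: pullback_def case_prod_beta)

lemma to_hall_CF:
  fixes f :: "('i, 'h, 'k::{field,finite}, 'e) cf"
  assumes f: "f \<in> CF Q"
  shows "to_hall f \<in> hall_space Q" "(\<lambda>p. \<iota> (f p)) = pullback (to_hall f)"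
proof -
  have "{c. to_hall f c \<noteq> 0} \<subseteq> {c. class_value f c \<noteq> 0}" by (auto simp: to_hall_def)
  then have "finite {c. to_hall f c \<noteq> 0}" using pullback_class_value(2)[OF f] by (rule finite_subset)
  then show "to_hall f \<in> hall_space Q" by (auto simp: hall_space_def to_hall_def class_value_def split: if_splits)
  have "pullback (to_hall f) p = \<iota> (pullback (class_value f) p)" for p unfolding to_hall_def by (rule \<iota>_pullback[symmetric])
  then show "(\<lambda>p. \<iota> (f p)) = pullback (to_hall f)" unfolding pullback_class_value(1)[OF f] by (intro ext) (rule sym)
qed

text \<open>Every identity between invariant functions is verified by this criterion, after transport to
  complex coefficients.\<close>

lemma to_hall_eqI:
  fixes f :: "('i, 'h, 'k::{field,finite}, 'e) cf"
  assumes H: "H \<in> hall_space Q" and f: "(\<lambda>p. \<iota> (f p)) = pullback H"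
  shows "f \<in> CF Q" "to_hall f = H"
proof -
  let ?G = "\<lambda>c. inv_into UNIV \<iota> (H c)"
  have G0: "?G c = 0 \<longleftrightarrow> H c = 0" for c using \<iota>_inject[of "?G c" 0] by simp
  have "\<iota> (f p) = \<iota> (pullback ?G p)" for p unfolding \<iota>_pullback using fun_cong[OF f, of p] by simp
  then have fG: "f = pullback ?G" by (auto simp: \<iota>_inject)
  have "finite {c. ?G c \<noteq> 0}" using H by (simp add: G0 hall_space_def)
  then show "f \<in> CF Q" unfolding fG by (rule pullback_CF)
  have "class_value f = ?G"
    unfolding fG by (rule class_value_pullback) (use H in \<open>auto simp: G0 hall_space_def\<close>)
  then show "to_hall f = H" by (simp add: to_hall_def)
qed

lemma to_hall_mult:
  fixes f g :: "('i, 'h, 'k::{field,finite}, 'e) cf"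
  assumes f: "f \<in> CF Q" and g: "g \<in> CF Q"
  shows "CF_mult v Q f g \<in> CF Q" "to_hall (CF_mult v Q f g) = hall_mult (\<iota> v) Q (to_hall f) (to_hall g)"
proof -
  have "(\<lambda>p. \<iota> (CF_mult v Q f g p)) = pullback (hall_mult (\<iota> v) Q (to_hall f) (to_hall g))"
    unfolding \<iota>_CF_mult to_hall_CF(2)[OF f] to_hall_CF(2)[OF g]
    by (rule CF_mult_pullback[OF to_hall_CF(1)[OF f] to_hall_CF(1)[OF g]])
  note * = to_hall_eqI[OF hall_mult_hall_space[OF to_hall_CF(1)[OF f] to_hall_CF(1)[OF g]] this]
  show "CF_mult v Q f g \<in> CF Q" "to_hall (CF_mult v Q f g) = hall_mult (\<iota> v) Q (to_hall f) (to_hall g)"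
    by (rule *)+
qed

lemma to_hall_antipode:
  fixes f :: "('i, 'h, 'k::{field,finite}, 'e) cf"
  assumes f: "f \<in> CF Q"
  shows "CF_antipode v Q f \<in> CF Q" "to_hall (CF_antipode v Q f) = hall_antipode (\<iota> v) Q (to_hall f)"
proof -
  have "(\<lambda>p. \<iota> (CF_antipode v Q f p)) = pullback (hall_antipode (\<iota> v) Q (to_hall f))"
    unfolding \<iota>_CF_antipode to_hall_CF(2)[OF f] by (rule CF_antipode_pullback[OF \<iota>_v_nonzero to_hall_CF(1)[OF f]])
  note * = to_hall_eqI[OF hall_antipode_hall_space[OF \<iota>_v_nonzero to_hall_CF(1)[OF f]] this]
  show "CF_antipode v Q f \<in> CF Q" "to_hall (CF_antipode v Q f) = hall_antipode (\<iota> v) Q (to_hall f)"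
    by (rule *)+
qed

lemma to_hall_add:
  fixes f g :: "('i, 'h, 'k::{field,finite}, 'e) cf"
  shows "to_hall (f + g) = to_hall f + to_hall g"
  by (auto simp: to_hall_def class_value_def hom_add)

lemma to_hall_scale:
  fixes f :: "('i, 'h, 'k::{field,finite}, 'e) cf"
  shows "to_hall (scale c f) = scale (\<iota> c) (to_hall f)"
  by (auto simp: to_hall_def class_value_def scale_def hom_mult)

lemma to_hall_orbit_fun:
  fixes M :: "('i, 'h, 'k::{field,finite}) kQ_module"
  assumes M: "is_rep Q M"
  shows "(orbit_fun Q M :: ('i, 'h, 'k, 'e) cf) \<in> CF Q"
    and "to_hall (orbit_fun Q M) = class_basis (isoclass Q M)"
proof -
  have "\<iota> (orbit_fun Q M p) = pullback (class_basis (isoclass Q M)) p" for p :: "('i \<Rightarrow> nat) \<times> ('h, 'k) point"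
    unfolding orbit_fun_pullback[OF M] \<iota>_pullback class_basis_def by (simp add: if_distrib cong: if_cong)
  then have *: "(\<lambda>p. \<iota> (orbit_fun Q M p)) = pullback (class_basis (isoclass Q M))" by (rule ext)
  have H: "class_basis (isoclass Q M) \<in> hall_space Q"
    using M by (intro class_basis_hall_space) (simp add: isoclasses_def)
  show "(orbit_fun Q M :: ('i, 'h, 'k, 'e) cf) \<in> CF Q" "to_hall (orbit_fun Q M) = class_basis (isoclass Q M)"
    by (rule to_hall_eqI[OF H *])+
qed

lemma to_hall_one:
  "to_hall (\<lambda>(\<alpha>, x). if \<alpha> = 0 \<and> x \<in> rep_space_F Q 0 then 1 else 0 :: 'e) =
    class_basis (isoclass Q (zero_rep :: ('i, 'h, 'k::{field,finite}) kQ_module))"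
proof (rule to_hall_eqI(2)[OF class_basis_hall_space[OF zero_class(1)]], rule ext)
  fix p :: "('i \<Rightarrow> nat) \<times> ('h, 'k) point"
  obtain \<alpha> x where p: "p = (\<alpha>, x)" by (cases p)
  show "\<iota> ((\<lambda>(\<alpha>, x). if \<alpha> = 0 \<and> x \<in> rep_space_F Q 0 then 1 else 0 :: 'e) p) =
    pullback (class_basis (isoclass Q (zero_rep :: ('i, 'h, 'k) kQ_module))) p"
  proof (cases "\<alpha> \<in> dimvecs Q \<and> x \<in> rep_space_F Q \<alpha>")
    case True
    then have \<alpha>: "\<alpha> \<in> dimvecs Q" and x: "x \<in> rep_space_F Q \<alpha>" by auto
    note M = is_rep_module_of_point[OF x]
    have "cdim (mcl (module_of_point \<alpha> x)) = \<alpha>" using cdim_mcl[OF M] dimv_module_of_point[OF \<alpha>, of x] by simp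
    then have "mcl (module_of_point \<alpha> x) = isoclass Q zero_rep \<longleftrightarrow> \<alpha> = 0"
      using eq_zero_class_iff[OF mcl_isoclasses[OF M]] by simp
    then show ?thesis unfolding p pullback_apply[OF \<alpha> x] using x by (auto simp: class_basis_def)
  next
    case False
    moreover have "(0 :: 'i \<Rightarrow> nat) \<in> dimvecs Q" by (simp add: dimvecs_def)
    ultimately show ?thesis by (auto simp: p pullback_def)
  qed
qed

lemma bij_betw_to_hall:
  "bij_betw to_hall (CF Q :: ('i, 'h, 'k::{field,finite}, 'e) cf set) (hall_space Q)"
  unfolding bij_betw_def
proof
  show "inj_on to_hall (CF Q :: ('i, 'h, 'k, 'e) cf set)"
  proof (rule inj_onI)
    fix f g :: "('i, 'h, 'k, 'e) cf" assume f: "f \<in> CF Q" and g: "g \<in> CF Q" and eq: "to_hall f = to_hall g"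
    have "\<iota> (f p) = \<iota> (g p)" for p
      using fun_cong[OF to_hall_CF(2)[OF f], of p] fun_cong[OF to_hall_CF(2)[OF g], of p] unfolding eq by simp
    then show "f = g" unfolding \<iota>_inject by (rule ext)
  qed
  show "to_hall ` (CF Q :: ('i, 'h, 'k, 'e) cf set) = hall_space Q"
  proof (intro equalityI subsetI)
    fix H assume "H \<in> to_hall ` (CF Q :: ('i, 'h, 'k, 'e) cf set)"
    then show "H \<in> hall_space Q" using to_hall_CF(1) by blast
  next
    fix H :: "('i, 'h, 'k) kQ_module set \<Rightarrow> complex" assume H: "H \<in> hall_space Q"
    let ?f = "pullback (\<lambda>c. inv_into UNIV \<iota> (H c))"
    have f: "(\<lambda>p. \<iota> (?f p)) = pullback H" unfolding \<iota>_pullback \<iota>_inv ..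
    show "H \<in> to_hall ` (CF Q :: ('i, 'h, 'k, 'e) cf set)"
      using imageI[OF to_hall_eqI(1)[OF H f], of to_hall] unfolding to_hall_eqI(2)[OF H f] .
  qed
qed

text \<open>This is \<open>\<Phi> \<otimes> \<Phi>\<close>, extended to all functions on pairs by evaluating at the chosen points.\<close>

definition to_hall2 :: "((('i \<Rightarrow> nat) \<times> ('h, 'k::{field,finite}) point) \<times> (('i \<Rightarrow> nat) \<times> ('h, 'k) point) \<Rightarrow> 'e) \<Rightarrow>
    ('i, 'h, 'k) kQ_module set \<times> ('i, 'h, 'k) kQ_module set \<Rightarrow> complex" where
  "to_hall2 u = (\<lambda>(a, b). if a \<in> isoclasses Q \<and> b \<in> isoclasses Q then \<iota> (u (class_point a, class_point b)) else 0)"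

lemma is_tensor_square_map_to_hall2: "is_tensor_square_map \<iota> V to_hall to_hall2"
  unfolding is_tensor_square_map_def
  by (auto simp: to_hall2_def to_hall_def class_value_def pure_tensor_def scale_def hom_add hom_mult fun_eq_iff)

lemma \<iota>_CF_comult_pullback2:
  fixes f :: "('i, 'h, 'k::{field,finite}, 'e) cf"
  assumes f: "f \<in> CF Q"
  shows "\<iota> (CF_comult v Q f p) = pullback2 (hall_comult (\<iota> v) Q (to_hall f)) p"
  unfolding \<iota>_CF_comult to_hall_CF(2)[OF f] CF_comult_pullback[OF to_hall_CF(1)[OF f]] ..

lemma to_hall2_comult:
  fixes f :: "('i, 'h, 'k::{field,finite}, 'e) cf"
  assumes f: "f \<in> CF Q"
  shows "hall_comult (\<iota> v) Q (to_hall f) = to_hall2 (CF_comult v Q f)"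
proof
  fix p :: "('i, 'h, 'k) kQ_module set \<times> ('i, 'h, 'k) kQ_module set"
  obtain a b where p: "p = (a, b)" by (cases p)
  show "hall_comult (\<iota> v) Q (to_hall f) p = to_hall2 (CF_comult v Q f) p"
  proof (cases "a \<in> isoclasses Q \<and> b \<in> isoclasses Q")
    case True
    then have a: "a \<in> isoclasses Q" and b: "b \<in> isoclasses Q" by auto
    obtain x where x: "class_point a = (cdim a, x)" "x \<in> rep_space_F Q (cdim a)" "mcl (module_of_point (cdim a) x) = a"
      by (rule class_point[OF a])
    obtain y where y: "class_point b = (cdim b, y)" "y \<in> rep_space_F Q (cdim b)" "mcl (module_of_point (cdim b) y) = b"
      by (rule class_point[OF b])
    have "to_hall2 (CF_comult v Q f) p = \<iota> (CF_comult v Q f (class_point a, class_point b))"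
      using a b by (simp add: to_hall2_def p)
    also have "\<dots> = hall_comult (\<iota> v) Q (to_hall f) p"
      unfolding \<iota>_CF_comult_pullback2[OF f] x(1) y(1) using x y by (simp add: pullback2_def cdim_dimvecs p)
    finally show ?thesis by (rule sym)
  next
    case False
    then show ?thesis by (auto simp: p to_hall2_def hall_comult_def hall_comult_untwisted_def)
  qed
qed

lemma sum_pure_tensor_apply: "(\<Sum>s\<in>S. pure_tensor (f s) (g s)) (x, y) = (\<Sum>s\<in>S. f s x * g s y)"
  by (induction S rule: infinite_finite_induct) (simp_all add: pure_tensor_def)

lemma sum_tensor_square:
  assumes S: "finite S" and fg: "\<And>s. s \<in> S \<Longrightarrow> f s \<in> V \<and> g s \<in> V"
  shows "(\<Sum>s\<in>S. pure_tensor (f s) (g s)) \<in> tensor_square V"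
proof -
  obtain e where "bij_betw e {0..<card S} S" using ex_bij_betw_nat_finite[OF S] by blast
  then have e: "bij_betw e {..<card S} S" by (simp add: atLeast0LessThan)
  have "(\<Sum>s\<in>S. pure_tensor (f s) (g s)) = (\<Sum>j<card S. pure_tensor (f (e j)) (g (e j)))"
    by (rule sum.reindex_bij_betw[OF e, symmetric])
  moreover have "\<forall>j<card S. f (e j) \<in> V \<and> g (e j) \<in> V" using fg bij_betwE[OF e] by auto
  ultimately show ?thesis
    unfolding tensor_square_def
    by (intro CollectI exI[of _ "card S"] exI[of _ "\<lambda>j. f (e j)"] exI[of _ "\<lambda>j. g (e j)"]) blast
qed

text \<open>The coproduct of \<open>f\<close> is constant on pairs of orbits and vanishes on all but finitely many of
  them, hence is a finite combination of tensors of orbit functions.\<close>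

lemma CF_comult_tensor_square:
  fixes f :: "('i, 'h, 'k::{field,finite}, 'e) cf"
  assumes f: "f \<in> CF Q"
  shows "CF_comult v Q f \<in> tensor_square (CF Q)"
proof -
  let ?h = "hall_comult (\<iota> v) Q (to_hall f)" and ?k = "\<lambda>p. inv_into UNIV \<iota> (hall_comult (\<iota> v) Q (to_hall f) p)"
  let ?S = "{p. ?h p \<noteq> 0}"
  let ?d = "\<lambda>a c. if c = a then 1 else 0 :: 'e"
  have fin: "finite ?S" by (rule finite_hall_comult_support[OF to_hall_CF(1)[OF f]])
  have fin1: "finite {c :: ('i, 'h, 'k) kQ_module set. w * ?d a c \<noteq> 0}" for w a
    by (rule finite_subset[of _ "{a}"]) auto
  have k0: "?k p = 0 \<longleftrightarrow> ?h p = 0" for p using \<iota>_inject[of "?k p" 0] by simp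
  have eq: "CF_comult v Q f = (\<Sum>s\<in>?S. pure_tensor (pullback (\<lambda>c. ?k s * ?d (fst s) c)) (pullback (?d (snd s))))"
  proof
    fix p :: "(('i \<Rightarrow> nat) \<times> ('h, 'k) point) \<times> (('i \<Rightarrow> nat) \<times> ('h, 'k) point)"
    obtain \<alpha> x \<beta> y where p: "p = ((\<alpha>, x), (\<beta>, y))" by (metis prod.exhaust)
    have "CF_comult v Q f p =
        (\<Sum>s\<in>?S. pullback (\<lambda>c. ?k s * ?d (fst s) c) (\<alpha>, x) * pullback (?d (snd s)) (\<beta>, y))"
    proof (cases "\<alpha> \<in> dimvecs Q \<and> x \<in> rep_space_F Q \<alpha> \<and> \<beta> \<in> dimvecs Q \<and> y \<in> rep_space_F Q \<beta>")
      case True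
      let ?s = "(mcl (module_of_point \<alpha> x), mcl (module_of_point \<beta> y))"
      have "\<iota> (CF_comult v Q f p) = \<iota> (?k ?s)"
        unfolding \<iota>_CF_comult_pullback2[OF f] using True by (simp add: p pullback2_def)
      then have "CF_comult v Q f p = ?k ?s" unfolding \<iota>_inject .
      also have "\<dots> = (\<Sum>s\<in>?S. if ?s = s then ?k s else 0)"
        unfolding sum.delta'[OF fin] using k0[of ?s] by auto
      also have "\<dots> = (\<Sum>s\<in>?S. pullback (\<lambda>c. ?k s * ?d (fst s) c) (\<alpha>, x) * pullback (?d (snd s)) (\<beta>, y))"
        using True by (intro sum.cong refl) (auto simp: pullback_apply)
      finally show ?thesis .
    next
      case False
      have "\<iota> (CF_comult v Q f p) = 0"
        unfolding \<iota>_CF_comult_pullback2[OF f] using False by (auto simp: p pullback2_def)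
      then have "CF_comult v Q f p = 0" using \<iota>_inject[of _ 0] by simp
      moreover have "pullback (\<lambda>c. ?k s * ?d (fst s) c) (\<alpha>, x) * pullback (?d (snd s)) (\<beta>, y) = 0" for s
        using False by (auto simp: pullback_def)
      ultimately show ?thesis by (simp only: sum.neutral_const)
    qed
    then show "CF_comult v Q f p =
        (\<Sum>s\<in>?S. pure_tensor (pullback (\<lambda>c. ?k s * ?d (fst s) c)) (pullback (?d (snd s)))) p"
      unfolding p sum_pure_tensor_apply .
  qed
  have mem: "pullback (\<lambda>c. ?k s * ?d (fst s) c) \<in> CF Q \<and> pullback (?d (snd s)) \<in> CF Q" for s
    using fin1[of 1] by (intro conjI pullback_CF fin1) simp
  show ?thesis unfolding eq by (rule sum_tensor_square[OF fin]) (rule mem)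
qed

end

theorem theorem3p9:
  fixes Q :: "('i, 'h) pre_digraph"
    and l :: nat
    and \<iota> :: "'e::{alg_closed_field,field_char_0} \<Rightarrow> complex"
    and v :: 'e
  assumes "fin_digraph Q"
    and "prime l" and "l \<noteq> CHAR('k::{field,finite})"
    and "is_Ql_closure l TYPE('e)"
    and "field_iso \<iota>"
    and "v\<^sup>2 = of_nat CARD('k)"
  shows "\<exists>\<Phi> :: ('i, 'h, 'k, 'e) cf \<Rightarrow> (('i, 'h, 'k) kQ_module set \<Rightarrow> complex).
    \<Phi> \<in> ring_iso (CF_algebra v Q) (hall_algebra (\<iota> v) Q) \<and>
    (\<forall>c. \<forall>f\<in>CF Q. \<Phi> (scale c f) = scale (\<iota> c) (\<Phi> f)) \<and>
    (\<forall>M. is_rep Q M \<longrightarrow> (orbit_fun Q M :: ('i, 'h, 'k, 'e) cf) \<in> CF Q \<and>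
       \<Phi> (orbit_fun Q M) = class_basis (isoclass Q M)) \<and>
    (\<forall>f\<in>CF Q. \<forall>g\<in>CF Q. CF_mult v Q f g \<in> (CF Q :: ('i, 'h, 'k, 'e) cf set)) \<and>
    (\<exists>T. is_tensor_square_map \<iota> (CF Q) \<Phi> T \<and>
       (\<forall>f\<in>CF Q. CF_comult v Q f \<in> tensor_square (CF Q) \<and>
          hall_comult (\<iota> v) Q (\<Phi> f) = T (CF_comult v Q f))) \<and>
    (\<forall>f\<in>CF Q. CF_antipode v Q f \<in> CF Q \<and>
       hall_antipode (\<iota> v) Q (\<Phi> f) = \<Phi> (CF_antipode v Q f))"
proof -
  have v: "v \<noteq> 0"
  proof
    assume "v = 0"
    then have "v\<^sup>2 = 0" by simp
    then show False using assms(6) by simp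
  qed
  have bij: "bij \<iota>" using assms(5) by (simp add: field_iso_def)
  interpret coefficient_iso Q \<iota> v
  proof (rule coefficient_iso.intro)
    show "quiver Q" using assms(1) by (rule quiver.intro)
    show "field_hom \<iota>" by (rule field_hom_of_field_iso[OF assms(5)])
    show "coefficient_iso_axioms \<iota> v" using bij v by (rule coefficient_iso_axioms.intro)
  qed
  let ?A = "CF_algebra v Q :: ('i, 'h, 'k, 'e) cf ring" and ?\<Phi> = "to_hall :: ('i, 'h, 'k, 'e) cf \<Rightarrow> _"
  have "?\<Phi> \<in> Ring.ring_hom ?A (hall_algebra (\<iota> v) Q)"
  proof (rule ring_hom_memI)
    fix f assume "f \<in> carrier ?A"
    then have f: "f \<in> CF Q" by (simp add: CF_algebra_def)
    show "?\<Phi> f \<in> carrier (hall_algebra (\<iota> v) Q)" using to_hall_CF(1)[OF f] by (simp add: hall_algebra_def)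
    fix g assume "g \<in> carrier ?A"
    then have g: "g \<in> CF Q" by (simp add: CF_algebra_def)
    show "?\<Phi> (f \<otimes>\<^bsub>?A\<^esub> g) = ?\<Phi> f \<otimes>\<^bsub>hall_algebra (\<iota> v) Q\<^esub> ?\<Phi> g"
      unfolding CF_algebra_def hall_algebra_def monoid.select_convs by (rule to_hall_mult(2)[OF f g])
    show "?\<Phi> (f \<oplus>\<^bsub>?A\<^esub> g) = ?\<Phi> f \<oplus>\<^bsub>hall_algebra (\<iota> v) Q\<^esub> ?\<Phi> g"
      unfolding CF_algebra_def hall_algebra_def ring.select_convs by (rule to_hall_add)
  next
    show "?\<Phi> \<one>\<^bsub>?A\<^esub> = \<one>\<^bsub>hall_algebra (\<iota> v) Q\<^esub>"
      unfolding CF_algebra_def hall_algebra_def monoid.select_convs by (rule to_hall_one)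
  qed
  moreover have "bij_betw ?\<Phi> (carrier ?A) (carrier (hall_algebra (\<iota> v) Q))"
    using bij_betw_to_hall by (simp add: CF_algebra_def hall_algebra_def)
  ultimately have iso: "?\<Phi> \<in> ring_iso ?A (hall_algebra (\<iota> v) Q)" by (simp add: ring_iso_def)
  have linear: "\<forall>c. \<forall>f\<in>CF Q. ?\<Phi> (scale c f) = scale (\<iota> c) (?\<Phi> f)"
    by (intro allI ballI to_hall_scale)
  have basis: "\<forall>M. is_rep Q M \<longrightarrow> (orbit_fun Q M :: ('i, 'h, 'k, 'e) cf) \<in> CF Q \<and>
      ?\<Phi> (orbit_fun Q M) = class_basis (isoclass Q M)"
    by (intro allI impI conjI to_hall_orbit_fun)
  have closed: "\<forall>f\<in>CF Q. \<forall>g\<in>CF Q. CF_mult v Q f g \<in> (CF Q :: ('i, 'h, 'k, 'e) cf set)"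
    by (intro ballI to_hall_mult(1))
  have comult: "\<exists>T. is_tensor_square_map \<iota> (CF Q) ?\<Phi> T \<and>
      (\<forall>f\<in>CF Q. CF_comult v Q f \<in> tensor_square (CF Q) \<and> hall_comult (\<iota> v) Q (?\<Phi> f) = T (CF_comult v Q f))"
    by (intro exI[of _ to_hall2] conjI ballI is_tensor_square_map_to_hall2 CF_comult_tensor_square to_hall2_comult)
  have antipode: "\<forall>f\<in>CF Q. CF_antipode v Q f \<in> CF Q \<and> hall_antipode (\<iota> v) Q (?\<Phi> f) = ?\<Phi> (CF_antipode v Q f)"
    by (intro ballI conjI to_hall_antipode(1) to_hall_antipode(2)[symmetric])
  show ?thesis
    by (intro exI[of _ ?\<Phi>] conjI iso linear basis closed comult antipode)
qed

end
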